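(* Let $G$ be a non-trivial compact Hausdorff topological group and let $X$ be a compact Hausdorff space with a continuous action of $G$ such that $X\to X/G$ is a locally trivial principal $G$-bundle. Then there is no continuous $G$-equivariant map $X*G\to X$, where $X*G$ carries the diagonal $G$-action.
   Context: For compact Hausdorff spaces $X,Y$, the topological join $X*Y$ is the quotient of $X\times Y\times[0,1]$ by the relation which, for each fixed $y_0\in Y$, identifies all points $(x,y_0,0)$ ($x\in X$), and, for each fixed $x_0\in X$, identifies all points $(x_0,y,1)$ ($y\in Y$). If $G$ acts on $X$ from the right, the diagonal action on $X*G$ is $[(x,h,t)]\cdot g=[(xg,hg,t)]$. The map $X\to X/G$ is a locally trivial principal $G$-bundle if every point of $X/G$ has an open neighbourhood $U$ whose preimage in $X$ is $G$-equivariantly homeomorphic, over $U$, to $U\times G$ with $G$ acting by right translation on the second factor.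
   Formalization: The space X is additionally assumed non-empty: for X empty, the join X*G (as the stated quotient of X×G×[0,1]) is empty, the bundle condition holds vacuously, and the empty map is a continuous G-equivariant map X*G → X, so the claim fails. *)

theory Defs
  imports "HOL-Analysis.Analysis" "HOL-Algebra.Group"
begin

section \<open>Topological groups and continuous right actions\<close>

locale topological_group = group G for G (structure) +
  fixes T :: "'a topology"
  assumes topspace_eq_carrier: "topspace T = carrier G"
    and continuous_mult: "continuous_map (prod_topology T T) T (\<lambda>(g, h). g \<otimes> h)"
    and continuous_inv: "continuous_map T T (\<lambda>g. inv g)"

locale continuous_right_action = topological_group +
  fixes X :: "'x topology" and act :: "'x \<Rightarrow> 'a \<Rightarrow> 'x"
  assumes continuous_act: "continuous_map (prod_topology X T) X (\<lambda>(x, g). act x g)"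
    and act_one: "x \<in> topspace X \<Longrightarrow> act x \<one> = x"
    and act_mult: "\<lbrakk>x \<in> topspace X; g \<in> carrier G; h \<in> carrier G\<rbrakk>
                     \<Longrightarrow> act (act x g) h = act x (g \<otimes> h)"
begin

lemma act_closed: "\<lbrakk>x \<in> topspace X; g \<in> carrier G\<rbrakk> \<Longrightarrow> act x g \<in> topspace X"
  using continuous_act
  by (auto simp: continuous_map_def topspace_eq_carrier topspace_prod_topology Pi_iff)

end

definition equivariant_on ::
  "('g, 'm) monoid_scheme \<Rightarrow> 'a set \<Rightarrow> ('a \<Rightarrow> 'g \<Rightarrow> 'a) \<Rightarrow> ('b \<Rightarrow> 'g \<Rightarrow> 'b) \<Rightarrow> ('a \<Rightarrow> 'b) \<Rightarrow> bool"
  where "equivariant_on G S actA actB f \<longleftrightarrow>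
    (\<forall>x\<in>S. \<forall>g\<in>carrier G. f (actA x g) = actB (f x) g)"


section \<open>Quotient spaces\<close>

text \<open>The finest topology on the image of \<open>q\<close> making \<open>q\<close> continuous.\<close>

definition quotient_topology :: "'a topology \<Rightarrow> ('a \<Rightarrow> 'b) \<Rightarrow> 'b topology" where
  "quotient_topology X q =
     topology (\<lambda>U. U \<subseteq> q ` topspace X \<and> openin X {x \<in> topspace X. q x \<in> U})"

lemma openin_quotient_topology:
  "openin (quotient_topology X q) U \<longleftrightarrow>
     U \<subseteq> q ` topspace X \<and> openin X {x \<in> topspace X. q x \<in> U}"
proof -
  have int: "{x \<in> topspace X. q x \<in> S \<inter> S'} =
      {x \<in> topspace X. q x \<in> S} \<inter> {x \<in> topspace X. q x \<in> S'}" for S S'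
    by blast
  have un: "{x \<in> topspace X. q x \<in> \<Union>K} = (\<Union>S\<in>K. {x \<in> topspace X. q x \<in> S})" for K
    by blast
  have "istopology (\<lambda>U. U \<subseteq> q ` topspace X \<and> openin X {x \<in> topspace X. q x \<in> U})"
    unfolding istopology_def int un by (intro conjI allI impI openin_Int openin_Union) auto
  then show ?thesis
    by (simp add: quotient_topology_def topology_inverse')
qed

lemma topspace_quotient_topology [simp]:
  "topspace (quotient_topology X q) = q ` topspace X"
proof (rule subset_antisym)
  show "topspace (quotient_topology X q) \<subseteq> q ` topspace X"
    using openin_quotient_topology[of X q "topspace (quotient_topology X q)"]
    by (simp add: openin_topspace)
  have "{x \<in> topspace X. q x \<in> q ` topspace X} = topspace X" by blast
  then have "openin (quotient_topology X q) (q ` topspace X)"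
    by (simp add: openin_quotient_topology)
  then show "q ` topspace X \<subseteq> topspace (quotient_topology X q)"
    by (rule openin_subset)
qed

lemma quotient_map_quotient_topology: "quotient_map X (quotient_topology X q) q"
  by (auto simp: quotient_map_def openin_quotient_topology)


section \<open>Locally trivial principal bundles\<close>

definition right_orbit :: "('g, 'm) monoid_scheme \<Rightarrow> ('x \<Rightarrow> 'g \<Rightarrow> 'x) \<Rightarrow> 'x \<Rightarrow> 'x set" where
  "right_orbit G act x = act x ` carrier G"

definition orbit_space ::
  "('g, 'm) monoid_scheme \<Rightarrow> 'x topology \<Rightarrow> ('x \<Rightarrow> 'g \<Rightarrow> 'x) \<Rightarrow> 'x set topology" where
  "orbit_space G X act = quotient_topology X (right_orbit G act)"

definition locally_trivial_principal_bundle ::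
  "('g, 'm) monoid_scheme \<Rightarrow> 'g topology \<Rightarrow> 'x topology \<Rightarrow> ('x \<Rightarrow> 'g \<Rightarrow> 'x) \<Rightarrow> bool" where
  "locally_trivial_principal_bundle G T X act \<longleftrightarrow>
    (\<forall>b \<in> topspace (orbit_space G X act).
      \<exists>U. openin (orbit_space G X act) U \<and> b \<in> U \<and>
        (let P = {x \<in> topspace X. right_orbit G act x \<in> U} in
         \<exists>\<phi>. homeomorphic_map (subtopology X P)
                (prod_topology (subtopology (orbit_space G X act) U) T) \<phi> \<and>
             (\<forall>x\<in>P. fst (\<phi> x) = right_orbit G act x) \<and>
             equivariant_on G P act (\<lambda>(u, h) g. (u, h \<otimes>\<^bsub>G\<^esub> g)) \<phi>))"


section \<open>The topological join\<close>

text \<open>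
  The two families of identifications together with the diagonal are already an equivalence
  relation, because the first lives at parameter 0 and the second at parameter 1. If one factor
  is empty, then so is this quotient.
\<close>

definition join_rel ::
  "'a topology \<Rightarrow> 'b topology \<Rightarrow> (('a \<times> 'b \<times> real) \<times> ('a \<times> 'b \<times> real)) set" where
  "join_rel X Y =
    {((x, y, t), (x', y', t')).
       x \<in> topspace X \<and> x' \<in> topspace X \<and> y \<in> topspace Y \<and> y' \<in> topspace Y \<and>
       t \<in> {0..1} \<and> t' = t \<and>
       (x = x' \<and> y = y' \<or> t = 0 \<and> y = y' \<or> t = 1 \<and> x = x')}"

definition topological_join :: "'a topology \<Rightarrow> 'b topology \<Rightarrow> ('a \<times> 'b \<times> real) set topology" where
  "topological_join X Y =
     quotient_topology (prod_topology X (prod_topology Y (top_of_set {0..1})))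
       (\<lambda>p. join_rel X Y `` {p})"

lemma equiv_join_rel:
  "equiv (topspace (prod_topology X (prod_topology Y (top_of_set {0..1})))) (join_rel X Y)"
proof (rule equivI)
  let ?A = "topspace (prod_topology X (prod_topology Y (top_of_set {0..1::real})))"
  show "join_rel X Y \<subseteq> ?A \<times> ?A"
    by (auto simp: join_rel_def)
  show "refl_on ?A (join_rel X Y)"
    by (auto simp: join_rel_def refl_on_def)
  show "sym (join_rel X Y)"
    by (rule symI) (clarsimp simp: join_rel_def, metis)
  show "trans (join_rel X Y)"
    by (rule transI) (clarsimp simp: join_rel_def, metis zero_neq_one)
qed

lemma topspace_topological_join:
  "topspace (topological_join X Y) =
     topspace (prod_topology X (prod_topology Y (top_of_set {0..1}))) // join_rel X Y"
  unfolding topological_join_def topspace_quotient_topology quotient_def by blast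

definition join_diag_act ::
  "('g, 'm) monoid_scheme \<Rightarrow> 'g topology \<Rightarrow> 'x topology \<Rightarrow> ('x \<Rightarrow> 'g \<Rightarrow> 'x) \<Rightarrow>
   ('x \<times> 'g \<times> real) set \<Rightarrow> 'g \<Rightarrow> ('x \<times> 'g \<times> real) set" where
  "join_diag_act G T X act C g =
     (\<Union>(x, h, t)\<in>C. join_rel X T `` {(act x g, h \<otimes>\<^bsub>G\<^esub> g, t)})"

lemma (in continuous_right_action) join_diag_act_class:
  assumes "x \<in> topspace X" "h \<in> carrier G" "t \<in> {0..1}" "g \<in> carrier G"
  shows "join_diag_act G T X act (join_rel X T `` {(x, h, t)}) g =
           join_rel X T `` {(act x g, h \<otimes> g, t)}"
proof -
  let ?q = "\<lambda>(x, h, t). join_rel X T `` {(act x g, h \<otimes> g, t)}"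
  let ?A = "topspace (prod_topology X (prod_topology T (top_of_set {0..1::real})))"
  have "?q p = ?q p'" if "(p, p') \<in> join_rel X T" for p p'
  proof -
    obtain x h t x' h' t' where p: "p = (x, h, t)" "p' = (x', h', t')"
      by (metis prod_cases3)
    have "((act x g, h \<otimes> g, t), (act x' g, h' \<otimes> g, t')) \<in> join_rel X T"
      using that assms(4) by (auto simp: p join_rel_def topspace_eq_carrier act_closed)
    then show ?thesis
      by (simp add: p equiv_class_eq[OF equiv_join_rel])
  qed
  then have "?q respects join_rel X T"
    by (rule congruentI)
  moreover have "(x, h, t) \<in> ?A"
    using assms by (simp add: topspace_eq_carrier)
  ultimately have "\<Union>(?q ` (join_rel X T `` {(x, h, t)})) = ?q (x, h, t)"
    by (rule UN_equiv_class[OF equiv_join_rel])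
  then show ?thesis
    by (simp add: join_diag_act_def)
qed

end

(*
  Iterating an equivariant map X * G -> X yields equivariant maps from all iterated joins
  G * ... * G to X. Finite cyclic and free abelian groups act freely on such highly connected
  joins, so that certain products of equivariant cohomology classes are non-zero there; on X,
  finitely many charts of the bundle trivialise the factors one by one.
  Classes are evaluated on explicit simplicial chains in subdivided joins, so fine that
  every simplex is mapped into a chart.

  If G is torsion-free and totally disconnected, the bicentraliser of an element is an
  uncountable abelian group and contains Z^n, n being the number of charts. The n coordinate
  classes are locally constant in the charts, and their product is detected by a Koszul chain.

  Otherwise the spectral theory of convolution operators provides a function F on G and,
  by simultaneous Diophantine approximation, elements h whose power h^N is close to the identity
  while F(x h^j) is close to exp(2 pi i q j / N) F(x) for j <= N, with q prime to N. So up to small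
  errors h generates a free action of Z/N on X. The charts carry F over to functions on X, their averages
  over Z/N are exact eigenfunctions, and their arguments trivialise the Bockstein class of Z/N
  piece by piece, while its powers are non-zero as for lens spaces. The number of functions depends on F
  only, whereas the errors can be made small afterwards.
*)

theory Submission
  imports Defs "HOL-Number_Theory.Cong" "HOL-Algebra.Generated_Groups"
begin

section \<open>Cochains on tuples\<close>

text \<open>A general compact group offers neither a finite subgroup nor a circle, and an
  \<open>h\<close> with \<open>h [^] N\<close> merely near the identity does not act cyclically on
  \<open>X\<close>. The cyclic action therefore lives on the labels of an abstract complex, where it
  is exact; only the evaluation of the complex in \<open>X\<close> is approximately equivariant.
  Errors must survive the whole tower of joins, hence the equicontinuity of all iterates.

  The two cases are exhaustive: an eigenvalue of infinite order or a torsion element yields an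
  almost torsion function. Otherwise every eigenvalue of a translation is a root of unity, so the
  angles form a countable set, whereas the norm of a second difference varies continuously with the
  group element. It is then constant on connected sets, which forces them to be points.

  No homology groups occur. A nonzero product is certified by one integer, congruent to 1 modulo
  \<open>N\<close> in the cyclic case and equal to 1 in the free abelian case, which the charts
  force to be 0.\<close>

fun cobd :: "('p list \<Rightarrow> int) \<Rightarrow> 'p list \<Rightarrow> int" where
  "cobd a [] = 0"
| "cobd a (v # vs) = a vs - cobd (\<lambda>l. a (v # l)) vs"

lemma cobd_add: "cobd (\<lambda>l. a l + b l) l = cobd a l + cobd b l"
  by (induction l arbitrary: a b) auto

lemma cobd_uminus: "cobd (\<lambda>l. - a l) l = - cobd a l"
  by (induction l arbitrary: a) auto

lemma cobd_diff: "cobd (\<lambda>l. a l - b l) l = cobd a l - cobd b l"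
  using cobd_add[of a "\<lambda>l. - b l" l] by (simp add: cobd_uminus)

lemma cobd_sum: "cobd (\<lambda>l. \<Sum>i\<in>I. a i l) l = (\<Sum>i\<in>I. cobd (a i) l)"
proof (induction l arbitrary: a)
  case (Cons v vs)
  show ?case
    using Cons[of "\<lambda>i l. a i (v # l)"] by (simp add: sum_subtractf)
qed simp

lemma cobd_map: "cobd (\<lambda>l. a (map f l)) l = cobd a (map f l)"
proof (induction l arbitrary: a)
  case (Cons v vs)
  show ?case using Cons[of "\<lambda>l. a (f v # l)"] by simp
qed simp

lemma cobd_cobd: "cobd (cobd a) l = 0"
proof (induction l arbitrary: a)
  case (Cons v vs)
  have "cobd (\<lambda>l. cobd a (v # l)) vs = cobd a vs - cobd (cobd (\<lambda>l. a (v # l))) vs"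
    by (simp add: cobd_diff)
  then show ?case using Cons by simp
qed simp

text \<open>The usual prism operator between two vertex maps: the signed sum over all tuples that
  follow \<open>F\<close> up to some entry, repeat this entry under \<open>G\<close> and continue
  with \<open>G\<close>.\<close>

fun prism :: "('p \<Rightarrow> 'q) \<Rightarrow> ('p \<Rightarrow> 'q) \<Rightarrow> ('q list \<Rightarrow> int) \<Rightarrow> 'p list \<Rightarrow> int" where
  "prism F G a [] = 0"
| "prism F G a (v # vs) = a (F v # G v # map G vs) - prism F G (\<lambda>l. a (F v # l)) vs"

lemma prism_add: "prism F G (\<lambda>l. a l + b l) l = prism F G a l + prism F G b l"
  by (induction l arbitrary: a b) auto

lemma prism_diff: "prism F G (\<lambda>l. a l - b l) l = prism F G a l - prism F G b l"
  by (induction l arbitrary: a b) auto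

lemma prism_cobd: "prism F G (cobd a) l + cobd (prism F G a) l = a (map G l) - a (map F l)"
proof (induction l arbitrary: a)
  case (Cons v vs)
  let ?b = "\<lambda>l. a (F v # l)"
  have 1: "prism F G (\<lambda>l. cobd a (F v # l)) vs = prism F G a vs - prism F G (cobd ?b) vs"
    by (simp add: prism_diff)
  have 2: "cobd (\<lambda>l. prism F G a (v # l)) vs
      = cobd (\<lambda>l. a (F v # G v # map G l)) vs - cobd (prism F G ?b) vs"
    by (simp add: cobd_diff)
  have 3: "cobd (\<lambda>l. a (F v # G v # map G l)) vs = cobd (\<lambda>l. a (F v # G v # l)) (map G vs)"
    using cobd_map[of "\<lambda>l. a (F v # G v # l)" G vs] by simp
  show ?case
    using Cons[of ?b] 1 2 3 by simp
qed simp

text \<open>The tuples in the hypothesis are all the simplices of the prism, so control of their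
  vertices is enough. Cones inherit supports in this way.\<close>

lemma prism_cong:
  assumes "\<And>i. i < length l \<Longrightarrow>
    a (map F (take (Suc i) l) @ map G (drop i l)) = b (map F (take (Suc i) l) @ map G (drop i l))"
  shows "prism F G a l = prism F G b l"
  using assms
proof (induction l arbitrary: a b)
  case (Cons v vs)
  have "prism F G (\<lambda>l. a (F v # l)) vs = prism F G (\<lambda>l. b (F v # l)) vs"
  proof (rule Cons.IH)
    show "a (F v # map F (take (Suc i) vs) @ map G (drop i vs)) =
        b (F v # map F (take (Suc i) vs) @ map G (drop i vs))" if "i < length vs" for i
      using Cons.prems[of "Suc i"] that by simp
  qed
  then show ?case
    using Cons.prems[of 0] by simp
qed simp

section \<open>Cones\<close>

text \<open>
  In the cone with apex \<open>Apex l\<close> over a complex containing \<open>d\<close>, the segment from the apex to \<open>d\<close> is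
  divided into \<open>R\<close> parts by the points \<open>Mid d l r\<close>; it ends at \<open>Up d\<close>, the copy of \<open>d\<close> in the cone.
\<close>

datatype 'l pt = Apex 'l | Up "'l pt" | Mid "'l pt" 'l nat

text \<open>Chains are represented by the additive functionals they induce on cochains.\<close>

definition level :: "nat \<Rightarrow> 'l \<Rightarrow> nat \<Rightarrow> 'l pt \<Rightarrow> 'l pt" where
  "level R u r d = (if r = 0 then Apex u else if r < R then Mid d u r else Up d)"

text \<open>The layer at the apex would be a degenerate prism, since \<open>level R u 0\<close> is
  constant; the ordinary cone over the first level replaces it. The other layers are prisms, so that
  all pieces become small as \<open>R\<close> grows.\<close>

definition cone ::
  "nat \<Rightarrow> 'l \<Rightarrow> (('l pt list \<Rightarrow> int) \<Rightarrow> int) \<Rightarrow> ('l pt list \<Rightarrow> int) \<Rightarrow> int" where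
  "cone R u z a = z (\<lambda>l. (\<Sum>r = 1..<R. prism (level R u r) (level R u (Suc r)) a l)
                        + a (Apex u # map (level R u 1) l))"

text \<open>Boundaries of consecutive layers cancel: by \<open>prism_cobd\<close> the sum telescopes
  from level 1 to level \<open>R\<close>, which is \<open>Up\<close>, and the ordinary cone cancels
  the inner end. The sides of the cone contribute \<open>z (cobd b)\<close>, which vanishes for a
  cycle.\<close>

lemma cone_cobd:
  assumes add: "\<And>a b. z (\<lambda>l. a l + b l) = z a + z b"
    and cycle: "\<And>b. z (cobd b) = 0" and R: "R \<ge> 1"
  shows "cone R u z (cobd a) = z (\<lambda>l. a (map Up l))"
proof -
  let ?H = "level R u"
  define b where "b l = (\<Sum>r = 1..<R. prism (?H r) (?H (Suc r)) a l) + a (Apex u # map (?H 1) l)" for l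
  have "(\<Sum>r = 1..<R. prism (?H r) (?H (Suc r)) (cobd a) l) + cobd a (Apex u # map (?H 1) l)
      + cobd b l = a (map Up l)" for l
  proof -
    have "cobd b l = (\<Sum>r = 1..<R. cobd (prism (?H r) (?H (Suc r)) a) l)
       + cobd (\<lambda>l. a (Apex u # l)) (map (?H 1) l)"
      unfolding b_def cobd_add cobd_sum
      using cobd_map[of "\<lambda>l. a (Apex u # l)" "?H 1" l] by simp
    then have "(\<Sum>r = 1..<R. prism (?H r) (?H (Suc r)) (cobd a) l) + cobd a (Apex u # map (?H 1) l)
      + cobd b l = (\<Sum>r = 1..<R. a (map (?H (Suc r)) l) - a (map (?H r) l)) + a (map (?H 1) l)"
      by (simp add: prism_cobd[symmetric] sum.distrib)
    also have "\<dots> = a (map (?H R) l)"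
      using sum_Suc_diff'[of 1 R "\<lambda>r. a (map (?H r) l)"] R by simp
    finally have "(\<Sum>r = 1..<R. prism (?H r) (?H (Suc r)) (cobd a) l) + cobd a (Apex u # map (?H 1) l)
      + cobd b l = a (map (?H R) l)" .
    moreover have "?H R = Up"
      using R by (auto simp: level_def)
    ultimately show ?thesis
      by simp
  qed
  then have "z (\<lambda>l. a (map Up l)) = z (\<lambda>l. ((\<Sum>r = 1..<R. prism (?H r) (?H (Suc r)) (cobd a) l)
      + cobd a (Apex u # map (?H 1) l)) + cobd b l)"
    by presburger
  also have "\<dots> = cone R u z (cobd a) + z (cobd b)"
    unfolding add cone_def by simp
  finally show ?thesis
    by (simp add: cycle)
qed

section \<open>Additive functionals and cup products\<close>

text \<open>Additivity is all the linearity a chain needs here: it already yields multiples by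
  natural numbers, hence congruences modulo \<open>N\<close>.\<close>

definition additive_on_cochains :: "(('p list \<Rightarrow> int) \<Rightarrow> int) \<Rightarrow> bool" where
  "additive_on_cochains z \<longleftrightarrow> (\<forall>a b. z (\<lambda>l. a l + b l) = z a + z b)"

lemma additive_add: "additive_on_cochains z \<Longrightarrow> z (\<lambda>l. a l + b l) = z a + z b"
  by (simp add: additive_on_cochains_def)

lemma additive_zero: "additive_on_cochains z \<Longrightarrow> z (\<lambda>l. 0) = 0"
  using additive_add[of z "\<lambda>l. 0" "\<lambda>l. 0"] by simp

lemma additive_scale:
  fixes n :: nat
  assumes "additive_on_cochains z"
  shows "z (\<lambda>l. int n * a l) = int n * z a"
proof (induction n)
  case (Suc n)
  then show ?case
    using additive_add[OF assms, of a "\<lambda>l. int n * a l"] by (simp add: algebra_simps)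
qed (simp add: additive_zero[OF assms])

text \<open>Cochains are ungraded and augmented, since \<open>cobd a [v] = a []\<close>. The value 0
  at \<open>[]\<close> is what makes the unit closed.\<close>

definition unit_cochain :: "'p list \<Rightarrow> int" where
  "unit_cochain l = (if length l = 1 then 1 else 0)"

text \<open>Front-face times back-face products with a first factor of degree 0, here, and 1 and 2
  below. Each degree has its own function because cochains carry no grading.\<close>

fun cup0 :: "('p \<Rightarrow> int) \<Rightarrow> ('p list \<Rightarrow> int) \<Rightarrow> 'p list \<Rightarrow> int" where
  "cup0 t z [] = 0"
| "cup0 t z (a # m) = t a * z (a # m)"

fun cup1 :: "('p \<Rightarrow> 'p \<Rightarrow> int) \<Rightarrow> ('p list \<Rightarrow> int) \<Rightarrow> 'p list \<Rightarrow> int" where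
  "cup1 t z [] = 0"
| "cup1 t z [a] = 0"
| "cup1 t z (a # b # m) = t a b * z (b # m)"

fun cup2 :: "('p \<Rightarrow> 'p \<Rightarrow> 'p \<Rightarrow> int) \<Rightarrow> ('p list \<Rightarrow> int) \<Rightarrow> 'p list \<Rightarrow> int" where
  "cup2 t z (a # b # c # m) = t a b c * z (c # m)"
| "cup2 t z _ = 0"

lemma cobd_scale: "cobd (\<lambda>l. k * a l) l = k * cobd a l"
  by (induction l arbitrary: a) (auto simp: algebra_simps)

lemma cobd_unit_cochain: "cobd unit_cochain l = 0"
proof (cases l)
  case (Cons v vs)
  have *: "cobd (\<lambda>l. if l = [] then 1 else 0) vs = (if length vs = 1 then 1 else 0)"
    for vs :: "'a list"
  proof (cases vs)
    case (Cons w ws)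
    have "cobd (\<lambda>l. 0 :: int) ws = 0" for ws :: "'a list"
      using cobd_diff[of "\<lambda>l. 0" "\<lambda>l. 0" ws] by simp
    then show ?thesis by (simp add: Cons)
  qed simp
  have "cobd (\<lambda>l. unit_cochain (v # l)) vs = cobd (\<lambda>l. if l = [] then 1 else 0) vs"
    by (rule arg_cong[of _ _ "\<lambda>f. cobd f vs"]) (auto simp: unit_cochain_def)
  then show ?thesis by (simp add: Cons * unit_cochain_def)
qed simp

text \<open>The Leibniz rule when the second factor is closed: only the coboundary of the first
  factor survives.\<close>

lemma cobd_cup0:
  fixes z :: "'p list \<Rightarrow> int"
  assumes "\<And>l. cobd z l = 0"
  shows "cobd (cup0 t z) = cup1 (\<lambda>a b. t b - t a) z"
proof
  fix l :: "'p list"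
  consider "l = []" | a where "l = [a]" | a b m where "l = a # b # m"
    by (metis neq_Nil_conv)
  then show "cobd (cup0 t z) l = cup1 (\<lambda>a b. t b - t a) z l"
  proof cases
    case (3 a b m)
    have "cobd (cup0 t z) l = t b * z (b # m) - cobd (\<lambda>l. t a * z (a # l)) (b # m)"
      by (simp add: 3)
    also have "\<dots> = t b * z (b # m) - t a * cobd (\<lambda>l. z (a # l)) (b # m)"
      by (simp only: cobd_scale)
    also have "cobd (\<lambda>l. z (a # l)) (b # m) = z (b # m)"
      using assms[of "a # b # m"] by simp
    finally show ?thesis
      by (simp add: 3 algebra_simps)
  qed auto
qed

lemma cobd_cup1:
  fixes z :: "'p list \<Rightarrow> int"
  assumes "\<And>l. cobd z l = 0"
  shows "cobd (cup1 t z) = cup2 (\<lambda>a b c. t b c - t a c + t a b) z"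
proof
  fix l :: "'p list"
  consider "l = []" | a where "l = [a]" | a b where "l = [a, b]" | a b c m where "l = a # b # c # m"
    by (metis neq_Nil_conv)
  then show "cobd (cup1 t z) l = cup2 (\<lambda>a b c. t b c - t a c + t a b) z l"
  proof cases
    case (4 a b c m)
    have "cobd (\<lambda>l. cup1 t z (a # b # l)) (c # m) = t a b * cobd (\<lambda>l. z (b # l)) (c # m)"
      by (simp only: cup1.simps cobd_scale)
    also have "cobd (\<lambda>l. z (b # l)) (c # m) = z (c # m)"
      using assms[of "b # c # m"] by simp
    finally show ?thesis
      by (simp add: 4 algebra_simps)
  qed auto
qed

lemma cup2_eq_0: "(\<And>a b c. a \<in> set l \<Longrightarrow> b \<in> set l \<Longrightarrow> c \<in> set l \<Longrightarrow> t a b c = 0) \<Longrightarrow> cup2 t z l = 0"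
  by (induction t z l rule: cup2.induct) auto

lemma list_cases3:
  obtains "l = []" | a where "l = [a]" | a b where "l = [a, b]" | a b c m where "l = a # b # c # m"
  by (metis neq_Nil_conv)

lemma cup2_map: "cup2 t z (map f l) = cup2 (\<lambda>a b c. t (f a) (f b) (f c)) (\<lambda>l. z (map f l)) l"
  by (cases l rule: list_cases3) auto

lemma cup1_map: "cup1 t z (map f l) = cup1 (\<lambda>a b. t (f a) (f b)) (\<lambda>l. z (map f l)) l"
  by (cases l rule: list_cases3) auto

lemma cup1_add: "cup1 (\<lambda>a b. s a b + t a b) z l = cup1 s z l + cup1 t z l"
  by (induction t z l rule: cup1.induct) (auto simp: algebra_simps)

lemma cup1_scale: "cup1 (\<lambda>a b. k * t a b) z l = k * cup1 t z l"
  by (induction t z l rule: cup1.induct) auto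

lemma cup1_sum: "cup1 (\<lambda>a b. \<Sum>i\<in>I. t i a b) z l = (\<Sum>i\<in>I. cup1 (t i) z l)"
proof -
  consider "l = []" | a where "l = [a]" | a b m where "l = a # b # m"
    by (metis neq_Nil_conv)
  then show ?thesis by cases (auto simp: sum_distrib_right)
qed

text \<open>Every factor is the coboundary of a 1-cochain \<open>t k\<close>, so the product is
  trivial on the complex itself. It carries information only equivariantly: the factors are
  invariant under rotation, while the \<open>t k\<close> need not be.\<close>

fun cup_classes :: "(nat \<Rightarrow> 'p \<Rightarrow> 'p \<Rightarrow> int) \<Rightarrow> nat \<Rightarrow> 'p list \<Rightarrow> int" where
  "cup_classes t 0 = unit_cochain"
| "cup_classes t (Suc k) = cup2 (\<lambda>a b c. t k b c - t k a c + t k a b) (cup_classes t k)"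

lemma cobd_cup_classes: "cobd (cup_classes t k) l = 0"
proof (induction k arbitrary: l)
  case 0
  then show ?case by (simp add: cobd_unit_cochain)
next
  case (Suc k)
  then have "cup_classes t (Suc k) = cobd (cup1 (t k) (cup_classes t k))"
    by (simp add: cobd_cup1)
  then show ?case by (simp add: cobd_cobd)
qed

lemma cup_classes_Nil: "cup_classes t k [] = 0"
  by (cases k) (auto simp: unit_cochain_def)

text \<open>
  Evaluating a product of 2-dimensional classes on a chain with boundaries alternately
  \<open>\<rho> - 1\<close> and \<open>1 + \<rho> + \<dots> + \<rho>^(N - 1)\<close> peels off one class at a time, as for lens spaces.
\<close>

lemma cup_classes_eval:
  fixes c :: "nat \<Rightarrow> ('p list \<Rightarrow> int) \<Rightarrow> int" and N :: nat
  assumes add: "\<And>k. additive_on_cochains (c k)"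
    and c0: "c 0 unit_cochain = 1"
    and odd: "\<And>k a. k < n \<Longrightarrow> c (Suc (2 * k)) (cobd a) = c (2 * k) (\<lambda>l. a (map \<rho> l) - a l)"
    and even: "\<And>k a. k < n \<Longrightarrow>
      c (Suc (Suc (2 * k))) (cobd a) = c (Suc (2 * k)) (\<lambda>l. \<Sum>j<N. a (map (\<rho> ^^ j) l))"
    and lab: "\<And>a. \<exists>q. \<eta> (\<rho> a) = \<eta> a + 1 + int N * q"
    and norm: "\<And>k a b. \<exists>q. (\<Sum>j<N. t k ((\<rho> ^^ j) a) ((\<rho> ^^ j) b)) = \<eta> b - \<eta> a + int N * q"
    and inv: "\<And>k a b d. t k (\<rho> b) (\<rho> d) - t k (\<rho> a) (\<rho> d) + t k (\<rho> a) (\<rho> b) = t k b d - t k a d + t k a b"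
  shows "[c (2 * n) (cup_classes t n) = 1] (mod int N)"
proof -
  have zinv: "cup_classes t k (map \<rho> l) = cup_classes t k l" for k l
  proof (induction k arbitrary: l)
    case (Suc k)
    then show ?case
      by (simp add: cup2_map inv)
  qed (simp add: unit_cochain_def)
  have zinvj: "cup_classes t k (map (\<rho> ^^ j) l) = cup_classes t k l" for k j l
  proof (induction j arbitrary: l)
    case (Suc j)
    have "cup_classes t k (map (\<rho> ^^ Suc j) l) = cup_classes t k (map \<rho> (map (\<rho> ^^ j) l))"
      by (simp add: comp_def)
    then show ?case
      using Suc by (simp only: zinv)
  qed simp
  have "[c (2 * k) (cup_classes t k) = 1] (mod int N)" if "k \<le> n" for k
    using that
  proof (induction k)
    case (Suc k)
    let ?z = "cup_classes t k"
    \<comment> \<open>Modulo \<open>N\<close>, the sum of \<open>t k\<close> over all rotations is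
      the coboundary of the label \<open>\<eta>\<close>, and \<open>\<eta>\<close> increases by 1
      under one rotation. Two boundaries therefore replace \<open>cup_classes t (Suc k)\<close> by
      \<open>cup_classes t k\<close>.\<close>
    obtain e where e: "\<And>a b. (\<Sum>j<N. t k ((\<rho> ^^ j) a) ((\<rho> ^^ j) b)) = \<eta> b - \<eta> a + int N * e a b"
      using norm by metis
    obtain q where q: "\<And>a. \<eta> (\<rho> a) = \<eta> a + 1 + int N * q a"
      using lab by metis
    have "c (2 * Suc k) (cup_classes t (Suc k)) = c (Suc (Suc (2 * k))) (cobd (cup1 (t k) ?z))"
      by (simp add: cobd_cup1 cobd_cup_classes)
    also have "\<dots> = c (Suc (2 * k)) (\<lambda>l. \<Sum>j<N. cup1 (t k) ?z (map (\<rho> ^^ j) l))"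
      using Suc.prems by (intro even) simp
    also have "(\<lambda>l. \<Sum>j<N. cup1 (t k) ?z (map (\<rho> ^^ j) l))
        = cup1 (\<lambda>a b. \<eta> b - \<eta> a + int N * e a b) ?z"
      unfolding cup1_map zinvj cup1_sum[symmetric] e by simp
    also have "\<dots> = (\<lambda>l. cup1 (\<lambda>a b. \<eta> b - \<eta> a) ?z l + int N * cup1 e ?z l)"
      by (simp add: fun_eq_iff cup1_add cup1_scale)
    also have "c (Suc (2 * k)) \<dots> = c (Suc (2 * k)) (cup1 (\<lambda>a b. \<eta> b - \<eta> a) ?z)
        + int N * c (Suc (2 * k)) (cup1 e ?z)"
      by (simp add: additive_add[OF add] additive_scale[OF add])
    also have "c (Suc (2 * k)) (cup1 (\<lambda>a b. \<eta> b - \<eta> a) ?z) = c (Suc (2 * k)) (cobd (cup0 \<eta> ?z))"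
      by (simp add: cobd_cup0 cobd_cup_classes)
    also have "\<dots> = c (2 * k) (\<lambda>l. cup0 \<eta> ?z (map \<rho> l) - cup0 \<eta> ?z l)"
      using Suc.prems by (intro odd) simp
    also have "(\<lambda>l. cup0 \<eta> ?z (map \<rho> l) - cup0 \<eta> ?z l) = (\<lambda>l. ?z l + int N * cup0 q ?z l)"
    proof
      fix l show "cup0 \<eta> ?z (map \<rho> l) - cup0 \<eta> ?z l = ?z l + int N * cup0 q ?z l"
        using zinv[of k l] by (cases l) (auto simp: q cup_classes_Nil algebra_simps)
    qed
    also have "c (2 * k) \<dots> = c (2 * k) ?z + int N * c (2 * k) (cup0 q ?z)"
      by (simp add: additive_add[OF add] additive_scale[OF add])
    finally have "c (2 * Suc k) (cup_classes t (Suc k)) =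
        c (2 * k) ?z + int N * (c (2 * k) (cup0 q ?z) + c (Suc (2 * k)) (cup1 e ?z))"
      by (simp add: algebra_simps)
    then have "[c (2 * Suc k) (cup_classes t (Suc k)) = c (2 * k) ?z] (mod int N)"
      by (simp add: cong_def)
    then show ?case
      using Suc by (meson cong_trans Suc_leD)
  qed (simp add: c0)
  then show ?thesis by simp
qed

text \<open>The differential of the Koszul resolution for commuting maps: deleting an index
  \<open>i\<close> is paired with \<open>\<rho> i - 1\<close>, with alternating signs. The chains
  \<open>c\<close> are indexed by lists, like the cells of a torus.\<close>

fun koszul :: "(nat \<Rightarrow> 'p \<Rightarrow> 'p) \<Rightarrow> (nat list \<Rightarrow> ('p list \<Rightarrow> int) \<Rightarrow> int) \<Rightarrow> nat list \<Rightarrow> ('p list \<Rightarrow> int) \<Rightarrow> int" where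
  "koszul \<rho> c [] a = 0"
| "koszul \<rho> c (i # is) a = c is (\<lambda>l. a (map (\<rho> i) l) - a l) - koszul \<rho> (\<lambda>js. c (i # js)) is a"

lemma koszul_eq_0:
  assumes "\<And>i js. i \<in> set is \<Longrightarrow> length js < length is \<Longrightarrow> c js (\<lambda>l. a (map (\<rho> i) l) - a l) = 0"
  shows "koszul \<rho> c is a = 0"
  using assms by (induction "is" arbitrary: c) auto

fun cup_product :: "(nat \<Rightarrow> 'p \<Rightarrow> int) \<Rightarrow> nat list \<Rightarrow> 'p list \<Rightarrow> int" where
  "cup_product t [] = unit_cochain"
| "cup_product t (i # is) = cup1 (\<lambda>a b. t i b - t i a) (cup_product t is)"

lemma cobd_cup_product: "cobd (cup_product t is) l = 0"
proof (induction "is" arbitrary: l)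
  case (Cons i "is")
  then have "cup_product t (i # is) = cobd (cup0 (t i) (cup_product t is))"
    by (simp add: cobd_cup0)
  then show ?case by (simp add: cobd_cobd)
qed (simp add: cobd_unit_cochain)

lemma cup_product_Nil: "cup_product t is [] = 0"
  by (cases "is") (auto simp: unit_cochain_def)

text \<open>Only the leading index contributes: \<open>t i\<close> increases by 1 under
  \<open>\<rho> i\<close> and is unchanged by the other maps of the list, whose indices differ from
  \<open>i\<close> by distinctness. One boundary thus removes the first factor with coefficient
  1.\<close>

lemma cup_product_eval:
  fixes c :: "nat list \<Rightarrow> ('p list \<Rightarrow> int) \<Rightarrow> int"
  assumes add: "\<And>is. additive_on_cochains (c is)"
    and c0: "c [] unit_cochain = 1"
    and bd: "\<And>is a. is \<noteq> [] \<Longrightarrow> length is \<le> n \<Longrightarrow> c is (cobd a) = koszul \<rho> c is a"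
    and t: "\<And>i j a. t i (\<rho> j a) = t i a + (if i = j then 1 else 0)"
    and "distinct is" "length is \<le> n"
  shows "c is (cup_product t is) = 1"
  using assms(5,6)
proof (induction "is")
  case (Cons i "is")
  let ?z = "cup_product t is"
  have zinv: "?z (map (\<rho> j) l) = ?z l" for j l
    using Cons.prems
    by (induction "is" arbitrary: l) (auto simp: unit_cochain_def cup1_map t)
  have diff: "(\<lambda>l. cup0 (t i) ?z (map (\<rho> j) l) - cup0 (t i) ?z l) = (if i = j then ?z else (\<lambda>l. 0))" for j
  proof
    fix l show "cup0 (t i) ?z (map (\<rho> j) l) - cup0 (t i) ?z l = (if i = j then ?z else (\<lambda>l. 0)) l"
      using zinv[of j l] by (cases l) (auto simp: t cup_product_Nil algebra_simps)
  qed
  have "c (i # is) (cup_product t (i # is)) = c (i # is) (cobd (cup0 (t i) ?z))"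
    by (simp add: cobd_cup0 cobd_cup_product)
  also have "\<dots> = koszul \<rho> c (i # is) (cup0 (t i) ?z)"
    using Cons.prems by (intro bd) simp
  also have "\<dots> = c is ?z - koszul \<rho> (\<lambda>js. c (i # js)) is (cup0 (t i) ?z)"
    by (simp add: diff)
  also have "koszul \<rho> (\<lambda>js. c (i # js)) is (cup0 (t i) ?z) = 0"
  proof (rule koszul_eq_0)
    fix j js assume "j \<in> set is"
    with Cons.prems have "i \<noteq> j" by auto
    then show "c (i # js) (\<lambda>l. cup0 (t i) ?z (map (\<rho> j) l) - cup0 (t i) ?z l) = 0"
      by (simp add: diff additive_zero[OF add])
  qed
  finally show ?case
    using Cons by simp
qed (simp add: c0)

section \<open>Towers of cones\<close>

lemma cone_additive: "additive_on_cochains z \<Longrightarrow> additive_on_cochains (cone R u z)"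
  unfolding additive_on_cochains_def[of "cone R u z"]
proof (intro allI)
  fix a b assume z: "additive_on_cochains z"
  define A where "A a l = (\<Sum>r = 1..<R. prism (level R u r) (level R u (Suc r)) a l)
    + a (Apex u # map (level R u 1) l)" for a l
  have "A (\<lambda>l. a l + b l) = (\<lambda>l. A a l + A b l)"
    by (simp add: A_def prism_add sum.distrib fun_eq_iff)
  then have "z (A (\<lambda>l. a l + b l)) = z (A a) + z (A b)"
    using additive_add[OF z] by simp
  then show "cone R u z (\<lambda>l. a l + b l) = cone R u z a + cone R u z b"
    by (simp add: cone_def A_def[abs_def])
qed

text \<open>Records on which simplices a chain lives without writing it as a sum. The condition
  \<open>l \<noteq> []\<close> matters for cones, where the apex has to be the image of some vertex
  under \<open>level R u 0\<close>.\<close>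

definition supported_on :: "(('p list \<Rightarrow> int) \<Rightarrow> int) \<Rightarrow> ('p set \<Rightarrow> bool) \<Rightarrow> bool" where
  "supported_on z P \<longleftrightarrow> (\<forall>a b. (\<forall>l. l \<noteq> [] \<longrightarrow> P (set l) \<longrightarrow> a l = b l) \<longrightarrow> z a = z b)"

lemma supported_onD:
  "supported_on z P \<Longrightarrow> (\<And>l. l \<noteq> [] \<Longrightarrow> P (set l) \<Longrightarrow> a l = b l) \<Longrightarrow> z a = z b"
  by (auto simp: supported_on_def)

lemma supported_on_cone:
  assumes z: "supported_on z P" and R: "R \<ge> 1"
    and mono: "\<And>S S'. Q S \<Longrightarrow> S' \<subseteq> S \<Longrightarrow> Q S'"
    and step: "\<And>S r. P S \<Longrightarrow> r < R \<Longrightarrow> Q (level R u r ` S \<union> level R u (Suc r) ` S)"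
  shows "supported_on (cone R u z) Q"
  unfolding supported_on_def
proof (intro allI impI)
  fix a b :: "'a pt list \<Rightarrow> int"
  assume ab: "\<forall>l. l \<noteq> [] \<longrightarrow> Q (set l) \<longrightarrow> a l = b l"
  have eq: "a l' = b l'"
    if "P (set l)" "r < R" "l' \<noteq> []" "set l' \<subseteq> level R u r ` set l \<union> level R u (Suc r) ` set l"
    for l' l r
    using step[OF that(1,2)] mono that(3,4) ab by blast
  show "cone R u z a = cone R u z b"
    unfolding cone_def
  proof (rule supported_onD[OF z])
    fix l :: "'a pt list" assume l: "l \<noteq> []" "P (set l)"
    have "prism (level R u r) (level R u (Suc r)) a l = prism (level R u r) (level R u (Suc r)) b l"
      if "r \<in> {1..<R}" for r
      using that l
      by (intro prism_cong eq[of l r])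
         (auto dest!: in_set_takeD in_set_dropD)
    moreover have "a (Apex u # map (level R u 1) l) = b (Apex u # map (level R u 1) l)"
    proof (rule eq[of l 0])
      have "Apex u \<in> level R u 0 ` set l"
        using l by (cases l) (auto simp: level_def)
      then show "set (Apex u # map (level R u 1) l) \<subseteq> level R u 0 ` set l \<union> level R u (Suc 0) ` set l"
        by auto
    qed (use l R in auto)
    ultimately show "(\<Sum>r = 1..<R. prism (level R u r) (level R u (Suc r)) a l) + a (Apex u # map (level R u 1) l)
      = (\<Sum>r = 1..<R. prism (level R u r) (level R u (Suc r)) b l) + b (Apex u # map (level R u 1) l)"
      by simp
  qed
qed

lemma map_pt_funpow:
  fixes f :: "'l \<Rightarrow> 'l"
  shows "map_pt f ^^ n = map_pt (f ^^ n)"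
proof (induction n)
  case (Suc n)
  have "map_pt f \<circ> map_pt (f ^^ n) = map_pt (f \<circ> f ^^ n)"
    by (simp add: fun_eq_iff pt.map_comp)
  then show ?case using Suc by (simp add: comp_def)
qed (simp add: pt.map_id0[unfolded id_def] id_def)

lemma map_pt_Up_funpow: "map_pt f ((Up ^^ n) p) = (Up ^^ n) (map_pt f p)"
  by (induction n) auto

text \<open>Alternately \<open>\<rho> - 1\<close> and the norm: the two differentials in the
  periodic resolution of a cyclic group.\<close>

definition cyc_op :: "nat \<Rightarrow> ('p \<Rightarrow> 'p) \<Rightarrow> nat \<Rightarrow> ('p list \<Rightarrow> int) \<Rightarrow> 'p list \<Rightarrow> int" where
  "cyc_op N \<rho> k a l = (if even k then a (map \<rho> l) - a l else (\<Sum>j<N. a (map (\<rho> ^^ j) l)))"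

lemma cobd_cyc_op: "cyc_op N \<rho> k (cobd a) l = cobd (cyc_op N \<rho> k a) l"
proof (cases "even k")
  case True
  then have "cyc_op N \<rho> k a = (\<lambda>l. a (map \<rho> l) - a l)" by (auto simp: cyc_op_def)
  then show ?thesis using True by (simp add: cyc_op_def cobd_diff cobd_map)
next
  case False
  then have "cyc_op N \<rho> k a = (\<lambda>l. \<Sum>j<N. a (map (\<rho> ^^ j) l))" by (auto simp: cyc_op_def)
  then show ?thesis using False by (simp add: cyc_op_def cobd_sum cobd_map)
qed

lemma cyc_op_add: "cyc_op N \<rho> k (\<lambda>l. a l + b l) l = cyc_op N \<rho> k a l + cyc_op N \<rho> k b l"
  by (simp add: cyc_op_def sum.distrib)

text \<open>In either order this is \<open>\<rho> - 1\<close> times the norm; the sum over a full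
  period does not change when its index is shifted.\<close>

lemma cyc_op_cyc_op:
  assumes "\<rho> ^^ N = id"
  shows "cyc_op N \<rho> k (cyc_op N \<rho> (Suc k) a) l = 0"
proof -
  have *: "(\<Sum>j<N. a (map (\<rho> ^^ j) (map \<rho> l))) = (\<Sum>j<N. a (map (\<rho> ^^ j) l))"
  proof -
    have "(\<Sum>j<N. a (map (\<rho> ^^ j) (map \<rho> l))) = (\<Sum>j<N. a (map (\<rho> ^^ Suc j) l))"
      by (simp add: comp_def funpow_swap1)
    also have "\<dots> = (\<Sum>j<N. a (map (\<rho> ^^ j) l)) + a (map (\<rho> ^^ N) l) - a (map (\<rho> ^^ 0) l)"
      using sum.lessThan_Suc_shift[of "\<lambda>j. a (map (\<rho> ^^ j) l)" N] by simp
    finally show ?thesis using assms by simp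
  qed
  have **: "(\<Sum>j<N. a (map \<rho> (map (\<rho> ^^ j) l))) = (\<Sum>j<N. a (map (\<rho> ^^ j) l))"
    using * by (simp add: comp_def funpow_swap1)
  show ?thesis
    using * ** by (simp add: cyc_op_def sum_subtractf)
qed

text \<open>The cells of an infinite-dimensional lens space, one in each dimension: a new cone is
  erected over \<open>\<rho> - 1\<close> or the norm applied to the previous chain, which is a
  cycle. The previous complex sits in the new one through \<open>Up\<close>.\<close>

fun cyc_chain :: "nat \<Rightarrow> 'l \<Rightarrow> nat \<Rightarrow> ('l \<Rightarrow> 'l) \<Rightarrow> nat \<Rightarrow> ('l pt list \<Rightarrow> int) \<Rightarrow> int" where
  "cyc_chain R u N f 0 a = a [Apex u]"
| "cyc_chain R u N f (Suc k) a = cone R u (\<lambda>b. cyc_chain R u N f k (cyc_op N (map_pt f) k b)) a"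

lemma cyc_chain_additive: "additive_on_cochains (cyc_chain R u N f k)"
proof (induction k)
  case (Suc k)
  have "additive_on_cochains (\<lambda>b. cyc_chain R u N f k (cyc_op N (map_pt f) k b))"
    using Suc by (simp add: additive_on_cochains_def cyc_op_add[abs_def])
  then show ?case
    using cone_additive by simp
qed (simp add: additive_on_cochains_def)

lemma cyc_chain_cobd:
  assumes "f ^^ N = id" "R \<ge> 1"
  shows "cyc_chain R u N f (Suc k) (cobd a) = cyc_chain R u N f k (cyc_op N (map_pt f) k (\<lambda>l. a (map Up l)))"
proof (induction k arbitrary: a)
  case 0
  show ?case
    unfolding cyc_chain.simps(2)
    by (subst cone_cobd) (use assms in \<open>auto simp: cyc_op_def\<close>)
next
  case (Suc k)
  have up: "cyc_op N (map_pt f) k (\<lambda>l. b (map Up l)) = (\<lambda>l. cyc_op N (map_pt f) k b (map Up l))" for b k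
    by (auto simp: cyc_op_def fun_eq_iff comp_def map_pt_funpow)
  have id: "map_pt f ^^ N = id"
    using assms by (simp add: map_pt_funpow pt.map_id0)
  \<comment> \<open>The base of the new cone is a cycle, because its boundary involves two
    consecutive operators.\<close>
  have "cyc_chain R u N f (Suc k) (cyc_op N (map_pt f) (Suc k) (cobd b)) = 0" for b
  proof -
    have "cyc_chain R u N f (Suc k) (cyc_op N (map_pt f) (Suc k) (cobd b))
      = cyc_chain R u N f k (cyc_op N (map_pt f) k (cyc_op N (map_pt f) (Suc k) (\<lambda>l. b (map Up l))))"
      unfolding cobd_cyc_op[abs_def] Suc up ..
    then show ?thesis
      by (simp add: cyc_op_cyc_op[OF id, abs_def] additive_zero[OF cyc_chain_additive])
  qed
  then show ?case
    unfolding cyc_chain.simps(2)[of _ _ _ _ "Suc k"]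
    by (subst cone_cobd)
       (use assms in \<open>auto simp: cyc_op_add[abs_def] additive_add[OF cyc_chain_additive]\<close>)
qed

text \<open>Smallness has to be stable under rotation, as the operators rotate simplices, and under
  one cone layer. The predicate depends on \<open>k\<close> so that the permitted error may grow
  with the dimension.\<close>

lemma supported_on_cyc_chain:
  assumes "R \<ge> 1"
    and mono: "\<And>k S S'. P k S \<Longrightarrow> S' \<subseteq> S \<Longrightarrow> P k S'"
    and base: "P 0 {Apex u}"
    and rot: "\<And>k S. P k S \<Longrightarrow> P k (map_pt f ` S)"
    and step: "\<And>k S r. P k S \<Longrightarrow> r < R \<Longrightarrow> P (Suc k) (level R u r ` S \<union> level R u (Suc r) ` S)"
  shows "supported_on (cyc_chain R u N f k) (P k)"
proof (induction k)
  case 0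
  show ?case using base by (auto simp: supported_on_def)
next
  case (Suc k)
  have rotj: "P k S \<Longrightarrow> P k ((map_pt f ^^ j) ` S)" for j S
  proof (induction j)
    case (Suc j)
    then have "P k (map_pt f ` (map_pt f ^^ j) ` S)" using rot by blast
    then show ?case by (simp add: image_comp comp_def)
  qed simp
  have "supported_on (\<lambda>b. cyc_chain R u N f k (cyc_op N (map_pt f) k b)) (P k)"
    unfolding supported_on_def
  proof (intro allI impI, rule supported_onD[OF Suc])
    fix a b :: "'a pt list \<Rightarrow> int" and l :: "'a pt list"
    assume ab: "\<forall>l. l \<noteq> [] \<longrightarrow> P k (set l) \<longrightarrow> a l = b l" and l: "l \<noteq> []" "P k (set l)"
    have "a (map (map_pt f ^^ j) l) = b (map (map_pt f ^^ j) l)" for j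
      using ab l rotj[of "set l" j] by auto
    from this this[of 1] show "cyc_op N (map_pt f) k a l = cyc_op N (map_pt f) k b l"
      using ab l by (simp add: cyc_op_def)
  qed
  then have "supported_on (cone R u (\<lambda>b. cyc_chain R u N f k (cyc_op N (map_pt f) k b))) (P (Suc k))"
    by (rule supported_on_cone) (use assms in auto)
  then show ?case by (simp add: fun_eq_iff supported_on_def)
qed

lemma koszul_add:
  assumes "\<And>js. additive_on_cochains (c js)"
  shows "koszul \<rho> c is (\<lambda>l. a l + b l) = koszul \<rho> c is a + koszul \<rho> c is b"
  using assms
proof (induction "is" arbitrary: c)
  case (Cons i "is")
  have "(\<lambda>l. a (map (\<rho> i) l) + b (map (\<rho> i) l) - (a l + b l)) =
     (\<lambda>l. (a (map (\<rho> i) l) - a l) + (b (map (\<rho> i) l) - b l))"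
    by (simp add: fun_eq_iff)
  then have "c is (\<lambda>l. a (map (\<rho> i) l) + b (map (\<rho> i) l) - (a l + b l)) =
     c is (\<lambda>l. a (map (\<rho> i) l) - a l) + c is (\<lambda>l. b (map (\<rho> i) l) - b l)"
    using additive_add[OF Cons.prems, of "is" "\<lambda>l. a (map (\<rho> i) l) - a l"] by simp
  moreover have "koszul \<rho> (\<lambda>js. c (i # js)) is (\<lambda>l. a l + b l) =
    koszul \<rho> (\<lambda>js. c (i # js)) is a + koszul \<rho> (\<lambda>js. c (i # js)) is b"
    using Cons by simp
  ultimately show ?case
    by simp
qed simp

lemma koszul_diff_left:
  "koszul \<rho> (\<lambda>js b. c js b - d js b) is a = koszul \<rho> c is a - koszul \<rho> d is a"
  by (induction "is" arbitrary: c d) auto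

lemma koszul_translate:
  assumes comm: "\<And>i j p. \<rho> i (\<rho> j p) = \<rho> j (\<rho> i p)"
  shows "koszul \<rho> (\<lambda>js b. c js (\<lambda>l. b (map (\<rho> i) l) - b l)) is a
       = koszul \<rho> c is (\<lambda>l. a (map (\<rho> i) l) - a l)"
proof (induction "is" arbitrary: c)
  case (Cons j "is")
  have *: "map (\<rho> j) (map (\<rho> i) l) = map (\<rho> i) (map (\<rho> j) l)" for l
    using comm by simp
  have "(\<lambda>l. (a (map (\<rho> j) (map (\<rho> i) l)) - a (map (\<rho> i) l)) - (a (map (\<rho> j) l) - a l)) =
    (\<lambda>l. (a (map (\<rho> i) (map (\<rho> j) l)) - a (map (\<rho> j) l)) - (a (map (\<rho> i) l) - a l))"
    unfolding * by (simp add: fun_eq_iff del: map_map)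
  moreover have "koszul \<rho> (\<lambda>js b. c (j # js) (\<lambda>l. b (map (\<rho> i) l) - b l)) is a
    = koszul \<rho> (\<lambda>js. c (j # js)) is (\<lambda>l. a (map (\<rho> i) l) - a l)"
    by (rule Cons)
  ultimately show ?case
    by (simp only: koszul.simps)
qed simp

text \<open>The terms in which the leading index is deleted before or after another one cancel by
  \<open>koszul_translate\<close>; the remaining terms are covered by the induction.\<close>

lemma koszul_koszul:
  assumes comm: "\<And>i j p. \<rho> i (\<rho> j p) = \<rho> j (\<rho> i p)"
  shows "koszul \<rho> (koszul \<rho> c) is a = 0"
proof (induction "is" arbitrary: c)
  case (Cons i "is")
  have *: "(\<lambda>js. koszul \<rho> c (i # js)) = (\<lambda>js b. c js (\<lambda>l. b (map (\<rho> i) l) - b l)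
      - koszul \<rho> (\<lambda>js. c (i # js)) js b)"
    by (simp add: fun_eq_iff)
  have "koszul \<rho> (\<lambda>js. koszul \<rho> c (i # js)) is a
     = koszul \<rho> (\<lambda>js b. c js (\<lambda>l. b (map (\<rho> i) l) - b l)) is a
       - koszul \<rho> (koszul \<rho> (\<lambda>js. c (i # js))) is a"
    unfolding * by (rule koszul_diff_left)
  also have "koszul \<rho> (koszul \<rho> (\<lambda>js. c (i # js))) is a = 0"
    by (rule Cons)
  also have "koszul \<rho> (\<lambda>js b. c js (\<lambda>l. b (map (\<rho> i) l) - b l)) is a
       = koszul \<rho> c is (\<lambda>l. a (map (\<rho> i) l) - a l)"
    by (rule koszul_translate) (rule comm)
  finally show ?case
    unfolding koszul.simps(2)[of \<rho> "koszul \<rho> c"] by (simp del: koszul.simps)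
qed simp

lemma koszul_cong:
  assumes "\<And>i js. i \<in> set is \<Longrightarrow> Suc (length js) = length is \<Longrightarrow>
    c js (\<lambda>l. a (map (\<rho> i) l) - a l) = d js (\<lambda>l. b (map (\<rho> i) l) - b l)"
  shows "koszul \<rho> c is a = koszul \<rho> d is b"
  using assms by (induction "is" arbitrary: c d) auto

text \<open>The depth \<open>k\<close> is separate from the index list so that the recursion can
  refer to all lists at once; the boundary formula below concerns lists whose length equals the
  depth.\<close>

fun koszul_chain :: "nat \<Rightarrow> 'l \<Rightarrow> (nat \<Rightarrow> 'l \<Rightarrow> 'l) \<Rightarrow> nat \<Rightarrow> nat list \<Rightarrow> ('l pt list \<Rightarrow> int) \<Rightarrow> int" where
  "koszul_chain R u f 0 is a = a [Apex u]"
| "koszul_chain R u f (Suc k) is a =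
     cone R u (koszul (\<lambda>i. map_pt (f i)) (koszul_chain R u f k) is) a"

lemma koszul_chain_additive: "additive_on_cochains (koszul_chain R u f k is)"
proof (induction k arbitrary: "is")
  case (Suc k)
  then have "additive_on_cochains (koszul (\<lambda>i. map_pt (f i)) (koszul_chain R u f k) is)"
    unfolding additive_on_cochains_def[of "koszul _ _ _"] using koszul_add by blast
  then show ?case
    using cone_additive by (simp add: fun_eq_iff additive_on_cochains_def)
qed (simp add: additive_on_cochains_def)

lemma koszul_chain_cobd:
  assumes comm: "\<And>i j p. f i (f j p) = f j (f i p)" and "R \<ge> 1" "length is = Suc k"
  shows "koszul_chain R u f (Suc k) is (cobd a)
    = koszul (\<lambda>i. map_pt (f i)) (koszul_chain R u f k) is (\<lambda>l. a (map Up l))"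
  using assms(3)
proof (induction k arbitrary: a "is")
  case 0
  then obtain i where "is = [i]"
    by (metis Suc_length_conv length_0_conv)
  then show ?case
    unfolding koszul_chain.simps(2)
    by (subst cone_cobd) (use assms in auto)
next
  case (Suc k)
  let ?\<rho> = "\<lambda>i. map_pt (f i)" and ?c = "koszul_chain R u f"
  have commpt: "?\<rho> i (?\<rho> j p) = ?\<rho> j (?\<rho> i p)" for i j p
    using comm by (simp add: pt.map_comp comp_def)
  have "koszul ?\<rho> (?c (Suc k)) is (cobd b) = 0" for b
  proof -
    have "koszul ?\<rho> (?c (Suc k)) is (cobd b) = koszul ?\<rho> (koszul ?\<rho> (?c k)) is (\<lambda>l. b (map Up l))"
    proof (rule koszul_cong)
      fix i and js :: "nat list" assume js: "Suc (length js) = length is"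
      have "(\<lambda>l. cobd b (map (?\<rho> i) l) - cobd b l) = cobd (\<lambda>l. b (map (?\<rho> i) l) - b l)"
        by (simp add: fun_eq_iff cobd_diff cobd_map)
      moreover have "?c (Suc k) js (cobd (\<lambda>l. b (map (?\<rho> i) l) - b l)) =
          koszul ?\<rho> (?c k) js (\<lambda>l. b (map (?\<rho> i) (map Up l)) - b (map Up l))"
        using js Suc by simp
      ultimately show "?c (Suc k) js (\<lambda>l. cobd b (map (?\<rho> i) l) - cobd b l) =
         koszul ?\<rho> (?c k) js (\<lambda>l. b (map Up (map (?\<rho> i) l)) - b (map Up l))"
        by (simp add: comp_def)
    qed
    also have "\<dots> = 0"
      by (rule koszul_koszul) (rule commpt)
    finally show ?thesis .
  qed
  then show ?case
    unfolding koszul_chain.simps(2)[of _ _ _ "Suc k"]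
    by (subst cone_cobd)
       (use assms koszul_add[OF koszul_chain_additive] in \<open>auto\<close>)
qed

lemma supported_on_koszul:
  assumes "\<And>js. supported_on (c js) P" and "\<And>i S. P S \<Longrightarrow> P (\<rho> i ` S)"
  shows "supported_on (koszul \<rho> c is) P"
  using assms(1)
proof (induction "is" arbitrary: c)
  case Nil
  then show ?case by (simp add: supported_on_def)
next
  case (Cons i "is")
  show ?case
    unfolding supported_on_def
  proof (intro allI impI)
    fix a b :: "'a list \<Rightarrow> int"
    assume ab: "\<forall>l. l \<noteq> [] \<longrightarrow> P (set l) \<longrightarrow> a l = b l"
    have "koszul \<rho> (\<lambda>js. c (i # js)) is a = koszul \<rho> (\<lambda>js. c (i # js)) is b"
      using Cons.IH[of "\<lambda>js. c (i # js)"] Cons.prems ab by (auto simp: supported_on_def)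
    moreover have "c is (\<lambda>l. a (map (\<rho> i) l) - a l) = c is (\<lambda>l. b (map (\<rho> i) l) - b l)"
      using ab assms(2) by (intro supported_onD[OF Cons.prems]) auto
    ultimately show "koszul \<rho> c (i # is) a = koszul \<rho> c (i # is) b"
      by simp
  qed
qed

lemma supported_on_koszul_chain:
  assumes "R \<ge> 1"
    and mono: "\<And>k S S'. P k S \<Longrightarrow> S' \<subseteq> S \<Longrightarrow> P k S'"
    and base: "P 0 {Apex u}"
    and rot: "\<And>k i S. P k S \<Longrightarrow> P k (map_pt (f i) ` S)"
    and step: "\<And>k S r. P k S \<Longrightarrow> r < R \<Longrightarrow> P (Suc k) (level R u r ` S \<union> level R u (Suc r) ` S)"
  shows "supported_on (koszul_chain R u f k is) (P k)"
proof (induction k arbitrary: "is")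
  case 0
  show ?case using base by (auto simp: supported_on_def)
next
  case (Suc k)
  have "supported_on (koszul (\<lambda>i. map_pt (f i)) (koszul_chain R u f k) is) (P k)"
    by (rule supported_on_koszul) (use Suc rot in auto)
  then have "supported_on (cone R u (koszul (\<lambda>i. map_pt (f i)) (koszul_chain R u f k) is)) (P (Suc k))"
    by (rule supported_on_cone) (use assms in auto)
  then show ?case by (simp add: fun_eq_iff supported_on_def)
qed

section \<open>Equicontinuous families\<close>

text \<open>Values lie in a metric space so that real test functions, used with bumps, and complex
  ones, used with eigenfunctions, are treated together.\<close>

definition equicts :: "'a topology \<Rightarrow> ('a \<Rightarrow> 'b::metric_space) set \<Rightarrow> bool" where
  "equicts X H \<longleftrightarrow> (\<forall>x\<in>topspace X. \<forall>\<epsilon>>0. \<exists>U. openin X U \<and> x \<in> U \<and>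
     (\<forall>y\<in>U. \<forall>f\<in>H. dist (f y) (f x) < \<epsilon>))"

lemma equictsD:
  "equicts X H \<Longrightarrow> x \<in> topspace X \<Longrightarrow> \<epsilon> > 0 \<Longrightarrow>
    \<exists>U. openin X U \<and> x \<in> U \<and> (\<forall>y\<in>U. \<forall>f\<in>H. dist (f y) (f x) < \<epsilon>)"
  unfolding equicts_def by blast

lemma equicts_mono: "equicts X H \<Longrightarrow> H' \<subseteq> H \<Longrightarrow> equicts X H'"
  unfolding equicts_def by (meson subsetD)

lemma equicts_imp_continuous:
  assumes "equicts X H" "f \<in> H"
  shows "continuous_map X euclidean f"
  unfolding continuous_map_def
proof (intro conjI allI impI)
  fix V :: "'b set" assume V: "openin euclidean V"
  show "openin X {x \<in> topspace X. f x \<in> V}"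
  proof (subst openin_subopen, clarify)
    fix x assume x: "x \<in> topspace X" "f x \<in> V"
    obtain \<epsilon> where \<epsilon>: "\<epsilon> > 0" "\<And>y. dist y (f x) < \<epsilon> \<Longrightarrow> y \<in> V"
      using V x by (auto simp: open_dist)
    obtain U where "openin X U" "x \<in> U" "\<forall>y\<in>U. \<forall>f\<in>H. dist (f y) (f x) < \<epsilon>"
      using equictsD[OF assms(1) x(1) \<epsilon>(1)] by blast
    with \<epsilon> assms show "\<exists>T. openin X T \<and> x \<in> T \<and> T \<subseteq> {x \<in> topspace X. f x \<in> V}"
      by (intro exI[of _ U]) (auto dest: openin_subset)
  qed
qed auto

lemma equicts_finite:
  assumes "finite H" "\<And>f. f \<in> H \<Longrightarrow> continuous_map X euclidean f"
  shows "equicts X H"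
  unfolding equicts_def
proof (intro ballI allI impI)
  fix x and \<epsilon> :: real assume x: "x \<in> topspace X" and \<epsilon>: "\<epsilon> > 0"
  let ?U = "topspace X \<inter> (\<Inter>f\<in>H. {y \<in> topspace X. f y \<in> ball (f x) \<epsilon>})"
  have "openin X {y \<in> topspace X. f y \<in> ball (f x) \<epsilon>}" if "f \<in> H" for f
    using assms(2)[OF that] by (auto simp: continuous_map_def)
  then have "openin X ?U"
    using assms(1) by (cases "H = {}") (auto intro!: openin_Int openin_INT)
  then show "\<exists>U. openin X U \<and> x \<in> U \<and> (\<forall>y\<in>U. \<forall>f\<in>H. dist (f y) (f x) < \<epsilon>)"
    using x \<epsilon> by (intro exI[of _ ?U]) (auto simp: dist_commute)
qed

lemma equicts_compose:
  assumes "equicts Y H" "continuous_map X Y g"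
  shows "equicts X {\<lambda>x. f (g x) |f. f \<in> H}"
  unfolding equicts_def
proof (intro ballI allI impI)
  fix x and \<epsilon> :: real assume x: "x \<in> topspace X" and \<epsilon>: "\<epsilon> > 0"
  then have "g x \<in> topspace Y"
    using assms(2) by (auto simp: continuous_map_def)
  then obtain U where U: "openin Y U" "g x \<in> U" "\<forall>y\<in>U. \<forall>f\<in>H. dist (f y) (f (g x)) < \<epsilon>"
    using equictsD[OF assms(1) _ \<epsilon>] by blast
  then show "\<exists>U. openin X U \<and> x \<in> U \<and> (\<forall>y\<in>U. \<forall>f\<in>{\<lambda>x. f (g x) |f. f \<in> H}. dist (f y) (f x) < \<epsilon>)"
    using x assms(2)
    by (intro exI[of _ "{z \<in> topspace X. g z \<in> U}"]) (auto simp: continuous_map_def)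
qed

text \<open>A tube argument: compactness of \<open>K\<close> makes the neighbourhood of
  \<open>x\<close> independent of the parameter. In this way equicontinuity passes through a map
  with compact parameters.\<close>

lemma equicts_slices:
  assumes H: "equicts (prod_topology X K) H" and K: "compact_space K"
  shows "equicts X {\<lambda>x. f (x, k) |f k. f \<in> H \<and> k \<in> topspace K}"
  unfolding equicts_def
proof (intro ballI allI impI)
  fix x and \<epsilon> :: real assume x: "x \<in> topspace X" and \<epsilon>: "\<epsilon> > 0"
  define W where "W = \<Union>{A \<times> B |A B. openin X A \<and> openin K B \<and> x \<in> A \<and>
    (\<forall>y\<in>A. \<forall>k\<in>B. \<forall>f\<in>H. dist (f (y, k)) (f (x, k)) < \<epsilon>)}"
  have "openin (prod_topology X K) W"
    unfolding W_def by (rule openin_Union) (auto simp: openin_prod_Times_iff)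
  moreover have "{x} \<times> topspace K \<subseteq> W"
  proof clarify
    fix k assume k: "k \<in> topspace K"
    have "(x, k) \<in> topspace (prod_topology X K)" "\<epsilon> / 2 > 0"
      using x \<epsilon> k by auto
    from equictsD[OF H this] obtain U where U: "openin (prod_topology X K) U" "(x, k) \<in> U"
      "\<forall>p\<in>U. \<forall>f\<in>H. dist (f p) (f (x, k)) < \<epsilon> / 2"
      by blast
    from U(1)[unfolded openin_prod_topology_alt, rule_format, OF U(2)]
    obtain A B where AB: "openin X A" "openin K B" "x \<in> A" "k \<in> B" "A \<times> B \<subseteq> U"
      by (elim exE conjE)
    have "dist (f (y, l)) (f (x, l)) < \<epsilon>" if "y \<in> A" "l \<in> B" "f \<in> H" for y l f
    proof -
      have "(y, l) \<in> U" "(x, l) \<in> U" using that AB by auto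
      with U(3) that(3) have "dist (f (y, l)) (f (x, k)) < \<epsilon> / 2" "dist (f (x, l)) (f (x, k)) < \<epsilon> / 2" by auto
      then show ?thesis by (rule dist_triangle_half_l)
    qed
    then show "(x, k) \<in> W"
      unfolding W_def using AB by blast
  qed
  ultimately obtain U V where UV: "openin X U" "x \<in> U" "topspace K \<subseteq> V" "U \<times> V \<subseteq> W"
    using tube_lemma_right[of X K W "topspace K" x] K x by (auto simp: compact_space_def)
  have "dist (f (y, k)) (f (x, k)) < \<epsilon>" if "y \<in> U" "k \<in> topspace K" "f \<in> H" for y k f
  proof -
    have "(y, k) \<in> W" using that UV by blast
    then show ?thesis using that unfolding W_def by blast
  qed
  then show "\<exists>U. openin X U \<and> x \<in> U \<and>
      (\<forall>y\<in>U. \<forall>f\<in>{\<lambda>x. f (x, k) |f k. f \<in> H \<and> k \<in> topspace K}. dist (f y) (f x) < \<epsilon>)"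
    using UV by (intro exI[of _ U]) auto
qed

text \<open>The Lebesgue number of a cover of the interval turns the pointwise notion into one
  uniform modulus.\<close>

lemma equicts_uniform_interval:
  fixes H :: "(real \<Rightarrow> 'b::metric_space) set"
  assumes "equicts (top_of_set {0..1}) H" "\<epsilon> > 0"
  obtains \<delta> where "\<delta> > 0"
    "\<And>s t f. s \<in> {0..1} \<Longrightarrow> t \<in> {0..1} \<Longrightarrow> \<bar>s - t\<bar> < \<delta> \<Longrightarrow> f \<in> H \<Longrightarrow> dist (f s) (f t) < \<epsilon>"
proof -
  define \<C> where "\<C> = {U. open U \<and> (\<forall>s\<in>U \<inter> {0..1::real}. \<forall>t\<in>U \<inter> {0..1}. \<forall>f\<in>H. dist (f s) (f t) < \<epsilon>)}"
  have "{0..1} \<subseteq> \<Union>\<C>"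
  proof
    fix x :: real assume x: "x \<in> {0..1}"
    have "x \<in> topspace (top_of_set {0..1})" "\<epsilon> / 2 > 0"
      using x assms(2) by auto
    from equictsD[OF assms(1) this] obtain U where U: "openin (top_of_set {0..1}) U" "x \<in> U"
        "\<forall>y\<in>U. \<forall>f\<in>H. dist (f y) (f x) < \<epsilon> / 2"
      by blast
    then obtain V where "open V" "U = {0..1} \<inter> V"
      by (auto simp: openin_open)
    have "dist (f s) (f t) < \<epsilon>" if "s \<in> V \<inter> {0..1}" "t \<in> V \<inter> {0..1}" "f \<in> H" for s t f
    proof -
      have "s \<in> U" "t \<in> U" using that \<open>U = _\<close> by auto
      with U(3) that(3) have "dist (f s) (f x) < \<epsilon> / 2" "dist (f t) (f x) < \<epsilon> / 2" by auto
      then show ?thesis by (rule dist_triangle_half_l)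
    qed
    with \<open>open V\<close> have "V \<in> \<C>"
      by (auto simp: \<C>_def)
    then show "x \<in> \<Union>\<C>"
      using U \<open>U = _\<close> by blast
  qed
  moreover have "open U" if "U \<in> \<C>" for U
    using that by (simp add: \<C>_def)
  ultimately obtain \<delta> where \<delta>: "\<delta> > 0" "\<And>x. x \<in> {0..1} \<Longrightarrow> \<exists>U\<in>\<C>. ball x \<delta> \<subseteq> U"
    using Heine_Borel_lemma[OF compact_Icc] by metis
  show thesis
  proof
    fix s t :: real and f assume st: "s \<in> {0..1}" "t \<in> {0..1}" "\<bar>s - t\<bar> < \<delta>" "f \<in> H"
    obtain U where U: "U \<in> \<C>" "ball s \<delta> \<subseteq> U" using \<delta> st by blast
    have "s \<in> U" "t \<in> U" using U st \<delta> by (auto simp: dist_real_def)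
    then show "dist (f s) (f t) < \<epsilon>" using U st by (auto simp: \<C>_def)
  qed (rule \<delta>)
qed

lemmas projections =
  continuous_map_compose[OF continuous_map_snd continuous_map_fst, unfolded comp_def]
  continuous_map_compose[OF continuous_map_snd continuous_map_snd, unfolded comp_def]
  continuous_map_compose[OF continuous_map_compose[OF continuous_map_snd continuous_map_snd] continuous_map_fst, unfolded comp_def]
  continuous_map_compose[OF continuous_map_compose[OF continuous_map_snd continuous_map_snd] continuous_map_snd, unfolded comp_def]

section \<open>Evaluating cone points\<close>

locale compact_group = topological_group +
  assumes compact: "compact_space T" and Hausdorff: "Hausdorff_space T"

locale compact_action = continuous_right_action + compact_group +
  assumes compact_X: "compact_space X" and Hausdorff_X: "Hausdorff_space X"

text \<open>Despite the name, \<open>\<phi> x g 1\<close> need not equal \<open>x\<close>. For this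
  reason the copy \<open>Up p\<close> of an old point is evaluated by one more application of
  \<open>\<phi>\<close>.\<close>

locale join_retraction = compact_action +
  fixes \<phi> :: "'c \<Rightarrow> 'a \<Rightarrow> real \<Rightarrow> 'c"
  assumes \<phi>_cont: "continuous_map (prod_topology X (prod_topology T (top_of_set {0..1}))) X (\<lambda>(x, g, t). \<phi> x g t)"
    and \<phi>_act: "\<lbrakk>x \<in> topspace X; g \<in> carrier G; a \<in> carrier G; t \<in> {0..1}\<rbrakk>
      \<Longrightarrow> \<phi> (act x a) (g \<otimes> a) t = act (\<phi> x g t) a"
    and \<phi>_0: "\<lbrakk>x \<in> topspace X; x' \<in> topspace X; g \<in> carrier G\<rbrakk> \<Longrightarrow> \<phi> x g 0 = \<phi> x' g 0"
    and \<phi>_1: "\<lbrakk>x \<in> topspace X; g \<in> carrier G; g' \<in> carrier G\<rbrakk> \<Longrightarrow> \<phi> x g 1 = \<phi> x g' 1"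
begin

lemma \<phi>_closed [simp]: "\<lbrakk>x \<in> topspace X; g \<in> carrier G; 0 \<le> t; t \<le> 1\<rbrakk> \<Longrightarrow> \<phi> x g t \<in> topspace X"
  using \<phi>_cont by (force simp: continuous_map_def topspace_eq_carrier)

fun iter :: "'c \<Rightarrow> ('a \<times> real) list \<Rightarrow> 'c" where
  "iter x [] = x"
| "iter x ((g, t) # gs) = iter (\<phi> x g t) gs"

text \<open>A point created early in the tower undergoes further applications of
  \<open>\<phi>\<close>. Estimating all test functions after \<open>n\<close> such steps at once
  keeps early errors under control later.\<close>

definition iterates :: "('c \<Rightarrow> 'd) set \<Rightarrow> nat \<Rightarrow> ('c \<Rightarrow> 'd) set" where
  "iterates H n = {\<lambda>x. f (iter x gs) |f gs. f \<in> H \<and> length gs = n \<and> set gs \<subseteq> carrier G \<times> {0..1}}"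

lemma iterates_0: "iterates H 0 = H"
  by (auto simp: iterates_def)

lemma iterates_Suc_iff:
  "iterates H (Suc n) = {\<lambda>x. h (\<phi> x g t) |h g t. h \<in> iterates H n \<and> g \<in> carrier G \<and> t \<in> {0..1}}"
proof (intro Set.set_eqI iffI)
  fix k assume "k \<in> iterates H (Suc n)"
  then obtain f gs where f: "k = (\<lambda>x. f (iter x gs))" "f \<in> H" "length gs = Suc n" "set gs \<subseteq> carrier G \<times> {0..1}"
    by (auto simp: iterates_def)
  then obtain g t hs where gs: "gs = (g, t) # hs"
    by (cases gs) auto
  have "k = (\<lambda>x. (\<lambda>x. f (iter x hs)) (\<phi> x g t))" "(\<lambda>x. f (iter x hs)) \<in> iterates H n" "g \<in> carrier G" "t \<in> {0..1}"
    using f by (auto simp: gs iterates_def)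
  then show "k \<in> {\<lambda>x. h (\<phi> x g t) |h g t. h \<in> iterates H n \<and> g \<in> carrier G \<and> t \<in> {0..1}}"
    by (intro CollectI exI[of _ "\<lambda>x. f (iter x hs)"] exI[of _ g] exI[of _ t]) auto
next
  fix k assume "k \<in> {\<lambda>x. h (\<phi> x g t) |h g t. h \<in> iterates H n \<and> g \<in> carrier G \<and> t \<in> {0..1}}"
  then obtain h g t where h: "k = (\<lambda>x. h (\<phi> x g t))" "h \<in> iterates H n" "g \<in> carrier G" "t \<in> {0..1}"
    by blast
  then obtain f gs where f: "h = (\<lambda>x. f (iter x gs))" "f \<in> H" "length gs = n" "set gs \<subseteq> carrier G \<times> {0..1}"
    by (auto simp: iterates_def)
  then have "k = (\<lambda>x. f (iter x ((g, t) # gs)))"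
    by (simp add: h)
  then show "k \<in> iterates H (Suc n)"
    unfolding iterates_def using f h by (intro CollectI exI[of _ f] exI[of _ "(g, t) # gs"]) auto
qed

lemma compact_group_interval: "compact_space (prod_topology T (top_of_set {0..1::real}))"
  using compact by (simp add: compact_space_prod_topology compact_space_subtopology)

text \<open>Every step has its parameters in the compact space of pairs of group element and time,
  so \<open>equicts_slices\<close> applies once per step.\<close>

lemma equicts_iterates:
  assumes "equicts X H"
  shows "equicts X (iterates H n)"
proof (induction n)
  case (Suc n)
  have "equicts X {\<lambda>x. f (x, k) |f k. f \<in> {\<lambda>p. f ((\<lambda>(x, g, t). \<phi> x g t) p) |f. f \<in> iterates H n}
      \<and> k \<in> topspace (prod_topology T (top_of_set {0..1::real}))}"
    by (intro equicts_slices equicts_compose[OF Suc \<phi>_cont] compact_group_interval)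
  then show ?case
  proof (rule equicts_mono, intro subsetI)
    fix k assume "k \<in> iterates H (Suc n)"
    then obtain h g t where "k = (\<lambda>x. h (\<phi> x g t))" "h \<in> iterates H n" "g \<in> carrier G" "t \<in> {0..1}"
      unfolding iterates_Suc_iff by blast
    then show "k \<in> {\<lambda>x. f (x, k) |f k. f \<in> {\<lambda>p. f ((\<lambda>(x, g, t). \<phi> x g t) p) |f. f \<in> iterates H n}
      \<and> k \<in> topspace (prod_topology T (top_of_set {0..1::real}))}"
      by (intro CollectI exI[of _ "\<lambda>p. h ((\<lambda>(x, g, t). \<phi> x g t) p)"] exI[of _ "(g, t)"])
         (auto simp: topspace_eq_carrier)
  qed
qed (simp add: iterates_0 assms)

text \<open>Time is the variable and \<open>(x, g)\<close> the compact parameter, which gives one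
  step width for all points and group elements. It will determine the subdivision
  \<open>R\<close>.\<close>

lemma iterates_time_uniform:
  assumes "equicts X H" "\<epsilon> > 0"
  obtains \<delta> where "\<delta> > 0"
    "\<And>h x g s t. \<lbrakk>h \<in> iterates H n; x \<in> topspace X; g \<in> carrier G; s \<in> {0..1}; t \<in> {0..1}; \<bar>s - t\<bar> < \<delta>\<rbrakk>
      \<Longrightarrow> dist (h (\<phi> x g s)) (h (\<phi> x g t)) < \<epsilon>"
proof -
  let ?I = "top_of_set {0..1::real}"
  have "continuous_map (prod_topology ?I (prod_topology X T)) (prod_topology X (prod_topology T ?I))
     (\<lambda>p. (fst (snd p), snd (snd p), fst p))"
    by (intro continuous_map_pairedI continuous_map_fst projections)
  then have "continuous_map (prod_topology ?I (prod_topology X T)) X (\<lambda>p. \<phi> (fst (snd p)) (snd (snd p)) (fst p))"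
    using continuous_map_compose[OF _ \<phi>_cont] by (fastforce simp: comp_def)
  then have "equicts ?I {\<lambda>x. f (x, k) |f k. f \<in> {\<lambda>p. f (\<phi> (fst (snd p)) (snd (snd p)) (fst p)) |f. f \<in> iterates H n}
      \<and> k \<in> topspace (prod_topology X T)}"
    using assms compact compact_X
    by (intro equicts_slices equicts_compose[OF equicts_iterates])
       (auto simp: compact_space_prod_topology)
  then obtain \<delta> where "\<delta> > 0" and
    \<delta>: "\<And>s t f. s \<in> {0..1} \<Longrightarrow> t \<in> {0..1} \<Longrightarrow> \<bar>s - t\<bar> < \<delta> \<Longrightarrow>
      f \<in> {\<lambda>x. f (x, k) |f k. f \<in> {\<lambda>p. f (\<phi> (fst (snd p)) (snd (snd p)) (fst p)) |f. f \<in> iterates H n}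
      \<and> k \<in> topspace (prod_topology X T)} \<Longrightarrow> dist (f s) (f t) < \<epsilon>"
    using equicts_uniform_interval[OF _ assms(2)] by blast
  show thesis
  proof
    fix h x g s t assume *: "h \<in> iterates H n" "x \<in> topspace X" "g \<in> carrier G" "s \<in> {0..1}" "t \<in> {0..1}" "\<bar>s - t\<bar> < \<delta>"
    have "(\<lambda>s. h (\<phi> x g s)) \<in> {\<lambda>x. f (x, k) |f k. f \<in> {\<lambda>p. f (\<phi> (fst (snd p)) (snd (snd p)) (fst p)) |f. f \<in> iterates H n}
      \<and> k \<in> topspace (prod_topology X T)}"
      using * by (intro CollectI exI[of _ "\<lambda>p. h (\<phi> (fst (snd p)) (snd (snd p)) (fst p))"] exI[of _ "(x, g)"])
         (auto simp: topspace_eq_carrier)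
    from \<delta>[OF *(4,5,6) this] show "dist (h (\<phi> x g s)) (h (\<phi> x g t)) < \<epsilon>" .
  qed (rule \<open>\<delta> > 0\<close>)
qed

text \<open>Perturbs the group coordinate on the right, with \<open>(x, g, t)\<close> as compact
  parameter. The neighbourhood found says how near to the identity \<open>h [^] N\<close> has to
  be.\<close>

lemma iterates_group_uniform:
  assumes "equicts X H" "\<epsilon> > 0"
  obtains V where "openin T V" "\<one> \<in> V"
    "\<And>h x g t v. \<lbrakk>h \<in> iterates H n; x \<in> topspace X; g \<in> carrier G; t \<in> {0..1}; v \<in> V\<rbrakk>
      \<Longrightarrow> dist (h (\<phi> x (g \<otimes> v) t)) (h (\<phi> x g t)) < \<epsilon>"
proof -
  let ?I = "top_of_set {0..1::real}"
  let ?K = "prod_topology X (prod_topology T ?I)"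
  have "continuous_map (prod_topology T ?K) T (\<lambda>p. fst (snd (snd p)) \<otimes> fst p)"
  proof -
    have "continuous_map (prod_topology T ?K) (prod_topology T T) (\<lambda>p. (fst (snd (snd p)), fst p))"
      by (intro continuous_map_pairedI continuous_map_fst projections)
    from continuous_map_compose[OF this continuous_mult] show ?thesis by (simp add: comp_def)
  qed
  then have "continuous_map (prod_topology T ?K) ?K (\<lambda>p. (fst (snd p), fst (snd (snd p)) \<otimes> fst p, snd (snd (snd p))))"
    by (intro continuous_map_pairedI projections)
  then have c: "continuous_map (prod_topology T ?K) X
     (\<lambda>p. \<phi> (fst (snd p)) (fst (snd (snd p)) \<otimes> fst p) (snd (snd (snd p))))"
    using continuous_map_compose[OF _ \<phi>_cont] by (fastforce simp: comp_def)
  let ?F = "{\<lambda>x. f (x, k) |f k. f \<in> {\<lambda>p. f (\<phi> (fst (snd p)) (fst (snd (snd p)) \<otimes> fst p) (snd (snd (snd p)))) |f. f \<in> iterates H n}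
      \<and> k \<in> topspace ?K}"
  have eq: "equicts T ?F"
    using assms compact compact_X
    by (intro equicts_slices equicts_compose[OF equicts_iterates c])
       (auto simp: compact_space_prod_topology compact_space_subtopology)
  have "\<one> \<in> topspace T"
    by (simp add: topspace_eq_carrier)
  from equictsD[OF eq this assms(2)] obtain V where V: "openin T V" "\<one> \<in> V" "\<forall>v\<in>V. \<forall>f\<in>?F. dist (f v) (f \<one>) < \<epsilon>"
    by (elim exE conjE)
  show thesis
  proof
    fix h x g v and t :: real assume *: "h \<in> iterates H n" "x \<in> topspace X" "g \<in> carrier G" "t \<in> {0..1}" "v \<in> V"
    have "(\<lambda>v. h (\<phi> x (g \<otimes> v) t)) \<in> ?F"
      using * by (intro CollectI exI[of _ "\<lambda>p. h (\<phi> (fst (snd p)) (fst (snd (snd p)) \<otimes> fst p) (snd (snd (snd p))))"] exI[of _ "(x, g, t)"])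
         (auto simp: topspace_eq_carrier)
    from V(3)[rule_format, OF *(5) this] show "dist (h (\<phi> x (g \<otimes> v) t)) (h (\<phi> x g t)) < \<epsilon>"
      using * by simp
  qed (use V in auto)
qed

text \<open>\<open>Mid p l r\<close> is the point at time \<open>r / R\<close> on the join segment
  from the vertex \<open>e l\<close> to \<open>p\<close>; the \<open>min\<close> keeps the time in
  the unit interval for every \<open>r\<close>. Choosing \<open>x0\<close> and \<open>\<one>\<close>
  is legitimate because the join forgets these coordinates at its ends.\<close>

fun eval_pt :: "nat \<Rightarrow> 'c \<Rightarrow> ('l \<Rightarrow> 'a) \<Rightarrow> 'l pt \<Rightarrow> 'c" where
  "eval_pt R x0 e (Apex l) = \<phi> x0 (e l) 0"
| "eval_pt R x0 e (Up p) = \<phi> (eval_pt R x0 e p) \<one> 1"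
| "eval_pt R x0 e (Mid p l r) = \<phi> (eval_pt R x0 e p) (e l) (min 1 (real r / real R))"

lemma eval_pt_closed: "x0 \<in> topspace X \<Longrightarrow> (\<And>l. e l \<in> carrier G) \<Longrightarrow> eval_pt R x0 e p \<in> topspace X"
  by (induction p) auto

text \<open>At \<open>Apex\<close> and \<open>Up\<close>, equivariance of \<open>\<phi>\<close>
  would also move the chosen \<open>x0\<close> or \<open>\<one>\<close>; the identifications at the
  ends of the join undo this.\<close>

lemma eval_pt_act:
  assumes x0: "x0 \<in> topspace X" and e: "\<And>l. e l \<in> carrier G" and a: "a \<in> carrier G"
    and f: "\<And>l. e (f l) = e l \<otimes> a"
  shows "eval_pt R x0 e (map_pt f p) = act (eval_pt R x0 e p) a"
proof (induction p)
  case (Apex l)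
  then show ?case
    using x0 e a \<phi>_act[of x0 "e l" a 0] \<phi>_0[of x0 "act x0 a" "e l \<otimes> a"] by (simp add: f act_closed)
next
  case (Up p)
  let ?y = "eval_pt R x0 e p"
  have "?y \<in> topspace X" by (simp add: eval_pt_closed x0 e)
  then show ?case
    using Up a \<phi>_act[of ?y \<one> a 1] \<phi>_1[of "act ?y a" \<one> "\<one> \<otimes> a"] by (simp add: act_closed)
next
  case (Mid p l r)
  then show ?case
    using a e \<phi>_act[of "eval_pt R x0 e p" "e l" a] by (simp add: f eval_pt_closed x0 e)
qed

end

fun depth :: "'l pt \<Rightarrow> nat" where
  "depth (Apex l) = 0"
| "depth (Up p) = Suc (depth p)"
| "depth (Mid p l r) = Suc (depth p)"

context join_retraction
begin

text \<open>Each cone coordinate causes at most one replacement of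
  \<open>e l \<otimes> a \<otimes> v\<close> by \<open>e l \<otimes> a\<close>, at cost
  \<open>\<eta>\<close>. Going one coordinate deeper lengthens the iterate \<open>h\<close> by one
  step, which explains the bound on \<open>depth p + n\<close>.\<close>

lemma eval_pt_almost_act:
  assumes x0: "x0 \<in> topspace X" and e: "\<And>l. e l \<in> carrier G" and a: "a \<in> carrier G"
    and V: "V \<subseteq> carrier G" "\<And>l. \<exists>v\<in>V. e (f l) = e l \<otimes> a \<otimes> v"
    and \<eta>: "\<And>n h x g t v. \<lbrakk>n \<le> m; h \<in> iterates H n; x \<in> topspace X; g \<in> carrier G; t \<in> {0..1}; v \<in> V\<rbrakk>
      \<Longrightarrow> dist (h (\<phi> x (g \<otimes> v) t)) (h (\<phi> x g t)) \<le> \<eta>"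
    and "depth p + n \<le> m" "h \<in> iterates H n"
  shows "dist (h (eval_pt R x0 e (map_pt f p))) (h (act (eval_pt R x0 e p) a)) \<le> (real (depth p) + 1) * \<eta>"
  using assms(7,8)
proof (induction p arbitrary: n h)
  case (Apex l)
  obtain v where v: "v \<in> V" "e (f l) = e l \<otimes> a \<otimes> v" using V by blast
  have "act (\<phi> x0 (e l) 0) a = \<phi> x0 (e l \<otimes> a) 0"
    using x0 e a \<phi>_act[of x0 "e l" a 0] \<phi>_0[of x0 "act x0 a" "e l \<otimes> a"] by (simp add: act_closed)
  then show ?case
    using \<eta>[of n h x0 "e l \<otimes> a" 0 v] Apex v x0 e a by simp
next
  case (Up p)
  let ?y = "eval_pt R x0 e p"
  have y: "?y \<in> topspace X" by (simp add: eval_pt_closed x0 e)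
  have "0 \<le> \<eta>"
  proof -
    obtain v where "v \<in> V" using V(2) by blast
    then have "dist (h (\<phi> x0 (\<one> \<otimes> v) 0)) (h (\<phi> x0 \<one> 0)) \<le> \<eta>"
      using Up.prems x0 by (intro \<eta>[of n]) auto
    then show ?thesis
      using zero_le_dist order_trans by blast
  qed
  have "act (\<phi> ?y \<one> 1) a = \<phi> (act ?y a) \<one> 1"
    using y a \<phi>_act[of ?y \<one> a 1] \<phi>_1[of "act ?y a" \<one> "\<one> \<otimes> a"] by (simp add: act_closed)
  moreover have "(\<lambda>x. h (\<phi> x \<one> 1)) \<in> iterates H (Suc n)"
    unfolding iterates_Suc_iff using Up.prems
    by (intro CollectI exI[of _ h] exI[of _ \<one>] exI[of _ 1]) auto
  from Up.IH[OF _ this] have "dist (h (\<phi> (eval_pt R x0 e (map_pt f p)) \<one> 1)) (h (\<phi> (act ?y a) \<one> 1)) \<le> (real (depth p) + 1) * \<eta>"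
    using Up.prems by simp
  ultimately show ?case
    using \<open>0 \<le> \<eta>\<close> by (simp add: algebra_simps)
next
  case (Mid p l r)
  let ?y = "eval_pt R x0 e p" and ?t = "min 1 (real r / real R)"
  have y: "?y \<in> topspace X" by (simp add: eval_pt_closed x0 e)
  have t: "?t \<in> {0..1}" by simp
  obtain v where v: "v \<in> V" "e (f l) = e l \<otimes> a \<otimes> v" using V by blast
  have "(\<lambda>x. h (\<phi> x (e (f l)) ?t)) \<in> iterates H (Suc n)"
    unfolding iterates_Suc_iff using Mid.prems e t by blast
  from Mid.IH[OF _ this] have 1: "dist (h (\<phi> (eval_pt R x0 e (map_pt f p)) (e (f l)) ?t)) (h (\<phi> (act ?y a) (e (f l)) ?t))
      \<le> (real (depth p) + 1) * \<eta>"
    using Mid.prems by simp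
  have 2: "dist (h (\<phi> (act ?y a) (e (f l)) ?t)) (h (\<phi> (act ?y a) (e l \<otimes> a) ?t)) \<le> \<eta>"
    unfolding v(2) using Mid.prems y a e t v by (intro \<eta>[of n]) (auto simp: act_closed)
  have "act (\<phi> ?y (e l) ?t) a = \<phi> (act ?y a) (e l \<otimes> a) ?t"
    using y a e t by (intro \<phi>_act[symmetric]) auto
  then show ?case
    using 1 2 dist_triangle[of "h (\<phi> (eval_pt R x0 e (map_pt f p)) (e (f l)) ?t)" "h (\<phi> (act ?y a) (e l \<otimes> a) ?t)"
        "h (\<phi> (act ?y a) (e (f l)) ?t)"]
    by (simp add: algebra_simps)
qed

text \<open>The quantifier over relabellings \<open>f\<close> makes the property stable under
  rotation and controls all translates of a simplex. The connected set \<open>C\<close> is there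
  because a chart coordinate in a totally disconnected group is constant on it. Errors are measured
  after the \<open>m - k\<close> steps still to come.\<close>

definition close_pts :: "nat \<Rightarrow> 'c \<Rightarrow> ('l \<Rightarrow> 'a) \<Rightarrow> ('c \<Rightarrow> 'd::metric_space) set \<Rightarrow>
    nat \<Rightarrow> real \<Rightarrow> nat \<Rightarrow> 'l pt set \<Rightarrow> bool" where
  "close_pts R x0 e H m \<eta> k S \<longleftrightarrow> (k \<le> m \<longrightarrow>
     (\<forall>p\<in>S. depth p \<le> k) \<and>
     (\<forall>f. \<exists>C. connectedin X C \<and> C \<noteq> {} \<and> (\<forall>p\<in>S. eval_pt R x0 e (map_pt f p) \<in> C) \<and>
       (\<forall>x\<in>C. \<forall>y\<in>C. \<forall>h\<in>iterates H (m - k). dist (h x) (h y) \<le> real k * \<eta>)))"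

lemma close_pts_mono: "close_pts R x0 e H m \<eta> k S \<Longrightarrow> S' \<subseteq> S \<Longrightarrow> close_pts R x0 e H m \<eta> k S'"
  unfolding close_pts_def by (meson subsetD)

lemma close_pts_Apex:
  fixes e :: "'l \<Rightarrow> 'a"
  assumes "x0 \<in> topspace X" "\<And>l. e l \<in> carrier G"
  shows "close_pts R x0 e H m \<eta> 0 {Apex u}"
  unfolding close_pts_def
proof (intro impI conjI ballI allI)
  fix f :: "'l \<Rightarrow> 'l"
  show "\<exists>C. connectedin X C \<and> C \<noteq> {} \<and> (\<forall>p\<in>{Apex u}. eval_pt R x0 e (map_pt f p) \<in> C) \<and>
      (\<forall>x\<in>C. \<forall>y\<in>C. \<forall>h\<in>iterates H (m - 0). dist (h x) (h y) \<le> real 0 * \<eta>)"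
    by (rule exI[of _ "{eval_pt R x0 e (map_pt f (Apex u))}"]) (use assms in \<open>simp add: connectedin_sing\<close>)
qed auto

lemma close_pts_map:
  fixes f :: "'l \<Rightarrow> 'l"
  assumes "close_pts R x0 e H m \<eta> k S"
  shows "close_pts R x0 e H m \<eta> k (map_pt f ` S)"
proof -
  have d: "depth (map_pt f p) = depth p" for p by (induction p) auto
  show ?thesis
    unfolding close_pts_def
  proof (intro impI conjI ballI allI)
    fix g :: "'l \<Rightarrow> 'l" assume k: "k \<le> m"
    from assms(1)[unfolded close_pts_def, rule_format, OF k, THEN conjunct2, rule_format, of "g \<circ> f"]
    obtain C where "connectedin X C" "C \<noteq> {}" "\<forall>p\<in>S. eval_pt R x0 e (map_pt (g \<circ> f) p) \<in> C"
       "\<forall>x\<in>C. \<forall>y\<in>C. \<forall>h\<in>iterates H (m - k). dist (h x) (h y) \<le> real k * \<eta>"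
      by (elim exE conjE)
    then show "\<exists>C. connectedin X C \<and> C \<noteq> {} \<and> (\<forall>p\<in>map_pt f ` S. eval_pt R x0 e (map_pt g p) \<in> C) \<and>
       (\<forall>x\<in>C. \<forall>y\<in>C. \<forall>h\<in>iterates H (m - k). dist (h x) (h y) \<le> real k * \<eta>)"
      by (intro exI[of _ C]) (auto simp: pt.map_comp)
  qed (use assms(1) d in \<open>auto simp: close_pts_def\<close>)
qed

lemma close_pts_level:
  fixes e :: "'l \<Rightarrow> 'a"
  assumes S: "close_pts R x0 e H m \<eta> k S" and r: "r < R"
    and x0: "x0 \<in> topspace X" and e: "\<And>l. e l \<in> carrier G"
    and \<eta>: "\<And>n h x g s t. \<lbrakk>n \<le> m; h \<in> iterates H n; x \<in> topspace X; g \<in> carrier G; s \<in> {0..1}; t \<in> {0..1};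
        \<bar>s - t\<bar> \<le> 1 / R\<rbrakk> \<Longrightarrow> dist (h (\<phi> x g s)) (h (\<phi> x g t)) \<le> \<eta>"
  shows "close_pts R x0 e H m \<eta> (Suc k) (level R u r ` S \<union> level R u (Suc r) ` S)"
  unfolding close_pts_def
proof (intro impI conjI ballI allI)
  fix p assume k: "Suc k \<le> m" and "p \<in> level R u r ` S \<union> level R u (Suc r) ` S"
  then show "depth p \<le> Suc k"
    using S by (fastforce simp: close_pts_def level_def)
next
  fix f :: "'l \<Rightarrow> 'l" assume k: "Suc k \<le> m"
  then obtain n where n: "m - k = Suc n" "m - Suc k = n"
    by (metis Suc_diff_Suc Suc_le_lessD)
  obtain C where C: "connectedin X C" "C \<noteq> {}" "\<And>p. p \<in> S \<Longrightarrow> eval_pt R x0 e (map_pt f p) \<in> C"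
     "\<And>x y h. \<lbrakk>x \<in> C; y \<in> C; h \<in> iterates H (Suc n)\<rbrakk> \<Longrightarrow> dist (h x) (h y) \<le> real k * \<eta>"
    using S k n unfolding close_pts_def by (metis Suc_leD)
  have CX: "C \<subseteq> topspace X" using C(1) by (simp add: connectedin_subset_topspace)
  let ?J = "{real r / R .. real (Suc r) / R}" and ?g = "e (f u)"
  have R: "R > 0" using r by simp
  have J: "?J \<subseteq> {0..1}" using r R by (auto simp: divide_simps)
  \<comment> \<open>One cone layer evaluates in the image of \<open>C\<close> during the times from
    \<open>r / R\<close> to \<open>(r + 1) / R\<close>, and this image is again connected.\<close>
  define D where "D = (\<lambda>(x, g, t). \<phi> x g t) ` (C \<times> {?g} \<times> ?J)"
  have "connectedin (prod_topology X (prod_topology T (top_of_set {0..1}))) (C \<times> {?g} \<times> ?J)"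
    using C(1) e J by (simp add: connectedin_Times connectedin_sing topspace_eq_carrier connectedin_subtopology
       connectedin_iff_connected)
  then have "connectedin X D"
    unfolding D_def using \<phi>_cont connectedin_continuous_map_image by blast
  moreover have "D \<noteq> {}"
    using C(2) R by (auto simp: D_def divide_simps)
  moreover have "eval_pt R x0 e (map_pt f p) \<in> D" if p: "p \<in> level R u r ` S \<union> level R u (Suc r) ` S" for p
  proof -
    obtain d s where d: "d \<in> S" "p = level R u s d" "s = r \<or> s = Suc r" using p by blast
    let ?y = "eval_pt R x0 e (map_pt f d)"
    have y: "?y \<in> C" using C d by blast
    have s: "real s / R \<in> ?J" "real s / R \<le> 1" "s \<le> R"
      using d r R by (auto simp: divide_simps)
    have "eval_pt R x0 e (map_pt f p) = \<phi> ?y ?g (real s / R)"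
    proof -
      consider "s = 0" | "0 < s" "s < R" | "s = R" "s > 0"
        using s R by linarith
      then show ?thesis
      proof cases
        case 1
        then show ?thesis using y CX x0 e \<phi>_0[of x0 ?y ?g] by (auto simp: d level_def)
      next
        case 2
        then show ?thesis using s by (simp add: d level_def)
      next
        case 3
        then show ?thesis using y CX e R \<phi>_1[of ?y \<one> ?g] by (auto simp: d level_def)
      qed
    qed
    then show ?thesis
      unfolding D_def using y s by (intro image_eqI[of _ _ "(?y, ?g, real s / R)"]) auto
  qed
  moreover have "dist (h x) (h y) \<le> real (Suc k) * \<eta>" if xyh: "x \<in> D" "y \<in> D" "h \<in> iterates H (m - Suc k)" for x y h
  proof -
    obtain x' s where x: "x' \<in> C" "s \<in> ?J" "x = \<phi> x' ?g s" using xyh by (auto simp: D_def)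
    obtain y' t where y: "y' \<in> C" "t \<in> ?J" "y = \<phi> y' ?g t" using xyh by (auto simp: D_def)
    \<comment> \<open>Moving the point inside \<open>C\<close> at a fixed time costs the old error,
      as \<open>h\<close> after one step is an iterate of length \<open>Suc n\<close>. Changing the
      time afterwards costs \<open>\<eta>\<close>.\<close>
    have "(\<lambda>x. h (\<phi> x ?g s)) \<in> iterates H (Suc n)"
      unfolding iterates_Suc_iff using xyh n e x J by blast
    from C(4)[OF x(1) y(1) this] have 1: "dist (h x) (h (\<phi> y' ?g s)) \<le> real k * \<eta>"
      using x by simp
    have "\<bar>s - t\<bar> \<le> real (Suc r) / R - real r / R"
      using x(2) y(2) by auto
    also have "\<dots> = 1 / R"
      by (simp add: diff_divide_distrib[symmetric])
    finally have "\<bar>s - t\<bar> \<le> 1 / R" .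
    then have "dist (h (\<phi> y' ?g s)) (h y) \<le> \<eta>"
      unfolding y(3)
    proof (intro \<eta>[of n])
      show "s \<in> {0..1}" "t \<in> {0..1}" using x(2) y(2) J by blast+
    qed (use xyh n y(1) CX e k in auto)
    then show ?thesis
      using 1 dist_triangle[of "h x" "h y" "h (\<phi> y' ?g s)"] by (simp add: algebra_simps)
  qed
  ultimately show "\<exists>C. connectedin X C \<and> C \<noteq> {} \<and>
     (\<forall>p\<in>level R u r ` S \<union> level R u (Suc r) ` S. eval_pt R x0 e (map_pt f p) \<in> C) \<and>
     (\<forall>x\<in>C. \<forall>y\<in>C. \<forall>h\<in>iterates H (m - Suc k). dist (h x) (h y) \<le> real (Suc k) * \<eta>)"
    by blast
qed

end

section \<open>The invariant mean of a compact group\<close>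

lemma continuous_map_slices_uniform:
  assumes "continuous_map (prod_topology X K) euclidean F" "compact_space K" "x \<in> topspace X" "\<epsilon> > 0"
  obtains U where "openin X U" "x \<in> U"
    "\<And>y k. y \<in> U \<Longrightarrow> k \<in> topspace K \<Longrightarrow> dist (F (y, k)) (F (x, k)) < \<epsilon>"
proof -
  have "equicts (prod_topology X K) {F}"
    using assms by (intro equicts_finite) auto
  from equictsD[OF equicts_slices[OF this assms(2)] assms(3,4)]
  obtain U where U: "openin X U" "x \<in> U"
    "\<forall>y\<in>U. \<forall>f\<in>{\<lambda>x. f (x, k) |f k. f \<in> {F} \<and> k \<in> topspace K}. dist (f y) (f x) < \<epsilon>"
    by (elim exE conjE)
  have "dist (F (y, k)) (F (x, k)) < \<epsilon>" if "y \<in> U" "k \<in> topspace K" for y k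
    using U(3)[rule_format, of y "\<lambda>x. F (x, k)"] that by blast
  then show thesis using that U by blast
qed

lemma real_eqI: "(\<And>\<epsilon>. \<epsilon> > 0 \<Longrightarrow> \<bar>x - y\<bar> \<le> \<epsilon>) \<Longrightarrow> x = (y :: real)"
  using dense_eq0_I[of "x - y"] by simp

context topological_group
begin

lemma mult_continuous:
  assumes "continuous_map X T f" "continuous_map X T g"
  shows "continuous_map X T (\<lambda>x. f x \<otimes> g x)"
  using continuous_map_compose[OF continuous_map_pairedI[OF assms] continuous_mult] by (simp add: comp_def)

lemma translate_right_continuous: "a \<in> carrier G \<Longrightarrow> continuous_map T T (\<lambda>x. x \<otimes> a)"
  by (intro mult_continuous) (auto simp: topspace_eq_carrier)

lemma translate_left_continuous: "a \<in> carrier G \<Longrightarrow> continuous_map T T (\<lambda>x. a \<otimes> x)"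
  by (intro mult_continuous) (auto simp: topspace_eq_carrier)

abbreviation cont :: "('a \<Rightarrow> real) \<Rightarrow> bool" where
  "cont f \<equiv> continuous_map T euclideanreal f"

lemma cont_translate_right: "cont f \<Longrightarrow> a \<in> carrier G \<Longrightarrow> cont (\<lambda>x. f (x \<otimes> a))"
  using continuous_map_compose[OF translate_right_continuous, of a _ f] by (simp add: comp_def)

lemma cont_translate_left: "cont f \<Longrightarrow> a \<in> carrier G \<Longrightarrow> cont (\<lambda>x. f (a \<otimes> x))"
  using continuous_map_compose[OF translate_left_continuous, of a _ f] by (simp add: comp_def)

lemma cont_inv: "cont f \<Longrightarrow> cont (\<lambda>x. f (inv x))"
  using continuous_map_compose[OF continuous_inv, of _ f] by (simp add: comp_def)

definition right_avg :: "nat \<Rightarrow> (nat \<Rightarrow> 'a) \<Rightarrow> ('a \<Rightarrow> real) \<Rightarrow> 'a \<Rightarrow> real" where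
  "right_avg n a f x = (\<Sum>i<n. f (x \<otimes> a i)) / real n"

definition left_avg :: "nat \<Rightarrow> (nat \<Rightarrow> 'a) \<Rightarrow> ('a \<Rightarrow> real) \<Rightarrow> 'a \<Rightarrow> real" where
  "left_avg n a f x = (\<Sum>i<n. f (a i \<otimes> x)) / real n"

text \<open>Averages of right translates commute with left translations. They therefore preserve the
  left modulus of continuity, the fact behind the existence of the mean.\<close>

inductive_set right_avgs :: "(('a \<Rightarrow> real) \<Rightarrow> 'a \<Rightarrow> real) set" where
  id: "(\<lambda>f. f) \<in> right_avgs"
| avg: "P \<in> right_avgs \<Longrightarrow> n > 0 \<Longrightarrow> (\<And>i. a i \<in> carrier G) \<Longrightarrow> (\<lambda>f. right_avg n a (P f)) \<in> right_avgs"

inductive_set left_avgs :: "(('a \<Rightarrow> real) \<Rightarrow> 'a \<Rightarrow> real) set" where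
  id: "(\<lambda>f. f) \<in> left_avgs"
| avg: "P \<in> left_avgs \<Longrightarrow> n > 0 \<Longrightarrow> (\<And>i. a i \<in> carrier G) \<Longrightarrow> (\<lambda>f. left_avg n a (P f)) \<in> left_avgs"

lemma avg_lower:
  fixes g :: "nat \<Rightarrow> real"
  assumes "n > 0" "\<And>i. i < n \<Longrightarrow> c \<le> g i" shows "c \<le> (\<Sum>i<n. g i) / real n"
  using sum_mono[of "{..<n}" "\<lambda>_. c" g] assms by (simp add: field_simps)

lemma avg_upper:
  fixes g :: "nat \<Rightarrow> real"
  assumes "n > 0" "\<And>i. i < n \<Longrightarrow> g i \<le> c" shows "(\<Sum>i<n. g i) / real n \<le> c"
  using sum_mono[of "{..<n}" g "\<lambda>_. c"] assms by (simp add: field_simps)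

lemma right_avgs_lower: "P \<in> right_avgs \<Longrightarrow> (\<And>x. x \<in> carrier G \<Longrightarrow> c \<le> f x) \<Longrightarrow> x \<in> carrier G \<Longrightarrow> c \<le> P f x"
  by (induction arbitrary: x rule: right_avgs.induct) (auto simp: right_avg_def intro!: avg_lower)

lemma right_avgs_upper: "P \<in> right_avgs \<Longrightarrow> (\<And>x. x \<in> carrier G \<Longrightarrow> f x \<le> c) \<Longrightarrow> x \<in> carrier G \<Longrightarrow> P f x \<le> c"
  by (induction arbitrary: x rule: right_avgs.induct) (auto simp: right_avg_def intro!: avg_upper)

lemma left_avgs_lower: "P \<in> left_avgs \<Longrightarrow> (\<And>x. x \<in> carrier G \<Longrightarrow> c \<le> f x) \<Longrightarrow> x \<in> carrier G \<Longrightarrow> c \<le> P f x"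
  by (induction arbitrary: x rule: left_avgs.induct) (auto simp: left_avg_def intro!: avg_lower)

lemma left_avgs_upper: "P \<in> left_avgs \<Longrightarrow> (\<And>x. x \<in> carrier G \<Longrightarrow> f x \<le> c) \<Longrightarrow> x \<in> carrier G \<Longrightarrow> P f x \<le> c"
  by (induction arbitrary: x rule: left_avgs.induct) (auto simp: left_avg_def intro!: avg_upper)

lemma right_avgs_add: "P \<in> right_avgs \<Longrightarrow> P (\<lambda>x. f x + g x) = (\<lambda>x. P f x + P g x)"
  by (induction rule: right_avgs.induct) (auto simp: right_avg_def fun_eq_iff sum.distrib add_divide_distrib)

lemma right_avgs_scale: "P \<in> right_avgs \<Longrightarrow> P (\<lambda>x. c * f x) = (\<lambda>x. c * P f x)"
  by (induction rule: right_avgs.induct) (auto simp: right_avg_def fun_eq_iff sum_distrib_left)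

lemma right_avgs_comp: "P \<in> right_avgs \<Longrightarrow> Q \<in> right_avgs \<Longrightarrow> (\<lambda>f. P (Q f)) \<in> right_avgs"
  by (induction rule: right_avgs.induct) (auto intro: right_avgs.avg)

lemma right_avgs_left_translate:
  "P \<in> right_avgs \<Longrightarrow> a \<in> carrier G \<Longrightarrow> x \<in> carrier G \<Longrightarrow> P (\<lambda>x. f (a \<otimes> x)) x = P f (a \<otimes> x)"
  by (induction arbitrary: x rule: right_avgs.induct) (auto simp: right_avg_def m_assoc)

lemma right_avgs_cong:
  "P \<in> right_avgs \<Longrightarrow> (\<And>x. x \<in> carrier G \<Longrightarrow> f x = g x) \<Longrightarrow> x \<in> carrier G \<Longrightarrow> P f x = P g x"
  by (induction arbitrary: x rule: right_avgs.induct) (auto simp: right_avg_def)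

text \<open>Left and right translations commute by associativity; the work is to move a finite sum
  through the linear operator \<open>P\<close>.\<close>

lemma right_left_commute:
  assumes P: "P \<in> right_avgs" and Q: "Q \<in> left_avgs" and x: "x \<in> carrier G"
  shows "Q (P f) x = P (Q f) x"
  using Q x
proof (induction arbitrary: x rule: left_avgs.induct)
  case (avg Q n a)
  have "left_avg n a (Q (P f)) x = (\<Sum>i<n. P (Q f) (a i \<otimes> x)) / n"
    using avg by (simp add: left_avg_def)
  also have "\<dots> = (\<Sum>i<n. P (\<lambda>x. Q f (a i \<otimes> x)) x) / n"
    using avg P by (simp add: right_avgs_left_translate)
  also have "\<dots> = P (\<lambda>x. (\<Sum>i<n. Q f (a i \<otimes> x)) / n) x"
  proof -
    have "P (\<lambda>x. \<Sum>i<k. Q f (a i \<otimes> x)) = (\<lambda>x. \<Sum>i<k. P (\<lambda>x. Q f (a i \<otimes> x)) x)" for k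
    proof (induction k)
      case 0
      show ?case using right_avgs_scale[OF P, of 0 "\<lambda>_. 0"] by simp
    next
      case (Suc k)
      then show ?case by (simp add: right_avgs_add[OF P])
    qed
    then show ?thesis
      using right_avgs_scale[OF P, of "1 / n" "\<lambda>x. \<Sum>i<n. Q f (a i \<otimes> x)"] by simp
  qed
  finally show ?case by (simp add: left_avg_def[abs_def])
qed simp

lemma right_avgs_cont: "P \<in> right_avgs \<Longrightarrow> cont f \<Longrightarrow> cont (P f)"
  by (induction rule: right_avgs.induct)
     (auto simp: right_avg_def[abs_def] intro!: continuous_intros cont_translate_right)

lemma right_avgs_modulus:
  assumes "P \<in> right_avgs" and "u \<in> carrier G" and "\<And>x. x \<in> carrier G \<Longrightarrow> \<bar>f (u \<otimes> x) - f x\<bar> \<le> \<delta>" "x \<in> carrier G"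
  shows "\<bar>P f (u \<otimes> x) - P f x\<bar> \<le> \<delta>"
proof -
  have "P f (u \<otimes> x) - P f x = P (\<lambda>x. f (u \<otimes> x) + (-1) * f x) x"
    using assms by (subst right_avgs_add, simp, subst right_avgs_scale, simp)
      (simp add: right_avgs_left_translate)
  also have "\<bar>\<dots>\<bar> \<le> \<delta>"
    unfolding abs_le_iff
    using right_avgs_upper[OF assms(1), of "\<lambda>x. f (u \<otimes> x) + (-1) * f x" \<delta> x]
      right_avgs_lower[OF assms(1), of "-\<delta>" "\<lambda>x. f (u \<otimes> x) + (-1) * f x" x] assms(3,4)
    by (fastforce simp: abs_le_iff)
  finally show ?thesis .
qed

end

context compact_group
begin

lemma left_modulus:
  assumes "cont f" "\<epsilon> > 0"
  obtains U where "openin T U" "\<one> \<in> U" "\<And>u x. u \<in> U \<Longrightarrow> x \<in> carrier G \<Longrightarrow> \<bar>f (u \<otimes> x) - f x\<bar> < \<epsilon>"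
proof -
  have "continuous_map (prod_topology T T) euclidean (\<lambda>p. f ((\<lambda>(g, h). g \<otimes> h) p))"
    using continuous_map_compose[OF continuous_mult assms(1)] by (simp add: comp_def)
  from continuous_map_slices_uniform[OF this compact _ assms(2), of \<one>]
  obtain U where "openin T U" "\<one> \<in> U" and U: "\<And>u x. u \<in> U \<Longrightarrow> x \<in> topspace T \<Longrightarrow>
      dist (f ((\<lambda>(g, h). g \<otimes> h) (u, x))) (f ((\<lambda>(g, h). g \<otimes> h) (\<one>, x))) < \<epsilon>"
    by (metis one_closed topspace_eq_carrier)
  then show thesis
    using that[of U] by (auto simp: topspace_eq_carrier dist_real_def)
qed

lemma finite_translates:
  assumes "openin T U" "\<one> \<in> U"
  obtains n :: nat and b where "n > 0" "\<And>i. b i \<in> carrier G" "\<And>x. x \<in> carrier G \<Longrightarrow> \<exists>i<n. x \<otimes> inv (b i) \<in> U"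
proof -
  let ?W = "\<lambda>b. {x \<in> topspace T. x \<otimes> inv b \<in> U}"
  have 1: "\<forall>U\<in>?W ` carrier G. openin T U"
    using translate_right_continuous[of "inv b" for b] assms by (auto simp: continuous_map_def)
  have 2: "topspace T \<subseteq> \<Union> (?W ` carrier G)"
    using assms by (auto simp: topspace_eq_carrier intro!: bexI)
  from compact[unfolded compact_space_alt, rule_format, OF conjI[OF 1 2]]
  obtain \<F> where F: "finite \<F>" "\<F> \<subseteq> ?W ` carrier G" "topspace T \<subseteq> \<Union>\<F>"
    by (elim exE conjE)
  from finite_subset_image[OF F(1,2)]
  obtain B where B: "finite B" "B \<subseteq> carrier G" "\<F> = ?W ` B"
    by (elim exE conjE)
  have "B \<noteq> {}"
    using F B one_closed by (auto simp: topspace_eq_carrier)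
  obtain b :: "nat \<Rightarrow> 'a" where b: "bij_betw b {0..<card B} B"
    using ex_bij_betw_nat_finite[OF B(1)] by blast
  let ?b = "\<lambda>i. if i < card B then b i else \<one>"
  show thesis
  proof (rule that[of "card B" ?b])
    show "card B > 0" using B \<open>B \<noteq> {}\<close> by (simp add: card_gt_0_iff)
    show "?b i \<in> carrier G" for i
      using b B by (auto simp: bij_betw_def)
    fix x assume "x \<in> carrier G"
    then obtain c where "c \<in> B" "x \<otimes> inv c \<in> U"
      using F B by (auto simp: topspace_eq_carrier)
    moreover then have "c \<in> b ` {0..<card B}"
      using b by (simp add: bij_betw_def)
    then obtain i where "i < card B" "b i = c"
      by auto
    ultimately show "\<exists>i<card B. x \<otimes> inv (?b i) \<in> U"
      by auto
  qed
qed

lemma cont_bounded: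
  assumes "cont f"
  obtains B where "B > 0" "\<And>x. x \<in> carrier G \<Longrightarrow> \<bar>f x\<bar> \<le> B"
proof -
  have "compact (f ` carrier G)"
    using image_compactin[OF compact[unfolded compact_space_def] assms]
    by (simp add: topspace_eq_carrier)
  then obtain B where "\<forall>y\<in>f ` carrier G. norm y \<le> B"
    by (meson bounded_iff compact_imp_bounded)
  then show thesis
    by (intro that[of "max 1 B"]) auto
qed

text \<open>Von Neumann's argument. Let \<open>s0\<close> be the infimum of the oscillations of
  right averages. If \<open>s0 > 0\<close>, an average whose oscillation is near \<open>s0\<close>
  has a low value, which the left modulus spreads over a translate of \<open>U\<close>; averaging
  over the \<open>n\<close> translates covering the group lowers the maximum by
  \<open>s0 / (4 * n)\<close>. As \<open>n\<close> depends only on the modulus of \<open>f\<close>,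
  the average can be chosen after \<open>n\<close>, and \<open>s0\<close> is undercut.\<close>

lemma right_avg_almost_constant:
  assumes f: "cont f" and \<epsilon>: "\<epsilon> > 0"
  obtains P c where "P \<in> right_avgs" "\<And>x. x \<in> carrier G \<Longrightarrow> \<bar>P f x - c\<bar> \<le> \<epsilon>"
proof -
  define S where "S = {s. \<exists>P\<in>right_avgs. \<exists>m. \<forall>x\<in>carrier G. m \<le> P f x \<and> P f x \<le> m + s}"
  obtain B where B: "\<And>x. x \<in> carrier G \<Longrightarrow> \<bar>f x\<bar> \<le> B"
    using cont_bounded[OF f] by blast
  have ne: "2 * B \<in> S"
    unfolding S_def
  proof (intro CollectI bexI[OF _ right_avgs.id] exI[of _ "-B"] ballI)
    fix x assume "x \<in> carrier G"
    from B[OF this] show "- B \<le> f x \<and> f x \<le> - B + 2 * B" by linarith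
  qed
  have S0: "0 \<le> s" if "s \<in> S" for s
    using that one_closed unfolding S_def by force
  then have bdd: "bdd_below S" by (meson bdd_belowI)
  define s0 where "s0 = Inf S"
  have s0: "s0 \<le> s" if "s \<in> S" for s
    unfolding s0_def using that bdd by (rule cInf_lower)
  have "s0 = 0"
  proof (rule ccontr)
    assume "s0 \<noteq> 0"
    moreover have "s0 \<ge> 0"
      unfolding s0_def using ne S0 by (intro cInf_greatest) auto
    ultimately have pos: "s0 > 0" by simp
    obtain U where U: "openin T U" "\<one> \<in> U" "\<And>u x. u \<in> U \<Longrightarrow> x \<in> carrier G \<Longrightarrow> \<bar>f (u \<otimes> x) - f x\<bar> < s0 / 4"
      using left_modulus[OF f, of "s0 / 4"] pos by auto
    have UG: "U \<subseteq> carrier G" using U(1) openin_subset topspace_eq_carrier by blast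
    obtain n :: nat and b where b: "n > 0" "\<And>i. b i \<in> carrier G" "\<And>x. x \<in> carrier G \<Longrightarrow> \<exists>i<n. x \<otimes> inv (b i) \<in> U"
      using finite_translates[OF U(1,2)] by blast
    have "Inf S < s0 + s0 / (4 * n)"
      using pos b by (simp add: s0_def)
    then obtain s where s: "s \<in> S" "s < s0 + s0 / (4 * n)"
      using cInf_lessD[of S] ne by blast
    then obtain P m where P: "P \<in> right_avgs" "\<And>x. x \<in> carrier G \<Longrightarrow> m \<le> P f x" "\<And>x. x \<in> carrier G \<Longrightarrow> P f x \<le> m + s"
      unfolding S_def by blast
    have "\<exists>x0\<in>carrier G. P f x0 < m + s - s0 / 2"
    proof (rule ccontr)
      assume "\<not> ?thesis"
      then have "s0 / 2 \<in> S"
        unfolding S_def using P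
        by (intro CollectI bexI[OF _ P(1)] exI[of _ "m + s - s0 / 2"]) (auto simp: not_less)
      then show False using s0 pos by fastforce
    qed
    then obtain x0 where x0: "x0 \<in> carrier G" "P f x0 < m + s - s0 / 2" by blast
    define a where "a i = inv (b i) \<otimes> x0" for i
    have a: "a i \<in> carrier G" for i using b x0 by (simp add: a_def)
    have up: "right_avg n a (P f) x \<le> m + (s - s0 / (4 * n))" if x: "x \<in> carrier G" for x
    proof -
      obtain i where i: "i < n" "x \<otimes> inv (b i) \<in> U" using b x by blast
      let ?u = "x \<otimes> inv (b i)"
      have "\<bar>P f (?u \<otimes> x0) - P f x0\<bar> \<le> s0 / 4"
        using i U(3) x0 UG by (intro right_avgs_modulus[OF P(1)]) (auto intro: less_imp_le)
      then have "P f (?u \<otimes> x0) \<le> m + s - s0 / 4"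
        using x0(2) by linarith
      then have le: "P f (x \<otimes> a i) \<le> m + s - s0 / 4"
        using x0 x b by (simp add: a_def m_assoc)
      have "(\<Sum>j<n. P f (x \<otimes> a j)) = P f (x \<otimes> a i) + (\<Sum>j\<in>{..<n} - {i}. P f (x \<otimes> a j))"
        using i by (subst sum.remove[of _ i]) auto
      also have "\<dots> \<le> (m + s - s0 / 4) + (\<Sum>j\<in>{..<n} - {i}. m + s)"
        using le x a P by (intro add_mono sum_mono) auto
      also have "\<dots> = n * (m + s) - s0 / 4"
        using i by (simp add: card_Diff_singleton of_nat_diff algebra_simps)
      finally show ?thesis
        using b by (simp add: right_avg_def field_simps)
    qed
    have low: "m \<le> right_avg n a (P f) x" if "x \<in> carrier G" for x
      unfolding right_avg_def using that a P b by (intro avg_lower) auto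
    have "s - s0 / (4 * n) \<in> S"
      unfolding S_def
      by (intro CollectI bexI[of _ "\<lambda>f. right_avg n a (P f)"] exI[of _ m] ballI conjI low up)
         (auto intro: right_avgs.avg P b a)
    then show False
      using s0 s by fastforce
  qed
  then have "Inf S < \<epsilon>" using \<epsilon> by (simp add: s0_def)
  then obtain s where s: "s \<in> S" "s < \<epsilon>"
    using cInf_lessD[of S] ne by blast
  then obtain P m where P: "P \<in> right_avgs" "\<And>x. x \<in> carrier G \<Longrightarrow> m \<le> P f x" "\<And>x. x \<in> carrier G \<Longrightarrow> P f x \<le> m + s"
    unfolding S_def by blast
  show thesis
  proof (rule that[OF P(1)])
    fix x assume "x \<in> carrier G"
    from P(2,3)[OF this] s show "\<bar>P f x - m\<bar> \<le> \<epsilon>" by linarith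
  qed
qed

text \<open>Left averages of \<open>f\<close> are the right averages of \<open>f \<circ> inv\<close> in the inverted variable.\<close>

lemma left_avg_almost_constant:
  assumes f: "cont f" and \<epsilon>: "\<epsilon> > 0"
  obtains Q c where "Q \<in> left_avgs" "\<And>x. x \<in> carrier G \<Longrightarrow> \<bar>Q f x - c\<bar> \<le> \<epsilon>"
proof -
  obtain P c where P: "P \<in> right_avgs" "\<And>x. x \<in> carrier G \<Longrightarrow> \<bar>P (\<lambda>x. f (inv x)) x - c\<bar> \<le> \<epsilon>"
    using right_avg_almost_constant[OF cont_inv[OF f] \<epsilon>] by blast
  have "\<exists>Q\<in>left_avgs. \<forall>x\<in>carrier G. Q f x = P (\<lambda>x. f (inv x)) (inv x)"
    using P(1)
  proof (induction rule: right_avgs.induct)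
    case id
    show ?case by (intro bexI[OF _ left_avgs.id]) auto
  next
    case (avg P n a)
    then obtain Q where Q: "Q \<in> left_avgs" "\<And>x. x \<in> carrier G \<Longrightarrow> Q f x = P (\<lambda>x. f (inv x)) (inv x)"
      by blast
    show ?case
    proof (intro bexI ballI)
      show "(\<lambda>f. left_avg n (\<lambda>i. inv (a i)) (Q f)) \<in> left_avgs"
        using Q avg by (intro left_avgs.avg) auto
      fix x assume "x \<in> carrier G"
      then show "left_avg n (\<lambda>i. inv (a i)) (Q f) x = right_avg n a (P (\<lambda>x. f (inv x))) (inv x)"
        using avg by (simp add: left_avg_def right_avg_def Q inv_mult_group)
    qed
  qed
  then obtain Q where "Q \<in> left_avgs" "\<And>x. x \<in> carrier G \<Longrightarrow> Q f x = P (\<lambda>x. f (inv x)) (inv x)"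
    by blast
  then show thesis
    using P by (intro that[of Q c]) auto
qed

definition mean :: "('a \<Rightarrow> real) \<Rightarrow> real" where
  "mean f = Sup {c. \<exists>P\<in>right_avgs. \<forall>x\<in>carrier G. c \<le> P f x}"

text \<open>Some left average \<open>Q f\<close> is nearly a constant \<open>d\<close>. Since
  \<open>Q\<close> commutes with \<open>P\<close> and \<open>P'\<close>, both bounds can be compared
  with \<open>d\<close>.\<close>

lemma right_avgs_constants:
  assumes f: "cont f" and P: "P \<in> right_avgs" "\<And>x. x \<in> carrier G \<Longrightarrow> c \<le> P f x"
    and P': "P' \<in> right_avgs" "\<And>x. x \<in> carrier G \<Longrightarrow> P' f x \<le> c'"
  shows "c \<le> c'"
proof (rule field_le_epsilon)
  fix \<epsilon> :: real assume \<epsilon>: "\<epsilon> > 0"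
  obtain Q d where Q: "Q \<in> left_avgs" "\<And>x. x \<in> carrier G \<Longrightarrow> \<bar>Q f x - d\<bar> \<le> \<epsilon> / 2"
    using left_avg_almost_constant[OF f half_gt_zero[OF \<epsilon>]] by blast
  have Qb: "d - \<epsilon> / 2 \<le> Q f x" "Q f x \<le> d + \<epsilon> / 2" if "x \<in> carrier G" for x
    using Q(2)[OF that] by linarith+
  have "c \<le> Q (P f) \<one>" by (rule left_avgs_lower[OF Q(1) P(2)]) auto
  also have "\<dots> = P (Q f) \<one>" by (rule right_left_commute[OF P(1) Q(1)]) auto
  also have "\<dots> \<le> d + \<epsilon> / 2" by (rule right_avgs_upper[OF P(1) Qb(2)]) auto
  finally have "c \<le> d + \<epsilon> / 2" .
  have "d - \<epsilon> / 2 \<le> P' (Q f) \<one>" by (rule right_avgs_lower[OF P'(1) Qb(1)]) auto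
  also have "\<dots> = Q (P' f) \<one>" by (rule right_left_commute[OF P'(1) Q(1), symmetric]) auto
  also have "\<dots> \<le> c'" by (rule left_avgs_upper[OF Q(1) P'(2)]) auto
  finally show "c \<le> c' + \<epsilon>" using \<open>c \<le> d + \<epsilon> / 2\<close> by simp
qed

lemma mean_lower:
  assumes "cont f" "P \<in> right_avgs" "\<And>x. x \<in> carrier G \<Longrightarrow> c \<le> P f x"
  shows "c \<le> mean f"
  unfolding mean_def
proof (rule cSup_upper)
  obtain B where B: "\<And>x. x \<in> carrier G \<Longrightarrow> \<bar>f x\<bar> \<le> B"
    using cont_bounded[OF assms(1)] by blast
  show "bdd_above {c. \<exists>P\<in>right_avgs. \<forall>x\<in>carrier G. c \<le> P f x}"
  proof (rule bdd_aboveI[of _ B])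
    fix c assume "c \<in> {c. \<exists>P\<in>right_avgs. \<forall>x\<in>carrier G. c \<le> P f x}"
    then show "c \<le> B"
      using right_avgs_constants[OF assms(1) _ _ right_avgs.id, of _ c B] B abs_le_D1 by blast
  qed
qed (use assms in blast)

lemma mean_upper:
  assumes "cont f" "P \<in> right_avgs" "\<And>x. x \<in> carrier G \<Longrightarrow> P f x \<le> c"
  shows "mean f \<le> c"
  unfolding mean_def
proof (rule cSup_least)
  obtain B where B: "\<And>x. x \<in> carrier G \<Longrightarrow> \<bar>f x\<bar> \<le> B"
    using cont_bounded[OF assms(1)] by blast
  have "- B \<in> {c. \<exists>P\<in>right_avgs. \<forall>x\<in>carrier G. c \<le> P f x}"
  proof (intro CollectI bexI[OF _ right_avgs.id] ballI)
    fix x assume "x \<in> carrier G"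
    from B[OF this] show "- B \<le> f x" by linarith
  qed
  then show "{c. \<exists>P\<in>right_avgs. \<forall>x\<in>carrier G. c \<le> P f x} \<noteq> {}" by blast
  fix d assume "d \<in> {c. \<exists>P\<in>right_avgs. \<forall>x\<in>carrier G. c \<le> P f x}"
  then show "d \<le> c"
    using right_avgs_constants[OF assms(1) _ _ assms(2), of _ d c] assms(3) by blast
qed

lemma mean_unique:
  assumes "cont f" "P \<in> right_avgs" "\<And>x. x \<in> carrier G \<Longrightarrow> \<bar>P f x - c\<bar> \<le> \<epsilon>"
  shows "\<bar>mean f - c\<bar> \<le> \<epsilon>"
proof -
  have "c - \<epsilon> \<le> P f x \<and> P f x \<le> c + \<epsilon>" if "x \<in> carrier G" for x
    using assms(3)[OF that] by linarith
  then have "c - \<epsilon> \<le> mean f" "mean f \<le> c + \<epsilon>"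
    using mean_lower[OF assms(1,2)] mean_upper[OF assms(1,2)] by blast+
  then show ?thesis by linarith
qed

lemma mean_approx:
  assumes "cont f" "\<epsilon> > 0"
  obtains P where "P \<in> right_avgs" "\<And>x. x \<in> carrier G \<Longrightarrow> \<bar>P f x - mean f\<bar> \<le> \<epsilon>"
proof -
  obtain P c where P: "P \<in> right_avgs" "\<And>x. x \<in> carrier G \<Longrightarrow> \<bar>P f x - c\<bar> \<le> \<epsilon> / 2"
    using right_avg_almost_constant[OF assms(1) half_gt_zero[OF assms(2)]] by blast
  from mean_unique[OF assms(1) this] have m: "\<bar>mean f - c\<bar> \<le> \<epsilon> / 2" .
  show thesis
  proof (rule that[OF P(1)])
    fix x assume "x \<in> carrier G"
    from P(2)[OF this] m show "\<bar>P f x - mean f\<bar> \<le> \<epsilon>" by linarith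
  qed
qed

text \<open>A right average of \<open>P f\<close> is also a right average of \<open>f\<close>, so
  the two means are approximated by the same function.\<close>

lemma mean_right_avgs:
  assumes "cont f" "P \<in> right_avgs" shows "mean (P f) = mean f"
proof -
  have "\<bar>mean f - mean (P f)\<bar> \<le> \<epsilon>" if \<epsilon>: "\<epsilon> > 0" for \<epsilon>
  proof -
    obtain Q where "Q \<in> right_avgs" "\<And>x. x \<in> carrier G \<Longrightarrow> \<bar>Q (P f) x - mean (P f)\<bar> \<le> \<epsilon>"
      using mean_approx[OF right_avgs_cont[OF assms(2,1)] \<epsilon>] by blast
    then show ?thesis
      using mean_unique[OF assms(1) right_avgs_comp[of Q P]] assms(2) by blast
  qed
  then show ?thesis
    by (intro real_eqI) (simp add: abs_minus_commute)
qed

lemma mean_translate_right: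
  assumes "cont f" "a \<in> carrier G" shows "mean (\<lambda>x. f (x \<otimes> a)) = mean f"
proof -
  have "(\<lambda>f. right_avg 1 (\<lambda>_. a) f) \<in> right_avgs"
    using right_avgs.avg[OF right_avgs.id] assms by simp
  from mean_right_avgs[OF assms(1) this] show ?thesis
    by (simp add: right_avg_def[abs_def])
qed

lemma mean_cong:
  assumes "\<And>x. x \<in> carrier G \<Longrightarrow> f x = g x" shows "mean f = mean g"
proof -
  have "P f x = P g x" if "P \<in> right_avgs" "x \<in> carrier G" for P x
    using right_avgs_cong[OF that(1) assms that(2)] .
  then show ?thesis
    unfolding mean_def by (metis (no_types, lifting))
qed

text \<open>Right averages commute with left translation, so both means are suprema of the same
  set.\<close>

lemma mean_translate_left:
  assumes "cont f" "a \<in> carrier G" shows "mean (\<lambda>x. f (a \<otimes> x)) = mean f"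
proof -
  have "(\<forall>x\<in>carrier G. c \<le> P (\<lambda>x. f (a \<otimes> x)) x) \<longleftrightarrow> (\<forall>x\<in>carrier G. c \<le> P f x)"
    if P: "P \<in> right_avgs" for c P
  proof
    assume *: "\<forall>x\<in>carrier G. c \<le> P (\<lambda>x. f (a \<otimes> x)) x"
    show "\<forall>x\<in>carrier G. c \<le> P f x"
    proof
      fix x assume "x \<in> carrier G"
      then show "c \<le> P f x"
        using *[rule_format, of "inv a \<otimes> x"] assms P
        by (simp add: right_avgs_left_translate m_assoc[symmetric])
    qed
  qed (use P assms in \<open>simp add: right_avgs_left_translate\<close>)
  then have "{c. \<exists>P\<in>right_avgs. \<forall>x\<in>carrier G. c \<le> P (\<lambda>x. f (a \<otimes> x)) x} =
    {c. \<exists>P\<in>right_avgs. \<forall>x\<in>carrier G. c \<le> P f x}"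
    by blast
  then show ?thesis
    by (simp add: mean_def)
qed

lemma mean_add:
  assumes "cont f" "cont g" shows "mean (\<lambda>x. f x + g x) = mean f + mean g"
proof -
  have "\<bar>mean (\<lambda>x. f x + g x) - (mean f + mean g)\<bar> \<le> \<epsilon>" if \<epsilon>: "\<epsilon> > 0" for \<epsilon>
  proof -
    obtain P where P: "P \<in> right_avgs" "\<And>x. x \<in> carrier G \<Longrightarrow> \<bar>P f x - mean f\<bar> \<le> \<epsilon> / 2"
      using mean_approx[OF assms(1) half_gt_zero[OF \<epsilon>]] by blast
    obtain Q where Q: "Q \<in> right_avgs" "\<And>x. x \<in> carrier G \<Longrightarrow> \<bar>Q (P g) x - mean g\<bar> \<le> \<epsilon> / 2"
      using mean_approx[OF right_avgs_cont[OF P(1) assms(2)] half_gt_zero[OF \<epsilon>]]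
      unfolding mean_right_avgs[OF assms(2) P(1)] by blast
    have Pf: "mean f - \<epsilon> / 2 \<le> P f x" "P f x \<le> mean f + \<epsilon> / 2" if "x \<in> carrier G" for x
      using P(2)[OF that] by linarith+
    have "\<bar>Q (P (\<lambda>x. f x + g x)) x - (mean f + mean g)\<bar> \<le> \<epsilon>" if x: "x \<in> carrier G" for x
    proof -
      have "Q (P (\<lambda>x. f x + g x)) x = Q (P f) x + Q (P g) x"
        by (simp add: right_avgs_add P Q)
      moreover have "mean f - \<epsilon> / 2 \<le> Q (P f) x" "Q (P f) x \<le> mean f + \<epsilon> / 2"
        using right_avgs_lower[OF Q(1)] right_avgs_upper[OF Q(1)] Pf x by blast+
      ultimately show ?thesis
        using Q(2)[OF x] by linarith
    qed
    moreover have "cont (\<lambda>x. f x + g x)"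
      using assms by (intro continuous_intros)
    ultimately show ?thesis
      using mean_unique[OF _ right_avgs_comp[OF Q(1) P(1)]] by blast
  qed
  then show ?thesis
    by (intro real_eqI) (simp add: abs_minus_commute)
qed

lemma mean_scale:
  assumes "cont f" shows "mean (\<lambda>x. c * f x) = c * mean f"
proof -
  have "\<bar>mean (\<lambda>x. c * f x) - c * mean f\<bar> \<le> \<epsilon>" if \<epsilon>: "\<epsilon> > 0" for \<epsilon>
  proof -
    obtain P where P: "P \<in> right_avgs" "\<And>x. x \<in> carrier G \<Longrightarrow> \<bar>P f x - mean f\<bar> \<le> \<epsilon> / (\<bar>c\<bar> + 1)"
      using mean_approx[OF assms, of "\<epsilon> / (\<bar>c\<bar> + 1)"] \<epsilon> by auto
    have "\<bar>P (\<lambda>x. c * f x) x - c * mean f\<bar> \<le> \<epsilon>" if x: "x \<in> carrier G" for x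
    proof -
      have "\<bar>P (\<lambda>x. c * f x) x - c * mean f\<bar> = \<bar>c\<bar> * \<bar>P f x - mean f\<bar>"
        by (simp add: right_avgs_scale[OF P(1)] abs_mult[symmetric] algebra_simps)
      also have "\<dots> \<le> \<bar>c\<bar> * (\<epsilon> / (\<bar>c\<bar> + 1))"
        using P(2)[OF x] by (intro mult_left_mono) auto
      also have "\<dots> \<le> \<epsilon>"
        using \<epsilon> by (simp add: field_simps)
      finally show ?thesis .
    qed
    moreover have "cont (\<lambda>x. c * f x)"
      using assms by (intro continuous_intros)
    ultimately show ?thesis
      using mean_unique[OF _ P(1)] by blast
  qed
  then show ?thesis
    by (intro real_eqI) (simp add: abs_minus_commute)
qed

lemma mean_diff: "cont f \<Longrightarrow> cont g \<Longrightarrow> mean (\<lambda>x. f x - g x) = mean f - mean g"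
  using mean_add[of f "\<lambda>x. (-1) * g x"] mean_scale[of g "-1"] by simp

lemma mean_sum:
  assumes "finite I" "\<And>i. i \<in> I \<Longrightarrow> cont (f i)"
  shows "mean (\<lambda>x. \<Sum>i\<in>I. f i x) = (\<Sum>i\<in>I. mean (f i))"
  using assms
proof (induction I rule: finite_induct)
  case empty
  then show ?case using mean_scale[of "\<lambda>_. 0" 0] by simp
next
  case (insert i I)
  moreover then have "cont (\<lambda>x. \<Sum>i\<in>I. f i x)"
    by (intro continuous_map_sum) auto
  ultimately show ?case
    using mean_add[of "f i" "\<lambda>x. \<Sum>i\<in>I. f i x"] by simp
qed

lemma mean_near: "cont f \<Longrightarrow> (\<And>x. x \<in> carrier G \<Longrightarrow> \<bar>f x - c\<bar> \<le> \<epsilon>) \<Longrightarrow> \<bar>mean f - c\<bar> \<le> \<epsilon>"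
  using mean_unique[OF _ right_avgs.id] by blast

lemma mean_const: "mean (\<lambda>x. c) = c"
  using mean_near[of "\<lambda>x. c" c 0] by simp

lemma mean_mono:
  assumes "cont f" "cont g" "\<And>x. x \<in> carrier G \<Longrightarrow> f x \<le> g x" shows "mean f \<le> mean g"
proof -
  have "cont (\<lambda>x. g x - f x)" using assms by (intro continuous_intros)
  from mean_lower[OF this right_avgs.id, of 0] show ?thesis
    using assms by (simp add: mean_diff)
qed

lemma mean_nonneg: "cont f \<Longrightarrow> (\<And>x. x \<in> carrier G \<Longrightarrow> 0 \<le> f x) \<Longrightarrow> 0 \<le> mean f"
  using mean_lower[OF _ right_avgs.id, of f 0] by blast

text \<open>Finitely many translates of a set on which \<open>f\<close> is at least
  \<open>f x0 / 2\<close> cover the group; the average over them is at least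
  \<open>f x0 / (2 * n)\<close>.\<close>

lemma mean_pos:
  assumes f: "cont f" and nn: "\<And>x. x \<in> carrier G \<Longrightarrow> 0 \<le> f x" and x0: "x0 \<in> carrier G" "f x0 > 0"
  shows "mean f > 0"
proof -
  obtain U where U: "openin T U" "\<one> \<in> U" "\<And>u x. u \<in> U \<Longrightarrow> x \<in> carrier G \<Longrightarrow> \<bar>f (u \<otimes> x) - f x\<bar> < f x0 / 2"
    using left_modulus[OF f, of "f x0 / 2"] x0 by auto
  have UG: "U \<subseteq> carrier G" using U(1) openin_subset topspace_eq_carrier by blast
  obtain n :: nat and b where b: "n > 0" "\<And>i. b i \<in> carrier G" "\<And>x. x \<in> carrier G \<Longrightarrow> \<exists>i<n. x \<otimes> inv (b i) \<in> U"
    using finite_translates[OF U(1,2)] by blast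
  define a where "a i = inv (b i) \<otimes> x0" for i
  have a: "a i \<in> carrier G" for i using b x0 by (simp add: a_def)
  have "f x0 / 2 / n \<le> right_avg n a f x" if x: "x \<in> carrier G" for x
  proof -
    obtain i where i: "i < n" "x \<otimes> inv (b i) \<in> U" using b x by blast
    have "\<bar>f (x \<otimes> inv (b i) \<otimes> x0) - f x0\<bar> < f x0 / 2"
      using i U(3) x0 by auto
    then have "f x0 / 2 \<le> f (x \<otimes> inv (b i) \<otimes> x0)"
      by linarith
    then have "f x0 / 2 \<le> f (x \<otimes> a i)"
      using x0 x b by (simp add: a_def m_assoc)
    also have "\<dots> \<le> (\<Sum>j<n. f (x \<otimes> a j))"
      using i x a nn by (intro member_le_sum[of i "{..<n}" "\<lambda>j. f (x \<otimes> a j)"]) auto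
    finally have "f x0 / 2 / n \<le> (\<Sum>j<n. f (x \<otimes> a j)) / n"
      by (rule divide_right_mono) simp
    then show ?thesis
      by (simp add: right_avg_def)
  qed
  moreover have "(\<lambda>f. right_avg n a f) \<in> right_avgs"
    using right_avgs.avg[OF right_avgs.id] a b by simp
  ultimately have "f x0 / 2 / n \<le> mean f"
    using mean_lower[OF f] by blast
  then show ?thesis
    using x0 b by (smt (verit) divide_pos_pos of_nat_0_less_iff)
qed

text \<open>\<open>J\<close> is unchanged by right averages, and some right average is nearly the
  constant \<open>mean f\<close>. This uniqueness serves to identify iterated means and thereby to
  interchange them.\<close>

lemma mean_eqI:
  assumes add: "\<And>n f. (\<And>i. i < n \<Longrightarrow> cont (f i)) \<Longrightarrow> J (\<lambda>x. (\<Sum>i<n. f i x) / real n) = (\<Sum>i<n. J (f i)) / real n"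
    and near: "\<And>f c \<epsilon>. cont f \<Longrightarrow> (\<And>x. x \<in> carrier G \<Longrightarrow> \<bar>f x - c\<bar> \<le> \<epsilon>) \<Longrightarrow> \<bar>J f - c\<bar> \<le> \<epsilon>"
    and inv: "\<And>f a. cont f \<Longrightarrow> a \<in> carrier G \<Longrightarrow> J (\<lambda>x. f (x \<otimes> a)) = J f"
    and f: "cont f"
  shows "J f = mean f"
proof -
  have J: "J (P f) = J f" if "P \<in> right_avgs" for P
    using that
  proof (induction rule: right_avgs.induct)
    case (avg P n a)
    have Pf: "cont (P f)" using avg f right_avgs_cont by blast
    have "J (right_avg n a (P f)) = (\<Sum>i<n. J (\<lambda>x. P f (x \<otimes> a i))) / real n"
      unfolding right_avg_def[abs_def] using avg Pf by (intro add cont_translate_right) auto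
    also have "\<dots> = J f"
      using avg Pf by (simp add: inv)
    finally show ?case .
  qed simp
  have "\<bar>J f - mean f\<bar> \<le> \<epsilon>" if \<epsilon>: "\<epsilon> > 0" for \<epsilon>
  proof -
    obtain P where P: "P \<in> right_avgs" "\<And>x. x \<in> carrier G \<Longrightarrow> \<bar>P f x - mean f\<bar> \<le> \<epsilon>"
      using mean_approx[OF f \<epsilon>] by blast
    with near[OF right_avgs_cont[OF P(1) f] P(2)] J show ?thesis by simp
  qed
  then show ?thesis
    by (intro real_eqI) (simp add: abs_minus_commute)
qed

lemma mean_param_continuous:
  assumes "continuous_map (prod_topology X T) euclideanreal F"
  shows "continuous_map X euclideanreal (\<lambda>x. mean (\<lambda>y. F (x, y)))"
proof -
  have cont: "cont (\<lambda>y. F (x, y))" if "x \<in> topspace X" for x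
    using continuous_map_compose[OF continuous_map_pairedI[of T X "\<lambda>_. x" T "\<lambda>y. y"] assms] that
    by (simp add: comp_def)
  have "equicts X {\<lambda>x. mean (\<lambda>y. F (x, y))}"
    unfolding equicts_def
  proof (intro ballI allI impI)
    fix x and \<epsilon> :: real assume x: "x \<in> topspace X" and \<epsilon>: "\<epsilon> > 0"
    obtain U where U: "openin X U" "x \<in> U"
      "\<And>y k. y \<in> U \<Longrightarrow> k \<in> topspace T \<Longrightarrow> dist (F (y, k)) (F (x, k)) < \<epsilon> / 2"
      using continuous_map_slices_uniform[OF assms compact x, of "\<epsilon> / 2"] \<epsilon> by auto
    have "dist (mean (\<lambda>k. F (y, k))) (mean (\<lambda>k. F (x, k))) < \<epsilon>" if y: "y \<in> U" for y
    proof -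
      have yX: "y \<in> topspace X" using U(1) y openin_subset by blast
      have "\<bar>mean (\<lambda>k. F (y, k) - F (x, k)) - 0\<bar> \<le> \<epsilon> / 2"
        using U(3)[OF y] cont[OF yX] cont[OF x]
        by (intro mean_near continuous_intros) (auto simp: topspace_eq_carrier dist_real_def intro: less_imp_le)
      then show ?thesis
        using cont[OF yX] cont[OF x] \<epsilon> by (simp add: mean_diff dist_real_def)
    qed
    then show "\<exists>U. openin X U \<and> x \<in> U \<and> (\<forall>y\<in>U. \<forall>f\<in>{\<lambda>x. mean (\<lambda>y. F (x, y))}. dist (f y) (f x) < \<epsilon>)"
      using U by (intro exI[of _ U]) auto
  qed
  then show ?thesis
    by (rule equicts_imp_continuous) simp
qed

lemma compact_group_DirProd: "compact_group (G \<times>\<times> G) (prod_topology T T)"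
proof -
  interpret GG: group "G \<times>\<times> G" by (intro DirProd_group) unfold_locales
  show ?thesis
  proof
    show "topspace (prod_topology T T) = carrier (G \<times>\<times> G)"
      by (simp add: topspace_eq_carrier DirProd_def)
    show "compact_space (prod_topology T T)" "Hausdorff_space (prod_topology T T)"
      using compact Hausdorff by (simp_all add: compact_space_prod_topology Hausdorff_space_prod_topology)
    have "continuous_map (prod_topology (prod_topology T T) (prod_topology T T)) (prod_topology T T)
       (\<lambda>p. (fst (fst p) \<otimes> fst (snd p), snd (fst p) \<otimes> snd (snd p)))"
      by (intro continuous_map_pairedI mult_continuous
          continuous_map_compose[OF continuous_map_fst continuous_map_fst, unfolded comp_def]
          continuous_map_compose[OF continuous_map_fst continuous_map_snd, unfolded comp_def] projections)
    moreover have "(\<lambda>(g, h). g \<otimes>\<^bsub>G \<times>\<times> G\<^esub> h) = (\<lambda>p. (fst (fst p) \<otimes> fst (snd p), snd (fst p) \<otimes> snd (snd p)))"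
      by (auto simp: DirProd_def fun_eq_iff)
    ultimately show "continuous_map (prod_topology (prod_topology T T) (prod_topology T T)) (prod_topology T T)
      (\<lambda>(g, h). g \<otimes>\<^bsub>G \<times>\<times> G\<^esub> h)" by simp
    have "continuous_map (prod_topology T T) (prod_topology T T) (\<lambda>p. (inv (fst p), inv (snd p)))"
      using continuous_map_compose[OF continuous_map_fst continuous_inv]
        continuous_map_compose[OF continuous_map_snd continuous_inv]
      by (intro continuous_map_pairedI) (auto simp: comp_def)
    then show "continuous_map (prod_topology T T) (prod_topology T T) (\<lambda>g. inv\<^bsub>G \<times>\<times> G\<^esub> g)"
      by (rule continuous_map_eq)
         (auto simp: topspace_eq_carrier inv_DirProd is_group)
  qed
qed

text \<open>The iterated mean is right invariant on the product group, so the uniqueness of the mean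
  there applies.\<close>

lemma iterated_mean:
  assumes F: "continuous_map (prod_topology T T) euclideanreal F"
  shows "mean (\<lambda>x. mean (\<lambda>y. F (x, y))) = compact_group.mean (G \<times>\<times> G) F"
proof -
  interpret GG: compact_group "G \<times>\<times> G" "prod_topology T T" by (rule compact_group_DirProd)
  have sl: "cont (\<lambda>y. F (x, y))" if "x \<in> carrier G" "continuous_map (prod_topology T T) euclideanreal F" for x F
    using continuous_map_compose[OF continuous_map_pairedI[of T T "\<lambda>_. x" T "\<lambda>y. y"] that(2)] that(1)
    by (simp add: comp_def topspace_eq_carrier)
  show ?thesis
  proof (rule GG.mean_eqI[of "\<lambda>F. mean (\<lambda>x. mean (\<lambda>y. F (x, y)))", OF _ _ _ F])
    fix n :: nat and f :: "nat \<Rightarrow> 'a \<times> 'a \<Rightarrow> real"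
    assume f: "\<And>i. i < n \<Longrightarrow> continuous_map (prod_topology T T) euclideanreal (f i)"
    have scale: "mean (\<lambda>x. h x / c) = mean h / c" if "cont h" for h c
      using mean_scale[OF that, of "1 / c"] by simp
    have "mean (\<lambda>y. (\<Sum>i<n. f i (x, y)) / real n) = (\<Sum>i<n. mean (\<lambda>y. f i (x, y))) / real n"
      if "x \<in> carrier G" for x
      using f sl[OF that] by (subst scale) (auto intro!: continuous_map_sum mean_sum arg_cong[of _ _ "\<lambda>x. x / real n"])
    then have "mean (\<lambda>x. mean (\<lambda>y. (\<Sum>i<n. f i (x, y)) / real n)) =
       mean (\<lambda>x. (\<Sum>i<n. mean (\<lambda>y. f i (x, y))) / real n)"
      by (intro mean_cong) auto
    also have "\<dots> = (\<Sum>i<n. mean (\<lambda>x. mean (\<lambda>y. f i (x, y)))) / real n"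
      using f by (subst scale) (auto intro!: continuous_map_sum mean_sum mean_param_continuous arg_cong[of _ _ "\<lambda>x. x / real n"])
    finally show "mean (\<lambda>x. mean (\<lambda>y. (\<Sum>i<n. f i (x, y)) / real n)) =
       (\<Sum>i<n. mean (\<lambda>x. mean (\<lambda>y. f i (x, y)))) / real n" .
  next
    fix f :: "'a \<times> 'a \<Rightarrow> real" and c \<epsilon>
    assume "continuous_map (prod_topology T T) euclideanreal f" "\<And>x. x \<in> carrier (G \<times>\<times> G) \<Longrightarrow> \<bar>f x - c\<bar> \<le> \<epsilon>"
    then show "\<bar>mean (\<lambda>x. mean (\<lambda>y. f (x, y))) - c\<bar> \<le> \<epsilon>"
      using sl by (intro mean_near mean_param_continuous) (auto simp: DirProd_def)
  next
    fix f :: "'a \<times> 'a \<Rightarrow> real" and p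
    assume f: "continuous_map (prod_topology T T) euclideanreal f" and p: "p \<in> carrier (G \<times>\<times> G)"
    obtain a b where ab: "p = (a, b)" "a \<in> carrier G" "b \<in> carrier G"
      using p by (auto simp: DirProd_def)
    have "mean (\<lambda>x. mean (\<lambda>y. f ((x, y) \<otimes>\<^bsub>G \<times>\<times> G\<^esub> p))) = mean (\<lambda>x. mean (\<lambda>y. f (x \<otimes> a, y)))"
    proof (rule mean_cong)
      fix x assume "x \<in> carrier G"
      then show "mean (\<lambda>y. f ((x, y) \<otimes>\<^bsub>G \<times>\<times> G\<^esub> p)) = mean (\<lambda>y. f (x \<otimes> a, y))"
        using mean_translate_right[OF sl[OF _ f], of "x \<otimes> a" b] ab by (simp add: DirProd_def)
    qed
    also have "\<dots> = mean (\<lambda>x. mean (\<lambda>y. f (x, y)))"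
      using mean_translate_right[OF mean_param_continuous[OF f] ab(2)] .
    finally show "mean (\<lambda>x. mean (\<lambda>y. f ((x, y) \<otimes>\<^bsub>G \<times>\<times> G\<^esub> p))) = mean (\<lambda>x. mean (\<lambda>y. f (x, y)))" .
  qed
qed

end

section \<open>Compact symmetric operators on continuous functions\<close>

text \<open>Arzela-Ascoli for nested sets instead of sequences. By Tychonoff's theorem the closures
  of the \<open>D n\<close> in a product of intervals have a common point, and equicontinuity
  upgrades pointwise to uniform approximation.\<close>

lemma equicontinuous_cluster:
  fixes D :: "nat \<Rightarrow> ('a \<Rightarrow> real) set"
  assumes X: "compact_space X" and ne: "\<And>n. D n \<noteq> {}" and dec: "\<And>m n. m \<le> n \<Longrightarrow> D n \<subseteq> D m"
    and eq: "equicts X (D 0)" and bound: "\<And>f x. f \<in> D 0 \<Longrightarrow> x \<in> topspace X \<Longrightarrow> \<bar>f x\<bar> \<le> B"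
  obtains v where "continuous_map X euclideanreal v"
    "\<And>n \<epsilon>. \<epsilon> > 0 \<Longrightarrow> \<exists>f\<in>D n. \<forall>x\<in>topspace X. \<bar>f x - v x\<bar> \<le> \<epsilon>"
proof -
  let ?Y = "product_topology (\<lambda>_. top_of_set {-B..B}) (topspace X)"
  let ?r = "\<lambda>f. restrict f (topspace X)"
  define C where "C n = ?Y closure_of (?r ` D n)" for n
  have D0: "D n \<subseteq> D 0" for n using dec by blast
  have rY: "?r ` D n \<subseteq> topspace ?Y" for n
    using bound D0 by (fastforce simp: abs_le_iff)
  have "compact_space ?Y"
    by (auto simp: compact_space_product_topology compact_space_subtopology)
  moreover have "\<forall>c\<in>range C. closedin ?Y c"
    by (auto simp: C_def)
  moreover have "\<Inter>\<F> \<noteq> {}" if F: "finite \<F>" "\<F> \<subseteq> range C" for \<F>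
  proof -
    obtain I where I: "finite I" "\<F> = C ` I"
      using F by (meson finite_subset_image subset_UNIV)
    obtain m where m: "\<And>i. i \<in> I \<Longrightarrow> i \<le> m"
      using I(1) by (meson finite_nat_set_iff_bounded_le)
    obtain f where f: "f \<in> D m" using ne by blast
    have "?r f \<in> C i" if "i \<in> I" for i
    proof -
      have "?r f \<in> ?r ` D i" using f dec[OF m[OF that]] by blast
      then show ?thesis
        unfolding C_def using closure_of_subset[OF rY, of i] by (rule subsetD[rotated])
    qed
    then show ?thesis unfolding I(2) by blast
  qed
  ultimately have "\<Inter>(range C) \<noteq> {}"
    unfolding compact_space_fip by blast
  then obtain v where v: "\<And>n. v \<in> C n" by blast
  have vY: "v \<in> topspace ?Y"
    using v[of 0] closure_of_subset_topspace unfolding C_def by (rule subsetD[rotated])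
  have cl: "\<exists>y\<in>?r ` D n. y \<in> W" if "openin ?Y W" "v \<in> W" for n W
    using v[of n] that unfolding C_def in_closure_of by blast
  have near: "\<exists>f\<in>D n. \<forall>x\<in>F. \<bar>f x - v x\<bar> < \<eta>" if F: "finite F" "F \<subseteq> topspace X" and \<eta>: "\<eta> > 0" for n F \<eta>
  proof -
    let ?W = "topspace ?Y \<inter> (\<Inter>x\<in>F. {w \<in> topspace ?Y. w x \<in> {-B..B} \<inter> ball (v x) \<eta>})"
    have "openin ?Y {w \<in> topspace ?Y. w x \<in> {-B..B} \<inter> ball (v x) \<eta>}" if "x \<in> F" for x
      using F that
      by (intro openin_continuous_map_preimage[OF continuous_map_product_projection])
         (auto simp: openin_open)
    then have op: "openin ?Y ?W"
      using F by (cases "F = {}") (auto intro!: openin_Int openin_INT simp del: topspace_product_topology)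
    have "v x \<in> {-B..B}" if "x \<in> F" for x
      using vY F that by (auto simp: PiE_iff)
    then have vW: "v \<in> ?W"
      using vY \<eta> by (auto simp del: topspace_product_topology)
    from cl[OF op vW, of n] obtain w where w: "w \<in> ?r ` D n" "w \<in> ?W" by (rule bexE)
    from w(1) obtain f where f: "w = ?r f" "f \<in> D n" by (rule imageE)
    from w(2) have f2: "?r f \<in> ?W" unfolding f(1) .
    have "\<bar>f x - v x\<bar> < \<eta>" if "x \<in> F" for x
      using f2 F that by (auto simp: dist_real_def abs_minus_commute subset_iff)
    with f(2) show ?thesis by blast
  qed
  have modulus: "\<bar>v y - v x\<bar> \<le> \<epsilon>"
    if xy: "x \<in> topspace X" "y \<in> topspace X" and le: "\<And>f. f \<in> D 0 \<Longrightarrow> \<bar>f y - f x\<bar> \<le> \<epsilon>" for x y \<epsilon>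
  proof (rule field_le_epsilon)
    fix \<eta> :: real assume \<eta>: "\<eta> > 0"
    obtain f where f: "f \<in> D 0" "\<forall>z\<in>{x, y}. \<bar>f z - v z\<bar> < \<eta> / 2"
      using near[of "{x, y}" "\<eta> / 2" 0] xy \<eta> by auto
    then show "\<bar>v y - v x\<bar> \<le> \<epsilon> + \<eta>"
    proof -
      have "\<bar>f x - v x\<bar> < \<eta> / 2" "\<bar>f y - v y\<bar> < \<eta> / 2" using f(2) by auto
      with le[OF f(1)] show ?thesis by linarith
    qed
  qed
  have nbhd: "\<exists>U. openin X U \<and> x \<in> U \<and> (\<forall>y\<in>U. \<forall>f\<in>D 0. \<bar>f y - f x\<bar> < \<epsilon>)"
    if "x \<in> topspace X" "\<epsilon> > 0" for x \<epsilon>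
    using equictsD[OF eq that] by (simp add: dist_real_def)
  show thesis
  proof
    have "equicts X {v}"
      unfolding equicts_def
    proof (intro ballI allI impI)
      fix x and \<epsilon> :: real assume x: "x \<in> topspace X" and \<epsilon>: "\<epsilon> > 0"
      obtain U where U: "openin X U" "x \<in> U" "\<forall>y\<in>U. \<forall>f\<in>D 0. \<bar>f y - f x\<bar> < \<epsilon> / 2"
        using nbhd[OF x half_gt_zero[OF \<epsilon>]] by blast
      have "\<bar>v y - v x\<bar> \<le> \<epsilon> / 2" if "y \<in> U" for y
        using U that x openin_subset[OF U(1)] by (intro modulus) (auto intro: less_imp_le)
      then show "\<exists>U. openin X U \<and> x \<in> U \<and> (\<forall>y\<in>U. \<forall>f\<in>{v}. dist (f y) (f x) < \<epsilon>)"
        using U \<epsilon> by (intro exI[of _ U]) (force simp: dist_real_def)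
    qed
    then show "continuous_map X euclideanreal v"
      by (rule equicts_imp_continuous) simp
  next
    fix n and \<epsilon> :: real assume \<epsilon>: "\<epsilon> > 0"
    then have e3: "\<epsilon> / 3 > 0" by simp
    obtain U where U: "\<And>x. x \<in> topspace X \<Longrightarrow> openin X (U x) \<and> x \<in> U x \<and> (\<forall>y\<in>U x. \<forall>f\<in>D 0. \<bar>f y - f x\<bar> < \<epsilon> / 3)"
      using nbhd[OF _ e3] by metis
    have 1: "\<forall>W\<in>U ` topspace X. openin X W" and 2: "topspace X \<subseteq> \<Union>(U ` topspace X)"
      using U by blast+
    from X[unfolded compact_space_alt, rule_format, OF conjI[OF 1 2]]
    obtain \<F> where F: "finite \<F>" "\<F> \<subseteq> U ` topspace X" "topspace X \<subseteq> \<Union>\<F>"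
      by (elim exE conjE)
    from finite_subset_image[OF F(1,2)] obtain F where F': "F \<subseteq> topspace X" "finite F" "\<F> = U ` F"
      by (elim exE conjE)
    obtain f where f: "f \<in> D n" "\<forall>x\<in>F. \<bar>f x - v x\<bar> < \<epsilon> / 3"
      using near[OF F'(2,1) e3] by blast
    show "\<exists>f\<in>D n. \<forall>x\<in>topspace X. \<bar>f x - v x\<bar> \<le> \<epsilon>"
    proof (intro bexI[OF _ f(1)] ballI)
      fix y assume y: "y \<in> topspace X"
      then obtain x where x: "x \<in> F" "y \<in> U x" using F F' by blast
      have xX: "x \<in> topspace X" using x F' by blast
      have D: "\<bar>g y - g x\<bar> < \<epsilon> / 3" if "g \<in> D 0" for g
        using U[OF xX] x that by blast
      have "\<bar>v y - v x\<bar> \<le> \<epsilon> / 3"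
        using D by (intro modulus xX y) (auto intro: less_imp_le)
      moreover have "\<bar>f y - f x\<bar> < \<epsilon> / 3"
        using D D0 f by blast
      ultimately show "\<bar>f y - v y\<bar> \<le> \<epsilon>"
        using f(2)[rule_format, OF x(1)] by linarith
    qed
  qed
qed

context compact_group
begin

definition ip :: "('a \<Rightarrow> real) \<Rightarrow> ('a \<Rightarrow> real) \<Rightarrow> real" where
  "ip f g = mean (\<lambda>x. f x * g x)"

lemma ip_commute: "ip f g = ip g f"
  by (simp add: ip_def mult.commute)

lemma ip_add_left: "cont f \<Longrightarrow> cont g \<Longrightarrow> cont h \<Longrightarrow> ip (\<lambda>x. f x + c * g x) h = ip f h + c * ip g h"
  unfolding ip_def
  by (simp add: distrib_right mult.assoc mean_add mean_scale continuous_intros)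

lemma ip_add_right: "cont f \<Longrightarrow> cont g \<Longrightarrow> cont h \<Longrightarrow> ip h (\<lambda>x. f x + c * g x) = ip h f + c * ip h g"
  using ip_add_left by (simp add: ip_commute)

lemma ip_cong: "(\<And>x. x \<in> carrier G \<Longrightarrow> f x = f' x) \<Longrightarrow> (\<And>x. x \<in> carrier G \<Longrightarrow> g x = g' x) \<Longrightarrow> ip f g = ip f' g'"
  unfolding ip_def by (intro mean_cong) auto

lemma ip_nonneg: "cont f \<Longrightarrow> 0 \<le> ip f f"
  unfolding ip_def by (intro mean_nonneg continuous_intros) auto

lemma ip_eq_0D: "cont f \<Longrightarrow> ip f f = 0 \<Longrightarrow> x \<in> carrier G \<Longrightarrow> f x = 0"
  using mean_pos[of "\<lambda>x. f x * f x" x] unfolding ip_def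
  by (cases "f x = 0") (auto simp: continuous_intros zero_less_mult_iff linorder_neq_iff)

lemma ip_add_self: "cont f \<Longrightarrow> cont g \<Longrightarrow>
  ip (\<lambda>x. f x + c * g x) (\<lambda>x. f x + c * g x) = ip f f + 2 * c * ip f g + c\<^sup>2 * ip g g"
  by (simp add: ip_add_left ip_add_right continuous_intros ip_commute[of g f] power2_eq_square algebra_simps)

lemma ip_Cauchy_Schwarz:
  assumes "cont f" "cont g" shows "(ip f g)\<^sup>2 \<le> ip f f * ip g g"
proof (cases "ip g g = 0")
  case True
  then have "ip f g = ip f (\<lambda>x. 0)"
    using ip_eq_0D[OF assms(2)] by (intro ip_cong) auto
  then show ?thesis
    using True by (simp add: ip_def mean_const)
next
  case False
  then have pos: "ip g g > 0" using ip_nonneg[OF assms(2)] by simp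
  have "cont (\<lambda>x. f x + (- ip f g / ip g g) * g x)"
    using assms by (intro continuous_intros)
  then have "0 \<le> ip f f + 2 * (- ip f g / ip g g) * ip f g + (- ip f g / ip g g)\<^sup>2 * ip g g"
    using ip_nonneg by (simp only: ip_add_self[OF assms, symmetric])
  also have "\<dots> = ip f f - (ip f g)\<^sup>2 / ip g g"
    using pos by (simp add: field_simps power2_eq_square)
  finally show ?thesis
    using pos by (simp add: field_simps)
qed

lemma ip_Cauchy_Schwarz': "cont f \<Longrightarrow> cont g \<Longrightarrow> \<bar>ip f g\<bar> \<le> sqrt (ip f f) * sqrt (ip g g)"
  using ip_Cauchy_Schwarz by (metis real_sqrt_abs real_sqrt_le_iff real_sqrt_mult)

lemma ip_self_le: "cont f \<Longrightarrow> 0 \<le> \<epsilon> \<Longrightarrow> (\<And>x. x \<in> carrier G \<Longrightarrow> \<bar>f x\<bar> \<le> \<epsilon>) \<Longrightarrow> ip f f \<le> \<epsilon>\<^sup>2"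
  unfolding ip_def
  using mean_mono[of "\<lambda>x. f x * f x" "\<lambda>x. \<epsilon>\<^sup>2"]
  by (simp add: mean_const continuous_intros power2_eq_square[symmetric] power2_le_iff_abs_le)

text \<open>Closed under uniform limits rather than limits in the norm of \<open>ip\<close>.
  Eigenfunctions arise directly as uniform limits, so no completion of the space of continuous
  functions enters.\<close>

definition closed_subspace :: "('a \<Rightarrow> real) set \<Rightarrow> bool" where
  "closed_subspace S \<longleftrightarrow> (\<forall>f\<in>S. cont f) \<and> (\<forall>f\<in>S. \<forall>g\<in>S. \<forall>c. (\<lambda>x. f x + c * g x) \<in> S) \<and>
    (\<forall>v. cont v \<longrightarrow> (\<forall>\<epsilon>>0. \<exists>f\<in>S. \<forall>x\<in>carrier G. \<bar>f x - v x\<bar> \<le> \<epsilon>) \<longrightarrow> v \<in> S)"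

text \<open>A compact operator attains its norm: \<open>\<nu>\<close> is the squared norm, and the
  images \<open>Q f\<close> of nearly maximal vectors accumulate uniformly at an eigenfunction of
  the square of \<open>Q\<close>. Using the square avoids deciding the sign of the
  eigenvalue.\<close>

lemma compact_symmetric_eigenfunction:
  assumes S: "closed_subspace S"
    and Q: "\<And>f. f \<in> S \<Longrightarrow> Q f \<in> S"
    and lin: "\<And>f g c x. f \<in> S \<Longrightarrow> g \<in> S \<Longrightarrow> x \<in> carrier G \<Longrightarrow> Q (\<lambda>x. f x + c * g x) x = Q f x + c * Q g x"
    and sym: "\<And>f g. f \<in> S \<Longrightarrow> g \<in> S \<Longrightarrow> ip (Q f) g = ip f (Q g)"
    and bound: "\<And>f x. f \<in> S \<Longrightarrow> x \<in> carrier G \<Longrightarrow> \<bar>Q f x\<bar> \<le> B * sqrt (ip f f)"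
    and eq: "equicts T {Q f |f. f \<in> S \<and> ip f f \<le> 1}"
    and nontrivial: "f0 \<in> S" "x0 \<in> carrier G" "Q f0 x0 \<noteq> 0"
  defines "\<nu> \<equiv> Sup {ip (Q f) (Q f) |f. f \<in> S \<and> ip f f \<le> 1}"
  shows "\<nu> > 0 \<and> (\<exists>F\<in>S. (\<exists>x\<in>carrier G. F x \<noteq> 0) \<and> (\<forall>x\<in>carrier G. Q (Q F) x = \<nu> * F x))"
proof -
  have cont: "cont f" if "f \<in> S" for f using S that by (simp add: closed_subspace_def)
  have add: "(\<lambda>x. f x + c * g x) \<in> S" if "f \<in> S" "g \<in> S" for f g c
    using S that by (simp add: closed_subspace_def)
  have B: "B \<ge> 0"
  proof (rule ccontr)
    assume "\<not> B \<ge> 0"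
    then have "B * sqrt (ip f0 f0) \<le> 0"
      using ip_nonneg[OF cont[OF nontrivial(1)]] by (simp add: mult_nonpos_nonneg)
    then show False using bound[OF nontrivial(1,2)] nontrivial(3) by linarith
  qed
  have Qball: "\<bar>Q f x\<bar> \<le> B" if "f \<in> S" "ip f f \<le> 1" "x \<in> carrier G" for f x
  proof -
    have "B * sqrt (ip f f) \<le> B * 1" using that B by (intro mult_left_mono) auto
    then show ?thesis using bound[OF that(1,3)] by linarith
  qed
  have Qsmall: "\<bar>Q f x\<bar> \<le> B * \<epsilon>"
    if "f \<in> S" "\<And>x. x \<in> carrier G \<Longrightarrow> \<bar>f x\<bar> \<le> \<epsilon>" "0 \<le> \<epsilon>" "x \<in> carrier G" for f x \<epsilon>
  proof -
    have "ip f f \<le> \<epsilon>\<^sup>2" using that cont by (intro ip_self_le) auto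
    then have "sqrt (ip f f) \<le> \<epsilon>" using that(3) real_le_lsqrt ip_nonneg[OF cont[OF that(1)]] by blast
    then have "B * sqrt (ip f f) \<le> B * \<epsilon>" using B by (rule mult_left_mono)
    then show ?thesis using bound[OF that(1,4)] by linarith
  qed
  have bdd: "bdd_above {ip (Q f) (Q f) |f. f \<in> S \<and> ip f f \<le> 1}"
  proof (rule bdd_aboveI[of _ "B\<^sup>2"])
    fix c assume "c \<in> {ip (Q f) (Q f) |f. f \<in> S \<and> ip f f \<le> 1}"
    then obtain f where "f \<in> S" "ip f f \<le> 1" "c = ip (Q f) (Q f)" by blast
    then show "c \<le> B\<^sup>2"
      using Qball B cont Q by (auto intro!: ip_self_le)
  qed
  have \<nu>ball: "ip (Q f) (Q f) \<le> \<nu>" if "f \<in> S" "ip f f \<le> 1" for f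
    unfolding \<nu>_def using that by (intro cSup_upper bdd) blast
  have \<nu>: "ip (Q f) (Q f) \<le> \<nu> * ip f f" if f: "f \<in> S" for f
  proof (cases "ip f f = 0")
    case True
    then have "ip (Q f) (Q f) \<le> 0\<^sup>2"
      using bound[OF f] by (intro ip_self_le cont Q f) auto
    then show ?thesis using True by simp
  next
    case False
    then have pos: "ip f f > 0" using ip_nonneg[OF cont[OF f]] by simp
    let ?c = "1 / sqrt (ip f f)"
    let ?g = "\<lambda>x. f x + (?c - 1) * f x"
    have g: "?g \<in> S" using f add by blast
    have geq: "?g = (\<lambda>x. ?c * f x)" by (simp add: fun_eq_iff algebra_simps)
    have scale: "ip (\<lambda>x. ?c * h x) (\<lambda>x. ?c * h x) = ip h h / ip f f" if "cont h" for h
    proof -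
      have "ip (\<lambda>x. ?c * h x) (\<lambda>x. ?c * h x) = mean (\<lambda>x. (?c * ?c) * (h x * h x))"
        unfolding ip_def by (simp add: mult_ac)
      also have "\<dots> = ?c * ?c * ip h h"
        unfolding ip_def using that by (intro mean_scale continuous_intros)
      finally show ?thesis using pos by (simp add: field_simps)
    qed
    have "ip ?g ?g \<le> 1" unfolding geq scale[OF cont[OF f]] using pos by simp
    from \<nu>ball[OF g this] have "ip (Q ?g) (Q ?g) \<le> \<nu>" .
    also have "ip (Q ?g) (Q ?g) = ip (\<lambda>x. ?c * Q f x) (\<lambda>x. ?c * Q f x)"
    proof -
      have "Q ?g x = ?c * Q f x" if "x \<in> carrier G" for x
        unfolding lin[OF f f that] by (simp add: algebra_simps)
      then show ?thesis by (intro ip_cong) simp_all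
    qed
    finally show ?thesis
      unfolding scale[OF cont[OF Q[OF f]]] using pos by (simp add: field_simps)
  qed
  have \<nu>pos: "\<nu> > 0"
  proof -
    have "0 < ip (Q f0) (Q f0)"
      using ip_eq_0D[OF cont[OF Q[OF nontrivial(1)]]] nontrivial ip_nonneg[OF cont[OF Q[OF nontrivial(1)]]]
      by (metis less_eq_real_def)
    also have "\<dots> \<le> \<nu> * ip f0 f0" using \<nu> nontrivial by blast
    finally show ?thesis
      using ip_nonneg[OF cont[OF nontrivial(1)]] by (simp add: zero_less_mult_iff)
  qed
  \<comment> \<open>Images of nearly maximal vectors, not the vectors themselves: only the images
    are known to be equicontinuous and uniformly bounded.\<close>
  define D where "D n = {Q f |f. f \<in> S \<and> ip f f \<le> 1 \<and> \<nu> - 1 / real (Suc n) \<le> ip (Q f) (Q f)}" for n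
  have Dne: "D n \<noteq> {}" for n
  proof -
    have "\<nu> - 1 / real (Suc n) < Sup {ip (Q f) (Q f) |f. f \<in> S \<and> ip f f \<le> 1}"
      unfolding \<nu>_def[symmetric] by simp
    moreover have "{ip (Q f) (Q f) |f. f \<in> S \<and> ip f f \<le> 1} \<noteq> {}"
    proof -
      have "(\<lambda>x. f0 x + (-1) * f0 x) \<in> S" using add nontrivial by blast
      moreover have "ip (\<lambda>x. f0 x + (-1) * f0 x) (\<lambda>x. f0 x + (-1) * f0 x) \<le> 1"
        by (simp add: ip_def mean_const)
      ultimately show ?thesis by blast
    qed
    ultimately obtain c where "c \<in> {ip (Q f) (Q f) |f. f \<in> S \<and> ip f f \<le> 1}" "\<nu> - 1 / real (Suc n) < c"
      using less_cSup_iff[OF _ bdd] by blast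
    then show ?thesis unfolding D_def by force
  qed
  have Ddec: "D n \<subseteq> D m" if "m \<le> n" for m n
  proof -
    have "1 / real (Suc n) \<le> 1 / real (Suc m)" using that by (simp add: field_simps)
    then show ?thesis unfolding D_def by fastforce
  qed
  have Deq: "equicts T (D 0)"
    using eq by (rule equicts_mono) (auto simp: D_def)
  obtain v where v: "cont v" "\<And>n \<epsilon>. \<epsilon> > 0 \<Longrightarrow> \<exists>f\<in>D n. \<forall>x\<in>topspace T. \<bar>f x - v x\<bar> \<le> \<epsilon>"
  proof (rule equicontinuous_cluster[where X = T and D = D and B = B])
    fix f x assume "f \<in> D 0" "x \<in> topspace T"
    then show "\<bar>f x\<bar> \<le> B" using Qball by (auto simp: D_def topspace_eq_carrier)
  qed (use compact Dne Ddec Deq in blast)+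
  have vD: "\<exists>f. f \<in> S \<and> ip f f \<le> 1 \<and> \<nu> - 1 / real (Suc n) \<le> ip (Q f) (Q f) \<and> (\<forall>x\<in>carrier G. \<bar>Q f x - v x\<bar> \<le> \<epsilon>)"
    if "\<epsilon> > 0" for n \<epsilon>
    using v(2)[OF that, of n] by (auto simp: D_def topspace_eq_carrier)
  have vS: "v \<in> S"
    using S v(1) vD Q unfolding closed_subspace_def by meson
  have est: "\<bar>Q (Q v) x - \<nu> * v x\<bar> \<le> \<eta>" if x: "x \<in> carrier G" and \<eta>: "\<eta> > 0" for x \<eta>
  proof -
    \<comment> \<open>Error budget: replacing \<open>Q f\<close> by \<open>v\<close> costs
      \<open>(B\<^sup>2 + \<nu>) * \<epsilon> = \<eta> / 2\<close>, and \<open>\<delta>\<close> is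
      chosen so that the defect \<open>w\<close> of the near maximiser costs at most
      \<open>\<eta> / 2\<close> after applying \<open>Q\<close>.\<close>
    define \<epsilon> where "\<epsilon> = \<eta> / (2 * (B\<^sup>2 + \<nu>))"
    have den: "B\<^sup>2 + \<nu> > 0" using \<nu>pos by (simp add: add_nonneg_pos)
    then have \<epsilon>: "\<epsilon> > 0" using \<eta> by (simp add: \<epsilon>_def)
    define \<delta> where "\<delta> = (\<eta> / (2 * (B + 1)))\<^sup>2 / \<nu>"
    have "\<delta> > 0" using \<eta> B \<nu>pos by (simp add: \<delta>_def)
    then obtain n where n: "1 / real (Suc n) < \<delta>"
      using reals_Archimedean[of \<delta>] by (auto simp: inverse_eq_divide)
    obtain f where f: "f \<in> S" "ip f f \<le> 1" "\<nu> - 1 / real (Suc n) \<le> ip (Q f) (Q f)" "\<And>x. x \<in> carrier G \<Longrightarrow> \<bar>Q f x - v x\<bar> \<le> \<epsilon>"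
      using vD[OF \<epsilon>] by blast
    define w where "w = (\<lambda>x. Q (Q f) x + (-\<nu>) * f x)"
    have wS: "w \<in> S" unfolding w_def using f Q add by blast
    \<comment> \<open>Symmetry of \<open>Q\<close> and the norm bound at \<open>Q f\<close> give
      \<open>ip w w \<le> \<nu> * (\<nu> - ip (Q f) (Q f))\<close>, which is small for a near
      maximiser.\<close>
    have "ip w w = ip (Q (Q f)) (Q (Q f)) + 2 * (-\<nu>) * ip (Q (Q f)) f + (-\<nu>)\<^sup>2 * ip f f"
      unfolding w_def using f Q cont by (intro ip_add_self) auto
    also have "ip (Q (Q f)) f = ip (Q f) (Q f)"
      using sym[OF Q[OF f(1)] f(1)] .
    also have "ip (Q (Q f)) (Q (Q f)) + 2 * (-\<nu>) * ip (Q f) (Q f) + (-\<nu>)\<^sup>2 * ip f f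
        \<le> \<nu> * ip (Q f) (Q f) + 2 * (-\<nu>) * ip (Q f) (Q f) + \<nu>\<^sup>2 * 1"
      using \<nu>[OF Q[OF f(1)]] mult_left_mono[OF f(2), of "\<nu>\<^sup>2"] by simp
    also have "\<dots> = \<nu> * (\<nu> - ip (Q f) (Q f))"
      by (simp add: power2_eq_square algebra_simps)
    also have "\<dots> \<le> \<nu> * \<delta>"
      using \<nu>pos f(3) n by (intro mult_left_mono) auto
    also have "\<dots> = (\<eta> / (2 * (B + 1)))\<^sup>2"
      using \<nu>pos by (simp add: \<delta>_def)
    finally have "sqrt (ip w w) \<le> \<eta> / (2 * (B + 1))"
      using \<eta> B by (intro real_le_lsqrt) auto
    then have "B * sqrt (ip w w) \<le> B * (\<eta> / (2 * (B + 1)))"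
      using B by (intro mult_left_mono) auto
    also have "\<dots> \<le> \<eta> / 2" using B \<eta> by (simp add: field_simps)
    finally have Qw: "\<bar>Q w x\<bar> \<le> \<eta> / 2" using bound[OF wS x] by linarith
    have QwEq: "Q w x = Q (Q (Q f)) x - \<nu> * Q f x"
      unfolding w_def lin[OF Q[OF Q[OF f(1)]] f(1) x] by simp
    define u where "u = (\<lambda>x. Q f x + (-1) * v x)"
    have uS: "u \<in> S" unfolding u_def using f Q vS add by blast
    have "\<bar>Q u y\<bar> \<le> B * \<epsilon>" if "y \<in> carrier G" for y
      using f(4) \<epsilon> that by (intro Qsmall[OF uS]) (auto simp: u_def)
    then have "\<bar>Q (Q u) x\<bar> \<le> B * (B * \<epsilon>)"
      using B \<epsilon> x by (intro Qsmall[OF Q[OF uS]]) auto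
    moreover have "Q (Q u) x = Q (Q (Q f)) x - Q (Q v) x"
    proof -
      have "Q u y = Q (Q f) y + (-1) * Q v y" if "y \<in> carrier G" for y
        unfolding u_def using lin[OF Q[OF f(1)] vS that] .
      then have Qu: "\<bar>Q u y + (-1) * (Q (Q f) y + (-1) * Q v y)\<bar> \<le> 0" if "y \<in> carrier G" for y
        using that by simp
      let ?h = "\<lambda>x. Q (Q f) x + (-1) * Q v x"
      have h: "?h \<in> S" using f Q vS add by blast
      have "\<bar>Q (\<lambda>y. Q u y + (-1) * ?h y) x\<bar> \<le> B * 0"
        using Qu x by (intro Qsmall add Q uS h) auto
      then have "Q (Q u) x = Q ?h x"
        unfolding lin[OF Q[OF uS] h x] by simp
      then show ?thesis
        unfolding lin[OF Q[OF Q[OF f(1)]] Q[OF vS] x] by simp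
    qed
    moreover have "\<bar>\<nu> * Q f x - \<nu> * v x\<bar> \<le> \<nu> * \<epsilon>"
      using f(4)[OF x] \<nu>pos by (simp add: right_diff_distrib[symmetric] abs_mult)
    ultimately have "\<bar>Q (Q v) x - \<nu> * v x\<bar> \<le> B * (B * \<epsilon>) + \<eta> / 2 + \<nu> * \<epsilon>"
      using Qw QwEq by linarith
    also have "\<dots> = (B\<^sup>2 + \<nu>) * \<epsilon> + \<eta> / 2"
      by (simp add: power2_eq_square algebra_simps)
    also have "\<dots> = \<eta>"
      using den by (simp add: \<epsilon>_def field_simps)
    finally show ?thesis .
  qed
  have "Q (Q v) x = \<nu> * v x" if "x \<in> carrier G" for x
    using est[OF that] by (rule real_eqI)
  moreover have "\<exists>x\<in>carrier G. v x \<noteq> 0"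
  proof (rule ccontr)
    assume 0: "\<not> ?thesis"
    define \<epsilon> where "\<epsilon> = sqrt (\<nu> / 3)"
    have \<epsilon>: "\<epsilon> > 0" using \<nu>pos by (simp add: \<epsilon>_def)
    have "\<nu> / 2 > 0" using \<nu>pos by simp
    then obtain n where n: "1 / real (Suc n) < \<nu> / 2"
      using reals_Archimedean[of "\<nu> / 2"] by (auto simp: inverse_eq_divide)
    obtain f where f: "f \<in> S" "ip f f \<le> 1" "\<nu> - 1 / real (Suc n) \<le> ip (Q f) (Q f)" "\<And>x. x \<in> carrier G \<Longrightarrow> \<bar>Q f x - v x\<bar> \<le> \<epsilon>"
      using vD[OF \<epsilon>] by blast
    have "ip (Q f) (Q f) \<le> \<epsilon>\<^sup>2"
      using f 0 \<epsilon> cont Q by (intro ip_self_le) force+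
    then show False
      using f(3) n \<nu>pos by (simp add: \<epsilon>_def)
  qed
  ultimately show ?thesis
    using \<nu>pos vS by blast
qed

end

section \<open>Convolution operators and functions harmonic along a cyclic subgroup\<close>

context compact_group
begin

text \<open>The kernel acts from the left, so that the operator commutes with right translations and
  hence with the second difference along any \<open>g\<close>.\<close>

definition conv :: "('a \<Rightarrow> real) \<Rightarrow> ('a \<Rightarrow> real) \<Rightarrow> 'a \<Rightarrow> real" where
  "conv k f x = mean (\<lambda>y. k (x \<otimes> inv y) * f y)"

definition sym_kernel :: "('a \<Rightarrow> real) \<Rightarrow> bool" where
  "sym_kernel k \<longleftrightarrow> cont k \<and> (\<forall>z\<in>carrier G. k (inv z) = k z)"

definition eigenspace :: "('a \<Rightarrow> real) \<Rightarrow> real \<Rightarrow> ('a \<Rightarrow> real) set" where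
  "eigenspace k \<nu> = {f. cont f \<and> (\<forall>x\<in>carrier G. conv k (conv k f) x = \<nu> * f x)}"

text \<open>Translation by \<open>g\<close> is an isometry but in general not symmetric; this
  combination with its inverse is symmetric and nonnegative on real functions. Its eigenfunctions
  are the \<open>harmonic\<close> ones, with eigenvalue \<open>2 - \<theta>\<close>.\<close>

definition second_diff :: "'a \<Rightarrow> ('a \<Rightarrow> real) \<Rightarrow> 'a \<Rightarrow> real" where
  "second_diff g f x = 2 * f x - f (x \<otimes> g) - f (x \<otimes> inv g)"

definition harmonic :: "'a \<Rightarrow> real \<Rightarrow> ('a \<Rightarrow> real) \<Rightarrow> bool" where
  "harmonic g \<theta> F \<longleftrightarrow> cont F \<and> (\<forall>x\<in>carrier G. F (x \<otimes> g) + F (x \<otimes> inv g) = \<theta> * F x)"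

lemma kernel_continuous:
  assumes "cont k" shows "continuous_map (prod_topology T T) euclideanreal (\<lambda>p. k (fst p \<otimes> inv (snd p)))"
proof -
  have "continuous_map (prod_topology T T) T (\<lambda>p. fst p \<otimes> inv (snd p))"
    using continuous_map_compose[OF continuous_map_snd continuous_inv]
    by (intro mult_continuous continuous_map_fst) (simp add: comp_def)
  from continuous_map_compose[OF this assms] show ?thesis by (simp add: comp_def)
qed

lemma cont_kernel_slice: "cont k \<Longrightarrow> x \<in> carrier G \<Longrightarrow> cont (\<lambda>y. k (x \<otimes> inv y))"
  using cont_inv[OF cont_translate_left] by blast

lemma conv_cont:
  assumes "cont k" "cont f" shows "cont (conv k f)"
proof -
  have "continuous_map (prod_topology T T) euclideanreal (\<lambda>p. k (fst p \<otimes> inv (snd p)) * f (snd p))"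
    using continuous_map_compose[OF continuous_map_snd assms(2)] kernel_continuous[OF assms(1)]
    by (intro continuous_intros) (auto simp: comp_def)
  from mean_param_continuous[OF this] show ?thesis
    by (simp add: conv_def[abs_def])
qed

lemma conv_linear:
  assumes "cont k" "cont f" "cont g" "x \<in> carrier G"
  shows "conv k (\<lambda>x. f x + c * g x) x = conv k f x + c * conv k g x"
  using ip_add_right[OF assms(2,3) cont_kernel_slice[OF assms(1,4)]] by (simp add: conv_def ip_def)

lemma conv_cong: "(\<And>x. x \<in> carrier G \<Longrightarrow> f x = g x) \<Longrightarrow> conv k f = conv k g"
  unfolding conv_def by (intro ext mean_cong) auto

lemma conv_bound:
  assumes "cont k" "\<And>z. z \<in> carrier G \<Longrightarrow> \<bar>k z\<bar> \<le> K" "cont f" "x \<in> carrier G"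
  shows "\<bar>conv k f x\<bar> \<le> K * sqrt (ip f f)"
proof -
  let ?k = "\<lambda>y. k (x \<otimes> inv y)"
  have K: "0 \<le> K" using assms(2)[OF one_closed] by simp
  have k: "cont ?k" using assms by (simp add: cont_kernel_slice)
  have "ip ?k ?k \<le> K\<^sup>2" using assms K by (intro ip_self_le k) auto
  then have "sqrt (ip ?k ?k) \<le> K" using K by (intro real_le_lsqrt ip_nonneg k) auto
  then have "sqrt (ip ?k ?k) * sqrt (ip f f) \<le> K * sqrt (ip f f)"
    using ip_nonneg[OF assms(3)] by (intro mult_right_mono) auto
  then show ?thesis
    using ip_Cauchy_Schwarz'[OF k assms(3)] by (simp add: conv_def ip_def)
qed

text \<open>By Cauchy-Schwarz, a modulus of the kernel that is uniform in the second variable is a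
  modulus for all convolutions of functions in the unit ball.\<close>

lemma conv_equicts:
  assumes "cont k" shows "equicts T {conv k f |f. cont f \<and> ip f f \<le> 1}"
  unfolding equicts_def
proof (intro ballI allI impI)
  fix x and \<epsilon> :: real assume x: "x \<in> topspace T" and \<epsilon>: "\<epsilon> > 0"
  then have xG: "x \<in> carrier G" by (simp add: topspace_eq_carrier)
  obtain U where U: "openin T U" "x \<in> U" "\<And>y k'. y \<in> U \<Longrightarrow> k' \<in> topspace T \<Longrightarrow>
      dist (k (fst (y, k') \<otimes> inv (snd (y, k')))) (k (fst (x, k') \<otimes> inv (snd (x, k')))) < \<epsilon> / 2"
    using continuous_map_slices_uniform[OF kernel_continuous[OF assms] compact x half_gt_zero[OF \<epsilon>]] by blast
  have "dist (conv k f y) (conv k f x) < \<epsilon>" if y: "y \<in> U" and f: "cont f" "ip f f \<le> 1" for y f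
  proof -
    have yG: "y \<in> carrier G" using y U(1) openin_subset topspace_eq_carrier by blast
    let ?d = "\<lambda>z. k (y \<otimes> inv z) + (-1) * k (x \<otimes> inv z)"
    have d: "cont ?d" using assms xG yG by (intro continuous_intros cont_kernel_slice)
    have "\<bar>?d z\<bar> \<le> \<epsilon> / 2" if "z \<in> carrier G" for z
      using U(3)[OF y, of z] that by (simp add: topspace_eq_carrier dist_real_def)
    then have "ip ?d ?d \<le> (\<epsilon> / 2)\<^sup>2" using \<epsilon> by (intro ip_self_le d) auto
    then have "sqrt (ip ?d ?d) \<le> \<epsilon> / 2" using \<epsilon> by (intro real_le_lsqrt ip_nonneg d) auto
    moreover have "sqrt (ip f f) \<le> 1" using f by simp
    ultimately have "sqrt (ip ?d ?d) * sqrt (ip f f) \<le> \<epsilon> / 2 * 1"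
      using \<epsilon> ip_nonneg[OF f(1)] by (intro mult_mono) auto
    moreover have "ip ?d f = conv k f y - conv k f x"
      using ip_add_left[OF cont_kernel_slice[OF assms yG] cont_kernel_slice[OF assms xG] f(1), of "-1"]
      by (simp add: conv_def ip_def)
    ultimately show ?thesis
      using ip_Cauchy_Schwarz'[OF d f(1)] \<epsilon> by (simp add: dist_real_def)
  qed
  then show "\<exists>U. openin T U \<and> x \<in> U \<and> (\<forall>y\<in>U. \<forall>f\<in>{conv k f |f. cont f \<and> ip f f \<le> 1}. dist (f y) (f x) < \<epsilon>)"
    using U by (intro exI[of _ U]) auto
qed

text \<open>The mean on the product group is unique, hence invariant under exchange of the
  factors.\<close>

lemma iterated_mean_swap:
  assumes F: "continuous_map (prod_topology T T) euclideanreal F"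
  shows "mean (\<lambda>x. mean (\<lambda>y. F (x, y))) = mean (\<lambda>y. mean (\<lambda>x. F (x, y)))"
proof -
  interpret GG: compact_group "G \<times>\<times> G" "prod_topology T T" by (rule compact_group_DirProd)
  have swap: "continuous_map (prod_topology T T) euclideanreal (\<lambda>p. f (snd p, fst p))"
    if "continuous_map (prod_topology T T) euclideanreal f" for f :: "'a \<times> 'a \<Rightarrow> real"
    using continuous_map_compose[OF continuous_map_pairedI[OF continuous_map_snd continuous_map_fst] that]
    by (simp add: comp_def)
  have "GG.mean (\<lambda>p. F (snd p, fst p)) = GG.mean F"
  proof (rule GG.mean_eqI[of "\<lambda>F. GG.mean (\<lambda>p. F (snd p, fst p))", OF _ _ _ F])
    fix n :: nat and f :: "nat \<Rightarrow> 'a \<times> 'a \<Rightarrow> real"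
    assume f: "\<And>i. i < n \<Longrightarrow> continuous_map (prod_topology T T) euclideanreal (f i)"
    have "GG.mean (\<lambda>p. 1 / real n * (\<Sum>i<n. f i (snd p, fst p))) = 1 / real n * GG.mean (\<lambda>p. \<Sum>i<n. f i (snd p, fst p))"
      using f swap by (intro GG.mean_scale continuous_map_sum) auto
    also have "GG.mean (\<lambda>p. \<Sum>i<n. f i (snd p, fst p)) = (\<Sum>i<n. GG.mean (\<lambda>p. f i (snd p, fst p)))"
      using f swap by (intro GG.mean_sum) auto
    finally show "GG.mean (\<lambda>p. (\<Sum>i<n. f i (snd p, fst p)) / real n) = (\<Sum>i<n. GG.mean (\<lambda>p. f i (snd p, fst p))) / real n"
      by simp
  next
    fix f :: "'a \<times> 'a \<Rightarrow> real" and c \<epsilon>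
    assume "continuous_map (prod_topology T T) euclideanreal f" "\<And>x. x \<in> carrier (G \<times>\<times> G) \<Longrightarrow> \<bar>f x - c\<bar> \<le> \<epsilon>"
    then show "\<bar>GG.mean (\<lambda>p. f (snd p, fst p)) - c\<bar> \<le> \<epsilon>"
      using swap by (intro GG.mean_near) (auto simp: DirProd_def)
  next
    fix f :: "'a \<times> 'a \<Rightarrow> real" and a
    assume f: "continuous_map (prod_topology T T) euclideanreal f" and a: "a \<in> carrier (G \<times>\<times> G)"
    have "GG.mean (\<lambda>p. f ((snd p, fst p) \<otimes>\<^bsub>G \<times>\<times> G\<^esub> a)) =
      GG.mean (\<lambda>p. (\<lambda>p. f (snd p, fst p)) (p \<otimes>\<^bsub>G \<times>\<times> G\<^esub> (snd a, fst a)))"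
      by (simp add: DirProd_def case_prod_unfold)
    also have "\<dots> = GG.mean (\<lambda>p. f (snd p, fst p))"
      using a by (intro GG.mean_translate_right swap f) (auto simp: DirProd_def)
    finally show "GG.mean (\<lambda>p. f ((snd p, fst p) \<otimes>\<^bsub>G \<times>\<times> G\<^esub> a)) = GG.mean (\<lambda>p. f (snd p, fst p))" .
  qed
  then show ?thesis
    using iterated_mean[OF F] iterated_mean[OF swap[OF F]] by simp
qed

lemma conv_sym:
  assumes k: "sym_kernel k" and f: "cont f" and g: "cont g"
  shows "ip (conv k f) g = ip f (conv k g)"
proof -
  let ?F = "\<lambda>p. k (fst p \<otimes> inv (snd p)) * f (snd p) * g (fst p)"
  have kc: "cont k" using k by (simp add: sym_kernel_def)
  have F: "continuous_map (prod_topology T T) euclideanreal ?F"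
    using kernel_continuous[OF kc] continuous_map_compose[OF continuous_map_snd f] continuous_map_compose[OF continuous_map_fst g]
    by (intro continuous_intros) (auto simp: comp_def)
  have "ip (conv k f) g = mean (\<lambda>x. mean (\<lambda>y. ?F (x, y)))"
    unfolding ip_def conv_def
  proof (rule mean_cong)
    fix x assume x: "x \<in> carrier G"
    have "mean (\<lambda>y. k (x \<otimes> inv y) * f y) * g x = mean (\<lambda>y. g x * (k (x \<otimes> inv y) * f y))"
      using x f kc by (subst mean_scale) (auto intro!: continuous_intros cont_kernel_slice)
    then show "mean (\<lambda>y. k (x \<otimes> inv y) * f y) * g x = mean (\<lambda>y. ?F (x, y))"
      by (simp add: mult_ac)
  qed
  also have "\<dots> = mean (\<lambda>y. mean (\<lambda>x. ?F (x, y)))"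
    by (rule iterated_mean_swap[OF F])
  also have "\<dots> = ip f (conv k g)"
    unfolding ip_def conv_def
  proof (rule mean_cong)
    fix y assume y: "y \<in> carrier G"
    have "mean (\<lambda>x. ?F (x, y)) = mean (\<lambda>x. f y * (k (y \<otimes> inv x) * g x))"
    proof (rule mean_cong)
      fix x assume x: "x \<in> carrier G"
      have "k (inv (y \<otimes> inv x)) = k (y \<otimes> inv x)" using k x y by (simp add: sym_kernel_def)
      then have "k (x \<otimes> inv y) = k (y \<otimes> inv x)" using x y by (simp add: inv_mult_group)
      then show "?F (x, y) = f y * (k (y \<otimes> inv x) * g x)" by simp
    qed
    also have "\<dots> = f y * mean (\<lambda>x. k (y \<otimes> inv x) * g x)"
      using y g kc by (intro mean_scale continuous_intros cont_kernel_slice)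
    finally show "mean (\<lambda>x. ?F (x, y)) = f y * mean (\<lambda>x. k (y \<otimes> inv x) * g x)" .
  qed
  finally show ?thesis .
qed

lemma conv_translate:
  assumes "cont k" "cont f" "x \<in> carrier G" "a \<in> carrier G"
  shows "conv k (\<lambda>x. f (x \<otimes> a)) x = conv k f (x \<otimes> a)"
proof -
  have "conv k f (x \<otimes> a) = mean (\<lambda>y. k (x \<otimes> a \<otimes> inv (y \<otimes> a)) * f (y \<otimes> a))"
    unfolding conv_def using assms
    by (intro mean_translate_right[symmetric] continuous_intros cont_kernel_slice) auto
  also have "\<dots> = conv k (\<lambda>x. f (x \<otimes> a)) x"
    unfolding conv_def
  proof (rule mean_cong)
    fix y assume y: "y \<in> carrier G"
    have "x \<otimes> a \<otimes> (inv a \<otimes> inv y) = x \<otimes> inv y"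
      using assms y by (metis inv_closed m_assoc m_closed r_inv r_one)
    then show "k (x \<otimes> a \<otimes> inv (y \<otimes> a)) * f (y \<otimes> a) = k (x \<otimes> inv y) * f (y \<otimes> a)"
      using assms y by (simp add: inv_mult_group)
  qed
  finally show ?thesis by simp
qed

text \<open>A symmetric bump near the identity, so narrow that only values of \<open>h\<close> with
  the sign of \<open>h x0\<close> are met, detects that \<open>h x0\<close> is nonzero.\<close>

lemma conv_nontrivial:
  assumes h: "cont h" and x0: "x0 \<in> carrier G" "h x0 \<noteq> 0"
  obtains k where "sym_kernel k" "conv k h x0 \<noteq> 0"
proof -
  define h' where "h' = (\<lambda>x. sgn (h x0) * h x)"
  have h': "cont h'" unfolding h'_def using h by (intro continuous_intros)
  have pos: "h' x0 > 0" using x0 by (simp add: h'_def sgn_mult_self_eq abs_sgn[symmetric] zero_less_abs_iff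
     mult.commute)
  obtain U where U: "openin T U" "\<one> \<in> U" "\<And>u x. u \<in> U \<Longrightarrow> x \<in> carrier G \<Longrightarrow> \<bar>h' (u \<otimes> x) - h' x\<bar> < h' x0 / 2"
    using left_modulus[OF h' half_gt_zero[OF pos]] by blast
  let ?W = "U \<inter> {z \<in> topspace T. inv z \<in> U}"
  have W: "openin T ?W"
    using U(1) continuous_inv by (intro openin_Int) (auto simp: continuous_map_def)
  have norm: "normal_space T"
    using compact Hausdorff compact_Hausdorff_or_regular_imp_normal_space by blast
  have cl: "closedin T {\<one>}"
    using Hausdorff by (simp add: closedin_Hausdorff_sing_eq topspace_eq_carrier)
  have cl': "closedin T (topspace T - ?W)" using W by blast
  have "disjnt (topspace T - ?W) {\<one>}"
    using U by (auto simp: disjnt_def topspace_eq_carrier)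
  from Urysohn_lemma[OF norm cl' cl this zero_le_one]
  obtain b where b: "continuous_map T (top_of_set {0..1::real}) b" "b ` (topspace T - ?W) \<subseteq> {0}" "b ` {\<one>} \<subseteq> {1}"
    by blast
  have bc: "cont b" and b01: "\<And>z. z \<in> carrier G \<Longrightarrow> 0 \<le> b z"
    using b(1) by (auto simp: continuous_map_in_subtopology topspace_eq_carrier image_subset_iff)
  define k where "k z = b z + b (inv z)" for z
  have kc: "cont k" unfolding k_def[abs_def] using bc cont_inv by (intro continuous_intros) auto
  have sym: "sym_kernel k" using kc by (simp add: sym_kernel_def k_def)
  have k0: "0 \<le> k z" if "z \<in> carrier G" for z using b01 that by (simp add: k_def)
  have supp: "k z = 0" if "z \<in> carrier G" "inv z \<notin> U" for z
  proof -
    have "b z = 0" "b (inv z) = 0"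
      using b(2) that by (auto simp: image_subset_iff topspace_eq_carrier)
    then show ?thesis by (simp add: k_def)
  qed
  let ?p = "\<lambda>y. k (x0 \<otimes> inv y) * h' y"
  have "0 < mean ?p"
  proof (rule mean_pos)
    show "cont ?p" using kc h' x0 by (intro continuous_intros cont_kernel_slice)
    show "0 \<le> ?p y" if y: "y \<in> carrier G" for y
    proof (cases "y \<otimes> inv x0 \<in> U")
      case True
      then have "\<bar>h' (y \<otimes> inv x0 \<otimes> x0) - h' x0\<bar> < h' x0 / 2" using U(3) x0 by blast
      then have "0 \<le> h' (y \<otimes> inv x0 \<otimes> x0)" by linarith
      then have "0 \<le> h' y" using x0 y by (simp add: m_assoc)
      then show ?thesis using k0 x0 y by simp
    next
      case False
      then have "k (x0 \<otimes> inv y) = 0" using x0 y by (intro supp) (auto simp: inv_mult_group)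
      then show ?thesis by simp
    qed
    have "b \<one> = 1" using b(3) by auto
    then show "0 < ?p x0" using pos x0 by (simp add: k_def)
  qed (rule x0)
  moreover have "mean ?p = sgn (h x0) * conv k h x0"
    unfolding conv_def h'_def using kc h x0
    by (subst mean_scale[symmetric]) (auto intro!: continuous_intros cont_kernel_slice mean_cong simp: mult_ac)
  ultimately have "conv k h x0 \<noteq> 0" by auto
  then show thesis using that sym by blast
qed

lemma conv_eigenfunction:
  assumes k: "sym_kernel k" and S: "closed_subspace S" and inv: "\<And>f. f \<in> S \<Longrightarrow> conv k f \<in> S"
    and h: "h \<in> S" "x0 \<in> carrier G" "conv k h x0 \<noteq> 0"
  obtains \<nu> F x where "\<nu> > 0" "F \<in> S" "F \<in> eigenspace k \<nu>" "x \<in> carrier G" "F x \<noteq> 0"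
proof -
  have kc: "cont k" using k by (simp add: sym_kernel_def)
  have cont: "cont f" if "f \<in> S" for f using S that by (simp add: closed_subspace_def)
  obtain K where K: "\<And>z. z \<in> carrier G \<Longrightarrow> \<bar>k z\<bar> \<le> K" using cont_bounded[OF kc] by blast
  let ?\<nu> = "Sup {ip (conv k f) (conv k f) |f. f \<in> S \<and> ip f f \<le> 1}"
  have "?\<nu> > 0 \<and> (\<exists>F\<in>S. (\<exists>x\<in>carrier G. F x \<noteq> 0) \<and> (\<forall>x\<in>carrier G. conv k (conv k F) x = ?\<nu> * F x))"
  proof (rule compact_symmetric_eigenfunction[OF S inv, where B = K])
    show "equicts T {conv k f |f. f \<in> S \<and> ip f f \<le> 1}"
      using conv_equicts[OF kc] by (rule equicts_mono) (use cont in blast)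
    show "conv k (\<lambda>x. f x + c * g x) x = conv k f x + c * conv k g x"
      if "f \<in> S" "g \<in> S" "x \<in> carrier G" for f g c x
      using that by (intro conv_linear kc cont)
    show "ip (conv k f) g = ip f (conv k g)" if "f \<in> S" "g \<in> S" for f g
      using that by (intro conv_sym k cont)
    show "\<bar>conv k f x\<bar> \<le> K * sqrt (ip f f)" if "f \<in> S" "x \<in> carrier G" for f x
      using that by (intro conv_bound kc K cont)
  qed (use h in auto)
  then show thesis
    using that cont unfolding eigenspace_def by blast
qed

lemma closed_subspace_cont: "closed_subspace S \<Longrightarrow> f \<in> S \<Longrightarrow> cont f"
  by (simp add: closed_subspace_def)

lemma closed_subspace_add: "closed_subspace S \<Longrightarrow> f \<in> S \<Longrightarrow> g \<in> S \<Longrightarrow> (\<lambda>x. f x + c * g x) \<in> S"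
  by (simp add: closed_subspace_def)

lemma closed_subspace_limit:
  assumes "closed_subspace S" "cont v" "\<And>\<epsilon>. \<epsilon> > 0 \<Longrightarrow> \<exists>f\<in>S. \<forall>x\<in>carrier G. \<bar>f x - v x\<bar> \<le> \<epsilon>"
  shows "v \<in> S"
  using assms(1)[unfolded closed_subspace_def, THEN conjunct2, THEN conjunct2, rule_format, OF assms(2)] assms(3)
  by simp

lemma closed_subspace_Int:
  assumes "closed_subspace S" "closed_subspace S'" shows "closed_subspace (S \<inter> S')"
  unfolding closed_subspace_def
proof (intro conjI ballI allI impI)
  fix v assume v: "cont v" and lim: "\<forall>\<epsilon>>0. \<exists>f\<in>S \<inter> S'. \<forall>x\<in>carrier G. \<bar>f x - v x\<bar> \<le> \<epsilon>"
  have 1: "\<exists>f\<in>S. \<forall>x\<in>carrier G. \<bar>f x - v x\<bar> \<le> \<epsilon>" and 2: "\<exists>f\<in>S'. \<forall>x\<in>carrier G. \<bar>f x - v x\<bar> \<le> \<epsilon>"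
    if "\<epsilon> > 0" for \<epsilon>
    using lim[rule_format, OF that] by blast+
  show "v \<in> S \<inter> S'"
    using closed_subspace_limit[OF assms(1) v 1] closed_subspace_limit[OF assms(2) v 2] by (rule IntI)
next
  fix f g c assume "f \<in> S \<inter> S'" "g \<in> S \<inter> S'"
  then show "(\<lambda>x. f x + c * g x) \<in> S \<inter> S'"
    using assms by (simp add: closed_subspace_add)
qed (use assms closed_subspace_cont in simp)

lemma closed_subspace_orthogonal:
  assumes "\<And>F. F \<in> A \<Longrightarrow> cont F"
  shows "closed_subspace {h. cont h \<and> (\<forall>F\<in>A. ip h F = 0)}" (is "closed_subspace ?S")
  unfolding closed_subspace_def
proof (intro conjI ballI allI impI)
  fix f g c assume "f \<in> ?S" "g \<in> ?S"
  then show "(\<lambda>x. f x + c * g x) \<in> ?S"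
    using assms by (auto simp: ip_add_left intro!: continuous_intros)
next
  fix v assume v: "cont v" and lim: "\<forall>\<epsilon>>0. \<exists>f\<in>?S. \<forall>x\<in>carrier G. \<bar>f x - v x\<bar> \<le> \<epsilon>"
  have "ip v F = 0" if F: "F \<in> A" for F
  proof -
    have Fc: "cont F" using assms F .
    have "\<bar>ip v F - 0\<bar> \<le> \<epsilon>" if \<epsilon>: "\<epsilon> > 0" for \<epsilon>
    proof -
      let ?\<delta> = "\<epsilon> / (sqrt (ip F F) + 1)"
      have \<delta>: "?\<delta> > 0" using \<epsilon> ip_nonneg[OF Fc] by (simp add: add_nonneg_pos)
      then obtain f where f: "f \<in> ?S" "\<forall>x\<in>carrier G. \<bar>f x - v x\<bar> \<le> ?\<delta>" using lim by blast
      let ?d = "\<lambda>x. v x + (-1) * f x"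
      have d: "cont ?d" using v f by (intro continuous_intros) auto
      have "ip v F = ip ?d F" using f F v Fc by (subst ip_add_left) auto
      moreover have "ip ?d ?d \<le> ?\<delta>\<^sup>2"
        using f(2) \<delta> by (intro ip_self_le d) (auto simp: abs_minus_commute)
      then have "sqrt (ip ?d ?d) \<le> ?\<delta>" using \<delta> by (intro real_le_lsqrt ip_nonneg d) auto
      then have "sqrt (ip ?d ?d) * sqrt (ip F F) \<le> ?\<delta> * sqrt (ip F F)"
        using ip_nonneg[OF Fc] by (intro mult_right_mono) auto
      moreover have "?\<delta> * sqrt (ip F F) \<le> \<epsilon>"
        using \<epsilon> ip_nonneg[OF Fc] by (simp add: divide_simps add_nonneg_pos)
      ultimately show ?thesis
        using ip_Cauchy_Schwarz'[OF d Fc] by simp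
    qed
    then show ?thesis by (rule real_eqI)
  qed
  then show "v \<in> ?S" using v by blast
qed auto

lemma closed_subspace_eigenspace:
  assumes k: "cont k" shows "closed_subspace (eigenspace k \<nu>)"
  unfolding closed_subspace_def
proof (intro conjI ballI allI impI)
  fix f g c assume fg: "f \<in> eigenspace k \<nu>" "g \<in> eigenspace k \<nu>"
  have c: "cont f" "cont g" using fg by (auto simp: eigenspace_def)
  have "conv k (conv k (\<lambda>x. f x + c * g x)) x = conv k (conv k f) x + c * conv k (conv k g) x" if "x \<in> carrier G" for x
  proof -
    have "conv k (conv k (\<lambda>x. f x + c * g x)) = conv k (\<lambda>x. conv k f x + c * conv k g x)"
      by (rule conv_cong) (simp add: conv_linear k c)
    then show ?thesis using that by (simp add: conv_linear conv_cont k c)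
  qed
  then show "(\<lambda>x. f x + c * g x) \<in> eigenspace k \<nu>"
    using fg by (auto simp: eigenspace_def algebra_simps intro!: continuous_intros)
next
  fix v assume v: "cont v" and lim: "\<forall>\<epsilon>>0. \<exists>f\<in>eigenspace k \<nu>. \<forall>x\<in>carrier G. \<bar>f x - v x\<bar> \<le> \<epsilon>"
  obtain K where K: "K > 0" "\<And>z. z \<in> carrier G \<Longrightarrow> \<bar>k z\<bar> \<le> K" using cont_bounded[OF k] by blast
  have small: "\<bar>conv k d x\<bar> \<le> K * \<epsilon>" if "cont d" "\<And>x. x \<in> carrier G \<Longrightarrow> \<bar>d x\<bar> \<le> \<epsilon>" "0 \<le> \<epsilon>" "x \<in> carrier G" for d \<epsilon> x
  proof -
    have "ip d d \<le> \<epsilon>\<^sup>2" using that by (intro ip_self_le)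
    then have "sqrt (ip d d) \<le> \<epsilon>" using that by (intro real_le_lsqrt ip_nonneg) auto
    then have "K * sqrt (ip d d) \<le> K * \<epsilon>" using K by (intro mult_left_mono) auto
    then show ?thesis using conv_bound[OF k K(2) that(1,4)] by linarith
  qed
  have "conv k (conv k v) x = \<nu> * v x" if x: "x \<in> carrier G" for x
  proof (rule real_eqI)
    fix \<epsilon> :: real assume \<epsilon>: "\<epsilon> > 0"
    let ?\<delta> = "\<epsilon> / (K * K + \<bar>\<nu>\<bar>)"
    have den: "K * K + \<bar>\<nu>\<bar> > 0" using K by (simp add: add_pos_nonneg)
    then have \<delta>: "?\<delta> > 0" using \<epsilon> by simp
    then obtain f where f: "f \<in> eigenspace k \<nu>" "\<forall>x\<in>carrier G. \<bar>f x - v x\<bar> \<le> ?\<delta>" using lim by blast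
    have fc: "cont f" using f by (simp add: eigenspace_def)
    let ?d = "\<lambda>x. v x + (-1) * f x"
    have d: "cont ?d" using v fc by (intro continuous_intros) auto
    have "\<bar>conv k ?d y\<bar> \<le> K * ?\<delta>" if "y \<in> carrier G" for y
      using f(2) \<delta> that by (intro small d) (auto simp: abs_minus_commute)
    then have "\<bar>conv k (conv k ?d) x\<bar> \<le> K * (K * ?\<delta>)"
      using x by (intro small[OF conv_cont[OF k d]] mult_nonneg_nonneg less_imp_le[OF K(1)] less_imp_le[OF \<delta>])
    moreover have "conv k (conv k ?d) = conv k (\<lambda>x. conv k v x + (-1) * conv k f x)"
      by (rule conv_cong) (rule conv_linear[OF k v fc])
    moreover have "conv k (\<lambda>x. conv k v x + (-1) * conv k f x) x = conv k (conv k v) x + (-1) * conv k (conv k f) x"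
      by (rule conv_linear) (use k v fc x conv_cont in auto)
    moreover have "conv k (conv k f) x = \<nu> * f x" using f x by (simp add: eigenspace_def)
    ultimately have "\<bar>conv k (conv k v) x - \<nu> * f x\<bar> \<le> K * (K * ?\<delta>)" by simp
    moreover have "\<bar>\<nu> * f x - \<nu> * v x\<bar> \<le> \<bar>\<nu>\<bar> * ?\<delta>"
      using f(2) x by (simp only: right_diff_distrib[symmetric] abs_mult) (intro mult_left_mono; simp)
    ultimately have "\<bar>conv k (conv k v) x - \<nu> * v x\<bar> \<le> (K * K + \<bar>\<nu>\<bar>) * ?\<delta>"
      by (simp only: distrib_right mult.assoc)
    then show "\<bar>conv k (conv k v) x - \<nu> * v x\<bar> \<le> \<epsilon>" using den by simp
  qed
  then show "v \<in> eigenspace k \<nu>" using v by (simp add: eigenspace_def)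
qed (simp add: eigenspace_def)

lemma eigenspace_translate:
  assumes "cont k" "f \<in> eigenspace k \<nu>" "a \<in> carrier G"
  shows "(\<lambda>x. f (x \<otimes> a)) \<in> eigenspace k \<nu>"
proof -
  have f: "cont f" using assms by (simp add: eigenspace_def)
  have "conv k (conv k (\<lambda>x. f (x \<otimes> a))) = conv k (\<lambda>x. conv k f (x \<otimes> a))"
    by (rule conv_cong) (rule conv_translate[OF assms(1) f _ assms(3)])
  moreover have "conv k (\<lambda>x. conv k f (x \<otimes> a)) x = conv k (conv k f) (x \<otimes> a)" if "x \<in> carrier G" for x
    using that assms f by (intro conv_translate conv_cont)
  ultimately show ?thesis
    using assms f by (auto simp: eigenspace_def intro: cont_translate_right)
qed

text \<open>On an eigenspace \<open>f\<close> equals \<open>conv k (conv k f) / \<nu>\<close>, so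
  the norm of \<open>ip\<close> controls the supremum. Together with
  \<open>eigenspace_equicts\<close> this makes the unit ball relatively compact for uniform
  convergence.\<close>

lemma eigenspace_bound:
  assumes k: "cont k" and \<nu>: "\<nu> > 0"
  obtains B where "B \<ge> 0" "\<And>f x. f \<in> eigenspace k \<nu> \<Longrightarrow> x \<in> carrier G \<Longrightarrow> \<bar>f x\<bar> \<le> B * sqrt (ip f f)"
proof -
  obtain K where K: "K > 0" "\<And>z. z \<in> carrier G \<Longrightarrow> \<bar>k z\<bar> \<le> K" using cont_bounded[OF k] by blast
  show thesis
  proof (rule that[of "K * K / \<nu>"])
    show "K * K / \<nu> \<ge> 0" using K \<nu> by simp
    fix f x assume f: "f \<in> eigenspace k \<nu>" and x: "x \<in> carrier G"
    have fc: "cont f" using f by (simp add: eigenspace_def)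
    have "ip (conv k f) (conv k f) \<le> (K * sqrt (ip f f))\<^sup>2"
      using K fc k ip_nonneg[OF fc] by (intro ip_self_le conv_cont conv_bound) auto
    then have "sqrt (ip (conv k f) (conv k f)) \<le> K * sqrt (ip f f)"
      using K ip_nonneg[OF fc] k fc by (intro real_le_lsqrt ip_nonneg conv_cont) auto
    then have "K * sqrt (ip (conv k f) (conv k f)) \<le> K * (K * sqrt (ip f f))" using K by simp
    moreover have "\<bar>conv k (conv k f) x\<bar> \<le> K * sqrt (ip (conv k f) (conv k f))"
      using k K fc x by (intro conv_bound conv_cont)
    moreover have "conv k (conv k f) x = \<nu> * f x" using f x by (simp add: eigenspace_def)
    ultimately have "\<nu> * \<bar>f x\<bar> \<le> K * (K * sqrt (ip f f))" using \<nu> by (simp add: abs_mult)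
    then show "\<bar>f x\<bar> \<le> K * K / \<nu> * sqrt (ip f f)" using \<nu> by (simp add: field_simps)
  qed
qed

lemma eigenspace_equicts:
  assumes k: "cont k" and \<nu>: "\<nu> > 0"
  shows "equicts T {f \<in> eigenspace k \<nu>. ip f f \<le> 1}"
  unfolding equicts_def
proof (intro ballI allI impI)
  fix x and \<epsilon> :: real assume x: "x \<in> topspace T" and \<epsilon>: "\<epsilon> > 0"
  obtain K where K: "K > 0" "\<And>z. z \<in> carrier G \<Longrightarrow> \<bar>k z\<bar> \<le> K" using cont_bounded[OF k] by blast
  have "\<epsilon> * \<nu> / K > 0" using \<epsilon> \<nu> K by simp
  from equictsD[OF conv_equicts[OF k] x this]
  obtain U where U: "openin T U" "x \<in> U" "\<forall>y\<in>U. \<forall>f\<in>{conv k f |f. cont f \<and> ip f f \<le> 1}. dist (f y) (f x) < \<epsilon> * \<nu> / K"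
    by (elim exE conjE)
  have "dist (f y) (f x) < \<epsilon>" if y: "y \<in> U" and f: "f \<in> eigenspace k \<nu>" "ip f f \<le> 1" for y f
  proof -
    have fc: "cont f" using f by (simp add: eigenspace_def)
    have xy: "x \<in> carrier G" "y \<in> carrier G"
      using x y openin_subset[OF U(1)] by (auto simp: topspace_eq_carrier)
    \<comment> \<open>Division by \<open>K\<close> puts \<open>conv k f\<close> into the unit ball,
      where \<open>conv_equicts\<close> applies; then \<open>conv k h\<close> is
      \<open>\<nu> / K\<close> times \<open>f\<close>.\<close>
    define h where "h = (\<lambda>x. (1 / K) * conv k f x)"
    have hc: "cont h" unfolding h_def using k fc by (intro continuous_intros conv_cont)
    have "\<bar>h z\<bar> \<le> 1" if "z \<in> carrier G" for z
    proof -
      have "\<bar>conv k f z\<bar> \<le> K * sqrt (ip f f)" by (rule conv_bound[OF k K(2) fc that])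
      also have "\<dots> \<le> K * 1" using f K by (intro mult_left_mono) auto
      finally show ?thesis using K by (simp add: h_def)
    qed
    then have "ip h h \<le> 1\<^sup>2" by (intro ip_self_le hc) auto
    then have "dist (conv k h y) (conv k h x) < \<epsilon> * \<nu> / K" using U(3) y hc by force
    moreover have "conv k h z = \<nu> / K * f z" if "z \<in> carrier G" for z
    proof -
      have "conv k h z = 1 / K * conv k (conv k f) z"
        using conv_linear[OF k, of "\<lambda>_. 0" "conv k f" z "1 / K"] that k fc conv_cont
        by (simp add: h_def conv_def[of _ "\<lambda>_. 0"] mean_const)
      then show ?thesis using f that by (simp add: eigenspace_def)
    qed
    ultimately have "\<bar>\<nu> / K * (f y - f x)\<bar> < \<nu> / K * \<epsilon>"
      using xy by (simp add: dist_real_def right_diff_distrib mult.commute)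
    moreover have c: "\<nu> / K > 0" using \<nu> K by simp
    ultimately have "\<nu> / K * \<bar>f y - f x\<bar> < \<nu> / K * \<epsilon>"
      by (simp only: abs_mult abs_of_pos)
    then show ?thesis
      by (simp only: mult_less_cancel_left_pos[OF c] dist_real_def)
  qed
  then show "\<exists>U. openin T U \<and> x \<in> U \<and> (\<forall>y\<in>U. \<forall>f\<in>{f \<in> eigenspace k \<nu>. ip f f \<le> 1}. dist (f y) (f x) < \<epsilon>)"
    using U by (intro exI[of _ U]) auto
qed

end

section \<open>Second differences along one element and their eigenfunctions\<close>

context compact_group
begin

lemma ip_translate:
  assumes "cont f" "cont h" "a \<in> carrier G"
  shows "ip (\<lambda>x. f (x \<otimes> a)) (\<lambda>x. h (x \<otimes> a)) = ip f h"
  unfolding ip_def using assms by (intro mean_translate_right continuous_intros)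

lemma ip_shift:
  assumes "cont f" "cont h" "a \<in> carrier G"
  shows "ip (\<lambda>x. f (x \<otimes> a)) h = ip f (\<lambda>x. h (x \<otimes> inv a))"
proof -
  have "ip (\<lambda>x. f (x \<otimes> a)) h = ip (\<lambda>x. f (x \<otimes> a)) (\<lambda>x. h (x \<otimes> a \<otimes> inv a))"
    using assms by (intro ip_cong) (auto simp: m_assoc)
  also have "\<dots> = ip f (\<lambda>x. h (x \<otimes> inv a))"
    using assms by (intro ip_translate cont_translate_right) auto
  finally show ?thesis .
qed

lemma ip_translate_le:
  assumes "cont f" "a \<in> carrier G"
  shows "ip (\<lambda>x. f (x \<otimes> a)) f \<le> ip f f"
proof -
  have "\<bar>ip (\<lambda>x. f (x \<otimes> a)) f\<bar> \<le> sqrt (ip f f) * sqrt (ip f f)"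
    using ip_Cauchy_Schwarz'[OF cont_translate_right[OF assms] assms(1)] by (simp add: ip_translate assms)
  then show ?thesis
    using ip_nonneg[OF assms(1)] by simp
qed

lemma cont_second_diff: "cont f \<Longrightarrow> g \<in> carrier G \<Longrightarrow> cont (second_diff g f)"
  unfolding second_diff_def[abs_def] by (intro continuous_intros cont_translate_right) auto

lemma ip_second_diff_left:
  assumes "cont f" "cont h" "g \<in> carrier G"
  shows "ip (second_diff g f) h = 2 * ip f h - ip (\<lambda>x. f (x \<otimes> g)) h - ip (\<lambda>x. f (x \<otimes> inv g)) h"
proof -
  have c: "cont (\<lambda>x. f (x \<otimes> g))" "cont (\<lambda>x. f (x \<otimes> inv g))"
    using assms by (auto intro: cont_translate_right)
  have "second_diff g f = (\<lambda>x. ((f x + 1 * f x) + (-1) * f (x \<otimes> g)) + (-1) * f (x \<otimes> inv g))"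
    by (simp add: second_diff_def fun_eq_iff)
  then have "ip (second_diff g f) h = ip (\<lambda>x. ((f x + 1 * f x) + (-1) * f (x \<otimes> g)) + (-1) * f (x \<otimes> inv g)) h"
    by simp
  also have "\<dots> = ip (\<lambda>x. (f x + 1 * f x) + (-1) * f (x \<otimes> g)) h + (-1) * ip (\<lambda>x. f (x \<otimes> inv g)) h"
    using assms c by (intro ip_add_left continuous_intros)
  also have "ip (\<lambda>x. (f x + 1 * f x) + (-1) * f (x \<otimes> g)) h = ip (\<lambda>x. f x + 1 * f x) h + (-1) * ip (\<lambda>x. f (x \<otimes> g)) h"
    using assms c by (intro ip_add_left continuous_intros)
  also have "ip (\<lambda>x. f x + 1 * f x) h = ip f h + 1 * ip f h"
    using assms c by (intro ip_add_left continuous_intros)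
  finally show ?thesis by simp
qed

lemma second_diff_sym:
  assumes "cont f" "cont h" "g \<in> carrier G"
  shows "ip (second_diff g f) h = ip f (second_diff g h)"
proof -
  have "ip f (second_diff g h) = ip (second_diff g h) f"
    by (rule ip_commute)
  also have "\<dots> = 2 * ip f h - ip (\<lambda>x. h (x \<otimes> g)) f - ip (\<lambda>x. h (x \<otimes> inv g)) f"
    using ip_second_diff_left[OF assms(2,1,3)] by (simp add: ip_commute)
  also have "ip (\<lambda>x. h (x \<otimes> g)) f = ip (\<lambda>x. f (x \<otimes> inv g)) h"
    using ip_shift[OF assms(2,1,3)] by (simp add: ip_commute)
  also have "ip (\<lambda>x. h (x \<otimes> inv g)) f = ip (\<lambda>x. f (x \<otimes> g)) h"
    using ip_shift[OF assms(2,1), of "inv g"] assms(3) by (simp add: ip_commute)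
  finally show ?thesis
    using ip_second_diff_left[OF assms] by simp
qed

lemma second_diff_nonneg:
  assumes "cont f" "g \<in> carrier G" shows "0 \<le> ip (second_diff g f) f"
  using ip_translate_le[OF assms] ip_translate_le[OF assms(1), of "inv g"] assms
  by (simp add: ip_second_diff_left)

lemma second_diff_in_closed_subspace:
  assumes "closed_subspace S" "f \<in> S" "(\<lambda>x. f (x \<otimes> g)) \<in> S" "(\<lambda>x. f (x \<otimes> inv g)) \<in> S"
  shows "second_diff g f \<in> S"
proof -
  have "(\<lambda>x. ((\<lambda>x. (\<lambda>x. f x + 1 * f x) x + (-1) * f (x \<otimes> g)) x) + (-1) * f (x \<otimes> inv g)) \<in> S"
    using assms by (intro closed_subspace_add)
  then show ?thesis by (simp add: second_diff_def[abs_def])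
qed

text \<open>Inside an eigenspace of a convolution the second difference is a compact operator.
  Writing Q for it, Q Q F = \<open>\<mu>\<close> F makes \<open>F'\<close>, which is Q F +
  \<open>sqrt \<mu>\<close> F, an eigenfunction of Q itself; it cannot vanish because Q is
  nonnegative.\<close>

lemma second_diff_eigenfunction:
  assumes S: "closed_subspace S" "S \<subseteq> eigenspace k \<nu>" and k: "cont k" and \<nu>: "\<nu> > 0" and g: "g \<in> carrier G"
    and trans: "\<And>f. f \<in> S \<Longrightarrow> (\<lambda>x. f (x \<otimes> g)) \<in> S" "\<And>f. f \<in> S \<Longrightarrow> (\<lambda>x. f (x \<otimes> inv g)) \<in> S"
    and f0: "f0 \<in> S" "x0 \<in> carrier G" "second_diff g f0 x0 \<noteq> 0"
  defines "\<mu> \<equiv> Sup {ip (second_diff g f) (second_diff g f) |f. f \<in> S \<and> ip f f \<le> 1}"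
  shows "\<mu> > 0 \<and> (\<exists>F\<in>S. (\<exists>x\<in>carrier G. F x \<noteq> 0) \<and> (\<forall>x\<in>carrier G. second_diff g F x = sqrt \<mu> * F x))"
proof -
  have cont: "cont f" if "f \<in> S" for f using closed_subspace_cont[OF S(1) that] .
  obtain B where B: "B \<ge> 0" "\<And>f x. f \<in> eigenspace k \<nu> \<Longrightarrow> x \<in> carrier G \<Longrightarrow> \<bar>f x\<bar> \<le> B * sqrt (ip f f)"
    using eigenspace_bound[OF k \<nu>] by blast
  have sdS: "second_diff g f \<in> S" if "f \<in> S" for f
    using that trans by (intro second_diff_in_closed_subspace S)
  have main: "\<mu> > 0 \<and> (\<exists>F\<in>S. (\<exists>x\<in>carrier G. F x \<noteq> 0) \<and> (\<forall>x\<in>carrier G. second_diff g (second_diff g F) x = \<mu> * F x))"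
    unfolding \<mu>_def
  proof (rule compact_symmetric_eigenfunction[OF S(1) sdS, where B = "4 * B"])
    show "second_diff g (\<lambda>x. f x + c * h x) x = second_diff g f x + c * second_diff g h x" for f h c x
      by (simp add: second_diff_def algebra_simps)
    show "ip (second_diff g f) h = ip f (second_diff g h)" if "f \<in> S" "h \<in> S" for f h
      using that by (intro second_diff_sym cont g)
    show "\<bar>second_diff g f x\<bar> \<le> 4 * B * sqrt (ip f f)" if f: "f \<in> S" and x: "x \<in> carrier G" for f x
    proof -
      have fE: "f \<in> eigenspace k \<nu>" using f S by blast
      have "\<bar>f x\<bar> \<le> B * sqrt (ip f f)" "\<bar>f (x \<otimes> g)\<bar> \<le> B * sqrt (ip f f)" "\<bar>f (x \<otimes> inv g)\<bar> \<le> B * sqrt (ip f f)"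
        using x g by (intro B(2)[OF fE]; simp)+
      then show ?thesis unfolding second_diff_def by linarith
    qed
    show "equicts T {second_diff g f |f. f \<in> S \<and> ip f f \<le> 1}"
      unfolding equicts_def
    proof (intro ballI allI impI)
      fix x and \<epsilon> :: real assume x: "x \<in> topspace T" and \<epsilon>: "\<epsilon> > 0"
      have xG: "x \<in> carrier G" using x by (simp add: topspace_eq_carrier)
      have "\<exists>U. openin T U \<and> z \<in> U \<and> (\<forall>y\<in>U. \<forall>f\<in>{f \<in> eigenspace k \<nu>. ip f f \<le> 1}. dist (f y) (f z) < \<epsilon> / 4)"
        if "z \<in> carrier G" for z
        using that \<epsilon> by (intro equictsD[OF eigenspace_equicts[OF k \<nu>]]) (auto simp: topspace_eq_carrier)
      then obtain U where U: "\<And>z. z \<in> carrier G \<Longrightarrow> openin T (U z)" "\<And>z. z \<in> carrier G \<Longrightarrow> z \<in> U z"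
        "\<And>z y f. z \<in> carrier G \<Longrightarrow> y \<in> U z \<Longrightarrow> f \<in> eigenspace k \<nu> \<Longrightarrow> ip f f \<le> 1 \<Longrightarrow> \<bar>f y - f z\<bar> < \<epsilon> / 4"
        by (simp add: dist_real_def) metis
      let ?W = "U x \<inter> {y \<in> topspace T. y \<otimes> g \<in> U (x \<otimes> g)} \<inter> {y \<in> topspace T. y \<otimes> inv g \<in> U (x \<otimes> inv g)}"
      have "openin T ?W"
        using xG g U(1)
        by (intro openin_Int openin_continuous_map_preimage[OF translate_right_continuous]) auto
      moreover have "x \<in> ?W" using x xG g U(2) by auto
      moreover have "dist (second_diff g f y) (second_diff g f x) < \<epsilon>" if "y \<in> ?W" "f \<in> S" "ip f f \<le> 1" for y f
      proof -
        have fE: "f \<in> eigenspace k \<nu>" using that S by blast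
        have "\<bar>f y - f x\<bar> < \<epsilon> / 4" "\<bar>f (y \<otimes> g) - f (x \<otimes> g)\<bar> < \<epsilon> / 4"
          "\<bar>f (y \<otimes> inv g) - f (x \<otimes> inv g)\<bar> < \<epsilon> / 4"
          using that g xG fE U(3)[of x y f] U(3)[of "x \<otimes> g" "y \<otimes> g" f] U(3)[of "x \<otimes> inv g" "y \<otimes> inv g" f]
          by auto
        then show ?thesis
          unfolding dist_real_def second_diff_def by linarith
      qed
      ultimately show "\<exists>U. openin T U \<and> x \<in> U \<and>
         (\<forall>y\<in>U. \<forall>f\<in>{second_diff g f |f. f \<in> S \<and> ip f f \<le> 1}. dist (f y) (f x) < \<epsilon>)"
        by (intro exI[of _ ?W]) auto
    qed
  qed (use f0 in auto)
  then obtain F x where F: "F \<in> S" "x \<in> carrier G" "F x \<noteq> 0"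
    "\<And>x. x \<in> carrier G \<Longrightarrow> second_diff g (second_diff g F) x = \<mu> * F x" by blast
  have \<mu>: "\<mu> > 0" using main by blast
  let ?r = "sqrt \<mu>"
  define F' where "F' = (\<lambda>x. second_diff g F x + ?r * F x)"
  have F'S: "F' \<in> S" unfolding F'_def using F sdS by (intro closed_subspace_add S)
  have ev: "second_diff g F' y = ?r * F' y" if y: "y \<in> carrier G" for y
  proof -
    have "second_diff g F' y = second_diff g (second_diff g F) y + ?r * second_diff g F y"
      by (simp add: F'_def second_diff_def algebra_simps)
    also have "\<dots> = ?r * F' y"
      using \<mu> by (simp add: F(4)[OF y] F'_def algebra_simps)
    finally show ?thesis .
  qed
  have "\<exists>x\<in>carrier G. F' x \<noteq> 0"
  proof (rule ccontr)
    assume "\<not> ?thesis"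
    then have "second_diff g F y = - ?r * F y" if "y \<in> carrier G" for y
      using that by (auto simp: F'_def add_eq_0_iff2)
    then have "ip (second_diff g F) F = ip (\<lambda>x. - ?r * F x) F"
      by (intro ip_cong) auto
    also have "\<dots> = - ?r * ip F F"
      unfolding ip_def using cont[OF F(1)]
      by (subst mean_scale[symmetric]) (auto intro!: continuous_intros simp: mult.assoc)
    finally have "?r * ip F F \<le> 0"
      using second_diff_nonneg[OF cont[OF F(1)] g] by simp
    then have "ip F F = 0"
      using \<mu> ip_nonneg[OF cont[OF F(1)]] by (simp add: mult_le_0_iff)
    then show False using ip_eq_0D[OF cont[OF F(1)]] F by blast
  qed
  then show ?thesis using \<mu> F'S ev by blast
qed

lemma harmonic_iff: "harmonic g \<theta> F \<longleftrightarrow> cont F \<and> (\<forall>x\<in>carrier G. second_diff g F x = (2 - \<theta>) * F x)"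
  unfolding harmonic_def second_diff_def by (auto simp: algebra_simps)

lemma harmonic_conv:
  assumes "harmonic g \<theta> F" "cont k" "g \<in> carrier G" shows "harmonic g \<theta> (conv k F)"
proof -
  have F: "cont F" using assms by (simp add: harmonic_def)
  have "conv k F (x \<otimes> g) + conv k F (x \<otimes> inv g) = \<theta> * conv k F x" if x: "x \<in> carrier G" for x
  proof -
    have "conv k F (x \<otimes> g) + conv k F (x \<otimes> inv g) = conv k (\<lambda>x. F (x \<otimes> g)) x + 1 * conv k (\<lambda>x. F (x \<otimes> inv g)) x"
      using x assms F by (simp add: conv_translate)
    also have "\<dots> = conv k (\<lambda>x. F (x \<otimes> g) + 1 * F (x \<otimes> inv g)) x"
      using x assms F by (intro conv_linear[symmetric] cont_translate_right) auto
    also have "conv k (\<lambda>x. F (x \<otimes> g) + 1 * F (x \<otimes> inv g)) = conv k (\<lambda>x. F x + (\<theta> - 1) * F x)"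
      using assms by (intro conv_cong) (auto simp: harmonic_def algebra_simps)
    also have "conv k (\<lambda>x. F x + (\<theta> - 1) * F x) x = \<theta> * conv k F x"
      unfolding conv_linear[OF assms(2) F F x] by (simp add: algebra_simps)
    finally show ?thesis .
  qed
  then show ?thesis using assms F by (auto simp: harmonic_def intro: conv_cont)
qed

lemma harmonic_translate:
  assumes "harmonic g \<theta> F" "g \<in> carrier G"
  shows "harmonic g \<theta> (\<lambda>x. F (x \<otimes> g))" "harmonic g \<theta> (\<lambda>x. F (x \<otimes> inv g))"
proof -
  have F: "cont F" and eq: "\<And>x. x \<in> carrier G \<Longrightarrow> F (x \<otimes> g) + F (x \<otimes> inv g) = \<theta> * F x"
    using assms by (auto simp: harmonic_def)
  have c: "x \<otimes> inv g \<otimes> g = x" "x \<otimes> g \<otimes> inv g = x" if "x \<in> carrier G" for x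
    using that assms by (auto simp: m_assoc)
  show "harmonic g \<theta> (\<lambda>x. F (x \<otimes> g))"
    unfolding harmonic_def
  proof (intro conjI ballI)
    fix x assume x: "x \<in> carrier G"
    show "F (x \<otimes> g \<otimes> g) + F (x \<otimes> inv g \<otimes> g) = \<theta> * F (x \<otimes> g)"
      using eq[of "x \<otimes> g"] x assms(2) by (simp only: c m_closed)
  qed (use F assms in \<open>auto intro: cont_translate_right\<close>)
  show "harmonic g \<theta> (\<lambda>x. F (x \<otimes> inv g))"
    unfolding harmonic_def
  proof (intro conjI ballI)
    fix x assume x: "x \<in> carrier G"
    show "F (x \<otimes> g \<otimes> inv g) + F (x \<otimes> inv g \<otimes> inv g) = \<theta> * F (x \<otimes> inv g)"
      using eq[of "x \<otimes> inv g"] x assms(2) by (simp only: c m_closed inv_closed)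
  qed (use F assms in \<open>auto intro: cont_translate_right\<close>)
qed

lemma exists_separating:
  assumes "a \<in> carrier G" "a \<noteq> \<one>"
  obtains h where "cont h" "h a \<noteq> h \<one>"
proof -
  have norm: "normal_space T"
    using compact Hausdorff compact_Hausdorff_or_regular_imp_normal_space by blast
  have cl: "closedin T {\<one>}" "closedin T {a}"
    using Hausdorff assms by (auto simp: closedin_Hausdorff_sing_eq topspace_eq_carrier)
  have d: "disjnt {\<one>} {a}" using assms by (auto simp: disjnt_def)
  from Urysohn_lemma_alt[OF norm cl d]
  obtain h where "cont h" "h ` {\<one>} \<subseteq> {0 :: real}" "h ` {a} \<subseteq> {1}" by blast
  then show thesis using that by auto
qed

text \<open>If \<open>a\<close> fixes a total family, any \<open>h\<close> and its translate by
  \<open>a\<close> have the same inner products with the family, hence agree. A function separating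
  \<open>a\<close> from \<open>\<one>\<close> contradicts this.\<close>

lemma orthogonal_translate_trivial:
  assumes a: "a \<in> carrier G" and A: "\<And>F. F \<in> A \<Longrightarrow> cont F"
    and fixed: "\<And>F x. F \<in> A \<Longrightarrow> x \<in> carrier G \<Longrightarrow> F (x \<otimes> a) = F x"
    and dense: "\<And>h x. cont h \<Longrightarrow> (\<And>F. F \<in> A \<Longrightarrow> ip h F = 0) \<Longrightarrow> x \<in> carrier G \<Longrightarrow> h x = 0"
  shows "a = \<one>"
proof (rule ccontr)
  assume "a \<noteq> \<one>"
  then obtain h where h: "cont h" "h a \<noteq> h \<one>" using exists_separating[OF a] by blast
  let ?h = "\<lambda>x. h (x \<otimes> a) + (-1) * h x"
  have ha: "cont (\<lambda>x. h (x \<otimes> a))" using h a by (intro cont_translate_right)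
  have "cont ?h" using h ha by (intro continuous_intros)
  moreover have "ip ?h F = 0" if F: "F \<in> A" for F
  proof -
    have "ip (\<lambda>x. h (x \<otimes> a)) F = ip h (\<lambda>x. F (x \<otimes> inv a))"
      by (rule ip_shift[OF h(1) A[OF F] a])
    also have "\<dots> = ip h F"
    proof (rule ip_cong)
      fix x assume x: "x \<in> carrier G"
      show "F (x \<otimes> inv a) = F x"
        using fixed[OF F, of "x \<otimes> inv a"] x a by (simp add: m_assoc)
    qed simp
    finally show ?thesis
      using ip_add_left[OF ha h(1) A[OF F], of "-1"] by simp
  qed
  ultimately have "?h \<one> = 0" using dense[of ?h \<one>] by blast
  then show False using h a by simp
qed

lemma ip_self_nonzero: "cont f \<Longrightarrow> x \<in> carrier G \<Longrightarrow> f x \<noteq> 0 \<Longrightarrow> ip f f \<noteq> 0"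
  using ip_eq_0D by blast

text \<open>The functions harmonic along \<open>g\<close> are total. Their orthogonal complement is
  invariant under convolutions and translation by \<open>g\<close>; were it nonzero, it would
  contain an eigenfunction of a convolution and, within that eigenspace, one of the second
  difference. The latter is harmonic, hence orthogonal to itself.\<close>

theorem harmonic_separates:
  assumes g: "g \<in> carrier G" and a: "a \<in> carrier G" "a \<noteq> \<one>"
  obtains \<theta> F x where "harmonic g \<theta> F" "x \<in> carrier G" "F (x \<otimes> a) \<noteq> F x"
proof -
  define A where "A = {F. \<exists>\<theta>. harmonic g \<theta> F}"
  have Ac: "cont F" if "F \<in> A" for F using that by (auto simp: A_def harmonic_def)
  define S where "S = {h. cont h \<and> (\<forall>F\<in>A. ip h F = 0)}"
  have S: "closed_subspace S" unfolding S_def by (rule closed_subspace_orthogonal) (rule Ac)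
  have SA: "f x = 0" if "f \<in> S" "f \<in> A" "x \<in> carrier G" for f x
    using that ip_eq_0D by (auto simp: S_def)
  have "h x0 = 0" if h: "h \<in> S" and x0: "x0 \<in> carrier G" for h x0
  proof (rule ccontr)
    assume "h x0 \<noteq> 0"
    then obtain k where k: "sym_kernel k" "conv k h x0 \<noteq> 0"
      using conv_nontrivial h x0 by (auto simp: S_def)
    have kc: "cont k" using k by (simp add: sym_kernel_def)
    have convS: "conv k f \<in> S" if "f \<in> S" for f
    proof -
      have "ip (conv k f) F = 0" if F: "F \<in> A" for F
      proof -
        have "conv k F \<in> A" using F harmonic_conv[OF _ kc g] by (auto simp: A_def)
        moreover have "ip (conv k f) F = ip f (conv k F)"
          using \<open>f \<in> S\<close> Ac[OF F] by (intro conv_sym k) (auto simp: S_def)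
        ultimately show ?thesis using \<open>f \<in> S\<close> by (simp add: S_def)
      qed
      then show ?thesis using that kc by (auto simp: S_def intro: conv_cont)
    qed
    obtain \<nu> F x where F: "\<nu> > 0" "F \<in> S" "F \<in> eigenspace k \<nu>" "x \<in> carrier G" "F x \<noteq> 0"
      using conv_eigenfunction[OF k(1) S convS h x0 k(2)] by blast
    define S' where "S' = S \<inter> eigenspace k \<nu>"
    have S': "closed_subspace S'" unfolding S'_def by (intro closed_subspace_Int S closed_subspace_eigenspace kc)
    have trans: "(\<lambda>x. f (x \<otimes> b)) \<in> S'" if f: "f \<in> S'" and b: "b = g \<or> b = inv g" for f b
    proof -
      have bG: "b \<in> carrier G" using b g by auto
      have fc: "cont f" and fS: "f \<in> S" and fE: "f \<in> eigenspace k \<nu>" using f by (auto simp: S'_def S_def)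
      have "ip (\<lambda>x. f (x \<otimes> b)) F = 0" if F: "F \<in> A" for F
      proof -
        obtain \<theta> where "harmonic g \<theta> F" using F by (auto simp: A_def)
        from harmonic_translate[OF this g] have "(\<lambda>x. F (x \<otimes> inv b)) \<in> A"
          using b g by (auto simp: A_def)
        then show ?thesis
          using ip_shift[OF fc Ac[OF F] bG] fS by (simp add: S_def)
      qed
      then have "(\<lambda>x. f (x \<otimes> b)) \<in> S"
        using fc bG by (auto simp: S_def intro: cont_translate_right)
      then show ?thesis
        using eigenspace_translate[OF kc fE bG] by (simp add: S'_def)
    qed
    have "F \<in> S'" using F by (simp add: S'_def)
    show False
    proof (cases "\<exists>x\<in>carrier G. second_diff g F x \<noteq> 0")
      case True
      then obtain x1 where x1: "x1 \<in> carrier G" "second_diff g F x1 \<noteq> 0" by blast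
      let ?\<mu> = "Sup {ip (second_diff g f) (second_diff g f) |f. f \<in> S' \<and> ip f f \<le> 1}"
      have "?\<mu> > 0 \<and> (\<exists>F\<in>S'. (\<exists>x\<in>carrier G. F x \<noteq> 0) \<and> (\<forall>x\<in>carrier G. second_diff g F x = sqrt ?\<mu> * F x))"
        by (rule second_diff_eigenfunction[OF S' _ kc F(1) g _ _ \<open>F \<in> S'\<close> x1]) (use trans in \<open>auto simp: S'_def\<close>)
      then obtain F' y where F': "F' \<in> S'" "y \<in> carrier G" "F' y \<noteq> 0" "\<forall>x\<in>carrier G. second_diff g F' x = sqrt ?\<mu> * F' x"
        by blast
      have "harmonic g (2 - sqrt ?\<mu>) F'"
        unfolding harmonic_iff using F' by (auto simp: S'_def S_def)
      then have "F' \<in> A" by (auto simp: A_def)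
      then show False using SA F' by (auto simp: S'_def)
    next
      case False
      then have "harmonic g 2 F"
        unfolding harmonic_iff using F by (auto simp: S_def)
      then have "F \<in> A" by (auto simp: A_def)
      then show False using SA F by blast
    qed
  qed
  then have dense: "h x = 0" if "cont h" "\<And>F. F \<in> A \<Longrightarrow> ip h F = 0" "x \<in> carrier G" for h x
    using that by (simp add: S_def)
  have "\<exists>F\<in>A. \<exists>x\<in>carrier G. F (x \<otimes> a) \<noteq> F x"
  proof (rule ccontr)
    assume no: "\<not> ?thesis"
    have "a = \<one>"
    proof (rule orthogonal_translate_trivial[where A = A, OF a(1)])
      show "cont F" if "F \<in> A" for F using Ac[OF that] .
      show "F (x \<otimes> a) = F x" if "F \<in> A" "x \<in> carrier G" for F x using no that by blast
      show "h x = 0" if "cont h" "\<And>F. F \<in> A \<Longrightarrow> ip h F = 0" "x \<in> carrier G" for h x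
        using that(2) by (rule dense[OF that(1) _ that(3)])
    qed
    then show False using a(2) by simp
  qed
  then show thesis using that by (auto simp: A_def)
qed

text \<open>Write \<open>\<tau>\<close> for translation by \<open>g\<close>. As
  \<open>\<tau>\<close> is an isometry, \<open>\<theta>\<close> lies between -2 and 2. At
  \<open>F\<close> the polynomial \<open>\<tau>^2 - \<theta> \<tau> + 1\<close> vanishes; applying
  the factor \<open>\<tau> - cnj \<zeta>\<close> leaves an eigenfunction for \<open>\<zeta>\<close>,
  whose imaginary part is a multiple of \<open>F\<close>. If \<open>\<theta>\<close> is 2 or -2,
  equality in Cauchy-Schwarz makes \<open>F\<close> itself an eigenfunction.\<close>

theorem harmonic_eigenfunction:
  assumes F: "harmonic g \<theta> F" and g: "g \<in> carrier G" and x0: "x0 \<in> carrier G" "F x0 \<noteq> 0"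
  obtains \<zeta> \<kappa> \<Psi> where "cmod \<zeta> = 1" "\<theta> = 2 * Re \<zeta>" "continuous_map T euclidean \<Psi>"
    "\<And>x. x \<in> carrier G \<Longrightarrow> \<Psi> (x \<otimes> g) = \<zeta> * \<Psi> x" "\<And>x. x \<in> carrier G \<Longrightarrow> F x = Re (\<kappa> * \<Psi> x)"
proof -
  have Fc: "cont F" and eq: "\<And>x. x \<in> carrier G \<Longrightarrow> F (x \<otimes> g) + F (x \<otimes> inv g) = \<theta> * F x"
    using F by (auto simp: harmonic_def)
  have pos: "ip F F > 0" using ip_self_nonzero[OF Fc x0] ip_nonneg[OF Fc] by simp
  have Fg: "cont (\<lambda>x. F (x \<otimes> g))" using Fc g by (rule cont_translate_right)
  have sd: "ip (second_diff g F) F = (2 - \<theta>) * ip F F"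
  proof -
    have "ip (second_diff g F) F = ip (\<lambda>x. F x + (1 - \<theta>) * F x) F"
      using F by (intro ip_cong) (auto simp: harmonic_iff algebra_simps)
    then show ?thesis using ip_add_left[OF Fc Fc Fc, of "1 - \<theta>"] by (simp add: algebra_simps)
  qed
  have shift: "ip (\<lambda>x. F (x \<otimes> inv g)) F = ip (\<lambda>x. F (x \<otimes> g)) F"
    using ip_shift[OF Fc Fc g] by (simp add: ip_commute)
  have corr: "ip (\<lambda>x. F (x \<otimes> g)) F = \<theta> / 2 * ip F F"
    using sd ip_second_diff_left[OF Fc Fc g] shift by (simp add: algebra_simps)
  have "\<bar>ip (\<lambda>x. F (x \<otimes> g)) F\<bar> \<le> ip F F"
    using ip_Cauchy_Schwarz'[OF Fg Fc] ip_translate[OF Fc Fc g] ip_nonneg[OF Fc] by simp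
  then have th: "\<bar>\<theta>\<bar> \<le> 2"
    using pos by (simp add: corr abs_mult)
  show thesis
  proof (cases "\<bar>\<theta>\<bar> = 2")
    case True
    let ?r = "\<theta> / 2"
    have "\<theta> = 2 \<or> \<theta> = - 2" using True by linarith
    then have r2: "?r * ?r = 1" by auto
    let ?d = "\<lambda>x. F (x \<otimes> g) + (- ?r) * F x"
    have d: "cont ?d" using Fc Fg by (intro continuous_intros)
    have "ip ?d ?d = ip F F + 2 * (- ?r) * (?r * ip F F) + (- ?r)\<^sup>2 * ip F F"
      using ip_add_self[OF Fg Fc, of "- ?r"] by (simp add: ip_translate Fc g corr)
    also have "\<dots> = 0" using r2 by (simp add: power2_eq_square algebra_simps)
    finally have "F (x \<otimes> g) = ?r * F x" if "x \<in> carrier G" for x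
      using ip_eq_0D[OF d _ that] by simp
    then have "complex_of_real (F (x \<otimes> g)) = complex_of_real ?r * complex_of_real (F x)" if "x \<in> carrier G" for x
      using that by (simp only: of_real_mult[symmetric])
    moreover have "continuous_map T euclidean (\<lambda>x. complex_of_real (F x))"
      using continuous_map_compose[OF Fc, of euclidean complex_of_real] by (simp add: comp_def continuous_intros)
    ultimately show thesis
      using True by (intro that[of "complex_of_real ?r" "\<lambda>x. complex_of_real (F x)" 1]) (simp_all add: norm_divide)
  next
    case False
    with th have th2: "\<theta>\<^sup>2 < 4"
      using power_strict_mono[of "\<bar>\<theta>\<bar>" 2 2] by simp
    define s where "s = sqrt (1 - \<theta>\<^sup>2 / 4)"
    have s: "s > 0" using th2 by (simp add: s_def)
    have s2: "s * s = 1 - \<theta>\<^sup>2 / 4" using th2 by (simp add: s_def)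
    define \<zeta> where "\<zeta> = Complex (\<theta> / 2) s"
    define \<Psi> where "\<Psi> x = complex_of_real (F (x \<otimes> g)) - cnj \<zeta> * complex_of_real (F x)" for x
    have "(\<theta> / 2)\<^sup>2 + s\<^sup>2 = 1" using s2 by (simp add: power2_eq_square)
    then have n: "cmod \<zeta> = 1" by (simp add: \<zeta>_def cmod_def)
    have cont: "continuous_map T euclidean \<Psi>"
      unfolding \<Psi>_def[abs_def]
      using continuous_map_compose[OF Fc, of euclidean "\<lambda>t. cnj \<zeta> * complex_of_real t"]
        continuous_map_compose[OF Fg, of euclidean complex_of_real]
      by (intro continuous_intros) (auto simp: comp_def continuous_intros)
    have rec: "\<Psi> (x \<otimes> g) = \<zeta> * \<Psi> x" if x: "x \<in> carrier G" for x
    proof -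
      have "F (x \<otimes> g \<otimes> g) + F x = \<theta> * F (x \<otimes> g)"
        using eq[of "x \<otimes> g"] x g by (simp add: m_assoc)
      then have e: "F (x \<otimes> g \<otimes> g) = \<theta> * F (x \<otimes> g) - F x" by simp
      show ?thesis
        by (rule complex_eqI)
           (use s2 in \<open>simp_all add: \<Psi>_def e \<zeta>_def power2_eq_square algebra_simps\<close>)
    qed
    have "F x = Re ((- \<i> / s) * \<Psi> x)" for x
      using s by (simp add: \<Psi>_def \<zeta>_def field_simps)
    with n cont rec show thesis
      by (intro that[of \<zeta> \<Psi> "- \<i> / s"]) (auto simp: \<zeta>_def)
  qed
qed

lemma eigenfunction_power:
  fixes \<Psi> :: "'a \<Rightarrow> complex"
  assumes "g \<in> carrier G" "\<And>x. x \<in> carrier G \<Longrightarrow> \<Psi> (x \<otimes> g) = \<zeta> * \<Psi> x" "x \<in> carrier G"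
  shows "\<Psi> (x \<otimes> g [^] (n::nat)) = \<zeta> ^ n * \<Psi> x"
proof (induction n)
  case (Suc n)
  then show ?case
    using assms(2)[of "x \<otimes> g [^] n"] assms(1,3) by (simp add: m_assoc mult.assoc)
qed (use assms in simp)

text \<open>Each point outside \<open>V\<close> is separated from \<open>\<one>\<close> by a
  function harmonic along \<open>g\<close>, and the powers of \<open>g\<close> act on it only
  through one number \<open>\<zeta> ^ n\<close>. Compactness of the complement of \<open>V\<close>
  leaves finitely many such numbers.\<close>

theorem power_near_one:
  assumes g: "g \<in> carrier G" and V: "openin T V" "\<one> \<in> V"
  obtains L \<epsilon> where "finite L" "\<And>\<zeta>. \<zeta> \<in> L \<Longrightarrow> cmod \<zeta> = 1" "\<epsilon> > 0"
    "\<And>n::nat. (\<And>\<zeta>. \<zeta> \<in> L \<Longrightarrow> cmod (\<zeta> ^ n - 1) < \<epsilon>) \<Longrightarrow> g [^] n \<in> V"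
proof -
  have "\<exists>W \<zeta> \<epsilon>. openin T W \<and> a \<in> W \<and> cmod \<zeta> = 1 \<and> \<epsilon> > 0 \<and> (\<forall>n::nat. g [^] n \<in> W \<longrightarrow> \<epsilon> \<le> cmod (\<zeta> ^ n - 1))"
    if a: "a \<in> topspace T - V" for a
  proof -
    have aG: "a \<in> carrier G" "a \<noteq> \<one>" using a V by (auto simp: topspace_eq_carrier)
    obtain \<theta> F x where F: "harmonic g \<theta> F" "x \<in> carrier G" "F (x \<otimes> a) \<noteq> F x"
      using harmonic_separates[OF g aG] by blast
    have Fc: "cont F" using F by (simp add: harmonic_def)
    have "\<exists>x0\<in>carrier G. F x0 \<noteq> 0" using F aG by (metis m_closed)
    then obtain \<zeta> \<kappa> \<Psi> where \<Psi>: "cmod \<zeta> = 1" "\<theta> = 2 * Re \<zeta>" "continuous_map T euclidean \<Psi>"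
      "\<And>x. x \<in> carrier G \<Longrightarrow> \<Psi> (x \<otimes> g) = \<zeta> * \<Psi> x" "\<And>x. x \<in> carrier G \<Longrightarrow> F x = Re (\<kappa> * \<Psi> x)"
      using harmonic_eigenfunction[OF F(1) g] by metis
    define r where "r = \<bar>F (x \<otimes> a) - F x\<bar> / 2"
    have r: "r > 0" using F by (simp add: r_def)
    let ?W = "{b \<in> topspace T. \<bar>F (x \<otimes> b) - F x\<bar> \<in> {r<..}}"
    have "cont (\<lambda>b. \<bar>F (x \<otimes> b) - F x\<bar>)"
      using cont_translate_left[OF Fc F(2)] by (intro continuous_intros)
    then have "openin T ?W"
      by (rule openin_continuous_map_preimage) simp
    moreover have "a \<in> ?W"
      using a r by (simp add: r_def)
    moreover have "r / (cmod (\<kappa> * \<Psi> x) + 1) \<le> cmod (\<zeta> ^ n - 1)" if n: "g [^] n \<in> ?W" for n :: nat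
    proof -
      have "F (x \<otimes> g [^] n) - F x = Re ((\<zeta> ^ n - 1) * (\<kappa> * \<Psi> x))"
        using \<Psi>(5)[of "x \<otimes> g [^] n"] \<Psi>(5)[of x] F(2) g eigenfunction_power[where \<Psi> = \<Psi> and \<zeta> = \<zeta> and n = n, OF g \<Psi>(4) F(2)]
        by (simp add: algebra_simps)
      then have "r < cmod ((\<zeta> ^ n - 1) * (\<kappa> * \<Psi> x))"
        using n abs_Re_le_cmod[of "(\<zeta> ^ n - 1) * (\<kappa> * \<Psi> x)"] by simp
      also have "\<dots> \<le> cmod (\<zeta> ^ n - 1) * (cmod (\<kappa> * \<Psi> x) + 1)"
        by (simp add: norm_mult distrib_left)
      finally show ?thesis
        by (subst pos_divide_le_eq) (auto intro: add_nonneg_pos)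
    qed
    moreover have "r / (cmod (\<kappa> * \<Psi> x) + 1) > 0"
      using r by (intro divide_pos_pos) (auto intro: add_nonneg_pos)
    ultimately show ?thesis using \<Psi>(1) by blast
  qed
  then obtain W \<zeta> \<epsilon> where W: "\<And>a. a \<in> topspace T - V \<Longrightarrow> openin T (W a) \<and> a \<in> W a \<and> cmod (\<zeta> a) = 1 \<and> \<epsilon> a > 0
     \<and> (\<forall>n::nat. g [^] n \<in> W a \<longrightarrow> \<epsilon> a \<le> cmod (\<zeta> a ^ n - 1))"
    by metis
  have "compactin T (topspace T - V)"
    using V compact by (intro closedin_compact_space) auto
  moreover have "openin T U" if "U \<in> W ` (topspace T - V)" for U
    using that W by blast
  moreover have "topspace T - V \<subseteq> \<Union>(W ` (topspace T - V))"
    using W by blast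
  ultimately obtain \<F> where \<F>: "finite \<F>" "\<F> \<subseteq> W ` (topspace T - V)" "topspace T - V \<subseteq> \<Union>\<F>"
    unfolding compactin_def by meson
  from finite_subset_image[OF \<F>(1,2)] obtain A where A: "A \<subseteq> topspace T - V" "finite A" "\<F> = W ` A"
    by (elim exE conjE)
  define \<epsilon>0 where "\<epsilon>0 = Min (insert 1 (\<epsilon> ` A))"
  have \<epsilon>0: "\<epsilon>0 \<le> \<epsilon> a" if "a \<in> A" for a unfolding \<epsilon>0_def using A that by (intro Min_le) auto
  show thesis
  proof
    show "finite (\<zeta> ` A)" using A by simp
    show "cmod z = 1" if "z \<in> \<zeta> ` A" for z using that W A by auto
    have "\<forall>e\<in>insert 1 (\<epsilon> ` A). e > 0" using W A by auto
    then show "\<epsilon>0 > 0" unfolding \<epsilon>0_def using A by (subst Min_gr_iff) auto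
    fix n :: nat assume n: "\<And>z. z \<in> \<zeta> ` A \<Longrightarrow> cmod (z ^ n - 1) < \<epsilon>0"
    show "g [^] n \<in> V"
    proof (rule ccontr)
      assume "g [^] n \<notin> V"
      then have "g [^] n \<in> topspace T - V" using g by (simp add: topspace_eq_carrier)
      then obtain a where a: "a \<in> A" "g [^] n \<in> W a" using \<F> A by blast
      then have "\<epsilon> a \<le> cmod (\<zeta> a ^ n - 1)" using W A by blast
      then show False using n[of "\<zeta> a"] \<epsilon>0[OF a(1)] a by force
    qed
  qed
qed

end

lemma abs_diff_Sup_le:
  fixes p q :: "'a \<Rightarrow> real"
  assumes "I \<noteq> {}" and le: "\<And>i. i \<in> I \<Longrightarrow> \<bar>p i - q i\<bar> \<le> e"
    and B: "\<And>i. i \<in> I \<Longrightarrow> p i \<le> B" "\<And>i. i \<in> I \<Longrightarrow> q i \<le> B"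
  shows "\<bar>Sup (p ` I) - Sup (q ` I)\<bar> \<le> e"
proof -
  have up: "p i \<le> Sup (p ` I)" "q i \<le> Sup (q ` I)" if "i \<in> I" for i
    using that B by (auto intro!: cSup_upper bdd_aboveI[of _ B])
  have "Sup (p ` I) \<le> Sup (q ` I) + e"
  proof (rule cSup_least)
    fix c assume "c \<in> p ` I"
    then obtain i where "i \<in> I" "c = p i" by blast
    then show "c \<le> Sup (q ` I) + e" using le[of i] up(2)[of i] by linarith
  qed (use assms in simp)
  moreover have "Sup (q ` I) \<le> Sup (p ` I) + e"
  proof (rule cSup_least)
    fix c assume "c \<in> q ` I"
    then obtain i where "i \<in> I" "c = q i" by blast
    then show "c \<le> Sup (p ` I) + e" using le[of i] up(1)[of i] by linarith
  qed (use assms in simp)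
  ultimately show ?thesis by linarith
qed

section \<open>Dependence of the second difference on the group element\<close>

context compact_group
begin

text \<open>For \<open>f\<close> in the unit ball of an eigenspace, the functions
  \<open>f (x \<otimes> g)\<close> of \<open>g\<close> are equicontinuous uniformly in
  \<open>x\<close>. The norms of second differences thus vary uniformly over the ball, and so does
  their supremum.\<close>

lemma second_diff_norm_continuous:
  assumes k: "cont k" and \<nu>: "\<nu> > 0"
  shows "cont (\<lambda>g. Sup ((\<lambda>f. ip (second_diff g f) (second_diff g f)) ` {f \<in> eigenspace k \<nu>. ip f f \<le> 1}))"
    (is "cont ?N")
proof -
  let ?E = "{f \<in> eigenspace k \<nu>. ip f f \<le> 1}"
  have Ec: "cont f" if "f \<in> ?E" for f using that by (simp add: eigenspace_def)
  obtain B where B: "B \<ge> 0" "\<And>f x. f \<in> eigenspace k \<nu> \<Longrightarrow> x \<in> carrier G \<Longrightarrow> \<bar>f x\<bar> \<le> B * sqrt (ip f f)"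
    using eigenspace_bound[OF k \<nu>] by blast
  have EB: "\<bar>f x\<bar> \<le> B" if "f \<in> ?E" "x \<in> carrier G" for f x
  proof -
    have "B * sqrt (ip f f) \<le> B * 1" using that B by (intro mult_left_mono) auto
    then show ?thesis using B(2)[of f x] that by simp
  qed
  have sdB: "\<bar>second_diff g f x\<bar> \<le> 4 * B" if "f \<in> ?E" "x \<in> carrier G" "g \<in> carrier G" for g f x
    using EB[OF that(1,2)] EB[OF that(1), of "x \<otimes> g"] EB[OF that(1), of "x \<otimes> inv g"] that(2,3)
    unfolding second_diff_def by simp
  have NB: "ip (second_diff g f) (second_diff g f) \<le> (4 * B)\<^sup>2" if "f \<in> ?E" "g \<in> carrier G" for g f
    using that sdB B Ec by (intro ip_self_le cont_second_diff) auto
  have ne: "?E \<noteq> {}"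
  proof -
    have "(\<lambda>_. 0) \<in> ?E" by (simp add: eigenspace_def conv_def ip_def mean_const)
    then show ?thesis by blast
  qed
  have mulc: "continuous_map (prod_topology T T) T (\<lambda>p. snd p \<otimes> fst p)"
    by (intro mult_continuous continuous_map_fst continuous_map_snd)
  define H where "H = {\<lambda>g. f (x \<otimes> g) |f x. f \<in> ?E \<and> x \<in> carrier G}"
  have H: "equicts T H"
    using equicts_slices[OF equicts_compose[OF eigenspace_equicts[OF k \<nu>] mulc] compact]
  proof (rule equicts_mono, intro subsetI)
    fix h assume "h \<in> H"
    then obtain f x where "h = (\<lambda>g. f (x \<otimes> g))" "f \<in> ?E" "x \<in> carrier G" unfolding H_def by blast
    then show "h \<in> {\<lambda>x. f (x, k) |f k. f \<in> {\<lambda>x. f (snd x \<otimes> fst x) |f. f \<in> ?E} \<and> k \<in> topspace T}"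
      by (intro CollectI exI[of _ "\<lambda>p. f (snd p \<otimes> fst p)"] exI[of _ x]) (auto simp: topspace_eq_carrier)
  qed
  have "equicts T {?N}"
    unfolding equicts_def
  proof (intro ballI allI impI)
    fix g and \<epsilon> :: real assume g: "g \<in> topspace T" and \<epsilon>: "\<epsilon> > 0"
    have gG: "g \<in> carrier G" using g by (simp add: topspace_eq_carrier)
    \<comment> \<open>Chosen so that \<open>(2 * \<delta>) * (8 * B) \<le> \<epsilon> / 2\<close>,
      the bound obtained by factoring a difference of two squares.\<close>
    define \<delta> where "\<delta> = \<epsilon> / (32 * (B + 1))"
    have \<delta>: "\<delta> > 0" using \<epsilon> B by (simp add: \<delta>_def)
    obtain U where U: "openin T U" "g \<in> U" "\<forall>y\<in>U. \<forall>f\<in>H. dist (f y) (f g) < \<delta>"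
      using equictsD[OF H g \<delta>] by (elim exE conjE)
    have "inv g \<in> topspace T" using gG by (simp add: topspace_eq_carrier)
    from equictsD[OF H this \<delta>]
    obtain V where V: "openin T V" "inv g \<in> V" "\<forall>y\<in>V. \<forall>f\<in>H. dist (f y) (f (inv g)) < \<delta>"
      by (elim exE conjE)
    let ?W = "U \<inter> {y \<in> topspace T. inv y \<in> V}"
    have "openin T ?W"
      using U(1) V(1) by (intro openin_Int openin_continuous_map_preimage[OF continuous_inv])
    moreover have "g \<in> ?W" using U V g by simp
    moreover have "dist (?N y) (?N g) < \<epsilon>" if y: "y \<in> ?W" for y
    proof -
      have yG: "y \<in> carrier G" using y by (simp add: topspace_eq_carrier)
      have "\<bar>ip (second_diff y f) (second_diff y f) - ip (second_diff g f) (second_diff g f)\<bar> \<le> \<epsilon> / 2" if f: "f \<in> ?E" for f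
      proof -
        let ?p = "second_diff y f" and ?q = "second_diff g f"
        have c: "cont ?p" "cont ?q" using f Ec yG gG by (auto intro: cont_second_diff)
        have "\<bar>?p x * ?p x - ?q x * ?q x\<bar> \<le> \<epsilon> / 2" if x: "x \<in> carrier G" for x
        proof -
          have "(\<lambda>g. f (x \<otimes> g)) \<in> H" using f x by (auto simp: H_def)
          then have "\<bar>f (x \<otimes> y) - f (x \<otimes> g)\<bar> < \<delta>" "\<bar>f (x \<otimes> inv y) - f (x \<otimes> inv g)\<bar> < \<delta>"
            using U(3) V(3) y by (force simp: dist_real_def)+
          then have "\<bar>?p x - ?q x\<bar> \<le> 2 * \<delta>"
            unfolding second_diff_def by linarith
          moreover have "\<bar>?p x + ?q x\<bar> \<le> 8 * B"
            using sdB[OF f x yG] sdB[OF f x gG] by linarith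
          ultimately have "\<bar>?p x - ?q x\<bar> * \<bar>?p x + ?q x\<bar> \<le> (2 * \<delta>) * (8 * B)"
            using \<delta> by (intro mult_mono) auto
          also have "\<dots> \<le> \<epsilon> / 2"
            using B \<epsilon> by (simp add: \<delta>_def field_simps)
          finally show ?thesis
            by (simp add: abs_mult[symmetric] algebra_simps)
        qed
        then have "\<bar>mean (\<lambda>x. ?p x * ?p x - ?q x * ?q x) - 0\<bar> \<le> \<epsilon> / 2"
          using c by (intro mean_near continuous_intros) auto
        then show ?thesis
          using c by (simp add: ip_def mean_diff continuous_intros)
      qed
      then have "\<bar>?N y - ?N g\<bar> \<le> \<epsilon> / 2"
        using ne NB yG gG by (intro abs_diff_Sup_le) auto
      then show ?thesis using \<epsilon> by (simp add: dist_real_def)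
    qed
    ultimately show "\<exists>U. openin T U \<and> g \<in> U \<and> (\<forall>y\<in>U. \<forall>f\<in>{?N}. dist (f y) (f g) < \<epsilon>)"
      by (intro exI[of _ ?W]) auto
  qed
  then show ?thesis by (rule equicts_imp_continuous) simp
qed

text \<open>
  The largest eigenvalue of the second difference along \<open>g\<close> depends continuously on \<open>g\<close>; if the
  angles of all elements lie in a countable set, it is constant on connected sets.
\<close>

theorem countable_angles_imp_connected_trivial:
  assumes \<Theta>: "countable \<Theta>"
    and angles: "\<And>g \<theta> F x. \<lbrakk>g \<in> carrier G; harmonic g \<theta> F; x \<in> carrier G; F x \<noteq> 0\<rbrakk> \<Longrightarrow> \<theta> \<in> \<Theta>"
    and C: "connectedin T C" "x \<in> C" "y \<in> C"
  shows "x = y"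
proof -
  have xy: "x \<in> carrier G" "y \<in> carrier G"
    using C connectedin_subset_topspace topspace_eq_carrier by blast+
  define a where "a = inv x \<otimes> y"
  have a: "a \<in> carrier G" using xy by (simp add: a_def)
  define A where "A = {F. \<exists>k \<nu>. sym_kernel k \<and> \<nu> > 0 \<and> F \<in> eigenspace k \<nu>}"
  have "a = \<one>"
  proof (rule orthogonal_translate_trivial[where A = A, OF a])
    show "cont F" if "F \<in> A" for F using that by (auto simp: A_def eigenspace_def)
  next
    fix F z assume "F \<in> A" and z: "z \<in> carrier G"
    then obtain k \<nu> where k: "sym_kernel k" and \<nu>: "\<nu> > 0" and F: "F \<in> eigenspace k \<nu>" by (auto simp: A_def)
    have kc: "cont k" using k by (simp add: sym_kernel_def)
    have Fc: "cont F" using F by (simp add: eigenspace_def)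
    let ?E = "eigenspace k \<nu>"
    define N where "N g = Sup ((\<lambda>f. ip (second_diff g f) (second_diff g f)) ` {f \<in> ?E. ip f f \<le> 1})" for g
    have Neq: "N g = Sup {ip (second_diff g f) (second_diff g f) |f. f \<in> ?E \<and> ip f f \<le> 1}" for g
      unfolding N_def by (rule arg_cong[of _ _ Sup]) auto
    have zero: "N g = 0" if "\<And>f x. f \<in> ?E \<Longrightarrow> x \<in> carrier G \<Longrightarrow> second_diff g f x = 0" for g
    proof -
      have "ip (second_diff g f) (second_diff g f) = 0" if "f \<in> ?E" for f
      proof -
        have "ip (second_diff g f) (second_diff g f) = ip (\<lambda>_. 0) (\<lambda>_. 0)"
          using \<open>f \<in> ?E\<close> \<open>\<And>f x. f \<in> ?E \<Longrightarrow> x \<in> carrier G \<Longrightarrow> second_diff g f x = 0\<close> by (intro ip_cong) auto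
        then show ?thesis by (simp add: ip_def mean_const)
      qed
      moreover have "(\<lambda>_. 0) \<in> {f \<in> ?E. ip f f \<le> 1}" by (simp add: eigenspace_def conv_def ip_def mean_const)
      ultimately have "(\<lambda>f. ip (second_diff g f) (second_diff g f)) ` {f \<in> ?E. ip f f \<le> 1} = {0}"
        by force
      then show ?thesis by (simp add: N_def)
    qed
    have pos: "N g > 0 \<and> (\<exists>F\<in>?E. (\<exists>x\<in>carrier G. F x \<noteq> 0) \<and> (\<forall>x\<in>carrier G. second_diff g F x = sqrt (N g) * F x))"
      if g: "g \<in> carrier G" and f: "f \<in> ?E" "x \<in> carrier G" "second_diff g f x \<noteq> 0" for g f x
      unfolding Neq
      by (rule second_diff_eigenfunction[OF closed_subspace_eigenspace[OF kc] _ kc \<nu> g _ _ f])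
         (use eigenspace_translate[OF kc] g in auto)
    \<comment> \<open>If positive, \<open>N g\<close> is \<open>(2 - \<theta>)\<^sup>2\<close> for
      the angle \<open>\<theta>\<close> of some harmonic function, so \<open>N\<close> takes only
      countably many values.\<close>
    have range: "N g \<in> insert 0 ((\<lambda>\<theta>. (2 - \<theta>)\<^sup>2) ` \<Theta>)" if g: "g \<in> carrier G" for g
    proof (cases "\<exists>f\<in>?E. \<exists>x\<in>carrier G. second_diff g f x \<noteq> 0")
      case True
      then obtain f x where "f \<in> ?E" "x \<in> carrier G" "second_diff g f x \<noteq> 0" by blast
      from pos[OF g this] obtain F x where F: "N g > 0" "F \<in> ?E" "x \<in> carrier G" "F x \<noteq> 0"
        "\<forall>x\<in>carrier G. second_diff g F x = sqrt (N g) * F x" by blast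
      then have "harmonic g (2 - sqrt (N g)) F" by (simp add: harmonic_iff eigenspace_def)
      then have "2 - sqrt (N g) \<in> \<Theta>" using angles g F by blast
      moreover have "N g = (2 - (2 - sqrt (N g)))\<^sup>2" using F(1) by simp
      ultimately show ?thesis by blast
    next
      case False
      then show ?thesis using zero[of g] by blast
    qed
    let ?C = "(\<lambda>z. inv x \<otimes> z) ` C"
    have C': "connectedin T ?C"
      using translate_left_continuous[of "inv x"] C xy by (intro connectedin_continuous_map_image) auto
    have "connectedin euclideanreal (N ` ?C)"
      using second_diff_norm_continuous[OF kc \<nu>] C' unfolding N_def[abs_def]
      by (rule connectedin_continuous_map_image)
    then have "connected (N ` ?C)" by simp
    moreover have "countable (N ` ?C)"
    proof (rule countable_subset)
      show "N ` ?C \<subseteq> insert 0 ((\<lambda>\<theta>. (2 - \<theta>)\<^sup>2) ` \<Theta>)"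
        using range connectedin_subset_topspace[OF C'] unfolding topspace_eq_carrier by blast
    qed (use \<Theta> in simp)
    moreover have "N \<one> \<in> N ` ?C" "N a \<in> N ` ?C"
      using C xy by (auto simp: a_def intro!: imageI image_eqI[of \<one> _ x])
    \<comment> \<open>A connected set of reals with two points is uncountable. So \<open>N\<close>
      vanishes at \<open>a\<close> as it does at \<open>\<one>\<close>, and \<open>a\<close> moves
      no function of the eigenspace.\<close>
    ultimately have "N a = N \<one>" using connected_uncountable by blast
    also have "N \<one> = 0" by (rule zero) (simp add: second_diff_def)
    finally have "second_diff a F w = 0" if "w \<in> carrier G" for w
      using pos[OF a F that] by fastforce
    then have sd0: "ip (second_diff a F) F = 0"
      using ip_cong[of "second_diff a F" "\<lambda>_. 0" F F] by (simp add: ip_def mean_const)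
    have Fa: "cont (\<lambda>x. F (x \<otimes> a))" using Fc a by (rule cont_translate_right)
    let ?d = "\<lambda>x. F (x \<otimes> a) + (-1) * F x"
    have d: "cont ?d" using Fc Fa by (intro continuous_intros)
    have "ip ?d ?d = ip F F + 2 * (-1) * ip (\<lambda>x. F (x \<otimes> a)) F + (-1)\<^sup>2 * ip F F"
      unfolding ip_add_self[OF Fa Fc] ip_translate[OF Fc Fc a] ..
    also have "\<dots> = ip (second_diff a F) F"
      using ip_second_diff_left[OF Fc Fc a] ip_shift[OF Fc Fc a] by (simp add: ip_commute)
    finally have "?d z = 0" using ip_eq_0D[OF d _ z] sd0 by simp
    then show "F (z \<otimes> a) = F z" by simp
  next
    fix h z assume h: "cont h" "\<And>F. F \<in> A \<Longrightarrow> ip h F = 0" and z: "z \<in> carrier G"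
    show "h z = 0"
    proof (rule ccontr)
      assume "h z \<noteq> 0"
      then obtain k where k: "sym_kernel k" "conv k h z \<noteq> 0" using conv_nontrivial[OF h(1) z] by blast
      have kc: "cont k" using k by (simp add: sym_kernel_def)
      \<comment> \<open>The complement \<open>S\<close> of the eigenfunctions of this one kernel is
        invariant under its convolution; a nonzero convolution on \<open>S\<close> would produce an
        eigenfunction orthogonal to itself.\<close>
      define B where "B = {F. \<exists>\<nu>>0. F \<in> eigenspace k \<nu>}"
      define S where "S = {h. cont h \<and> (\<forall>F\<in>B. ip h F = 0)}"
      have Bc: "cont F" if "F \<in> B" for F using that by (auto simp: B_def eigenspace_def)
      have S: "closed_subspace S" unfolding S_def by (rule closed_subspace_orthogonal) (rule Bc)
      have convB: "conv k F \<in> B" if FB: "F \<in> B" for F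
      proof -
        obtain \<nu> where \<nu>: "\<nu> > 0" "cont F" "\<And>x. x \<in> carrier G \<Longrightarrow> conv k (conv k F) x = \<nu> * F x"
          using FB by (auto simp: B_def eigenspace_def)
        have "conv k (conv k (conv k F)) = conv k (\<lambda>x. F x + (\<nu> - 1) * F x)"
          by (rule conv_cong) (simp add: \<nu>(3) algebra_simps)
        moreover have "conv k (\<lambda>x. F x + (\<nu> - 1) * F x) x = \<nu> * conv k F x" if "x \<in> carrier G" for x
          unfolding conv_linear[OF kc \<nu>(2,2) that] by (simp add: algebra_simps)
        ultimately have "conv k F \<in> eigenspace k \<nu>"
          using conv_cont[OF kc \<nu>(2)] by (simp add: eigenspace_def)
        then show ?thesis using \<nu> by (auto simp: B_def)
      qed
      have convS: "conv k f \<in> S" if "f \<in> S" for f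
        using that convB conv_sym[OF k(1)] Bc conv_cont[OF kc] by (simp add: S_def)
      have hS: "h \<in> S" using h k by (auto simp: S_def A_def B_def)
      obtain \<nu> F w where F: "\<nu> > 0" "F \<in> S" "F \<in> eigenspace k \<nu>" "w \<in> carrier G" "F w \<noteq> 0"
        using conv_eigenfunction[OF k(1) S convS hS z k(2)] by blast
      then have "F \<in> B" by (auto simp: B_def)
      then have "ip F F = 0" using F by (simp add: S_def)
      then show False using ip_eq_0D[OF Bc[OF \<open>F \<in> B\<close>]] F by blast
    qed
  qed
  then show ?thesis
    using xy unfolding a_def by (metis inv_closed inv_equality inv_inv)
qed

end

section \<open>Almost torsion elements\<close>

lemma norm_cis_diff_1_le: "norm (cis t - 1) \<le> \<bar>t\<bar>"
proof -
  have "cis t = exp (\<i> * of_real t)" by (simp add: cis_conv_exp)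
  then have "norm (cis t - 1) = 2 * \<bar>sin (t / 2)\<bar>"
    using dist_exp_i_1[of t] by simp
  also have "\<dots> \<le> 2 * \<bar>t / 2\<bar>"
    by (intro mult_left_mono abs_sin_x_le_abs_x) auto
  finally show ?thesis by simp
qed

lemma norm_cis_2pi_diff_1_le: "norm (cis (2 * pi * t) - 1) \<le> 2 * pi * \<bar>t - of_int z\<bar>"
proof -
  have "cis (2 * pi * t) = cis (2 * pi * (t - of_int z) + 2 * pi * of_int z)"
    by (simp add: algebra_simps)
  also have "\<dots> = cis (2 * pi * (t - of_int z)) * cis (2 * pi * of_int z)"
    by (rule cis_mult[symmetric])
  also have "cis (2 * pi * of_int z) = 1"
    by (rule cis_multiple_2pi) simp
  finally show ?thesis
    using norm_cis_diff_1_le[of "2 * pi * (t - of_int z)"] by (simp add: abs_mult)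
qed

lemma Dirichlet_nat:
  fixes \<theta> :: "nat \<Rightarrow> real" and N n :: nat
  assumes "N > 0"
  obtains q p where "0 < q" "q \<le> N ^ n" "\<And>i. i < n \<Longrightarrow> \<bar>real q * \<theta> i - of_int (p i)\<bar> < 1 / N"
proof -
  obtain q p where "0 < q" "q \<le> int (N ^ n)" "\<And>i. i < n \<Longrightarrow> \<bar>of_int q * \<theta> i - of_int (p i)\<bar> < 1 / N"
    using Dirichlet_approx_simult[OF assms, of n \<theta>] by metis
  then show thesis
    by (intro that[of "nat q" p]) (auto simp: nat_le_iff)
qed

text \<open>
  Multiples of the small return vector \<open>v\<close> run along a line; the line passes near an integer
  point whose first coordinate \<open>k\<close> is bounded independently of \<open>v\<close>, so one can divide by
  a prime exceeding that bound and fixed before \<open>v\<close>.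
\<close>

lemma almost_torsion_multiple:
  fixes \<alpha> :: "nat \<Rightarrow> real" and r :: nat
  assumes irr: "\<alpha> 0 \<notin> \<rat>" and r: "r > 0" and \<epsilon>: "\<epsilon> > 0"
  obtains M l q :: nat where "prime l" "0 < q" "q < l"
    "\<And>i. i < r \<Longrightarrow> \<exists>z::int. \<bar>real l * real M * \<alpha> i - of_int z\<bar> < \<epsilon>"
    "\<exists>z::int. \<bar>real M * \<alpha> 0 - real q / real l - of_int z\<bar> < \<epsilon> / real l"
proof -
  obtain Nd :: nat where Nd: "Nd > 0" "1 / real Nd < \<epsilon> / 2"
    using reals_Archimedean[of "\<epsilon> / 2"] \<epsilon> by (metis half_gt_zero inverse_eq_divide zero_less_Suc)
  \<comment> \<open>\<open>Nd ^ r\<close> bounds the number \<open>k\<close> that Dirichlet's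
    theorem produces for precision \<open>1 / Nd\<close>; the prime \<open>l\<close> is thus larger
    than \<open>k\<close> whatever \<open>v\<close> turns out to be.\<close>
  obtain l :: nat where l: "prime l" "l > Nd ^ r" using bigger_prime by blast
  have l0: "real l > 0" using l by simp
  \<comment> \<open>Rounding the time below costs at most one vector \<open>v\<close>, which is then
    multiplied by \<open>l\<close>; hence the precision \<open>\<epsilon> / (2 * l)\<close>.\<close>
  have "\<epsilon> / (2 * l) > 0" using \<epsilon> l0 by simp
  then obtain N' :: nat where N': "N' > 0" "1 / real N' < \<epsilon> / (2 * l)"
    using reals_Archimedean[of "\<epsilon> / (2 * l)"] by (metis inverse_eq_divide zero_less_Suc)
  obtain M0 p where M0: "0 < M0" "\<And>i. i < r \<Longrightarrow> \<bar>real M0 * \<alpha> i - of_int (p i)\<bar> < 1 / N'"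
    using Dirichlet_nat[OF N'(1), of r \<alpha>] by metis
  define v where "v i = real M0 * \<alpha> i - of_int (p i)" for i
  have v: "\<bar>v i\<bar> < \<epsilon> / (2 * l)" if "i < r" for i
    using M0(2)[OF that] N'(2) by (simp add: v_def)
  have v0: "v 0 \<noteq> 0"
  proof
    assume "v 0 = 0"
    then have "\<alpha> 0 = of_int (p 0) / of_nat M0" using M0(1) by (simp add: v_def field_simps)
    then show False using irr by simp
  qed
  obtain k w where k: "0 < k" "k \<le> Nd ^ r" "\<And>i. i < r \<Longrightarrow> \<bar>real k * (v i / \<bar>v 0\<bar>) - of_int (w i)\<bar> < 1 / Nd"
    using Dirichlet_nat[OF Nd(1), of r "\<lambda>i. v i / \<bar>v 0\<bar>"] by metis
  have kl: "k < l" using k l by simp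
  \<comment> \<open>At the real time \<open>t\<close>,
    \<open>l * t * v i = k * (v i / \<bar>v 0\<bar>)\<close> is nearly an integer, and
    \<open>t * v 0\<close> is \<open>k / l\<close> up to sign. The integer part of \<open>t\<close>
    gives the multiple \<open>M0 * t'\<close>.\<close>
  define t where "t = real k / (\<bar>v 0\<bar> * l)"
  define t' where "t' = nat \<lfloor>t\<rfloor>"
  have t0: "t \<ge> 0" by (simp add: t_def)
  then have tt: "\<bar>real t' - t\<bar> \<le> 1" unfolding t'_def by linarith
  have tv: "t * v i = real k * (v i / \<bar>v 0\<bar>) / l" for i by (simp add: t_def)
  have Ma: "real (M0 * t') * \<alpha> i = t * v i + (real t' - t) * v i + real t' * of_int (p i)" for i
    by (simp add: v_def algebra_simps)
  have err: "\<bar>(real t' - t) * v i\<bar> < \<epsilon> / (2 * l)" if "i < r" for i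
  proof -
    have "\<bar>(real t' - t) * v i\<bar> \<le> 1 * \<bar>v i\<bar>" unfolding abs_mult using tt by (intro mult_right_mono) auto
    then show ?thesis using v[OF that] by simp
  qed
  have near: "\<exists>z::int. \<bar>real l * real (M0 * t') * \<alpha> i - of_int z\<bar> < \<epsilon>" if i: "i < r" for i
  proof -
    have "real l * real (M0 * t') * \<alpha> i = l * (t * v i + (real t' - t) * v i + real t' * of_int (p i))"
      unfolding Ma[symmetric] by simp
    also have "\<dots> = real k * (v i / \<bar>v 0\<bar>) + l * ((real t' - t) * v i) + of_int (int l * int t' * p i)"
      using l0 by (simp add: tv algebra_simps)
    finally have eq: "real l * real (M0 * t') * \<alpha> i - of_int (w i + int l * int t' * p i)
       = (real k * (v i / \<bar>v 0\<bar>) - of_int (w i)) + l * ((real t' - t) * v i)"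
      by simp
    have "\<bar>l * ((real t' - t) * v i)\<bar> = l * \<bar>(real t' - t) * v i\<bar>"
      using l0 by (simp only: abs_mult[of "real l"] abs_of_pos)
    also have "\<dots> < l * (\<epsilon> / (2 * l))"
      by (rule mult_strict_left_mono[OF err[OF i] l0])
    also have "\<dots> = \<epsilon> / 2"
      using l0 by simp
    finally have "\<bar>l * ((real t' - t) * v i)\<bar> < \<epsilon> / 2" .
    moreover have "\<bar>real k * (v i / \<bar>v 0\<bar>) - of_int (w i)\<bar> < \<epsilon> / 2" using k(3)[OF i] Nd(2) by linarith
    ultimately have "\<bar>real l * real (M0 * t') * \<alpha> i - of_int (w i + int l * int t' * p i)\<bar> < \<epsilon>"
      unfolding eq using abs_triangle_ineq[of "real k * (v i / \<bar>v 0\<bar>) - of_int (w i)" "l * ((real t' - t) * v i)"]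
      by (smt (verit) field_sum_of_halves)
    then show ?thesis by blast
  qed
  have e0: "\<bar>(real t' - t) * v 0\<bar> < \<epsilon> / l"
    using err[OF r] \<epsilon> l0 by (simp add: field_simps)
  show thesis
  proof (cases "v 0 > 0")
    case True
    have "real (M0 * t') * \<alpha> 0 - real k / l - of_int (int t' * p 0) = (real t' - t) * v 0"
      unfolding Ma tv using True by simp
    then have "\<exists>z::int. \<bar>real (M0 * t') * \<alpha> 0 - real k / l - of_int z\<bar> < \<epsilon> / l" using e0 by metis
    then show ?thesis using that[of l k "M0 * t'"] l k kl near by blast
  next
    case False
    \<comment> \<open>For negative \<open>v 0\<close> the residue is \<open>- k / l\<close>; adding
      1 represents it by \<open>l - k\<close>.\<close>
    then have "v 0 / \<bar>v 0\<bar> = -1" using v0 by (simp add: divide_eq_eq)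
    then have "real (M0 * t') * \<alpha> 0 - real (l - k) / l - of_int (int t' * p 0 - 1) = (real t' - t) * v 0"
      unfolding Ma tv using kl l0 by (simp add: of_nat_diff field_simps)
    then have "\<exists>z::int. \<bar>real (M0 * t') * \<alpha> 0 - real (l - k) / l - of_int z\<bar> < \<epsilon> / l" using e0 by metis
    then show ?thesis using that[of l "l - k" "M0 * t'"] l k kl near by auto
  qed
qed

lemma norm_power_diff_le:
  fixes z w :: complex
  assumes "cmod z = 1" "cmod w = 1"
  shows "cmod (z ^ n - w ^ n) \<le> real n * cmod (z - w)"
proof (induction n)
  case (Suc n)
  have "z ^ Suc n - w ^ Suc n = z * (z ^ n - w ^ n) + (z - w) * w ^ n"
    by (simp add: algebra_simps)
  then have "cmod (z ^ Suc n - w ^ Suc n) \<le> cmod (z ^ n - w ^ n) + cmod (z - w)"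
    using norm_triangle_ineq[of "z * (z ^ n - w ^ n)" "(z - w) * w ^ n"] assms
    by (simp add: norm_mult norm_power)
  then show ?case using Suc by (simp add: algebra_simps)
qed simp

lemma cmod_1_cis: "cmod z = 1 \<Longrightarrow> \<exists>t. z = cis (2 * pi * t)"
proof -
  assume z: "cmod z = 1"
  then have "z \<noteq> 0" by auto
  with z have "z = cis (2 * pi * (Arg z / (2 * pi)))"
    using cis_Arg[of z] by (auto simp: sgn_div_norm)
  then show ?thesis by blast
qed

section \<open>Functions that detect almost torsion elements\<close>

context compact_group
begin

text \<open>\<open>F\<close> precedes \<open>V\<close> and \<open>\<epsilon>\<close>, while
  \<open>N\<close> may depend on them. The estimate covers the whole period \<open>j \<le> N\<close>
  because all rotations enter the average; an estimate for \<open>j = 1\<close> alone would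
  accumulate.\<close>

definition almost_torsion_eigenfunction :: "('a \<Rightarrow> complex) \<Rightarrow> bool" where
  "almost_torsion_eigenfunction F \<longleftrightarrow> continuous_map T euclidean F \<and> (\<exists>x\<in>carrier G. F x \<noteq> 0) \<and>
    (\<forall>V \<epsilon>. openin T V \<longrightarrow> \<one> \<in> V \<longrightarrow> \<epsilon> > 0 \<longrightarrow> (\<exists>h\<in>carrier G. \<exists>N q :: nat. N > 1 \<and> coprime q N \<and> h [^] N \<in> V \<and>
      (\<forall>x\<in>carrier G. \<forall>j\<le>N. cmod (F (x \<otimes> h [^] j) - cis (2 * pi * (real q / real N)) ^ j * F x) \<le> \<epsilon>)))"

lemma harmonic_eigenfunction_nonzero:
  assumes "harmonic g \<theta> F" "g \<in> carrier G" "x0 \<in> carrier G" "F x0 \<noteq> 0"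
  obtains \<zeta> \<kappa> \<Psi> where "cmod \<zeta> = 1" "\<theta> = 2 * Re \<zeta>" "continuous_map T euclidean \<Psi>" "\<Psi> x0 \<noteq> 0"
    "\<And>x. x \<in> carrier G \<Longrightarrow> \<Psi> (x \<otimes> g) = \<zeta> * \<Psi> x" "\<And>x. x \<in> carrier G \<Longrightarrow> F x = Re (\<kappa> * \<Psi> x)"
proof -
  obtain \<zeta> \<kappa> \<Psi> where \<Psi>: "cmod \<zeta> = 1" "\<theta> = 2 * Re \<zeta>" "continuous_map T euclidean \<Psi>"
    "\<And>x. x \<in> carrier G \<Longrightarrow> \<Psi> (x \<otimes> g) = \<zeta> * \<Psi> x" "\<And>x. x \<in> carrier G \<Longrightarrow> F x = Re (\<kappa> * \<Psi> x)"
    using harmonic_eigenfunction[OF assms] by metis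
  moreover have "\<Psi> x0 \<noteq> 0" using \<Psi>(5)[OF assms(3)] assms(4) by auto
  ultimately show thesis using that by metis
qed

text \<open>A power \<open>g\<close> of \<open>h\<close> has prime order \<open>p\<close>. A
  harmonic function moved by \<open>g\<close> yields an eigenvalue different from 1, which is a
  primitive \<open>p\<close>-th root of unity, and all errors are 0.\<close>

lemma torsion_imp_almost_torsion:
  assumes h: "h \<in> carrier G" "h \<noteq> \<one>" "h [^] (n::nat) = \<one>" "n > 0"
  obtains F where "almost_torsion_eigenfunction F"
proof -
  define n0 where "n0 = (LEAST n. n > 0 \<and> h [^] (n::nat) = \<one>)"
  have n0: "n0 > 0 \<and> h [^] n0 = \<one>" unfolding n0_def by (rule LeastI[of _ n]) (use h in auto)
  have least: "\<not> (m > 0 \<and> h [^] m = \<one>)" if "m < n0" for m :: nat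
    using not_less_Least[of m "\<lambda>n. n > 0 \<and> h [^] (n::nat) = \<one>"] that unfolding n0_def by blast
  have "n0 \<noteq> 1" using n0 h by auto
  then obtain p where p: "prime p" "p dvd n0" using prime_factor_nat by blast
  then obtain m where m: "n0 = p * m" by blast
  have m0: "m > 0" "m < n0" using n0 m prime_gt_1_nat[OF p(1)] by auto
  define g where "g = h [^] m"
  have g: "g \<in> carrier G" using h by (simp add: g_def)
  have g1: "g \<noteq> \<one>" using least[OF m0(2)] m0 by (simp add: g_def)
  have gp: "g [^] p = \<one>" using n0 h by (simp add: g_def nat_pow_pow m mult.commute)
  obtain \<theta> F x where F: "harmonic g \<theta> F" "x \<in> carrier G" "F (x \<otimes> g) \<noteq> F x"
    using harmonic_separates[OF g g g1] by blast
  have "\<exists>x0\<in>carrier G. F x0 \<noteq> 0" using F g by (metis m_closed)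
  then obtain x0 where x0: "x0 \<in> carrier G" "F x0 \<noteq> 0" by blast
  obtain \<zeta> \<kappa> \<Psi> where \<Psi>: "cmod \<zeta> = 1" "continuous_map T euclidean \<Psi>" "\<Psi> x0 \<noteq> 0"
    "\<And>x. x \<in> carrier G \<Longrightarrow> \<Psi> (x \<otimes> g) = \<zeta> * \<Psi> x" "\<And>x. x \<in> carrier G \<Longrightarrow> F x = Re (\<kappa> * \<Psi> x)"
    using harmonic_eigenfunction_nonzero[OF F(1) g x0] by metis
  have pow: "\<Psi> (x \<otimes> g [^] (n::nat)) = \<zeta> ^ n * \<Psi> x" if "x \<in> carrier G" for x n
    by (rule eigenfunction_power[where \<Psi> = \<Psi> and \<zeta> = \<zeta>, OF g \<Psi>(4) that])
  have "\<zeta> ^ p = 1" using pow[OF x0(1), of p] gp x0 \<Psi>(3) by simp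
  moreover have "\<zeta> \<noteq> 1"
  proof
    assume "\<zeta> = 1"
    then have "\<Psi> (x \<otimes> g) = \<Psi> x" using \<Psi>(4)[OF F(2)] by simp
    then show False using F \<Psi>(5)[of "x \<otimes> g"] \<Psi>(5)[of x] g by simp
  qed
  moreover have "bij_betw (\<lambda>k. cis (2 * pi * real k / real p)) {..<p} {z. z ^ p = 1}"
    using Complex.bij_betw_roots_unity[OF prime_gt_0_nat[OF p(1)]] by simp
  ultimately have "\<zeta> \<in> (\<lambda>k. cis (2 * pi * real k / real p)) ` {..<p}" "\<zeta> \<noteq> 1"
    by (simp_all add: bij_betw_def)
  then obtain q where q': "q < p" "\<zeta> = cis (2 * pi * real q / real p)" "\<zeta> \<noteq> 1"
    by auto
  then have q: "q < p" "\<zeta> = cis (2 * pi * (real q / real p))" "q \<noteq> 0"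
    by (auto intro: Nat.gr0I)
  have cop: "coprime q p"
    using p q by (metis coprime_commute dvd_imp_le not_less prime_imp_coprime_nat neq0_conv)
  have "almost_torsion_eigenfunction \<Psi>"
    unfolding almost_torsion_eigenfunction_def
  proof (intro conjI allI impI)
    show "\<exists>x\<in>carrier G. \<Psi> x \<noteq> 0" using x0 \<Psi> by blast
    fix V and \<epsilon> :: real assume V: "openin T V" "\<one> \<in> V" "\<epsilon> > 0"
    have "cmod (\<Psi> (x \<otimes> g [^] j) - cis (2 * pi * (real q / real p)) ^ j * \<Psi> x) \<le> \<epsilon>"
      if "x \<in> carrier G" for x j
      unfolding q(2)[symmetric] pow[OF that] using V by simp
    then show "\<exists>h\<in>carrier G. \<exists>N q :: nat. N > 1 \<and> coprime q N \<and> h [^] N \<in> V \<and>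
      (\<forall>x\<in>carrier G. \<forall>j\<le>N. cmod (\<Psi> (x \<otimes> h [^] j) - cis (2 * pi * (real q / real N)) ^ j * \<Psi> x) \<le> \<epsilon>)"
      using g gp V cop prime_gt_1_nat[OF p(1)]
      by (intro bexI[of _ g] exI[of _ p] exI[of _ q]) simp_all
  qed (rule \<Psi>)
  then show thesis by (rule that)
qed

text \<open>\<open>almost_torsion_multiple\<close> is applied to the angles of
  \<open>\<zeta>\<close> and of the finitely many numbers from \<open>power_near_one\<close>. For
  \<open>h = g [^] M\<close> these numbers force \<open>h [^] l \<in> V\<close>, while
  \<open>\<zeta> ^ M\<close> is so near to an \<open>l\<close>-th root of unity that all powers up
  to the \<open>l\<close>-th stay close.\<close>

lemma infinite_order_imp_almost_torsion:
  assumes g: "g \<in> carrier G" and \<Psi>: "continuous_map T euclidean \<Psi>" "x0 \<in> carrier G" "\<Psi> x0 \<noteq> 0"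
    "\<And>x. x \<in> carrier G \<Longrightarrow> \<Psi> (x \<otimes> g) = \<zeta> * \<Psi> x"
    and \<zeta>: "cmod \<zeta> = 1" "\<And>n. n > 0 \<Longrightarrow> \<zeta> ^ n \<noteq> 1"
  shows "almost_torsion_eigenfunction \<Psi>"
  unfolding almost_torsion_eigenfunction_def
proof (intro conjI allI impI)
  show "\<exists>x\<in>carrier G. \<Psi> x \<noteq> 0" using \<Psi> by blast
  fix V and \<epsilon> :: real assume V: "openin T V" "\<one> \<in> V" and \<epsilon>: "\<epsilon> > 0"
  obtain L \<delta> where L: "finite L" "\<And>z. z \<in> L \<Longrightarrow> cmod z = 1" "\<delta> > 0"
    "\<And>n::nat. (\<And>z. z \<in> L \<Longrightarrow> cmod (z ^ n - 1) < \<delta>) \<Longrightarrow> g [^] n \<in> V"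
    using power_near_one[OF g V] by metis
  have "continuous_map T euclideanreal (\<lambda>x. cmod (\<Psi> x))"
    using continuous_map_compose[OF \<Psi>(1), of euclideanreal norm] by (simp add: comp_def continuous_intros)
  from cont_bounded[OF this] obtain B where B: "B > 0" "\<And>x. x \<in> carrier G \<Longrightarrow> cmod (\<Psi> x) \<le> B"
    by auto
  obtain zs where zs: "set zs = L" using finite_list[OF L(1)] by blast
  let ?zs = "\<zeta> # zs"
  have "\<forall>i. \<exists>t. i < length ?zs \<longrightarrow> ?zs ! i = cis (2 * pi * t)"
  proof
    fix i show "\<exists>t. i < length ?zs \<longrightarrow> ?zs ! i = cis (2 * pi * t)"
    proof (cases "i < length ?zs")
      case True
      then have "?zs ! i \<in> insert \<zeta> L" using nth_mem[OF True] zs by simp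
      then have "cmod (?zs ! i) = 1" using L(2) \<zeta>(1) by auto
      then show ?thesis using cmod_1_cis by blast
    qed simp
  qed
  then obtain \<alpha> where \<alpha>: "\<And>i. i < length ?zs \<Longrightarrow> ?zs ! i = cis (2 * pi * \<alpha> i)" by metis
  have \<zeta>\<alpha>: "\<zeta> = cis (2 * pi * \<alpha> 0)" using \<alpha>[of 0] by simp
  have irr: "\<alpha> 0 \<notin> \<rat>"
  proof
    assume "\<alpha> 0 \<in> \<rat>"
    then obtain a :: int and b :: nat where ab: "b > 0" "\<alpha> 0 = of_int a / of_nat b"
      by (elim Rats_cases') (metis gr0I nat_0_less_mult_iff of_int_of_nat_eq pos_int_cases)
    have "real b * (2 * pi * \<alpha> 0) = 2 * pi * of_int a"
      using ab by simp
    then have "\<zeta> ^ b = cis (2 * pi * of_int a)"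
      by (simp only: \<zeta>\<alpha> Complex.DeMoivre)
    also have "\<dots> = 1" by (rule cis_multiple_2pi) simp
    finally show False using \<zeta>(2) ab by blast
  qed
  \<comment> \<open>8 exceeds \<open>2 * pi\<close>, the Lipschitz constant of
    \<open>cis (2 * pi * t)\<close> in \<open>t\<close>; \<open>B\<close> bounds
    \<open>\<Psi>\<close>.\<close>
  define \<eta> where "\<eta> = min (\<delta> / 8) (\<epsilon> / (8 * B))"
  have \<eta>: "\<eta> > 0" "8 * \<eta> \<le> \<delta>" "8 * \<eta> * B \<le> \<epsilon>" using L(3) \<epsilon> B(1) by (auto simp: \<eta>_def min_def field_simps)
  have pi8: "2 * pi < 8" using pi_less_4 by simp
  obtain M l q where M: "prime l" "0 < q" "q < l"
    "\<And>i. i < length ?zs \<Longrightarrow> \<exists>z::int. \<bar>real l * real M * \<alpha> i - of_int z\<bar> < \<eta>"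
    "\<exists>z::int. \<bar>real M * \<alpha> 0 - real q / real l - of_int z\<bar> < \<eta> / real l"
    using almost_torsion_multiple[where \<alpha> = \<alpha> and r = "length ?zs" and \<epsilon> = \<eta>, OF irr] \<eta> by (metis length_greater_0_conv list.discI)
  have l0: "real l > 0" using M by simp
  have "cmod (z ^ (M * l) - 1) < \<delta>" if z: "z \<in> L" for z
  proof -
    obtain i where i: "i < length zs" "zs ! i = z" using z zs by (metis in_set_conv_nth)
    then have za: "z = cis (2 * pi * \<alpha> (Suc i))" using \<alpha>[of "Suc i"] by simp
    obtain w :: int where w: "\<bar>real l * real M * \<alpha> (Suc i) - of_int w\<bar> < \<eta>" using M(4)[of "Suc i"] i by auto
    have "z ^ (M * l) = cis (2 * pi * (real l * real M * \<alpha> (Suc i)))"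
      by (simp add: za Complex.DeMoivre mult_ac)
    then have "cmod (z ^ (M * l) - 1) \<le> 2 * pi * \<bar>real l * real M * \<alpha> (Suc i) - of_int w\<bar>"
      using norm_cis_2pi_diff_1_le by simp
    also have "\<dots> < 8 * \<eta>" using w pi8 by (intro mult_strict_mono) auto
    finally show ?thesis using \<eta> by simp
  qed
  then have hV: "(g [^] M) [^] l \<in> V"
    using L(4) g by (simp add: nat_pow_pow)
  let ?\<omega> = "cis (2 * pi * (real q / real l))"
  have zM: "cmod (\<zeta> ^ M - ?\<omega>) \<le> 8 * \<eta> / l"
  proof -
    obtain w :: int where w: "\<bar>real M * \<alpha> 0 - real q / real l - of_int w\<bar> < \<eta> / real l" using M(5) by blast
    have "\<zeta> ^ M = cis (2 * pi * (real M * \<alpha> 0 - real q / real l) + 2 * pi * (real q / real l))"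
      by (simp add: \<zeta>\<alpha> Complex.DeMoivre algebra_simps)
    also have "\<dots> = cis (2 * pi * (real M * \<alpha> 0 - real q / real l)) * ?\<omega>" by (rule cis_mult[symmetric])
    finally have "\<zeta> ^ M - ?\<omega> = (cis (2 * pi * (real M * \<alpha> 0 - real q / real l)) - 1) * ?\<omega>"
      by (simp add: algebra_simps)
    then have "cmod (\<zeta> ^ M - ?\<omega>) \<le> 2 * pi * \<bar>real M * \<alpha> 0 - real q / real l - of_int w\<bar>"
      using norm_cis_2pi_diff_1_le[of "real M * \<alpha> 0 - real q / real l" w] by (simp add: norm_mult)
    also have "\<dots> \<le> 8 * (\<eta> / l)" using w pi8 by (intro mult_mono) auto
    finally show ?thesis by simp
  qed
  have "cmod (\<Psi> (x \<otimes> (g [^] M) [^] j) - ?\<omega> ^ j * \<Psi> x) \<le> \<epsilon>" if x: "x \<in> carrier G" and j: "j \<le> l" for x j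
  proof -
    have "\<Psi> (x \<otimes> (g [^] M) [^] j) = (\<zeta> ^ M) ^ j * \<Psi> x"
      using eigenfunction_power[where \<Psi> = \<Psi> and \<zeta> = \<zeta> and n = "M * j", OF g \<Psi>(4) x] g by (simp add: nat_pow_pow power_mult)
    then have "cmod (\<Psi> (x \<otimes> (g [^] M) [^] j) - ?\<omega> ^ j * \<Psi> x) = cmod ((\<zeta> ^ M) ^ j - ?\<omega> ^ j) * cmod (\<Psi> x)"
      by (simp add: norm_mult[symmetric] algebra_simps)
    also have "\<dots> \<le> (real j * cmod (\<zeta> ^ M - ?\<omega>)) * B"
      using \<zeta>(1) B(1) B(2)[OF x] by (intro mult_mono norm_power_diff_le) (auto simp: norm_power)
    also have "\<dots> \<le> (real l * (8 * \<eta> / l)) * B"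
      using zM j B(1) by (intro mult_right_mono mult_mono) auto
    also have "\<dots> \<le> \<epsilon>" using \<eta> l0 by simp
    finally show ?thesis .
  qed
  moreover have "coprime q l"
    using M by (metis coprime_commute dvd_imp_le not_less prime_imp_coprime_nat)
  ultimately show "\<exists>h\<in>carrier G. \<exists>N q :: nat. N > 1 \<and> coprime q N \<and> h [^] N \<in> V \<and>
      (\<forall>x\<in>carrier G. \<forall>j\<le>N. cmod (\<Psi> (x \<otimes> h [^] j) - cis (2 * pi * (real q / real N)) ^ j * \<Psi> x) \<le> \<epsilon>)"
    using g hV prime_gt_1_nat[OF M(1)] by (intro bexI[of _ "g [^] M"] exI[of _ l] exI[of _ q]) auto
qed (rule \<Psi>)

theorem almost_torsion_or_totally_disconnected:
  obtains F where "almost_torsion_eigenfunction F"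
  | "\<And>h n. \<lbrakk>h \<in> carrier G; h [^] (n::nat) = \<one>; n > 0\<rbrakk> \<Longrightarrow> h = \<one>"
    "\<And>C x y. \<lbrakk>connectedin T C; x \<in> C; y \<in> C\<rbrakk> \<Longrightarrow> x = y"
proof (cases "\<exists>F. almost_torsion_eigenfunction F")
  case True
  then show ?thesis using that(1) by blast
next
  case False
  let ?\<Theta> = "(\<lambda>z. 2 * Re z) ` (\<Union>n\<in>{0<..}. {z. z ^ n = 1})"
  have "countable ?\<Theta>"
    by (intro countable_image countable_UN[OF countableI_type] countable_finite finite_roots_unity) auto
  moreover have "\<theta> \<in> ?\<Theta>"
    if *: "g \<in> carrier G" "harmonic g \<theta> F" "x \<in> carrier G" "F x \<noteq> 0" for g \<theta> F x
  proof -
    obtain \<zeta> \<kappa> \<Psi> where \<Psi>: "cmod \<zeta> = 1" "\<theta> = 2 * Re \<zeta>" "continuous_map T euclidean \<Psi>" "\<Psi> x \<noteq> 0"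
      "\<And>x. x \<in> carrier G \<Longrightarrow> \<Psi> (x \<otimes> g) = \<zeta> * \<Psi> x"
      using harmonic_eigenfunction_nonzero[OF *(2,1,3,4)] by metis
    have "\<exists>n>0. \<zeta> ^ n = 1"
      using infinite_order_imp_almost_torsion[OF *(1) \<Psi>(3) *(3) \<Psi>(4,5,1)] False by blast
    then show ?thesis using \<Psi>(2) by auto
  qed
  ultimately have "\<And>C x y. \<lbrakk>connectedin T C; x \<in> C; y \<in> C\<rbrakk> \<Longrightarrow> x = y"
    by (rule countable_angles_imp_connected_trivial)
  moreover have "\<And>h n. \<lbrakk>h \<in> carrier G; h [^] (n::nat) = \<one>; n > 0\<rbrakk> \<Longrightarrow> h = \<one>"
    using torsion_imp_almost_torsion False by metis
  ultimately show ?thesis using that(2) by blast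
qed

end

section \<open>Functions on locally trivial bundles\<close>

context compact_action
begin

text \<open>A local trivialisation reduced to its group coordinate \<open>s\<close>, along which
  functions on the group are pulled back.\<close>

definition equivariant_chart :: "'c set \<Rightarrow> ('c \<Rightarrow> 'a) \<Rightarrow> bool" where
  "equivariant_chart W s \<longleftrightarrow> openin X W \<and> (\<forall>y\<in>W. \<forall>g\<in>carrier G. act y g \<in> W \<and> s (act y g) = s y \<otimes> g) \<and>
     continuous_map (subtopology X W) T s"

lemma equivariant_chart_iff:
  assumes "equivariant_chart W s" "y \<in> topspace X" "g \<in> carrier G"
  shows "act y g \<in> W \<longleftrightarrow> y \<in> W"
proof
  assume "act y g \<in> W"
  then have "act (act y g) (inv g) \<in> W" using assms by (simp add: equivariant_chart_def)
  then show "y \<in> W" using assms by (simp add: act_mult act_one)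
qed (use assms in \<open>simp add: equivariant_chart_def\<close>)

lemma equivariant_chart_closed: "equivariant_chart W s \<Longrightarrow> y \<in> W \<Longrightarrow> s y \<in> carrier G"
  unfolding equivariant_chart_def continuous_map_def topspace_eq_carrier
  by (elim conjE) (drule openin_subset, auto simp: Pi_iff)

lemma right_orbit_act:
  assumes "x \<in> topspace X" "g \<in> carrier G"
  shows "right_orbit G act (act x g) = right_orbit G act x"
proof -
  have "act x h \<in> act (act x g) ` carrier G" if "h \<in> carrier G" for h
    using that assms by (intro image_eqI[of _ _ "inv g \<otimes> h"]) (auto simp: act_mult m_assoc[symmetric])
  then show ?thesis
    using assms unfolding right_orbit_def by (auto simp: act_mult)
qed

lemma exists_equivariant_chart:
  assumes lt: "locally_trivial_principal_bundle G T X act" and x: "x \<in> topspace X"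
  obtains W s where "equivariant_chart W s" "x \<in> W"
proof -
  let ?B = "orbit_space G X act" and ?q = "right_orbit G act"
  have b: "?q x \<in> topspace ?B" using x by (simp add: orbit_space_def)
  from lt[unfolded locally_trivial_principal_bundle_def, rule_format, OF b]
  obtain U \<phi> where U: "openin ?B U" "?q x \<in> U"
    and \<phi>: "homeomorphic_map (subtopology X {x \<in> topspace X. ?q x \<in> U}) (prod_topology (subtopology ?B U) T) \<phi>"
      "equivariant_on G {x \<in> topspace X. ?q x \<in> U} act (\<lambda>(u, h) g. (u, h \<otimes> g)) \<phi>"
    unfolding Let_def by blast
  let ?W = "{x \<in> topspace X. ?q x \<in> U}"
  have "openin X ?W"
    using U(1) by (simp add: orbit_space_def openin_quotient_topology)
  moreover have "continuous_map (subtopology X ?W) T (\<lambda>y. snd (\<phi> y))"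
    using continuous_map_compose[OF homeomorphic_imp_continuous_map[OF \<phi>(1)] continuous_map_snd]
    by (simp add: comp_def)
  moreover have "act y g \<in> ?W \<and> snd (\<phi> (act y g)) = snd (\<phi> y) \<otimes> g" if "y \<in> ?W" "g \<in> carrier G" for y g
    using that \<phi>(2) by (auto simp: right_orbit_act act_closed equivariant_on_def case_prod_unfold)
  ultimately have "equivariant_chart ?W (\<lambda>y. snd (\<phi> y))"
    unfolding equivariant_chart_def by blast
  then show thesis using that x U by blast
qed

text \<open>\<open>p\<close> is constant on orbits, so multiplication by it preserves eigenvalue
  relations along the action.\<close>

definition chart_bump :: "'c set \<Rightarrow> ('c \<Rightarrow> 'a) \<Rightarrow> ('c \<Rightarrow> real) \<Rightarrow> bool" where
  "chart_bump W s p \<longleftrightarrow> equivariant_chart W s \<and> continuous_map X euclideanreal p \<and>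
     (\<forall>y\<in>topspace X. y \<notin> W \<longrightarrow> p y = 0) \<and> (\<forall>y\<in>topspace X. \<forall>g\<in>carrier G. p (act y g) = p y)"

text \<open>A Urysohn function is averaged along orbits by the invariant mean. The complement of
  \<open>W\<close> is invariant, so the average still vanishes there; \<open>mean_pos\<close> keeps
  it positive at \<open>x\<close>.\<close>

lemma exists_chart_bump:
  assumes W: "equivariant_chart W s" "x \<in> W"
  shows "\<exists>p. chart_bump W s p \<and> p x > 0"
proof -
  have WX: "openin X W" using W by (simp add: equivariant_chart_def)
  have x: "x \<in> topspace X" using W WX openin_subset by blast
  have norm: "normal_space X"
    using compact_X Hausdorff_X compact_Hausdorff_or_regular_imp_normal_space by blast
  have cl: "closedin X (topspace X - W)" "closedin X {x}"
    using WX Hausdorff_X x by (auto simp: closedin_Hausdorff_sing_eq)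
  have d: "disjnt (topspace X - W) {x}" using W by (auto simp: disjnt_def)
  from Urysohn_lemma[OF norm cl d zero_le_one]
  obtain f where f: "continuous_map X (top_of_set {0..1::real}) f" "f ` (topspace X - W) \<subseteq> {0}" "f ` {x} \<subseteq> {1}"
    by blast
  have fc: "continuous_map X euclideanreal f" and f0: "\<And>y. y \<in> topspace X \<Longrightarrow> 0 \<le> f y"
    using f(1) by (auto simp: continuous_map_in_subtopology image_subset_iff)
  have F: "continuous_map (prod_topology X T) euclideanreal (\<lambda>p. f ((\<lambda>(x, g). act x g) p))"
    using continuous_map_compose[OF continuous_act fc] by (simp add: comp_def)
  have slice: "cont (\<lambda>g. f (act y g))" if "y \<in> topspace X" for y
    using continuous_map_compose[OF continuous_map_pairedI[of T X "\<lambda>_. y" T "\<lambda>g. g"] F] that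
    by (simp add: comp_def)
  define p where "p y = mean (\<lambda>g. f (act y g))" for y
  show ?thesis
    unfolding chart_bump_def
  proof (intro exI[of _ p] conjI ballI impI)
    show "equivariant_chart W s" by (rule W)
    show "continuous_map X euclideanreal p"
      using mean_param_continuous[OF F] by (simp add: p_def[abs_def])
    show "p x > 0" unfolding p_def
    proof (rule mean_pos[OF slice[OF x]])
      show "0 < f (act x \<one>)" using f(3) x by (simp add: act_one)
    qed (use x in \<open>auto intro: f0 act_closed\<close>)
    show "p y = 0" if "y \<in> topspace X" "y \<notin> W" for y
    proof -
      have "mean (\<lambda>g. f (act y g)) = mean (\<lambda>g. 0)"
      proof (rule mean_cong)
        fix g assume "g \<in> carrier G"
        then have "act y g \<in> topspace X - W" using that equivariant_chart_iff[OF W(1)] act_closed by blast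
        then show "f (act y g) = 0" using f(2) by blast
      qed
      then show ?thesis by (simp add: p_def mean_const)
    qed
    show "p (act y g) = p y" if y: "y \<in> topspace X" and g: "g \<in> carrier G" for y g
    proof -
      have "mean (\<lambda>h. f (act (act y g) h)) = mean (\<lambda>h. f (act y (g \<otimes> h)))"
        using y g by (intro mean_cong) (simp add: act_mult)
      then show ?thesis using mean_translate_left[OF slice[OF y] g] by (simp add: p_def)
    qed
  qed
qed

lemma finite_open_cover_nat:
  assumes K: "compact_space K" and U: "\<And>x. x \<in> topspace K \<Longrightarrow> openin K (U x) \<and> x \<in> U x"
  obtains n :: nat and a where "\<And>i. i < n \<Longrightarrow> a i \<in> topspace K" "\<And>y. y \<in> topspace K \<Longrightarrow> \<exists>i<n. y \<in> U (a i)"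
proof -
  have 1: "\<forall>W\<in>U ` topspace K. openin K W" and 2: "topspace K \<subseteq> \<Union>(U ` topspace K)"
    using U by blast+
  from K[unfolded compact_space_alt, rule_format, OF conjI[OF 1 2]]
  obtain \<F> where F: "finite \<F>" "\<F> \<subseteq> U ` topspace K" "topspace K \<subseteq> \<Union>\<F>"
    by (elim exE conjE)
  from finite_subset_image[OF F(1,2)] obtain A where A: "A \<subseteq> topspace K" "finite A" "\<F> = U ` A"
    by (elim exE conjE)
  obtain as where as: "set as = A" using finite_list[OF A(2)] by blast
  show thesis
  proof (rule that[of "length as" "\<lambda>i. as ! i"])
    show "as ! i \<in> topspace K" if "i < length as" for i using nth_mem[OF that] as A by blast
    show "\<exists>i<length as. y \<in> U (as ! i)" if "y \<in> topspace K" for y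
      using that F A as by (metis UN_E in_set_conv_nth subsetD)
  qed
qed

theorem finite_chart_bumps:
  assumes lt: "locally_trivial_principal_bundle G T X act"
  obtains n :: nat and W s p c where "\<And>i. i < n \<Longrightarrow> chart_bump (W i) (s i) (p i)"
    "c > 0" "\<And>y. y \<in> topspace X \<Longrightarrow> \<exists>i<n. p i y > c"
proof -
  have "\<exists>W s p. chart_bump W s p \<and> p x > 0" if x: "x \<in> topspace X" for x
  proof -
    obtain W s where "equivariant_chart W s" "x \<in> W" by (rule exists_equivariant_chart[OF lt x])
    from exists_chart_bump[OF this] show ?thesis by blast
  qed
  then obtain W s p where Wsp: "\<And>x. x \<in> topspace X \<Longrightarrow> chart_bump (W x) (s x) (p x)"
    "\<And>x. x \<in> topspace X \<Longrightarrow> p x x > 0" by metis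
  define U where "U x = {y \<in> topspace X. p x y \<in> {p x x / 2 <..}}" for x
  have "openin X (U x) \<and> x \<in> U x" if "x \<in> topspace X" for x
    using openin_continuous_map_preimage[of X euclideanreal "p x" "{p x x / 2 <..}"] Wsp[OF that] that
    by (simp add: U_def chart_bump_def)
  from finite_open_cover_nat[where U = U, OF compact_X this]
  obtain n :: nat and a where a: "\<And>i. i < n \<Longrightarrow> a i \<in> topspace X" "\<And>y. y \<in> topspace X \<Longrightarrow> \<exists>i<n. y \<in> U (a i)"
    by metis
  define c where "c = Min (insert 1 ((\<lambda>i. p (a i) (a i) / 2) ` {..<n}))"
  have c: "c > 0" unfolding c_def using a Wsp(2) by (subst Min_gr_iff) auto
  have ci: "c \<le> p (a i) (a i) / 2" if "i < n" for i
    unfolding c_def using that by (intro Min_le) auto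
  show thesis
  proof (rule that[of n "\<lambda>i. W (a i)" "\<lambda>i. s (a i)" "\<lambda>i. p (a i)" c])
    fix y assume "y \<in> topspace X"
    then obtain i where i: "i < n" "y \<in> U (a i)" using a by blast
    then show "\<exists>i<n. c < p (a i) y" using ci[OF i(1)] by (intro exI[of _ i]) (auto simp: U_def)
  qed (use a Wsp c in auto)
qed

text \<open>Left translates of \<open>F\<close> satisfy the same relations under right translation.
  Finitely many of them have no common zero on the group; each is pulled back through each chart and
  cut off by the bump.\<close>

theorem chart_eigenfunctions:
  fixes F :: "'a \<Rightarrow> complex"
  assumes lt: "locally_trivial_principal_bundle G T X act"
    and F: "continuous_map T euclidean F" "x1 \<in> carrier G" "F x1 \<noteq> 0"
  obtains D :: nat and \<psi> c K where "\<And>i. i < D \<Longrightarrow> continuous_map X euclidean (\<psi> i)"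
    "c > 0" "\<And>y. y \<in> topspace X \<Longrightarrow> \<exists>i<D. cmod (\<psi> i y) > c" "K > 0"
    "\<And>i y g z \<epsilon>. \<lbrakk>i < D; y \<in> topspace X; g \<in> carrier G; \<And>x. x \<in> carrier G \<Longrightarrow> cmod (F (x \<otimes> g) - z * F x) \<le> \<epsilon>\<rbrakk>
      \<Longrightarrow> cmod (\<psi> i (act y g) - z * \<psi> i y) \<le> K * \<epsilon>"
proof -
  obtain n :: nat and W s p c where Wp: "\<And>i. i < n \<Longrightarrow> chart_bump (W i) (s i) (p i)"
    and c: "c > 0" "\<And>y. y \<in> topspace X \<Longrightarrow> \<exists>i<n. p i y > c"
    using finite_chart_bumps[OF lt] by metis
  have W: "equivariant_chart (W i) (s i)" if "i < n" for i using Wp[OF that] by (simp add: chart_bump_def)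
  have p: "continuous_map X euclideanreal (p i)"
    "\<And>y. y \<in> topspace X \<Longrightarrow> y \<notin> W i \<Longrightarrow> p i y = 0"
    "\<And>y g. y \<in> topspace X \<Longrightarrow> g \<in> carrier G \<Longrightarrow> p i (act y g) = p i y" if "i < n" for i
    using Wp[OF that] by (simp_all add: chart_bump_def)
  have Fn: "cont (\<lambda>x. cmod (F x))"
    using continuous_map_compose[OF F(1), of euclideanreal norm] by (simp add: comp_def continuous_intros)
  obtain B where B: "B > 0" "\<And>x. x \<in> carrier G \<Longrightarrow> cmod (F x) \<le> B"
    using cont_bounded[OF Fn] by auto
  define r where "r = cmod (F x1) / 2"
  have r: "r > 0" using F by (simp add: r_def)
  define U where "U t = {u \<in> topspace T. cmod (F (x1 \<otimes> inv t \<otimes> u)) \<in> {r<..}}" for t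
  have "openin T (U t) \<and> t \<in> U t" if "t \<in> topspace T" for t
  proof -
    have t: "t \<in> carrier G" using that by (simp add: topspace_eq_carrier)
    then have "cont (\<lambda>u. cmod (F (x1 \<otimes> inv t \<otimes> u)))" using F by (intro cont_translate_left[OF Fn]) auto
    moreover have "x1 \<otimes> inv t \<otimes> t = x1" using t F by (simp add: m_assoc)
    ultimately show ?thesis
      unfolding U_def using that r openin_continuous_map_preimage[of T euclideanreal _ "{r<..}"]
      by (auto simp: r_def)
  qed
  from finite_open_cover_nat[where U = U, OF compact this]
  obtain m :: nat and b where b: "\<And>i. i < m \<Longrightarrow> b i \<in> topspace T" "\<And>t. t \<in> topspace T \<Longrightarrow> \<exists>i<m. t \<in> U (b i)"
    by metis
  have bG: "b i \<in> carrier G" if "i < m" for i using b that by (simp add: topspace_eq_carrier)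
  \<comment> \<open>The index encodes a pair: chart \<open>i div m\<close> and left translate
    \<open>i mod m\<close>.\<close>
  define \<xi> where "\<xi> i y = (if y \<in> W (i div m) then of_real (p (i div m) y) * F (x1 \<otimes> inv (b (i mod m)) \<otimes> s (i div m) y) else 0)" for i y
  obtain P where P: "P > 0" "\<And>i y. i < n \<Longrightarrow> y \<in> topspace X \<Longrightarrow> \<bar>p i y\<bar> \<le> P"
  proof -
    have "\<exists>P>0. \<forall>y\<in>topspace X. \<bar>p i y\<bar> \<le> P" if "i < n" for i
    proof -
      have "compact (p i ` topspace X)"
        using image_compactin[OF compact_X[unfolded compact_space_def] p(1)[OF that]] by simp
      then obtain P where "\<forall>z\<in>p i ` topspace X. norm z \<le> P" by (meson bounded_iff compact_imp_bounded)
      then show ?thesis by (intro exI[of _ "max 1 P"]) auto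
    qed
    then obtain P where P: "\<And>i. i < n \<Longrightarrow> P i > 0 \<and> (\<forall>y\<in>topspace X. \<bar>p i y\<bar> \<le> P i)" by metis
    have "P i \<le> (\<Sum>i<n. P i)" if "i < n" for i
      using that P by (intro member_le_sum) (auto intro: less_imp_le)
    moreover have "0 \<le> (\<Sum>i<n. P i)" using P by (intro sum_nonneg) (auto intro: less_imp_le)
    ultimately show thesis
      using P by (intro that[of "(\<Sum>i<n. P i) + 1"]) (auto, meson order_trans le_add_same_cancel1 zero_le_one)
  qed
  have idx: "i div m < n" "i mod m < m" if "i < n * m" for i
    using that by (auto simp: less_mult_imp_div_less) (metis mod_less_divisor mult_0_right neq0_conv not_less0)
  show thesis
  proof
    fix i assume i: "i < n * m"
    let ?i = "i div m" and ?b = "x1 \<otimes> inv (b (i mod m))"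
    have bG': "?b \<in> carrier G" using bG idx[OF i] F by simp
    have WX: "openin X (W ?i)" using W[OF idx(1)[OF i]] by (simp add: equivariant_chart_def)
    have sW: "continuous_map (subtopology X (W ?i)) T (s ?i)" using W[OF idx(1)[OF i]] by (simp add: equivariant_chart_def)
    have "continuous_map (subtopology X (W ?i)) T (\<lambda>y. ?b \<otimes> s ?i y)"
      by (rule mult_continuous[OF _ sW]) (use bG' in \<open>simp only: continuous_map_const topspace_eq_carrier simp_thms\<close>)
    from continuous_map_compose[OF this F(1)]
    have 1: "continuous_map (subtopology X (W ?i)) euclidean (\<lambda>y. F (?b \<otimes> s ?i y))" by (simp add: comp_def)
    have "continuous_map (subtopology X (W ?i)) (prod_topology euclideanreal euclidean) (\<lambda>y. (p ?i y, F (?b \<otimes> s ?i y)))"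
      by (intro continuous_map_pairedI 1 continuous_map_from_subtopology[OF p(1)[OF idx(1)[OF i]]])
    then have "continuous_map (subtopology X (W ?i)) euclidean (\<lambda>y. (p ?i y, F (?b \<otimes> s ?i y)))" by simp
    from continuous_map_compose[OF this, of euclidean "\<lambda>z. of_real (fst z) * snd z"]
    have "continuous_map (subtopology X (W ?i)) euclidean (\<lambda>y. of_real (p ?i y) * F (?b \<otimes> s ?i y))"
      by (simp add: comp_def continuous_intros)
    then have loc: "continuous_map (subtopology X (W ?i)) euclidean (\<xi> i)"
      by (rule continuous_map_eq) (auto simp: \<xi>_def)
    have "equicts X {\<xi> i}"
      unfolding equicts_def
    proof (intro ballI allI impI)
      fix y and \<epsilon> :: real assume y: "y \<in> topspace X" and \<epsilon>: "\<epsilon> > 0"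
      show "\<exists>U. openin X U \<and> y \<in> U \<and> (\<forall>z\<in>U. \<forall>f\<in>{\<xi> i}. dist (f z) (f y) < \<epsilon>)"
      proof (cases "y \<in> W ?i")
        case True
        have "openin (subtopology X (W ?i)) {z \<in> topspace (subtopology X (W ?i)). \<xi> i z \<in> ball (\<xi> i y) \<epsilon>}"
          by (rule openin_continuous_map_preimage[OF loc]) simp
        then have "openin X {z \<in> topspace (subtopology X (W ?i)). \<xi> i z \<in> ball (\<xi> i y) \<epsilon>}"
          using WX by (rule openin_trans_full)
        then show ?thesis
          using True y \<epsilon>
          by (intro exI[of _ "{z \<in> topspace (subtopology X (W ?i)). \<xi> i z \<in> ball (\<xi> i y) \<epsilon>}"])
             (auto simp: dist_commute)
      next
        case False
        \<comment> \<open>Outside the chart, continuity comes from the bump alone: \<open>F\<close>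
          is bounded by \<open>B\<close>, so it suffices that the bump is below
          \<open>\<epsilon> / B\<close>.\<close>
        let ?U = "{z \<in> topspace X. \<bar>p ?i z\<bar> \<in> {..<\<epsilon> / B}}"
        have "continuous_map X euclideanreal (\<lambda>z. \<bar>p ?i z\<bar>)" using p(1)[OF idx(1)[OF i]] by (intro continuous_intros)
        then have "openin X ?U" by (rule openin_continuous_map_preimage) simp
        moreover have "y \<in> ?U" using y False p(2)[OF idx(1)[OF i]] \<epsilon> B by simp
        moreover have "dist (\<xi> i z) (\<xi> i y) < \<epsilon>" if z: "z \<in> ?U" for z
        proof (cases "z \<in> W ?i")
          case True
          have "s ?i z \<in> carrier G" using equivariant_chart_closed W[OF idx(1)[OF i]] True by blast
          then have "cmod (\<xi> i z) \<le> \<bar>p ?i z\<bar> * B"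
            using True bG' by (simp add: \<xi>_def norm_mult mult_left_mono B)
          also have "\<dots> < \<epsilon>" using z B by (simp add: pos_less_divide_eq)
          finally show ?thesis using False by (simp add: \<xi>_def)
        qed (use False \<epsilon> in \<open>simp add: \<xi>_def\<close>)
        ultimately show ?thesis by (intro exI[of _ ?U]) auto
      qed
    qed
    then show "continuous_map X euclidean (\<xi> i)" by (rule equicts_imp_continuous) simp
  next
    show "c * r > 0" using c r by simp
    fix y assume y: "y \<in> topspace X"
    obtain i where i: "i < n" "p i y > c" using c y by blast
    have yW: "y \<in> W i" using i p(2)[OF i(1) y] c(1) by force
    have sG: "s i y \<in> carrier G" using equivariant_chart_closed W[OF i(1)] yW by blast
    then obtain j where j: "j < m" "s i y \<in> U (b j)" using b by (auto simp: topspace_eq_carrier)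
    have "i * m + j < n * m"
    proof -
      have "i * m + j < Suc i * m" using j by simp
      also have "\<dots> \<le> n * m" using i by (intro mult_right_mono) auto
      finally show ?thesis .
    qed
    moreover have "cmod (\<xi> (i * m + j) y) > c * r"
    proof -
      have "cmod (\<xi> (i * m + j) y) = \<bar>p i y\<bar> * cmod (F (x1 \<otimes> inv (b j) \<otimes> s i y))"
        using j yW by (simp add: \<xi>_def norm_mult)
      also have "\<dots> > c * r"
        using i j c r by (intro mult_strict_mono) (auto simp: U_def)
      finally show ?thesis .
    qed
    ultimately show "\<exists>i<n * m. c * r < cmod (\<xi> i y)" by blast
  next
    show "P > 0" by (rule P)
    fix i y g z \<epsilon> assume i: "i < n * m" and y: "y \<in> topspace X" and g: "g \<in> carrier G"
      and eq: "\<And>x. x \<in> carrier G \<Longrightarrow> cmod (F (x \<otimes> g) - z * F x) \<le> \<epsilon>"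
    let ?i = "i div m" and ?b = "x1 \<otimes> inv (b (i mod m))"
    have bG': "?b \<in> carrier G" using bG idx[OF i] F by simp
    have e0: "0 \<le> \<epsilon>" using eq[OF one_closed] norm_ge_zero order_trans by blast
    show "cmod (\<xi> i (act y g) - z * \<xi> i y) \<le> P * \<epsilon>"
    proof (cases "y \<in> W ?i")
      case True
      have sG: "s ?i y \<in> carrier G" using equivariant_chart_closed W[OF idx(1)[OF i]] True by blast
      have a: "act y g \<in> W ?i" "s ?i (act y g) = s ?i y \<otimes> g"
        using W[OF idx(1)[OF i]] True g by (auto simp: equivariant_chart_def)
      have "\<xi> i (act y g) - z * \<xi> i y = of_real (p ?i y) * (F (?b \<otimes> s ?i y \<otimes> g) - z * F (?b \<otimes> s ?i y))"
        using True a p(3)[OF idx(1)[OF i] y g] bG' sG g by (simp add: \<xi>_def m_assoc algebra_simps)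
      then have "cmod (\<xi> i (act y g) - z * \<xi> i y) = \<bar>p ?i y\<bar> * cmod (F (?b \<otimes> s ?i y \<otimes> g) - z * F (?b \<otimes> s ?i y))"
        by (simp add: norm_mult)
      also have "\<dots> \<le> P * \<epsilon>"
        using P(2)[OF idx(1)[OF i] y] P(1) eq bG' sG by (intro mult_mono) auto
      finally show ?thesis .
    next
      case False
      then have "act y g \<notin> W ?i" using equivariant_chart_iff[OF W[OF idx(1)[OF i]] y g] by simp
      then show ?thesis using False e0 P(1) by (simp add: \<xi>_def)
    qed
  qed
qed

end

section \<open>Free cyclic actions\<close>

text \<open>A product vanishes on a simplex once one factor vanishes on all its faces. The factor
  \<open>i\<close> may stand anywhere, so the induction strips the factors in front of it.\<close>

lemma cup_classes_eq_0:
  assumes "i < n" "\<And>a b c. \<lbrakk>a \<in> set l; b \<in> set l; c \<in> set l\<rbrakk> \<Longrightarrow> t i b c - t i a c + t i a b = 0"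
  shows "cup_classes t n l = 0"
  using assms
proof (induction n arbitrary: l)
  case (Suc k)
  show ?case
  proof (cases "i = k")
    case True
    then show ?thesis using Suc.prems by (auto intro!: cup2_eq_0)
  next
    case False
    then have "i < k" using Suc.prems by simp
    show ?thesis
    proof (cases l rule: list_cases3)
      case (4 a b c m)
      have "cup_classes t k (c # m) = 0"
        using Suc.prems(2) by (intro Suc.IH[OF \<open>i < k\<close>]) (auto simp: 4)
      then show ?thesis by (simp add: 4)
    qed auto
  qed
qed simp

text \<open>The 1-cochain whose coboundary is the Bockstein of the difference class of labels modulo
  \<open>N\<close>; the division is exact.\<close>

definition carry :: "int \<Rightarrow> int \<Rightarrow> int \<Rightarrow> int" where
  "carry N x y = ((y - x) mod N - (y - x)) div N"

lemma carry: "N * carry N x y = (y - x) mod N - (y - x)"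
proof -
  have "N dvd (y - x) mod N - (y - x)"
    by (metis dvd_minus_mod dvd_minus_iff minus_diff_eq)
  then show ?thesis unfolding carry_def by simp
qed

text \<open>
  Every chart \<open>W i\<close> trivialises the class of the carry cocycle, so the product of all of them
  vanishes on simplices contained in a chart.
\<close>

theorem no_cyclic_cover:
  fixes c :: "nat \<Rightarrow> ('p list \<Rightarrow> int) \<Rightarrow> int" and N :: nat
    and \<eta> :: "'p \<Rightarrow> int" and W :: "nat \<Rightarrow> 'p \<Rightarrow> bool" and s :: "nat \<Rightarrow> 'p \<Rightarrow> int"
  assumes N: "N > 1"
    and add: "\<And>k. additive_on_cochains (c k)"
    and c0: "c 0 unit_cochain = 1"
    and bd: "\<And>k a. k < 2 * n \<Longrightarrow> c (Suc k) (cobd a) = c k (cyc_op N \<rho> k a)"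
    and lab: "\<And>p. 0 \<le> \<eta> p \<and> \<eta> p < int N" "\<And>p. \<eta> (\<rho> p) = (\<eta> p + 1) mod int N"
    and W: "\<And>i p. i < n \<Longrightarrow> W i (\<rho> p) \<longleftrightarrow> W i p"
    and s: "\<And>i p. i < n \<Longrightarrow> W i p \<Longrightarrow> s i (\<rho> p) mod int N = (s i p + 1) mod int N"
    and supp: "supported_on (c (2 * n)) P"
    and cover: "\<And>S. P S \<Longrightarrow> \<exists>i<n. (\<forall>p\<in>S. W i p) \<and> (\<forall>p\<in>S. \<forall>p'\<in>S. s i p mod int N = s i p' mod int N)"
  shows False
proof -
  let ?N = "int N"
  define good where "good i p p' \<longleftrightarrow> W i p \<and> W i p' \<and> s i p mod ?N = s i p' mod ?N" for i p p'
  \<comment> \<open>\<open>\<eta> - s i\<close> is unchanged by rotation modulo \<open>N\<close>,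
    and on good pairs its differences agree with those of \<open>\<eta>\<close>. Subtracting the
    invariant \<open>v i\<close> keeps the equivariant class of the carry cochain, but turns it into
    the coboundary of a 0-cochain on simplices inside the chart.\<close>
  define v where "v i p p' = (if good i p p' then carry ?N ((\<eta> p - s i p) mod ?N) ((\<eta> p' - s i p') mod ?N) else 0)" for i p p'
  define t where "t i p p' = carry ?N (\<eta> p) (\<eta> p') - v i p p'" for i p p'
  have N0: "?N \<noteq> 0" "?N > 0" using N by auto
  have w_inv: "(\<eta> (\<rho> p') - \<eta> (\<rho> p)) mod ?N = (\<eta> p' - \<eta> p) mod ?N" for p p'
    unfolding lab(2) by (simp add: mod_diff_eq)
  have good_inv: "good i (\<rho> p) (\<rho> p') \<longleftrightarrow> good i p p'" if "i < n" for i p p'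
  proof (cases "W i p \<and> W i p'")
    case True
    then have "(s i (\<rho> p) mod ?N = s i (\<rho> p') mod ?N) \<longleftrightarrow> ((s i p + 1) mod ?N = (s i p' + 1) mod ?N)"
      using s[OF that] by simp
    also have "\<dots> \<longleftrightarrow> s i p mod ?N = s i p' mod ?N"
      by (metis add_diff_cancel_right' mod_add_left_eq mod_diff_left_eq)
    finally show ?thesis using W[OF that] by (simp add: good_def)
  next
    case False
    then show ?thesis using W[OF that] by (auto simp: good_def)
  qed
  have v_inv: "v i (\<rho> p) (\<rho> p') = v i p p'" if i: "i < n" for i p p'
  proof (cases "good i p p'")
    case True
    have "(\<eta> (\<rho> p) - s i (\<rho> p)) mod ?N = (\<eta> p - s i p) mod ?N" if "W i p" for p
    proof -
      have "(\<eta> (\<rho> p) - s i (\<rho> p)) mod ?N = ((\<eta> p + 1) mod ?N - (s i p + 1) mod ?N) mod ?N"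
        unfolding lab(2) using s[OF i that] by (metis mod_diff_right_eq mod_mod_trivial)
      then show ?thesis by (simp add: mod_diff_eq)
    qed
    then show ?thesis using True good_inv[OF i, of p p'] by (simp add: v_def good_def)
  qed (use good_inv[OF i] in \<open>simp add: v_def\<close>)
  have v_invj: "v i ((\<rho> ^^ j) p) ((\<rho> ^^ j) p') = v i p p'" if "i < n" for i j p p'
    by (induction j) (simp_all add: v_inv that)
  have w_invj: "(\<eta> ((\<rho> ^^ j) p') - \<eta> ((\<rho> ^^ j) p)) mod ?N = (\<eta> p' - \<eta> p) mod ?N" for j p p'
    by (induction j) (simp_all add: w_inv)
  have labj: "\<eta> ((\<rho> ^^ j) p) = (\<eta> p + int j) mod ?N" for j p
  proof (induction j)
    case 0
    then show ?case using lab(1)[of p] by simp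
  next
    case (Suc j)
    then show ?case by (simp add: lab(2) mod_simps algebra_simps)
  qed
  have sum_lab: "(\<Sum>j<N. \<eta> ((\<rho> ^^ j) p)) = (\<Sum>j<N. int j)" for p
  proof -
    have "(\<Sum>j<N. (x + int j) mod ?N) = (\<Sum>j<N. int j)" if "0 \<le> x" "x < ?N" for x
    proof -
      have "bij_betw (\<lambda>j. nat ((x + int j) mod ?N)) {..<N} {..<N}"
      proof (rule bij_betwI[where g = "\<lambda>j. nat ((int j - x) mod ?N)"])
        show "(\<lambda>j. nat ((x + int j) mod ?N)) \<in> {..<N} \<rightarrow> {..<N}"
          "(\<lambda>j. nat ((int j - x) mod ?N)) \<in> {..<N} \<rightarrow> {..<N}"
          using N0 by (auto simp: nat_less_iff)
        show "nat ((int (nat ((x + int j) mod ?N)) - x) mod ?N) = j" if "j \<in> {..<N}" for j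
          using that N0 by (simp add: mod_diff_left_eq)
        show "nat ((x + int (nat ((int j - x) mod ?N))) mod ?N) = j" if "j \<in> {..<N}" for j
          using that N0 by (simp add: mod_add_right_eq)
      qed
      from sum.reindex_bij_betw[OF this, of int] show ?thesis using N0 by simp
    qed
    then show ?thesis using lab(1)[of p] by (simp add: labj)
  qed
  have t_prod: "?N * t i p p' = (\<eta> p' - \<eta> p) mod ?N - (\<eta> p' - \<eta> p) - ?N * v i p p'" for i p p'
    by (simp add: t_def right_diff_distrib carry)
  \<comment> \<open>From index \<open>n\<close> on, the plain carry cochain is a filler, because
    \<open>cup_classes_eval\<close> states its conditions for every index.\<close>
  have "[c (2 * n) (cup_classes (\<lambda>i. if i < n then t i else (\<lambda>p p'. carry ?N (\<eta> p) (\<eta> p'))) n) = 1] (mod ?N)"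
  proof (rule cup_classes_eval[where \<rho> = \<rho> and \<eta> = \<eta> and c = c and n = n and N = N])
    show "additive_on_cochains (c k)" "c 0 unit_cochain = 1" for k by (fact add c0)+
  next
    fix k a assume k: "k < n"
    have "cyc_op N \<rho> (2 * k) a = (\<lambda>l. a (map \<rho> l) - a l)" by (auto simp: cyc_op_def)
    then show "c (Suc (2 * k)) (cobd a) = c (2 * k) (\<lambda>l. a (map \<rho> l) - a l)"
      using bd[of "2 * k" a] k by simp
    have "cyc_op N \<rho> (Suc (2 * k)) a = (\<lambda>l. \<Sum>j<N. a (map (\<rho> ^^ j) l))" by (auto simp: cyc_op_def)
    then show "c (Suc (Suc (2 * k))) (cobd a) = c (Suc (2 * k)) (\<lambda>l. \<Sum>j<N. a (map (\<rho> ^^ j) l))"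
      using bd[of "Suc (2 * k)" a] k by simp
  next
    fix p
    show "\<exists>q. \<eta> (\<rho> p) = \<eta> p + 1 + ?N * q"
      unfolding lab(2) by (metis add.commute add_diff_cancel_left' minus_mult_div_eq_mod mult_minus_right uminus_add_conv_diff)
  next
    fix k a b
    \<comment> \<open>Over a full rotation every label occurs exactly once, so the label differences
      cancel by \<open>sum_lab\<close> and only the reduced difference remains.\<close>
    have carry_sum: "(\<Sum>j<N. carry ?N (\<eta> ((\<rho> ^^ j) a)) (\<eta> ((\<rho> ^^ j) b))) = (\<eta> b - \<eta> a) mod ?N"
    proof -
      have "?N * (\<Sum>j<N. carry ?N (\<eta> ((\<rho> ^^ j) a)) (\<eta> ((\<rho> ^^ j) b)))
        = (\<Sum>j<N. (\<eta> b - \<eta> a) mod ?N - (\<eta> ((\<rho> ^^ j) b) - \<eta> ((\<rho> ^^ j) a)))"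
        by (simp add: sum_distrib_left carry w_invj)
      also have "\<dots> = ?N * ((\<eta> b - \<eta> a) mod ?N)"
        by (simp add: sum_subtractf sum_lab)
      finally show ?thesis using N0 by simp
    qed
    have w: "\<exists>q. (\<eta> b - \<eta> a) mod ?N = \<eta> b - \<eta> a + ?N * q"
      by (metis minus_mult_div_eq_mod mult_minus_right uminus_add_conv_diff add.commute)
    show "\<exists>q. (\<Sum>j<N. (if k < n then t k else (\<lambda>p p'. carry ?N (\<eta> p) (\<eta> p'))) ((\<rho> ^^ j) a) ((\<rho> ^^ j) b)) = \<eta> b - \<eta> a + ?N * q"
    proof (cases "k < n")
      case True
      then have "(\<Sum>j<N. t k ((\<rho> ^^ j) a) ((\<rho> ^^ j) b)) = (\<eta> b - \<eta> a) mod ?N - ?N * v k a b"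
        by (simp add: t_def sum_subtractf carry_sum v_invj)
      moreover obtain q where "(\<eta> b - \<eta> a) mod ?N = \<eta> b - \<eta> a + ?N * q" using w by blast
      ultimately have "(\<Sum>j<N. t k ((\<rho> ^^ j) a) ((\<rho> ^^ j) b)) = \<eta> b - \<eta> a + ?N * (q - v k a b)"
        by (simp add: algebra_simps)
      then show ?thesis using True by auto
    qed (simp add: carry_sum w)
  next
    fix k a b d
    have carry_inv: "carry ?N (\<eta> (\<rho> b)) (\<eta> (\<rho> d)) - carry ?N (\<eta> (\<rho> a)) (\<eta> (\<rho> d)) + carry ?N (\<eta> (\<rho> a)) (\<eta> (\<rho> b))
      = carry ?N (\<eta> b) (\<eta> d) - carry ?N (\<eta> a) (\<eta> d) + carry ?N (\<eta> a) (\<eta> b)"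
    proof -
      have "?N * (carry ?N (\<eta> (\<rho> b)) (\<eta> (\<rho> d)) - carry ?N (\<eta> (\<rho> a)) (\<eta> (\<rho> d)) + carry ?N (\<eta> (\<rho> a)) (\<eta> (\<rho> b)))
      = ?N * (carry ?N (\<eta> b) (\<eta> d) - carry ?N (\<eta> a) (\<eta> d) + carry ?N (\<eta> a) (\<eta> b))"
        by (simp add: right_diff_distrib distrib_left carry w_inv)
      then show ?thesis using N0 by simp
    qed
    then show "(if k < n then t k else (\<lambda>p p'. carry ?N (\<eta> p) (\<eta> p'))) (\<rho> b) (\<rho> d)
       - (if k < n then t k else (\<lambda>p p'. carry ?N (\<eta> p) (\<eta> p'))) (\<rho> a) (\<rho> d)
       + (if k < n then t k else (\<lambda>p p'. carry ?N (\<eta> p) (\<eta> p'))) (\<rho> a) (\<rho> b)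
       = (if k < n then t k else (\<lambda>p p'. carry ?N (\<eta> p) (\<eta> p'))) b d
       - (if k < n then t k else (\<lambda>p p'. carry ?N (\<eta> p) (\<eta> p'))) a d
       + (if k < n then t k else (\<lambda>p p'. carry ?N (\<eta> p) (\<eta> p'))) a b"
      by (simp add: t_def v_inv)
  qed
  moreover have "c (2 * n) (cup_classes (\<lambda>i. if i < n then t i else (\<lambda>p p'. carry ?N (\<eta> p) (\<eta> p'))) n) = c (2 * n) (\<lambda>l. 0)"
  proof (rule supported_onD[OF supp])
    fix l :: "'p list" assume "l \<noteq> []" "P (set l)"
    then obtain i where i: "i < n" "\<And>p. p \<in> set l \<Longrightarrow> W i p"
      "\<And>p p'. p \<in> set l \<Longrightarrow> p' \<in> set l \<Longrightarrow> s i p mod ?N = s i p' mod ?N" using cover by meson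
    \<comment> \<open>On such a simplex \<open>int N * t i\<close> is the coboundary of
      \<open>(\<eta> - s i) mod int N - \<eta>\<close>, so its own coboundary vanishes.\<close>
    have tt: "?N * t i a b = (\<eta> b - s i b) mod ?N - (\<eta> a - s i a) mod ?N - (\<eta> b - \<eta> a)" if "a \<in> set l" "b \<in> set l" for a b
    proof -
      have "good i a b"
        unfolding good_def using i(2)[OF that(1)] i(2)[OF that(2)] i(3)[OF that] by blast
      moreover have "((\<eta> b - s i b) mod ?N - (\<eta> a - s i a) mod ?N) mod ?N = (\<eta> b - \<eta> a) mod ?N"
      proof -
        have "((\<eta> b - s i b) mod ?N - (\<eta> a - s i a) mod ?N) mod ?N = ((\<eta> b - \<eta> a) - (s i b - s i a)) mod ?N"
          by (simp add: mod_diff_eq algebra_simps)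
        moreover have "(s i b - s i a) mod ?N = 0"
          using i(3)[OF that(2,1)] by (simp add: mod_eq_dvd_iff)
        ultimately show ?thesis by (metis diff_zero mod_diff_right_eq)
      qed
      ultimately show ?thesis
        by (simp add: t_prod v_def carry)
    qed
    have "t i b d - t i a d + t i a b = 0" if "a \<in> set l" "b \<in> set l" "d \<in> set l" for a b d
    proof -
      have "?N * (t i b d - t i a d + t i a b) = 0"
        using that by (simp add: right_diff_distrib distrib_left tt)
      then show ?thesis using N0 by simp
    qed
    then show "cup_classes (\<lambda>i. if i < n then t i else (\<lambda>p p'. carry ?N (\<eta> p) (\<eta> p'))) n l = 0"
      using i(1) by (intro cup_classes_eq_0[OF i(1)]) simp
  qed
  ultimately have "[0 = 1] (mod ?N)"
    by (simp add: additive_zero[OF add])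
  then show False using N by (simp add: cong_def)
qed

text \<open>Pushes the chain of dimension \<open>k\<close> up to height \<open>m\<close>, so that
  all chains live on the same points and \<open>Up\<close> disappears from the boundary
  formula.\<close>

definition cyc_tower :: "nat \<Rightarrow> nat \<Rightarrow> nat \<Rightarrow> (nat \<Rightarrow> nat) \<Rightarrow> nat \<Rightarrow> (nat pt list \<Rightarrow> int) \<Rightarrow> int" where
  "cyc_tower m R N f k a = cyc_chain R 0 N f k (\<lambda>l. a (map (Up ^^ (m - k)) l))"

lemma cyc_tower_additive: "additive_on_cochains (cyc_tower m R N f k)"
  using cyc_chain_additive[of R 0 N f k] by (simp add: additive_on_cochains_def cyc_tower_def)

lemma cyc_tower_cobd:
  assumes "f ^^ N = id" "R \<ge> 1" "k < m"
  shows "cyc_tower m R N f (Suc k) (cobd a) = cyc_tower m R N f k (cyc_op N (map_pt f) k a)"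
proof -
  let ?U = "Up ^^ (m - Suc k)"
  have Usuc: "(Up ^^ (m - k)) p = ?U (Up p)" for p :: "nat pt"
    using assms(3) by (metis Suc_diff_Suc comp_apply funpow_Suc_right)
  have "(\<lambda>l. cobd a (map ?U l)) = cobd (\<lambda>l. a (map ?U l))"
    by (simp add: fun_eq_iff cobd_map)
  then have "cyc_tower m R N f (Suc k) (cobd a) = cyc_chain R 0 N f (Suc k) (cobd (\<lambda>l. a (map ?U l)))"
    by (simp add: cyc_tower_def del: cyc_chain.simps)
  also have "\<dots> = cyc_chain R 0 N f k (cyc_op N (map_pt f) k (\<lambda>l. a (map ?U (map Up l))))"
    by (rule cyc_chain_cobd[OF assms(1,2)])
  also have "cyc_op N (map_pt f) k (\<lambda>l. a (map ?U (map Up l)))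
      = (\<lambda>l. cyc_op N (map_pt f) k a (map (Up ^^ (m - k)) l))"
    by (auto simp: cyc_op_def fun_eq_iff comp_def map_pt_funpow Usuc[symmetric] map_pt_Up_funpow)
  finally show ?thesis by (simp add: cyc_tower_def)
qed

section \<open>Almost torsion elements and retractions\<close>

lemma Arg_cis_mult:
  assumes "w \<noteq> 0"
  shows "\<exists>z::int. Arg (cis t * w) = t + Arg w + 2 * pi * z"
proof -
  have "cis (Arg (cis t * w)) = cis (t + Arg w)"
    using assms by (simp add: cis_Arg sgn_mult sgn_cis cis_mult[symmetric])
  then have "sin (Arg (cis t * w)) = sin (t + Arg w) \<and> cos (Arg (cis t * w)) = cos (t + Arg w)"
    by (metis cis.sel)
  then show ?thesis
    unfolding sin_cos_eq_iff by (auto elim!: Ints_cases simp: algebra_simps)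
qed

text \<open>
  Two divisions of the plane into \<open>N\<close> sectors, shifted by half a sector: nearby numbers lie
  in a common sector of one of them.
\<close>

definition sector :: "nat \<Rightarrow> nat \<Rightarrow> complex \<Rightarrow> int" where
  "sector N a w = \<lfloor>N * Arg w / (2 * pi) + a / 2\<rfloor>"

lemma sector_cis_mult:
  assumes "w \<noteq> 0" "N > 0"
  shows "sector N a (cis (2 * pi * (real q / real N)) * w) mod int N = (sector N a w + int q) mod int N"
proof -
  obtain z :: int where z: "Arg (cis (2 * pi * (real q / real N)) * w) = 2 * pi * (real q / real N) + Arg w + 2 * pi * z"
    using Arg_cis_mult[OF assms(1)] by blast
  have "N * (2 * pi * (real q / real N) + Arg w + 2 * pi * z) / (2 * pi) + a / 2
      = N * Arg w / (2 * pi) + a / 2 + of_int (int q + int N * z)"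
    using assms(2) by (simp add: field_simps)
  then have "sector N a (cis (2 * pi * (real q / real N)) * w) = sector N a w + (int q + int N * z)"
    unfolding sector_def z by (simp only: floor_add_int)
  then have "sector N a (cis (2 * pi * (real q / real N)) * w) = sector N a w + int q + int N * z"
    by simp
  then show ?thesis by simp
qed

text \<open>A number in the middle half of its sector is served by \<open>a = 0\<close>; any other
  lies in the middle half for the shifted division. A quarter of a sector remains as margin, which
  continuity of \<open>Arg\<close> at 1 converts into the relative distance
  \<open>\<delta>\<close>.\<close>

lemma sector_near:
  assumes "N > 0"
  obtains \<delta> where "\<delta> > 0" "\<And>w0. w0 \<noteq> 0 \<Longrightarrow> \<exists>a<2. \<forall>w. cmod (w - w0) < \<delta> * cmod w0 \<longrightarrow>
    w \<noteq> 0 \<and> sector N a w mod int N = sector N a w0 mod int N"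
proof -
  have "isCont Arg 1" by (rule continuous_at_Arg) (simp add: complex_nonpos_Reals_iff)
  then obtain r where r: "r > 0" "\<And>u. dist u 1 < r \<Longrightarrow> dist (Arg u) (Arg 1) < pi / (2 * N)"
    using assms unfolding continuous_at_eps_delta by (metis divide_pos_pos mult_pos_pos of_nat_0_less_iff pi_gt_zero zero_less_numeral)
  show thesis
  proof
    show "min r 1 > 0" using r by simp
    fix w0 :: complex assume w0: "w0 \<noteq> 0"
    define t where "t = N * Arg w0 / (2 * pi)"
    define a :: nat where "a = (if 1 / 4 \<le> frac t \<and> frac t \<le> 3 / 4 then 0 else 1)"
    have a: "\<lfloor>t + d + a / 2\<rfloor> = \<lfloor>t + a / 2\<rfloor>" if d: "\<bar>d\<bar> < 1 / 4" for d
    proof -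
      define m where "m = (if a = 0 \<or> frac t < 1 / 4 then \<lfloor>t\<rfloor> else \<lfloor>t\<rfloor> + 1)"
      obtain x :: real where f: "frac t = x" "0 \<le> x" "x < 1" "t = \<lfloor>t\<rfloor> + x"
        using frac_ge_0[of t] frac_lt_1[of t] by (intro that[of "frac t"]) (simp_all add: frac_def)
      have "\<lfloor>t + d + a / 2\<rfloor> = m"
        using f(2-) d unfolding a_def m_def f(1) floor_eq_iff by (auto split: if_splits)
      moreover have "\<lfloor>t + a / 2\<rfloor> = m"
        using f(2-) unfolding a_def m_def f(1) floor_eq_iff by (auto split: if_splits)
      ultimately show ?thesis by simp
    qed
    show "\<exists>a<2. \<forall>w. cmod (w - w0) < min r 1 * cmod w0 \<longrightarrow>
       w \<noteq> 0 \<and> sector N a w mod int N = sector N a w0 mod int N"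
    proof (intro exI[of _ a] conjI allI impI)
      fix w assume "cmod (w - w0) < min r 1 * cmod w0"
      moreover define u where "u = w / w0"
      have w: "w = u * w0" using w0 by (simp add: u_def)
      moreover have "w - w0 = (u - 1) * w0" by (simp add: w algebra_simps)
      ultimately have u: "cmod (u - 1) < min r 1" using w0 by (simp add: norm_mult)
      then have u0: "u \<noteq> 0" by auto
      then show "w \<noteq> 0" using w w0 by simp
      have "\<bar>Arg u\<bar> < pi / (2 * N)" using r(2)[of u] u by (simp add: dist_norm dist_real_def)
      then have d: "\<bar>N * Arg u / (2 * pi)\<bar> < 1 / 4"
        using assms by (simp add: abs_mult field_simps)
      obtain z :: int where z: "Arg (cis (Arg u) * w0) = Arg u + Arg w0 + 2 * pi * z"
        using Arg_cis_mult[OF w0] by blast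
      have "w = of_real (cmod u) * (cis (Arg u) * w0)"
        using u0 by (simp add: w cis_Arg sgn_eq)
      then have "Arg w = Arg (cis (Arg u) * w0)"
        using u0 Arg_times_of_real[of "cmod u" "cis (Arg u) * w0"] by simp
      then have "Arg w = Arg u + Arg w0 + 2 * pi * z" by (simp only: z)
      then have "N * Arg w / (2 * pi) + a / 2 = t + N * Arg u / (2 * pi) + a / 2 + of_int (int N * z)"
        by (simp add: t_def field_simps)
      then have "sector N a w = \<lfloor>t + N * Arg u / (2 * pi) + a / 2\<rfloor> + int N * z"
        unfolding sector_def by (simp only: floor_add_int)
      also have "\<dots> = sector N a w0 + int N * z"
        unfolding a[OF d] by (simp add: sector_def t_def)
      finally show "sector N a w mod int N = sector N a w0 mod int N" by simp
    qed (simp add: a_def)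
  qed
qed

text \<open>A cyclic rotation within each block of \<open>N\<close> consecutive naturals, so that it
  is a permutation of all labels whose \<open>N\<close>-th power is the identity and adds 1 modulo
  \<open>N\<close>.\<close>

definition rotate_blocks :: "nat \<Rightarrow> nat \<Rightarrow> nat" where
  "rotate_blocks N l = N * (l div N) + (l + 1) mod N"

lemma funpow_rotate_blocks:
  assumes "N > 0"
  shows "(rotate_blocks N ^^ j) l = N * (l div N) + (l + j) mod N"
proof (induction j)
  case (Suc j)
  have "rotate_blocks N (N * (l div N) + (l + j) mod N) = N * (l div N) + (l + j + 1) mod N"
    using assms by (simp add: rotate_blocks_def mod_Suc_eq)
  then show ?case by (simp add: Suc)
qed simp

lemma funpow_rotate_blocks_mod: "N > 0 \<Longrightarrow> (rotate_blocks N ^^ j) l mod N = (l + j) mod N"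
  by (simp add: funpow_rotate_blocks)

lemma funpow_rotate_blocks_id: "N > 0 \<Longrightarrow> rotate_blocks N ^^ N = id"
  by (simp add: fun_eq_iff funpow_rotate_blocks)

text \<open>An equivariant choice of one label per point, which supplies integer labels for the
  complex.\<close>

fun top_label :: "'l pt \<Rightarrow> 'l" where
  "top_label (Apex l) = l"
| "top_label (Up p) = top_label p"
| "top_label (Mid p l r) = l"

lemma top_label_map_pt: "top_label (map_pt f p) = f (top_label p)"
  by (induction p) auto

text \<open>Averaging turns an approximate eigenfunction into an exact one.\<close>

definition spectral_part :: "nat \<Rightarrow> nat \<Rightarrow> ('p \<Rightarrow> 'p) \<Rightarrow> ('p \<Rightarrow> complex) \<Rightarrow> 'p \<Rightarrow> complex" where
  "spectral_part N q \<rho> \<psi> p =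
     (\<Sum>j<N. cis (2 * pi * (real q / real N)) ^ (N - j) * \<psi> ((\<rho> ^^ j) p)) / of_nat N"

text \<open>The exponent \<open>N - j\<close> stands for \<open>- j\<close>, as the weight is an
  \<open>N\<close>-th root of unity. Shifting the summation index multiplies the sum by this
  root.\<close>

lemma spectral_part_rotate:
  assumes "\<rho> ^^ N = id"
  shows "spectral_part N q \<rho> \<psi> (\<rho> p) = cis (2 * pi * (real q / real N)) * spectral_part N q \<rho> \<psi> p"
proof (cases "N = 0")
  case False
  let ?w = "cis (2 * pi * (real q / real N))"
  have wN: "?w ^ N = 1"
    using False by (simp add: Complex.DeMoivre cis_multiple_2pi)
  have "(\<Sum>j<N. ?w ^ (N - j) * \<psi> ((\<rho> ^^ j) (\<rho> p))) = (\<Sum>j<N. ?w * (?w ^ (N - Suc j) * \<psi> ((\<rho> ^^ Suc j) p)))"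
    by (intro sum.cong refl) (simp add: funpow_swap1 mult.assoc[symmetric] power_Suc[symmetric] Suc_diff_Suc del: power_Suc)
  also have "\<dots> = ?w * (\<Sum>j<N. ?w ^ (N - Suc j) * \<psi> ((\<rho> ^^ Suc j) p))"
    by (simp add: sum_distrib_left)
  also have "(\<Sum>j<N. ?w ^ (N - Suc j) * \<psi> ((\<rho> ^^ Suc j) p))
    = (\<Sum>j<N. ?w ^ (N - j) * \<psi> ((\<rho> ^^ j) p)) + ?w ^ (N - N) * \<psi> ((\<rho> ^^ N) p) - ?w ^ N * \<psi> p"
    using sum.lessThan_Suc_shift[of "\<lambda>j. ?w ^ (N - j) * \<psi> ((\<rho> ^^ j) p)" N] by simp
  finally show ?thesis
    using assms by (simp only: spectral_part_def wN) simp
qed (simp add: spectral_part_def)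

lemma norm_spectral_sum_le:
  assumes "N > 0" and "\<And>j. j < N \<Longrightarrow> cmod (f j) \<le> b"
  shows "cmod ((\<Sum>j<N. cis t ^ (N - j) * f j) / of_nat N) \<le> b"
proof -
  have "cmod (\<Sum>j<N. cis t ^ (N - j) * f j) \<le> (\<Sum>j<N. b)"
    using assms(2) by (intro sum_norm_le) (simp add: norm_mult norm_power)
  then show ?thesis using assms(1) by (simp add: norm_divide field_simps)
qed

lemma spectral_part_dist:
  assumes "N > 0" and "\<And>j. j < N \<Longrightarrow> cmod (\<psi> ((\<rho> ^^ j) p) - \<psi> ((\<rho> ^^ j) p')) \<le> b"
  shows "cmod (spectral_part N q \<rho> \<psi> p - spectral_part N q \<rho> \<psi> p') \<le> b"
  using norm_spectral_sum_le[where f = "\<lambda>j. \<psi> ((\<rho> ^^ j) p) - \<psi> ((\<rho> ^^ j) p')", OF assms]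
  by (simp add: spectral_part_def diff_divide_distrib right_diff_distrib sum_subtractf)

lemma spectral_part_near:
  assumes "N > 0"
    and "\<And>j. j < N \<Longrightarrow> cmod (\<psi> ((\<rho> ^^ j) p) - cis (2 * pi * (real q / real N)) ^ j * \<psi> p) \<le> b"
  shows "cmod (spectral_part N q \<rho> \<psi> p - \<psi> p) \<le> b"
proof -
  let ?w = "cis (2 * pi * (real q / real N))"
  have wN: "?w ^ N = 1"
    using assms(1) by (simp add: Complex.DeMoivre cis_multiple_2pi)
  have "(\<Sum>j<N. ?w ^ (N - j) * (?w ^ j * \<psi> p)) = (\<Sum>j<N. \<psi> p)"
  proof (rule sum.cong)
    fix j assume "j \<in> {..<N}"
    then have "?w ^ (N - j) * ?w ^ j = 1" using wN by (simp add: power_add[symmetric])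
    then show "?w ^ (N - j) * (?w ^ j * \<psi> p) = \<psi> p" by (simp add: mult.assoc[symmetric])
  qed simp
  then have "(\<Sum>j<N. ?w ^ (N - j) * (\<psi> ((\<rho> ^^ j) p) - ?w ^ j * \<psi> p)) / of_nat N = spectral_part N q \<rho> \<psi> p - \<psi> p"
    using assms(1) by (simp add: spectral_part_def right_diff_distrib sum_subtractf diff_divide_distrib)
  then show ?thesis
    using norm_spectral_sum_le[where f = "\<lambda>j. \<psi> ((\<rho> ^^ j) p) - ?w ^ j * \<psi> p" and t = "2 * pi * (real q / real N)", OF assms]
    by (simp only:)
qed

context join_retraction
begin

text \<open>The dependence of the constants is the point: \<open>D\<close> and \<open>c\<close> come
  from \<open>F\<close>, they fix \<open>\<eta>\<close> and the neighbourhood, these give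
  \<open>h\<close> and \<open>N\<close>, the margin \<open>\<delta>\<close> depends on
  \<open>N\<close>, and the mesh \<open>1 / R\<close> is chosen last.\<close>

theorem no_almost_torsion_eigenfunction:
  assumes lt: "locally_trivial_principal_bundle G T X act" and x0: "x0 \<in> topspace X"
  shows "\<not> almost_torsion_eigenfunction F"
proof
  assume F: "almost_torsion_eigenfunction F"
  then obtain x1 where F1: "continuous_map T euclidean F" "x1 \<in> carrier G" "F x1 \<noteq> 0"
    by (auto simp: almost_torsion_eigenfunction_def)
  obtain D :: nat and \<psi> c K where \<psi>: "\<And>i. i < D \<Longrightarrow> continuous_map X euclidean (\<psi> i :: 'c \<Rightarrow> complex)"
    and c: "c > 0" "\<And>y. y \<in> topspace X \<Longrightarrow> \<exists>i<D. cmod (\<psi> i y) > c" and K: "K > 0"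
    and eig: "\<And>i y g z \<epsilon>. \<lbrakk>i < D; y \<in> topspace X; g \<in> carrier G; \<And>x. x \<in> carrier G \<Longrightarrow> cmod (F (x \<otimes> g) - z * F x) \<le> \<epsilon>\<rbrakk>
      \<Longrightarrow> cmod (\<psi> i (act y g) - z * \<psi> i y) \<le> K * \<epsilon>"
    using chart_eigenfunctions[OF lt F1] by blast
  define H where "H = \<psi> ` {..<D}"
  have H: "equicts X H"
    unfolding H_def using \<psi> by (intro equicts_finite) auto
  \<comment> \<open>Two divisions into sectors for each of the \<open>D\<close> functions give
    \<open>2 * D\<close> charts. Each kills a class of degree 2, so the chain has dimension
    \<open>2 * (2 * D)\<close>.\<close>
  define m where "m = 2 * (2 * D)"
  \<comment> \<open>With the tolerance \<open>c / (8 * K)\<close> below, averaging stays within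
    \<open>c / 8 + c / 8 = c / 4\<close> of the original function.\<close>
  define \<eta> where "\<eta> = c / (8 * (real m + 1))"
  have \<eta>: "\<eta> > 0" using c by (simp add: \<eta>_def)
  have "\<exists>V. openin T V \<and> \<one> \<in> V \<and> (\<forall>h x g t v. h \<in> iterates H n \<longrightarrow> x \<in> topspace X \<longrightarrow> g \<in> carrier G \<longrightarrow> t \<in> {0..1} \<longrightarrow> v \<in> V
      \<longrightarrow> dist (h (\<phi> x (g \<otimes> v) t)) (h (\<phi> x g t)) < \<eta>)" for n
    by (rule iterates_group_uniform[OF H \<eta>, of n]) blast
  then obtain V where V: "\<And>n. openin T (V n)" "\<And>n. \<one> \<in> V n"
    "\<And>n h x g t v. \<lbrakk>h \<in> iterates H n; x \<in> topspace X; g \<in> carrier G; t \<in> {0..1}; v \<in> V n\<rbrakk>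
      \<Longrightarrow> dist (h (\<phi> x (g \<otimes> v) t)) (h (\<phi> x g t)) < \<eta>"
    by metis
  define V0 where "V0 = (\<Inter>n\<le>m. V n)"
  have V0: "openin T V0" "\<one> \<in> V0" using V by (auto simp: V0_def intro!: openin_INT)
  have V0G: "V0 \<subseteq> carrier G" using openin_subset[OF V0(1)] by (simp add: topspace_eq_carrier)
  \<comment> \<open>Inverses enter because a rotation that wraps around contributes the factor
    \<open>inv (h [^] N)\<close>.\<close>
  define V1 where "V1 = {g \<in> topspace T. inv g \<in> V0}"
  have V1: "openin T V1" "\<one> \<in> V1"
    using V0 openin_continuous_map_preimage[OF continuous_inv V0(1)] by (auto simp: V1_def topspace_eq_carrier)
  have "c / (8 * K) > 0" using c K by simp
  from F[unfolded almost_torsion_eigenfunction_def, THEN conjunct2, THEN conjunct2, rule_format, OF V1 this]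
  obtain h N q where h: "h \<in> carrier G" and N: "N > 1" "coprime q N" and hN: "h [^] (N::nat) \<in> V1"
    and hF: "\<And>x j. x \<in> carrier G \<Longrightarrow> j \<le> N \<Longrightarrow> cmod (F (x \<otimes> h [^] j) - cis (2 * pi * (real q / real N)) ^ j * F x) \<le> c / (8 * K)"
    by metis
  have N0: "N > 0" using N by simp
  let ?\<omega> = "cis (2 * pi * (real q / real N))" and ?f = "rotate_blocks N"
  \<comment> \<open>Labels are sent to powers of \<open>h\<close> with exponents below
    \<open>N\<close>, so that rotation is right multiplication by \<open>h\<close> except where it
    wraps around.\<close>
  define e where "e l = h [^] (l mod N)" for l :: nat
  have e: "e l \<in> carrier G" for l using h by (simp add: e_def)
  have e_rot: "\<exists>v\<in>V0. e ((?f ^^ j) l) = e l \<otimes> h [^] j \<otimes> v" if "j < N" for j l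
  proof (cases "l mod N + j < N")
    case True
    then have "(l + j) mod N = l mod N + j" using that by (metis mod_add_left_eq mod_less)
    then show ?thesis
      using V0 h N0 by (intro bexI[of _ \<one>]) (auto simp: e_def funpow_rotate_blocks_mod nat_pow_mult)
  next
    case False
    have "l mod N < N" using N0 by simp
    then have "l mod N + j - N < N" using that by linarith
    then have "(l mod N + j) mod N = l mod N + j - N" using False le_mod_geq[of N "l mod N + j"] by simp
    then have "(l + j) mod N = l mod N + j - N" "l mod N + j - N + N = l mod N + j"
      using False by (simp_all add: mod_add_left_eq)
    then have "e ((?f ^^ j) l) \<otimes> h [^] N = e l \<otimes> h [^] j"
      using h N0 by (simp add: e_def funpow_rotate_blocks_mod nat_pow_mult)
    then have "e ((?f ^^ j) l) = e l \<otimes> h [^] j \<otimes> inv (h [^] N)"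
      using h e by (metis inv_solve_right m_closed nat_pow_closed)
    then show ?thesis using hN by (auto simp: V1_def)
  qed
  obtain \<delta> where \<delta>: "\<delta> > 0" "\<And>w0. w0 \<noteq> 0 \<Longrightarrow> \<exists>a<2. \<forall>w. cmod (w - w0) < \<delta> * cmod w0 \<longrightarrow>
      w \<noteq> 0 \<and> sector N a w mod int N = sector N a w0 mod int N"
    using sector_near[OF N0] by metis
  \<comment> \<open>\<open>real m * \<kappa>\<close> stays below \<open>\<delta> * c / 4\<close>,
    while the averaged functions exceed \<open>c / 2\<close> where they are used; a simplex
    therefore does not leave its sector.\<close>
  define \<kappa> where "\<kappa> = \<delta> * c / (4 * (real m + 1))"
  have \<kappa>: "\<kappa> > 0" using \<delta> c by (simp add: \<kappa>_def)
  have "\<exists>r>0. \<forall>h x g s t. h \<in> iterates H n \<longrightarrow> x \<in> topspace X \<longrightarrow> g \<in> carrier G \<longrightarrow> s \<in> {0..1} \<longrightarrow> t \<in> {0..1} \<longrightarrow> \<bar>s - t\<bar> < r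
      \<longrightarrow> dist (h (\<phi> x g s)) (h (\<phi> x g t)) < \<kappa>" for n
    by (rule iterates_time_uniform[OF H \<kappa>, of n]) blast
  then obtain r where r: "\<And>n. r n > 0"
    "\<And>n h x g s t. \<lbrakk>h \<in> iterates H n; x \<in> topspace X; g \<in> carrier G; s \<in> {0..1}; t \<in> {0..1}; \<bar>s - t\<bar> < r n\<rbrakk>
      \<Longrightarrow> dist (h (\<phi> x g s)) (h (\<phi> x g t)) < \<kappa>"
    by metis
  define r0 where "r0 = Min (r ` {..m})"
  have r0: "r0 > 0" "\<And>n. n \<le> m \<Longrightarrow> r0 \<le> r n" using r(1) by (auto simp: r0_def)
  obtain R0 where R0: "inverse (real (Suc R0)) < r0" using reals_Archimedean[OF r0(1)] by blast
  define R where "R = Suc R0"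
  have R: "R \<ge> 1" "1 / real R < r0" using R0 by (auto simp: R_def inverse_eq_divide)
  let ?ev = "eval_pt R x0 e" and ?\<rho> = "map_pt ?f"
  let ?P = "close_pts R x0 e H m \<kappa>"
  have ev: "?ev p \<in> topspace X" for p using eval_pt_closed x0 e by blast
  have \<rho>N: "?\<rho> ^^ N = id" by (simp add: map_pt_funpow funpow_rotate_blocks_id N0 pt.map_id0)
  \<comment> \<open>The average is taken on the complex and not on \<open>X\<close>, since only on
    the complex is the \<open>N\<close>-th power of the rotation the identity.\<close>
  define \<Psi> where "\<Psi> i = spectral_part N q ?\<rho> (\<lambda>p. \<psi> i (?ev p))" for i
  have \<Psi>_rot: "\<Psi> i (?\<rho> p) = ?\<omega> * \<Psi> i p" for i p
    unfolding \<Psi>_def by (rule spectral_part_rotate[OF \<rho>N])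
  have supp: "supported_on (cyc_tower m R N ?f m) (?P m)"
  proof -
    have "supported_on (cyc_chain R 0 N ?f m) (?P m)"
    proof (rule supported_on_cyc_chain[where P = ?P])
      show "?P k S'" if "?P k S" "S' \<subseteq> S" for k S S' using close_pts_mono that by blast
      show "?P 0 {Apex 0}" by (rule close_pts_Apex[OF x0 e])
      show "?P k (?\<rho> ` S)" if "?P k S" for k S by (rule close_pts_map[OF that])
      show "?P (Suc k) (level R 0 u ` S \<union> level R 0 (Suc u) ` S)" if "?P k S" "u < R" for k S u
      proof (rule close_pts_level[OF that x0 e])
        fix n h x g and s t :: real
        assume "n \<le> m" "h \<in> iterates H n" "x \<in> topspace X" "g \<in> carrier G" "s \<in> {0..1}" "t \<in> {0..1}" "\<bar>s - t\<bar> \<le> 1 / R"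
        moreover from this have "\<bar>s - t\<bar> < r n" using r0(2)[of n] R(2) by linarith
        ultimately show "dist (h (\<phi> x g s)) (h (\<phi> x g t)) \<le> \<kappa>" by (intro less_imp_le r(2))
      qed
    qed (rule R)
    then show ?thesis by (simp add: cyc_tower_def[abs_def])
  qed
  have \<psi>H: "\<psi> i \<in> iterates H 0" if "i < D" for i using that by (simp add: iterates_0 H_def)
  have near: "cmod (\<Psi> i p - \<psi> i (?ev p)) \<le> c / 4" if i: "i < D" and p: "depth p \<le> m" for i p
    unfolding \<Psi>_def
  proof (rule spectral_part_near[OF N0])
    fix j assume j: "j < N"
    have hj: "h [^] j \<in> carrier G" using h by simp
    have "dist (\<psi> i (?ev (map_pt (?f ^^ j) p))) (\<psi> i (act (?ev p) (h [^] j))) \<le> (real (depth p) + 1) * \<eta>"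
    proof (rule eval_pt_almost_act[where V = V0 and m = m and n = 0 and H = H, OF x0 e hj V0G])
      fix n h x g v and t :: real assume "n \<le> m" "h \<in> iterates H n" "x \<in> topspace X" "g \<in> carrier G" "t \<in> {0..1}" "v \<in> V0"
      then show "dist (h (\<phi> x (g \<otimes> v) t)) (h (\<phi> x g t)) \<le> \<eta>"
        by (intro less_imp_le V(3)) (auto simp: V0_def)
    qed (use e_rot[OF j] \<psi>H[OF i] p in auto)
    also have "\<dots> \<le> (real m + 1) * \<eta>" using p \<eta> by (intro mult_right_mono) auto
    also have "\<dots> = c / 8" by (simp add: \<eta>_def add_pos_nonneg less_imp_neq[symmetric] divide_simps)
    finally have 1: "cmod (\<psi> i (?ev (map_pt (?f ^^ j) p)) - \<psi> i (act (?ev p) (h [^] j))) \<le> c / 8" by (simp add: dist_norm)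
    have "cmod (\<psi> i (act (?ev p) (h [^] j)) - ?\<omega> ^ j * \<psi> i (?ev p)) \<le> K * (c / (8 * K))"
      using j by (intro eig[OF i ev hj] hF) auto
    then have 2: "cmod (\<psi> i (act (?ev p) (h [^] j)) - ?\<omega> ^ j * \<psi> i (?ev p)) \<le> c / 8" using K by simp
    have "cmod (\<psi> i (?ev (map_pt (?f ^^ j) p)) - ?\<omega> ^ j * \<psi> i (?ev p)) \<le> c / 8 + c / 8"
      using norm_triangle_le[OF add_mono[OF 1 2]] by simp
    then show "cmod (\<psi> i (?ev ((?\<rho> ^^ j) p)) - ?\<omega> ^ j * \<psi> i (?ev p)) \<le> c / 4"
      by (simp add: map_pt_funpow)
  qed
  have close: "cmod (\<Psi> i p - \<Psi> i p') \<le> real m * \<kappa>" if i: "i < D" and S: "?P m S" "p \<in> S" "p' \<in> S" for i p p' S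
    unfolding \<Psi>_def
  proof (rule spectral_part_dist[OF N0])
    fix j assume "j < N"
    from S(1)[unfolded close_pts_def, rule_format, OF order_refl, THEN conjunct2, rule_format, of "?f ^^ j"]
    obtain C where "\<forall>p\<in>S. ?ev (map_pt (?f ^^ j) p) \<in> C" "\<forall>x\<in>C. \<forall>y\<in>C. \<forall>h\<in>iterates H (m - m). dist (h x) (h y) \<le> real m * \<kappa>"
      by (elim exE conjE)
    then have "dist (\<psi> i (?ev (map_pt (?f ^^ j) p))) (\<psi> i (?ev (map_pt (?f ^^ j) p'))) \<le> real m * \<kappa>"
      using \<psi>H[OF i] S by simp
    then show "cmod (\<psi> i (?ev ((?\<rho> ^^ j) p)) - \<psi> i (?ev ((?\<rho> ^^ j) p'))) \<le> real m * \<kappa>"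
      by (simp add: map_pt_funpow dist_norm)
  qed
  \<comment> \<open>A rotation advances the sector number by \<open>q\<close>; an inverse of
    \<open>q\<close> modulo \<open>N\<close> rescales this to 1.\<close>
  obtain b :: int where b: "(b * int q) mod int N = 1"
  proof -
    obtain b where "[int q * b = 1] (mod int N)"
      using N cong_solve_coprime_int[of "int q" "int N"] by auto
    then show thesis using N by (intro that[of b]) (simp add: cong_def mult.commute)
  qed
  show False
  proof (rule no_cyclic_cover[where n = "2 * D" and N = N and c = "cyc_tower m R N ?f" and \<rho> = ?\<rho> and P = "?P m"
        and \<eta> = "\<lambda>p. int (top_label p mod N)" and W = "\<lambda>i p. \<Psi> (i div 2) p \<noteq> 0"
        and s = "\<lambda>i p. b * sector N (i mod 2) (\<Psi> (i div 2) p)"])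
    show "N > 1" by (rule N)
    show "additive_on_cochains (cyc_tower m R N ?f k)" for k by (rule cyc_tower_additive)
    show "cyc_tower m R N ?f 0 unit_cochain = 1"
      by (simp add: cyc_tower_def unit_cochain_def)
    show "cyc_tower m R N ?f (Suc k) (cobd a) = cyc_tower m R N ?f k (cyc_op N ?\<rho> k a)" if "k < 2 * (2 * D)" for k a
      using that by (intro cyc_tower_cobd funpow_rotate_blocks_id N0 R) (simp add: m_def)
    show "0 \<le> int (top_label p mod N) \<and> int (top_label p mod N) < int N" for p :: "nat pt"
      using N0 by simp
    show "int (top_label (?\<rho> p) mod N) = (int (top_label p mod N) + 1) mod int N" for p
      using funpow_rotate_blocks_mod[OF N0, of 1 "top_label p"]
      by (simp add: top_label_map_pt zmod_int mod_simps add.commute)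
    show "\<Psi> (i div 2) (?\<rho> p) \<noteq> 0 \<longleftrightarrow> \<Psi> (i div 2) p \<noteq> 0" for i p by (simp add: \<Psi>_rot)
    show "b * sector N (i mod 2) (\<Psi> (i div 2) (?\<rho> p)) mod int N = (b * sector N (i mod 2) (\<Psi> (i div 2) p) + 1) mod int N"
      if "\<Psi> (i div 2) p \<noteq> 0" for i p
    proof -
      have "b * sector N (i mod 2) (\<Psi> (i div 2) (?\<rho> p)) mod int N
        = b * (sector N (i mod 2) (\<Psi> (i div 2) p) + int q) mod int N"
        unfolding \<Psi>_rot using sector_cis_mult[OF that N0] by (metis mod_mult_right_eq)
      also have "\<dots> = (b * sector N (i mod 2) (\<Psi> (i div 2) p) + (b * int q) mod int N) mod int N"
        by (simp add: distrib_left mod_simps)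
      finally show ?thesis by (simp only: b)
    qed
    show "supported_on (cyc_tower m R N ?f (2 * (2 * D))) (?P m)" using supp by (simp add: m_def)
    fix S assume S: "?P m S"
    show "\<exists>i<2 * D. (\<forall>p\<in>S. \<Psi> (i div 2) p \<noteq> 0) \<and> (\<forall>p\<in>S. \<forall>p'\<in>S. b * sector N (i mod 2) (\<Psi> (i div 2) p) mod int N
        = b * sector N (i mod 2) (\<Psi> (i div 2) p') mod int N)"
    proof (cases "S = {}")
      case True
      obtain i where "i < D" using c(2)[OF x0] by blast
      then show ?thesis using True by (intro exI[of _ i]) auto
    next
      case False
      then obtain p0 where p0: "p0 \<in> S" by blast
      then have d: "depth p0 \<le> m" using S by (simp add: close_pts_def)
      obtain i where i: "i < D" "cmod (\<psi> i (?ev p0)) > c" using c(2)[OF ev] by blast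
      have big: "cmod (\<Psi> i p0) > c / 2"
        using near[OF i(1) d] i(2) c(1) norm_triangle_ineq3[of "\<Psi> i p0" "\<psi> i (?ev p0)"] by linarith
      then have "\<Psi> i p0 \<noteq> 0" using c(1) by auto
      from \<delta>(2)[OF this] obtain a where a: "a < 2" and sec: "\<And>w. cmod (w - \<Psi> i p0) < \<delta> * cmod (\<Psi> i p0) \<Longrightarrow>
          w \<noteq> 0 \<and> sector N a w mod int N = sector N a (\<Psi> i p0) mod int N" by blast
      have p: "\<Psi> i p \<noteq> 0 \<and> sector N a (\<Psi> i p) mod int N = sector N a (\<Psi> i p0) mod int N" if "p \<in> S" for p
      proof (rule sec)
        have "cmod (\<Psi> i p - \<Psi> i p0) \<le> real m * \<kappa>" using close[OF i(1) S that p0] .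
        also have "\<dots> \<le> (real m + 1) * \<kappa>" using \<kappa> by (intro mult_right_mono) auto
        also have "\<dots> = \<delta> * (c / 4)" by (simp add: \<kappa>_def add_pos_nonneg less_imp_neq[symmetric] divide_simps)
        also have "\<dots> < \<delta> * cmod (\<Psi> i p0)" using big \<delta>(1) c(1) by (intro mult_strict_left_mono) auto
        finally show "cmod (\<Psi> i p - \<Psi> i p0) < \<delta> * cmod (\<Psi> i p0)" .
      qed
      have idx: "(2 * i + a) div 2 = i" "(2 * i + a) mod 2 = a" "2 * i + a < 2 * D" using a i by auto
      show ?thesis
      proof (intro exI[of _ "2 * i + a"] conjI ballI)
        fix p p' assume "p \<in> S" "p' \<in> S"
        then have "sector N a (\<Psi> i p) mod int N = sector N a (\<Psi> i p') mod int N" using p by simp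
        then show "b * sector N ((2 * i + a) mod 2) (\<Psi> ((2 * i + a) div 2) p) mod int N
          = b * sector N ((2 * i + a) mod 2) (\<Psi> ((2 * i + a) div 2) p') mod int N"
          unfolding idx by (metis mod_mult_right_eq)
      qed (use p idx in auto)
    qed
  qed
qed

end

section \<open>Torsion-free groups of large rank\<close>

context compact_group
begin

text \<open>Closed by its very form, as an intersection of centralisers, and abelian, because its
  members commute with \<open>g\<close> and hence with one another.\<close>

definition bicentralizer :: "'a \<Rightarrow> 'a set" where
  "bicentralizer g = {a \<in> carrier G. \<forall>y\<in>carrier G. y \<otimes> g = g \<otimes> y \<longrightarrow> a \<otimes> y = y \<otimes> a}"

lemma bicentralizer_commute:
  assumes "g \<in> carrier G" "a \<in> bicentralizer g" "b \<in> bicentralizer g"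
  shows "a \<otimes> b = b \<otimes> a"
proof -
  have "b \<in> carrier G" "b \<otimes> g = g \<otimes> b" using assms(1,3) by (simp_all add: bicentralizer_def)
  then show ?thesis using assms(2) by (simp add: bicentralizer_def)
qed

lemma subgroup_bicentralizer:
  assumes g: "g \<in> carrier G"
  shows "subgroup (bicentralizer g) G"
proof
  fix a assume "a \<in> bicentralizer g"
  then have a: "a \<in> carrier G" "\<And>y. y \<in> carrier G \<Longrightarrow> y \<otimes> g = g \<otimes> y \<Longrightarrow> a \<otimes> y = y \<otimes> a"
    by (auto simp: bicentralizer_def)
  have "inv a \<otimes> y = y \<otimes> inv a" if y: "y \<in> carrier G" "y \<otimes> g = g \<otimes> y" for y
  proof -
    have "a \<otimes> (y \<otimes> inv a) = y" using a(1) a(2)[OF y] y(1) by (simp add: m_assoc[symmetric]) (simp add: m_assoc)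
    then have "inv a \<otimes> y = inv a \<otimes> (a \<otimes> (y \<otimes> inv a))" by simp
    then show ?thesis using a(1) y(1) by (simp add: m_assoc[symmetric])
  qed
  then show "inv a \<in> bicentralizer g" using a by (simp add: bicentralizer_def)
  fix b assume "b \<in> bicentralizer g"
  then have b: "b \<in> carrier G" "\<And>y. y \<in> carrier G \<Longrightarrow> y \<otimes> g = g \<otimes> y \<Longrightarrow> b \<otimes> y = y \<otimes> b"
    by (auto simp: bicentralizer_def)
  have "a \<otimes> b \<otimes> y = y \<otimes> (a \<otimes> b)" if y: "y \<in> carrier G" "y \<otimes> g = g \<otimes> y" for y
    using a(1) b(1) y(1) a(2)[OF y] b(2)[OF y] by (metis m_assoc)
  then show "a \<otimes> b \<in> bicentralizer g" using a b by (simp add: bicentralizer_def)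
qed (auto simp: bicentralizer_def)

lemma mem_bicentralizer: "g \<in> carrier G \<Longrightarrow> g \<in> bicentralizer g"
  by (simp add: bicentralizer_def)

lemma homeomorphic_translation:
  assumes "a \<in> carrier G"
  shows "homeomorphic_map T T (\<lambda>x. a \<otimes> x)"
proof -
  have c: "continuous_map T T (\<lambda>x. b \<otimes> x)" if "b \<in> carrier G" for b
    using continuous_map_compose[OF continuous_map_pairedI[of T T "\<lambda>_. b" T "\<lambda>x. x"] continuous_mult] that
    by (simp add: comp_def topspace_eq_carrier)
  show ?thesis
    by (rule homeomorphic_maps_imp_map[of _ _ _ "\<lambda>x. inv a \<otimes> x"])
       (use assms in \<open>simp add: homeomorphic_maps_def c topspace_eq_carrier m_assoc[symmetric]\<close>)
qed

lemma closedin_bicentralizer: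
  assumes g: "g \<in> carrier G"
  shows "closedin T (bicentralizer g)"
proof -
  have cl: "closedin T {a \<in> topspace T. a \<otimes> y = y \<otimes> a}" if y: "y \<in> carrier G" for y
  proof -
    have "continuous_map T T (\<lambda>x. y \<otimes> x)"
      using homeomorphic_translation[OF y] by (simp add: homeomorphic_imp_continuous_map)
    moreover have "continuous_map T T (\<lambda>x. x \<otimes> y)"
      using continuous_map_compose[OF continuous_map_pairedI[of T T "\<lambda>x. x" T "\<lambda>_. y"] continuous_mult] y
      by (simp add: comp_def topspace_eq_carrier)
    ultimately show ?thesis
      using closedin_continuous_maps_eq[OF Hausdorff] by blast
  qed
  have "bicentralizer g = (\<Inter>y\<in>{y \<in> carrier G. y \<otimes> g = g \<otimes> y}. {a \<in> topspace T. a \<otimes> y = y \<otimes> a})"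
    using g by (auto simp: bicentralizer_def topspace_eq_carrier)
  also have "closedin T \<dots>"
    using cl g by (intro closedin_INT) auto
  finally show ?thesis .
qed

text \<open>An infinite compact set has a limit point, and translations by elements of
  \<open>A\<close> carry it to every point of \<open>A\<close>. So \<open>A\<close> is perfect and
  at least as large as the set of reals.\<close>

lemma uncountable_closed_subgroup:
  assumes A: "subgroup A G" "closedin T A" "infinite A"
  shows "uncountable A"
proof -
  have AG: "A \<subseteq> carrier G" using A(1) by (rule subgroup.subset)
  have comp: "compactin T A" using A(2) compact closedin_compact_space by blast
  have sub: "T derived_set_of A \<subseteq> A"
    using A(2) by (simp add: closedin_contains_derived_set)
  have "T derived_set_of A \<noteq> {}"
    using compactin_imp_Bolzano_Weierstrass[OF comp, of A] A(3) by auto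
  then obtain a where a: "a \<in> T derived_set_of A" by blast
  then have aA: "a \<in> A" using sub by blast
  have "A \<subseteq> T derived_set_of A"
  proof
    fix b assume b: "b \<in> A"
    define d where "d = b \<otimes> inv a"
    have dA: "d \<in> A" using A(1) aA b by (simp add: d_def subgroup.m_closed subgroup.m_inv_closed)
    have dG: "d \<in> carrier G" using dA AG by blast
    have "(\<lambda>x. d \<otimes> x) ` A = A"
    proof
      show "(\<lambda>x. d \<otimes> x) ` A \<subseteq> A" using A(1) dA by (auto simp: subgroup.m_closed)
      show "A \<subseteq> (\<lambda>x. d \<otimes> x) ` A"
      proof
        fix x assume x: "x \<in> A"
        then have "x = d \<otimes> (inv d \<otimes> x)" using dG AG by (auto simp: m_assoc[symmetric])
        moreover have "inv d \<otimes> x \<in> A" using A(1) dA x by (simp add: subgroup.m_closed subgroup.m_inv_closed)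
        ultimately show "x \<in> (\<lambda>x. d \<otimes> x) ` A" by blast
      qed
    qed
    then have "T derived_set_of A = (\<lambda>x. d \<otimes> x) ` (T derived_set_of A)"
      using homeomorphic_map_derived_set_of[OF homeomorphic_translation[OF dG], of A] AG by (simp add: topspace_eq_carrier)
    moreover have "b = d \<otimes> a" using aA b AG by (simp add: d_def m_assoc subsetD)
    ultimately show "b \<in> T derived_set_of A" using a by blast
  qed
  then have "(UNIV :: real set) \<lesssim> A"
    using sub aA compact Hausdorff compact_imp_locally_compact_space by (intro lepoll_perfect_set[of T]) auto
  then show ?thesis
    using countable_lepoll uncountable_UNIV_real by blast
qed

text \<open>In a torsion-free abelian group roots are unique, so only countably many elements of
  \<open>A\<close> have a nonzero power in the countable image of \<open>E\<close>. Any other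
  element is a further independent generator.\<close>

theorem exists_free_abelian_subgroup:
  assumes tf: "\<And>h n. \<lbrakk>h \<in> carrier G; h [^] (n::nat) = \<one>; n > 0\<rbrakk> \<Longrightarrow> h = \<one>"
    and nontriv: "carrier G \<noteq> {\<one>}"
  shows "\<exists>E :: (nat \<Rightarrow> int) \<Rightarrow> 'a. range E \<subseteq> carrier G \<and> (\<forall>i j. E (\<lambda>k. i k + j k) = E i \<otimes> E j) \<and>
    (\<forall>i j. E i = E j \<longleftrightarrow> (\<forall>k<n. i k = j k))"
proof -
  obtain g where g: "g \<in> carrier G" "g \<noteq> \<one>" using nontriv one_closed by blast
  define A where "A = bicentralizer g"
  have A: "subgroup A G" unfolding A_def by (rule subgroup_bicentralizer[OF g(1)])
  have AG: "A \<subseteq> carrier G" using A by (rule subgroup.subset)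
  have Acomm: "a \<otimes> b = b \<otimes> a" if "a \<in> A" "b \<in> A" for a b
    using bicentralizer_commute[OF g(1)] that by (simp add: A_def)
  have Apow: "a [^] i \<in> A" if "a \<in> A" for a and i :: int
    using subgroup_int_pow_closed[OF A that] .
  have tfi: "h = \<one> \<or> i = 0" if h: "h \<in> carrier G" "h [^] (i::int) = \<one>" for h i
  proof (cases "i \<ge> 0")
    case True
    then obtain k where k: "i = int k" using nonneg_int_cases by blast
    have "h [^] k = \<one>" using h(2) unfolding k int_pow_int .
    from tf[OF h(1) this] show ?thesis unfolding k by auto
  next
    case False
    define k where "k = nat (- i)"
    have k: "- i = int k" using False by (simp add: k_def)
    have "h [^] (- i) = \<one>" using h by (simp add: int_pow_neg)
    then have "h [^] k = \<one>" unfolding k int_pow_int .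
    from tf[OF h(1) this] show ?thesis using k by auto
  qed
  have "inj (\<lambda>i::int. g [^] i)"
  proof (rule injI)
    fix i j :: int assume "g [^] i = g [^] j"
    then have "g [^] (i - j) = \<one>" using g by (simp add: int_pow_diff)
    then have "i - j = 0" using tfi[OF g(1)] g(2) by blast
    then show "i = j" by simp
  qed
  then have "infinite (range (\<lambda>i::int. g [^] i))" using finite_imageD infinite_UNIV_int by blast
  moreover have "range (\<lambda>i::int. g [^] i) \<subseteq> A"
    using Apow mem_bicentralizer[OF g(1)] by (auto simp: A_def)
  ultimately have "infinite A" using finite_subset by blast
  then have unc: "uncountable A"
    using uncountable_closed_subgroup[OF A] closedin_bicentralizer[OF g(1)] by (simp add: A_def)
  have "\<exists>E :: (nat \<Rightarrow> int) \<Rightarrow> 'a. range E \<subseteq> A \<and> (\<forall>i j. E (\<lambda>k. i k + j k) = E i \<otimes> E j) \<and>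
    (\<forall>i j. E i = E j \<longleftrightarrow> (\<forall>k<n. i k = j k))" for n
  proof (induction n)
    case 0
    show ?case
      by (rule exI[of _ "\<lambda>_. \<one>"]) (use A in \<open>auto simp: subgroup.one_closed\<close>)
  next
    case (Suc n)
    then obtain E :: "(nat \<Rightarrow> int) \<Rightarrow> 'a" where E: "range E \<subseteq> A" "\<And>i j. E (\<lambda>k. i k + j k) = E i \<otimes> E j"
      "\<And>i j. E i = E j \<longleftrightarrow> (\<forall>k<n. i k = j k)" by blast
    have EA: "E i \<in> A" for i using E(1) by blast
    have EG: "E i \<in> carrier G" for i using EA AG by blast
    \<comment> \<open>Only the first \<open>n\<close> coordinates influence \<open>E\<close>, so
      lists of integers enumerate its image.\<close>
    have "E i \<in> (\<lambda>l. E (\<lambda>k. if k < length l then l ! k else 0)) ` UNIV" for i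
      by (rule image_eqI[of _ _ "map i [0..<n]"]) (auto simp: E(3))
    then have "countable (range E)"
      by (intro countable_subset[OF _ countable_image[OF countableI_type, of "\<lambda>l :: int list. E (\<lambda>k. if k < length l then l ! k else 0)" UNIV]]) blast
    define B where "B = (\<Union>q\<in>UNIV - {0}. \<Union>b\<in>range E. {a \<in> A. a [^] (q::int) = b})"
    have "countable {a \<in> A. a [^] q = b}" if "q \<noteq> 0" for q :: int and b
    proof -
      have "a = a'" if a: "a \<in> A" "a' \<in> A" "a [^] q = b" "a' [^] q = b" for a a'
      proof -
        have G: "a \<in> carrier G" "a' \<in> carrier G" using a AG by auto
        have "inv a' \<in> A" using A a by (simp add: subgroup.m_inv_closed)
        then have "(a \<otimes> inv a') [^] q = a [^] q \<otimes> (inv a') [^] q"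
          using G a Acomm by (intro int_pow_mult_distrib) auto
        also have "\<dots> = a [^] q \<otimes> inv (a [^] q)" using a(3,4) G by (simp add: int_pow_inv)
        also have "\<dots> = \<one>" using G by simp
        finally have "a \<otimes> inv a' = \<one>" using tfi[of "a \<otimes> inv a'" q] that G \<open>q \<noteq> 0\<close> by simp
        then show ?thesis using G by (metis inv_closed inv_equality inv_inv)
      qed
      then have "{a \<in> A. a [^] q = b} \<subseteq> {SOME a. a \<in> A \<and> a [^] q = b}"
        by (auto intro: someI2)
      then show ?thesis by (meson countable_finite finite.intros finite_subset)
    qed
    then have "countable B"
      unfolding B_def using \<open>countable (range E)\<close> by (intro countable_UN) auto
    then have "\<not> A \<subseteq> B" using unc countable_subset[of A B] by blast
    then obtain a where a: "a \<in> A" "a \<notin> B" by blast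
    have aG: "a \<in> carrier G" using a AG by blast
    define E' where "E' j = E j \<otimes> a [^] j n" for j
    show ?case
    proof (intro exI[of _ E'] conjI allI)
      show "range E' \<subseteq> A"
        using A EA Apow a by (auto simp: E'_def subgroup.m_closed)
      show "E' (\<lambda>k. i k + j k) = E' i \<otimes> E' j" for i j
      proof -
        have "E i \<otimes> E j \<otimes> (a [^] i n \<otimes> a [^] j n) = E i \<otimes> a [^] i n \<otimes> (E j \<otimes> a [^] j n)"
          using Acomm[OF EA[of j] Apow[OF a(1), of "i n"]] EG aG by (metis int_pow_closed m_assoc m_closed)
        then show ?thesis using aG by (simp add: E'_def E(2) int_pow_mult)
      qed
      show "E' i = E' j \<longleftrightarrow> (\<forall>k<Suc n. i k = j k)" for i j
      proof
        assume eq: "E' i = E' j"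
        have "E (\<lambda>k. j k + (i k - j k)) = E j \<otimes> E (\<lambda>k. i k - j k)" by (rule E(2))
        then have Ei: "E i = E j \<otimes> E (\<lambda>k. i k - j k)" by simp
        have "E j \<otimes> (E (\<lambda>k. i k - j k) \<otimes> a [^] i n) = E j \<otimes> a [^] j n"
          using eq EG aG by (simp add: E'_def Ei m_assoc)
        then have aj: "a [^] j n = E (\<lambda>k. i k - j k) \<otimes> a [^] i n" using EG aG by simp
        have "a [^] (j n - i n) = E (\<lambda>k. i k - j k)"
          using EG aG by (simp add: int_pow_diff aj m_assoc)
        then have "a \<in> B \<or> j n = i n" using a unfolding B_def by auto
        then have n: "i n = j n" using a by simp
        then have "E i = E j" using eq EG aG by (simp add: E'_def)
        then show "\<forall>k<Suc n. i k = j k" using n E(3) less_Suc_eq by auto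
      next
        assume "\<forall>k<Suc n. i k = j k"
        then show "E' i = E' j" using E(3)[of i j] by (simp add: E'_def)
      qed
    qed
  qed
  from this[of n] show ?thesis using AG by (meson subset_trans)
qed

text \<open>Coset representatives are chosen without any continuity. This is harmless, as
  \<open>\<kappa>\<close> will be applied where the chart coordinate is constant on each small
  simplex.\<close>

lemma exists_coset_coordinates:
  fixes E :: "(nat \<Rightarrow> int) \<Rightarrow> 'a"
  assumes E: "range E \<subseteq> carrier G" "\<And>i j. E (\<lambda>k. i k + j k) = E i \<otimes> E j"
    "\<And>i j. E i = E j \<longleftrightarrow> (\<forall>k<n. i k = j k)"
  shows "\<exists>\<kappa>. \<forall>x\<in>carrier G. \<forall>j. \<forall>k<n. \<kappa> (x \<otimes> E j) k = \<kappa> x k + j k"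
proof -
  have EG: "E j \<in> carrier G" for j using E(1) by blast
  define r where "r x = (SOME y. y \<in> carrier G \<and> (\<exists>j. x = y \<otimes> E j))" for x
  define \<kappa> where "\<kappa> x = (SOME j. x = r x \<otimes> E j)" for x
  have E0: "E (\<lambda>k. 0) = \<one>"
    using E(2)[of "\<lambda>k. 0" "\<lambda>k. 0"] EG by simp
  have r: "r x \<in> carrier G \<and> (\<exists>j. x = r x \<otimes> E j)" if "x \<in> carrier G" for x
    unfolding r_def by (rule someI[of _ x]) (use that E0 in \<open>auto intro!: exI[of _ "\<lambda>k. 0"]\<close>)
  then have \<kappa>: "x = r x \<otimes> E (\<kappa> x)" if "x \<in> carrier G" for x
    unfolding \<kappa>_def using that by (metis (mono_tags, lifting) someI)
  have rE: "r (x \<otimes> E j) = r x" if x: "x \<in> carrier G" for x j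
  proof -
    have eqv: "(\<exists>i. x \<otimes> E j = y \<otimes> E i) \<longleftrightarrow> (\<exists>i. x = y \<otimes> E i)" if y: "y \<in> carrier G" for y
    proof safe
      fix i assume *: "x \<otimes> E j = y \<otimes> E i"
      have "E (\<lambda>k. (i k - j k) + j k) = E (\<lambda>k. i k - j k) \<otimes> E j" by (rule E(2))
      then have "x \<otimes> E j = y \<otimes> E (\<lambda>k. i k - j k) \<otimes> E j" using * x y EG by (simp add: m_assoc)
      then show "\<exists>i. x = y \<otimes> E i" using x y EG by auto
    next
      fix i assume "x = y \<otimes> E i"
      then show "\<exists>i'. y \<otimes> E i \<otimes> E j = y \<otimes> E i'"
        using y EG by (intro exI[of _ "\<lambda>k. i k + j k"]) (simp add: E(2) m_assoc)
    qed
    have "(\<lambda>y. y \<in> carrier G \<and> (\<exists>i. x \<otimes> E j = y \<otimes> E i)) = (\<lambda>y. y \<in> carrier G \<and> (\<exists>i. x = y \<otimes> E i))"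
      by (intro ext conj_cong refl eqv)
    then show ?thesis unfolding r_def by simp
  qed
  show ?thesis
  proof (intro exI[of _ \<kappa>] ballI allI impI)
    fix x j k assume x: "x \<in> carrier G" and k: "k < n"
    have "r x \<otimes> E (\<kappa> (x \<otimes> E j)) = x \<otimes> E j"
      using \<kappa>[of "x \<otimes> E j"] x EG by (simp add: rE)
    also have "\<dots> = r x \<otimes> E (\<kappa> x) \<otimes> E j" using \<kappa>[OF x] by simp
    also have "\<dots> = r x \<otimes> E (\<lambda>k. \<kappa> x k + j k)" using r[OF x] EG by (simp add: E(2) m_assoc)
    finally have "E (\<kappa> (x \<otimes> E j)) = E (\<lambda>k. \<kappa> x k + j k)" using r[OF x] EG by simp
    then show "\<kappa> (x \<otimes> E j) k = \<kappa> x k + j k" using k by (simp add: E(3))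
  qed
qed

end

lemma cup_product_eq_0:
  "\<lbrakk>i \<in> set is; \<And>a b. \<lbrakk>a \<in> set l; b \<in> set l\<rbrakk> \<Longrightarrow> t i a = t i b\<rbrakk> \<Longrightarrow> cup_product t is l = 0"
proof (induction "is" arbitrary: l)
  case (Cons j "is")
  show ?case
  proof (cases l)
    case l: (Cons a l')
    show ?thesis
    proof (cases l')
      case (Cons b m)
      have "i \<noteq> j \<Longrightarrow> cup_product t is l' = 0"
        using Cons.prems by (intro Cons.IH) (auto simp: l)
      then show ?thesis using Cons.prems by (cases "i = j") (auto simp: l Cons)
    qed (simp add: l)
  qed (simp add: cup_product_Nil)
qed simp

text \<open>As with \<open>cyc_tower\<close>, all chains are pushed up to height \<open>m\<close>;
  the length of the index list is the dimension.\<close>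

definition koszul_tower :: "nat \<Rightarrow> nat \<Rightarrow> 'l \<Rightarrow> (nat \<Rightarrow> 'l \<Rightarrow> 'l) \<Rightarrow> nat list \<Rightarrow> ('l pt list \<Rightarrow> int) \<Rightarrow> int" where
  "koszul_tower m R u f is a = koszul_chain R u f (length is) is (\<lambda>l. a (map (Up ^^ (m - length is)) l))"

lemma koszul_tower_additive: "additive_on_cochains (koszul_tower m R u f is)"
  using koszul_chain_additive[of R u f "length is" "is"]
  by (simp add: additive_on_cochains_def koszul_tower_def)

lemma koszul_tower_cobd:
  fixes f :: "nat \<Rightarrow> 'l \<Rightarrow> 'l"
  assumes comm: "\<And>i j p. f i (f j p) = f j (f i p)" and "R \<ge> 1" "is \<noteq> []" "length is \<le> m"
  shows "koszul_tower m R u f is (cobd a) = koszul (\<lambda>i. map_pt (f i)) (koszul_tower m R u f) is a"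
proof -
  obtain k where k: "length is = Suc k" using assms(3) by (cases "is") auto
  let ?U = "Up ^^ (m - Suc k)"
  have Usuc: "(Up ^^ (m - k)) p = ?U (Up p)" for p :: "'l pt"
    using assms(4) k by (metis Suc_diff_le comp_apply diff_Suc_Suc funpow_Suc_right)
  then have U: "(\<lambda>p :: 'l pt. ?U (Up p)) = Up ^^ (m - k)"
    by (simp add: fun_eq_iff)
  have "(\<lambda>l. cobd a (map ?U l)) = cobd (\<lambda>l. a (map ?U l))"
    by (simp add: fun_eq_iff cobd_map)
  then have "koszul_tower m R u f is (cobd a) = koszul_chain R u f (Suc k) is (cobd (\<lambda>l. a (map ?U l)))"
    by (simp add: koszul_tower_def k del: koszul_chain.simps)
  also have "\<dots> = koszul (\<lambda>i. map_pt (f i)) (koszul_chain R u f k) is (\<lambda>l. a (map ?U (map Up l)))"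
    by (rule koszul_chain_cobd[where f = f]) (fact comm assms(2) k)+
  also have "\<dots> = koszul (\<lambda>i. map_pt (f i)) (koszul_tower m R u f) is a"
  proof (rule koszul_cong)
    fix i and js :: "nat list" assume "Suc (length js) = length is"
    then show "koszul_chain R u f k js (\<lambda>l. a (map ?U (map Up (map (map_pt (f i)) l))) - a (map ?U (map Up l)))
      = koszul_tower m R u f js (\<lambda>l. a (map (map_pt (f i)) l) - a l)"
      by (simp add: koszul_tower_def k comp_def U Usuc map_pt_Up_funpow)
  qed
  finally show ?thesis .
qed

context join_retraction
begin

text \<open>Small simplices evaluate in connected sets, on which a chart coordinate in a totally
  disconnected group is constant. Hence the class \<open>i\<close> vanishes on simplices in chart
  \<open>i\<close>, however irregular \<open>\<kappa>\<close> is.\<close>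

theorem not_torsion_free_totally_disconnected:
  assumes lt: "locally_trivial_principal_bundle G T X act" and x0: "x0 \<in> topspace X"
    and nontriv: "carrier G \<noteq> {\<one>}"
    and tf: "\<And>h n. \<lbrakk>h \<in> carrier G; h [^] (n::nat) = \<one>; n > 0\<rbrakk> \<Longrightarrow> h = \<one>"
    and td: "\<And>C x y. \<lbrakk>connectedin T C; x \<in> C; y \<in> C\<rbrakk> \<Longrightarrow> x = y"
  shows False
proof -
  obtain n :: nat and W s p c where W: "\<And>i. i < n \<Longrightarrow> chart_bump (W i) (s i) (p i)"
    and c: "c > 0" "\<And>y. y \<in> topspace X \<Longrightarrow> \<exists>i<n. p i y > c"
    using finite_chart_bumps[OF lt] by blast
  have chart: "equivariant_chart (W i) (s i)" if "i < n" for i using W[OF that] by (simp add: chart_bump_def)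
  have p0: "p i y = 0" if "i < n" "y \<in> topspace X" "y \<notin> W i" for i y using W[OF that(1)] that by (simp add: chart_bump_def)
  define H where "H = p ` {..<n}"
  have H: "equicts X H"
    unfolding H_def using W by (intro equicts_finite) (auto simp: chart_bump_def)
  have "\<exists>E :: (nat \<Rightarrow> int) \<Rightarrow> 'a. range E \<subseteq> carrier G \<and> (\<forall>i j. E (\<lambda>k. i k + j k) = E i \<otimes> E j) \<and>
    (\<forall>i j. E i = E j \<longleftrightarrow> (\<forall>k<n. i k = j k))"
    using tf nontriv by (rule exists_free_abelian_subgroup)
  then obtain E :: "(nat \<Rightarrow> int) \<Rightarrow> 'a" where E: "range E \<subseteq> carrier G" "\<And>i j. E (\<lambda>k. i k + j k) = E i \<otimes> E j"
    "\<And>i j. E i = E j \<longleftrightarrow> (\<forall>k<n. i k = j k)" by blast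
  have EG: "E j \<in> carrier G" for j using E(1) by blast
  obtain \<kappa> where \<kappa>: "\<And>x j k. x \<in> carrier G \<Longrightarrow> k < n \<Longrightarrow> \<kappa> (x \<otimes> E j) k = \<kappa> x k + j k"
    using exists_coset_coordinates[of E n, OF E] by blast
  \<comment> \<open>An error of \<open>n * \<eta> < c\<close> cannot lead from a point with
    \<open>p i > c\<close> to a zero of \<open>p i\<close>, so the connected set stays inside
    \<open>W i\<close>.\<close>
  define \<eta> where "\<eta> = c / (real n + 1)"
  have \<eta>: "\<eta> > 0" using c by (simp add: \<eta>_def)
  have "\<exists>r>0. \<forall>h x g s t. h \<in> iterates H k \<longrightarrow> x \<in> topspace X \<longrightarrow> g \<in> carrier G \<longrightarrow> s \<in> {0..1} \<longrightarrow> t \<in> {0..1} \<longrightarrow> \<bar>s - t\<bar> < r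
      \<longrightarrow> dist (h (\<phi> x g s)) (h (\<phi> x g t)) < \<eta>" for k
    by (rule iterates_time_uniform[OF H \<eta>, of k]) blast
  then obtain r where r: "\<And>k. r k > 0"
    "\<And>k h x g s t. \<lbrakk>h \<in> iterates H k; x \<in> topspace X; g \<in> carrier G; s \<in> {0..1}; t \<in> {0..1}; \<bar>s - t\<bar> < r k\<rbrakk>
      \<Longrightarrow> dist (h (\<phi> x g s)) (h (\<phi> x g t)) < \<eta>"
    by metis
  define r0 where "r0 = Min (r ` {..n})"
  have r0: "r0 > 0" "\<And>k. k \<le> n \<Longrightarrow> r0 \<le> r k" using r(1) by (auto simp: r0_def)
  obtain R0 where R0: "inverse (real (Suc R0)) < r0" using reals_Archimedean[OF r0(1)] by blast
  define R where "R = Suc R0"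
  have R: "R \<ge> 1" "1 / real R < r0" using R0 by (auto simp: R_def inverse_eq_divide)
  \<comment> \<open>Labels are integer vectors and \<open>f i\<close> adds the \<open>i\<close>-th
    unit vector; \<open>E\<close> turns this relabelling into an exact right translation.\<close>
  define f :: "nat \<Rightarrow> (nat \<Rightarrow> int) \<Rightarrow> nat \<Rightarrow> int" where "f i j = (\<lambda>k. j k + (if k = i then 1 else 0))" for i j
  let ?ev = "eval_pt R x0 E" and ?\<rho> = "\<lambda>i. map_pt (f i)"
  let ?P = "close_pts R x0 E H n \<eta>"
  have ev: "?ev x \<in> topspace X" for x using eval_pt_closed x0 EG by blast
  have ev_\<rho>: "?ev (?\<rho> i x) = act (?ev x) (E (\<lambda>k. if k = i then 1 else 0))" for i x
    by (rule eval_pt_act[OF x0 EG EG]) (simp add: f_def E(2))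
  let ?c = "koszul_tower n R (\<lambda>k. 0) f"
  \<comment> \<open>Outside chart \<open>i\<close> the \<open>i\<close>-th coordinate of
    \<open>top_label\<close> takes over, which increases under \<open>\<rho>\<close> in the same
    way. As \<open>W i\<close> is invariant, no rotation passes from one clause to the
    other.\<close>
  define t where "t i x = (if i < n \<and> ?ev x \<in> W i then \<kappa> (s i (?ev x)) i else top_label x i)" for i x
  have t\<rho>: "t i (?\<rho> j x) = t i x + (if i = j then 1 else 0)" for i j x
  proof (cases "i < n \<and> ?ev x \<in> W i")
    case True
    then have "s i (?ev (?\<rho> j x)) = s i (?ev x) \<otimes> E (\<lambda>k. if k = j then 1 else 0)" "?ev (?\<rho> j x) \<in> W i" "s i (?ev x) \<in> carrier G"
      using chart[of i] EG equivariant_chart_closed[OF chart] unfolding ev_\<rho> by (auto simp: equivariant_chart_def)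
    then show ?thesis using True \<kappa>[of "s i (?ev x)" i] by (simp add: t_def)
  next
    case False
    then have neg: "\<not> (i < n \<and> ?ev (?\<rho> j x) \<in> W i)"
      using equivariant_chart_iff[OF chart ev EG] unfolding ev_\<rho> by blast
    then show ?thesis unfolding t_def if_not_P[OF False] if_not_P[OF neg] by (simp add: top_label_map_pt f_def)
  qed
  have one: "?c [0..<n] (cup_product t [0..<n]) = 1"
  proof (rule cup_product_eval[where n = n and \<rho> = ?\<rho>])
    show "?c [] unit_cochain = 1" by (simp add: koszul_tower_def unit_cochain_def)
    show "?c is (cobd a) = koszul ?\<rho> ?c is a" if "is \<noteq> []" "length is \<le> n" for "is" a
      using that R by (intro koszul_tower_cobd) (auto simp: f_def)
  qed (auto simp: koszul_tower_additive t\<rho>)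
  have supp: "supported_on (?c [0..<n]) (?P n)"
  proof -
    have "supported_on (koszul_chain R (\<lambda>k. 0) f n [0..<n]) (?P n)"
    proof (rule supported_on_koszul_chain[where P = ?P])
      show "?P k S'" if "?P k S" "S' \<subseteq> S" for k S S' using close_pts_mono that by blast
      show "?P 0 {Apex (\<lambda>k. 0)}" by (rule close_pts_Apex[OF x0 EG])
      show "?P k (?\<rho> i ` S)" if "?P k S" for k i S by (rule close_pts_map[OF that])
      show "?P (Suc k) (level R (\<lambda>k. 0) u ` S \<union> level R (\<lambda>k. 0) (Suc u) ` S)" if "?P k S" "u < R" for k S u
      proof (rule close_pts_level[OF that x0 EG])
        fix k h x g and s t :: real
        assume "k \<le> n" "h \<in> iterates H k" "x \<in> topspace X" "g \<in> carrier G" "s \<in> {0..1}" "t \<in> {0..1}" "\<bar>s - t\<bar> \<le> 1 / R"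
        moreover from this have "\<bar>s - t\<bar> < r k" using r0(2)[of k] R(2) by linarith
        ultimately show "dist (h (\<phi> x g s)) (h (\<phi> x g t)) \<le> \<eta>" by (intro less_imp_le r(2))
      qed
    qed (rule R)
    then show ?thesis by (simp add: koszul_tower_def[abs_def])
  qed
  have "?c [0..<n] (cup_product t [0..<n]) = ?c [0..<n] (\<lambda>l. 0)"
  proof (rule supported_onD[OF supp])
    fix l :: "(nat \<Rightarrow> int) pt list" assume l: "?P n (set l)"
    from l[unfolded close_pts_def, rule_format, OF order_refl, THEN conjunct2, rule_format, of id]
    obtain C where C: "connectedin X C" "C \<noteq> {}" "\<forall>x\<in>set l. ?ev (map_pt id x) \<in> C"
      "\<forall>x\<in>C. \<forall>y\<in>C. \<forall>h\<in>iterates H (n - n). dist (h x) (h y) \<le> real n * \<eta>"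
      by (elim exE conjE)
    have CX: "C \<subseteq> topspace X" using C(1) by (rule connectedin_subset_topspace)
    obtain y0 where y0: "y0 \<in> C" using C(2) by blast
    obtain i where i: "i < n" "p i y0 > c" using c(2) y0 CX by blast
    have CW: "C \<subseteq> W i"
    proof (rule subsetI, rule ccontr)
      fix y assume y: "y \<in> C" "y \<notin> W i"
      then have "p i y = 0" using p0[OF i(1)] CX by blast
      then have "p i y0 \<le> real n * \<eta>" using C(4)[rule_format, OF y0 y(1), of "p i"] i by (auto simp: iterates_0 H_def dist_real_def)
      also have "\<dots> \<le> (real n + 1) * \<eta>" using \<eta> by (intro mult_right_mono) auto
      also have "\<dots> = c" by (simp add: \<eta>_def add_pos_nonneg less_imp_neq[symmetric] divide_simps)
      finally show False using i by simp
    qed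
    have "connectedin (subtopology X (W i)) C" using C(1) CW by (simp add: connectedin_subtopology)
    moreover have "continuous_map (subtopology X (W i)) T (s i)" using chart[OF i(1)] by (simp add: equivariant_chart_def)
    ultimately have "connectedin T (s i ` C)" using connectedin_continuous_map_image by blast
    from td[OF this] have "s i y = s i y0" if "y \<in> C" for y using y0 that by simp
    moreover have "?ev a \<in> C" if "a \<in> set l" for a using C(3) that by (simp add: pt.map_id)
    ultimately have "t i a = \<kappa> (s i y0) i" if "a \<in> set l" for a
      unfolding t_def using i(1) CW that by (metis subsetD)
    then show "cup_product t [0..<n] l = 0"
      using i by (intro cup_product_eq_0[where i = i]) auto
  qed
  then show False using one by (simp add: additive_zero[OF koszul_tower_additive])
qed

end

theorem theorem1p3:
  fixes G :: "('g, 'm) monoid_scheme" and T :: "'g topology"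
    and X :: "'x topology" and act :: "'x \<Rightarrow> 'g \<Rightarrow> 'x"
  assumes "topological_group G T" and "compact_space T" and "Hausdorff_space T"
    and "carrier G \<noteq> {\<one>\<^bsub>G\<^esub>}"
    and "compact_space X" and "Hausdorff_space X" and "topspace X \<noteq> {}"
    and "continuous_right_action G T X act"
    and "locally_trivial_principal_bundle G T X act"
  shows "\<not> (\<exists>f. continuous_map (topological_join X T) X f \<and>
              equivariant_on G (topspace (topological_join X T)) (join_diag_act G T X act) act f)"
proof
  assume "\<exists>f. continuous_map (topological_join X T) X f \<and>
              equivariant_on G (topspace (topological_join X T)) (join_diag_act G T X act) act f"
  then obtain f where f: "continuous_map (topological_join X T) X f"
    "equivariant_on G (topspace (topological_join X T)) (join_diag_act G T X act) act f" by blast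
  interpret compact_action G T X act
    using assms by (simp add: compact_action_def compact_action_axioms_def compact_group_def compact_group_axioms_def)
  let ?J = "prod_topology X (prod_topology T (top_of_set {0..1::real}))"
  \<comment> \<open>The map is lifted to representatives: the collapses at times 0 and 1 are the
    identifications of the join, and continuity comes from the quotient map.\<close>
  define \<phi> where "\<phi> x g t = f (join_rel X T `` {(x, g, t)})" for x g t
  have q: "continuous_map ?J (topological_join X T) (\<lambda>p. join_rel X T `` {p})"
    unfolding topological_join_def by (rule quotient_imp_continuous_map[OF quotient_map_quotient_topology])
  have eq: "join_rel X T `` {p} = join_rel X T `` {p'}" if "(p, p') \<in> join_rel X T" for p p'
    using equiv_class_eq[OF equiv_join_rel that] .
  interpret join_retraction G T X act \<phi>
  proof
    have "(\<lambda>(x, g, t). \<phi> x g t) = f \<circ> (\<lambda>p. join_rel X T `` {p})"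
      by (auto simp: \<phi>_def)
    then show "continuous_map ?J X (\<lambda>(x, g, t). \<phi> x g t)"
      using continuous_map_compose[OF q f(1)] by simp
  next
    fix x g a and t :: real assume x: "x \<in> topspace X" "g \<in> carrier G" "a \<in> carrier G" "t \<in> {0..1}"
    then have "join_rel X T `` {(x, g, t)} \<in> topspace (topological_join X T)"
      using continuous_map_image_subset_topspace[OF q] by (force simp: topspace_eq_carrier)
    then have "f (join_diag_act G T X act (join_rel X T `` {(x, g, t)}) a) = act (\<phi> x g t) a"
      using f(2) x(3) unfolding equivariant_on_def \<phi>_def by blast
    then show "\<phi> (act x a) (g \<otimes>\<^bsub>G\<^esub> a) t = act (\<phi> x g t) a"
      by (simp add: join_diag_act_class[OF x(1,2,4,3)] \<phi>_def)
  next
    fix x x' g assume "x \<in> topspace X" "x' \<in> topspace X" "g \<in> carrier G"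
    then show "\<phi> x g 0 = \<phi> x' g 0"
      unfolding \<phi>_def by (intro arg_cong[of _ _ f] eq) (simp add: join_rel_def topspace_eq_carrier)
  next
    fix x g g' assume "x \<in> topspace X" "g \<in> carrier G" "g' \<in> carrier G"
    then show "\<phi> x g 1 = \<phi> x g' 1"
      unfolding \<phi>_def by (intro arg_cong[of _ _ f] eq) (simp add: join_rel_def topspace_eq_carrier)
  qed
  obtain x0 where x0: "x0 \<in> topspace X" using assms(7) by blast
  show False
  proof (rule almost_torsion_or_totally_disconnected)
    show False if "almost_torsion_eigenfunction F" for F
      using no_almost_torsion_eigenfunction[OF assms(9) x0] that by blast
    show False if "\<And>h n. \<lbrakk>h \<in> carrier G; h [^]\<^bsub>G\<^esub> (n::nat) = \<one>\<^bsub>G\<^esub>; n > 0\<rbrakk> \<Longrightarrow> h = \<one>\<^bsub>G\<^esub>"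
      "\<And>C x y. \<lbrakk>connectedin T C; x \<in> C; y \<in> C\<rbrakk> \<Longrightarrow> x = y"
      by (rule not_torsion_free_totally_disconnected[OF assms(9) x0 assms(4)]) (fact that)+
  qed
qed

end
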